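(* Let $r\ge0$ and let $(Q,\tau)$ be the generalized Kronecker $\imath$quiver with vertices $1,2$, arrows $\alpha_1,\dots,\alpha_r:1\to2$ and $\beta_1,\dots,\beta_r:2\to1$, and involution $\tau$ given by $\tau 1=2$, $\tau(\alpha_s)=\beta_s$. Then the following identity holds in the $\imath$Hall algebra $\widetilde{\mathcal H}(kQ,\tau)$, $k=\mathbb F_q$: $$\sum_{t=0}^{2r+1}(-1)^t[S_1]^{(t)}*[S_2]*[S_1]^{(2r+1-t)}=-\mathbf v^{-r}(q-1)(q^{-1};q^{-1})_{2r}\,[S_1]^{(2r)}*[\mathbb K_1]+\mathbf v^{r}(q-1)(q;q)_{2r}\,[S_1]^{(2r)}*[\mathbb K_2].$$
   Context: $k=\mathbb F_q$, $\mathbf v=\sqrt q$, $[n]_{\mathbf v}=\frac{\mathbf v^n-\mathbf v^{-n}}{\mathbf v-\mathbf v^{-1}}$, $[n]_{\mathbf v}!=\prod_{s=1}^n[s]_{\mathbf v}$, $(a;x)_0=1$, $(a;x)_n=(1-a)(1-ax)\cdots(1-ax^{n-1})$. Divided powers: $[S_i]^{(l)}=[S_i]^{*l}/[l]_{\mathbf v}!$, with $[S_i]^{*l}$ the $l$-fold $*$-product. The $\imath$quiver algebra is $\Lambda^\imath=k\overline Q/\overline I$, where $\overline Q$ is $Q$ with added arrows $\varepsilon_1:1\to2$, $\varepsilon_2:2\to1$ and $\overline I=(\varepsilon_1\varepsilon_2,\varepsilon_2\varepsilon_1,\alpha_s\varepsilon_2-\varepsilon_1\beta_s,\beta_s\varepsilon_1-\varepsilon_2\alpha_s\mid1\le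 s\le r)$ (arrows compose right to left). For a quiver algebra $A$, $\mathrm{mod}^{\rm nil}(A)$ is the category of finite-dimensional left $A$-modules on which every oriented cycle acts nilpotently. $kQ$ is a subalgebra of $\Lambda^\imath$, giving restriction $\mathrm{res}:\mathrm{mod}^{\rm nil}(\Lambda^\imath)\to\mathrm{mod}^{\rm nil}(kQ)$. $S_i$ is the simple module at $i$. $\mathbb K_1$ (resp. $\mathbb K_2$) is the $\Lambda^\imath$-module with one-dimensional spaces at $1$ and $2$, $\varepsilon_1=1$ (resp. $\varepsilon_2=1$) and all other arrows acting by $0$. $\mathbb H\subseteq\Lambda^\imath$ is the subalgebra generated by the vertex idempotents and $\varepsilon_1,\varepsilon_2$; $\mathrm{res}_{\mathbb H}$ is restriction to $\mathbb H$. $\mathcal P^{\le1}(\Lambda^\imath)$ is the full subcategory of $\mathrm{mod}^{\rm nil}(\Lambda^\imath)$ of modules of projective dimension $\le1$. $\mathcal H(\Lambda^\imath)$ is the $\mathbb Q(\mathbf v)$-vector space with basis the isoclasses $[M]$ of $\mathrm{mod}^{\rm nil}(\Lambda^\imath)$ and product $[M]\diamond[N]=\sum_{[L]}\frac{|\mathrm{Ext}^1(M,N)_L|}{|\mathrm{Hom}(M,N)|}[L]$, where $\mathrm{Ext}^1(M,N)_L$ is the set of classes of extensions $0\to N\to L'\to M\to0$ with $L'\cong L$. Let $I$ be the two-sided ideal generated by all $[K]-[K']$ with $K,K'\in\mathcal P^{\le1}(\Lambda^\imath)$, $\mathrm{res}_{\mathbb H}(K)\cong\mathrm{res}_{\mathbb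 H}(K')$, and all $[L]-[K\oplus M]$ for which there is an exact sequence $0\to K\to L\to M\to0$ with $K\in\mathcal P^{\le1}(\Lambda^\imath)$. Let $\mathcal S=\{a[K]\mid a\in\mathbb Q^\times,K\in\mathcal P^{\le1}(\Lambda^\imath)\}$. The $\imath$Hall algebra $\widetilde{\mathcal H}(kQ,\tau)$ is the space $(\mathcal H(\Lambda^\imath)/I)[\mathcal S^{-1}]$ with twisted product $[M]*[N]=\mathbf v^{\langle\mathrm{res}(M),\mathrm{res}(N)\rangle_Q}[M]\diamond[N]$, where $\langle X,Y\rangle_Q=\dim\mathrm{Hom}_{kQ}(X,Y)-\dim\mathrm{Ext}^1_{kQ}(X,Y)$. *)

theory Defs
  imports
    "HOL-Library.Cardinality"
    "HOL-Computational_Algebra.Polynomial"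
    "HOL-Algebra.QuotRing"
    "Graph_Theory.Arc_Walk"
    "Jordan_Normal_Form.VS_Connect"
begin

section \<open>Modules over bound quiver algebras\<close>

text \<open>
  A left module over the path algebra of a finite quiver modulo relations is the same thing as a
  representation of the quiver that satisfies the relations; morphisms are families of linear maps
  commuting with the arrows. A relation \<open>(u, [(c\<^sub>1, p\<^sub>1), \<dots>])\<close> stands for the element
  \<open>c\<^sub>1 p\<^sub>1 + \<dots>\<close> of the path algebra, all paths starting at \<open>u\<close>. Paths are arc walks, listed in the
  order in which the arrows are traversed; with arrows composed from right to left, the product
  \<open>a b\<close> is therefore the list \<open>[b, a]\<close>.
\<close>

record ('k, 'i, 'a) bquiver =
  quiver :: "('i, 'a) pre_digraph"
  relns :: "('i \<times> ('k \<times> 'a list) list) set"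

text \<open>
  The spaces of a representation are subspaces of \<open>'k poly\<close>, which serves only as a \<open>k\<close>-vector space
  of countable dimension: up to isomorphism these are all modules of at most countable dimension,
  so all finite-dimensional modules and also the terms of their projective resolutions (the algebra
  of a finite quiver has countable dimension). All linear maps are extended by zero outside their
  domain.
\<close>

record (overloaded) ('k, 'i, 'a) rep =
  Sp :: "'i \<Rightarrow> 'k poly set"
  Mp :: "'a \<Rightarrow> 'k poly \<Rightarrow> 'k poly"

interpretation polyv: vector_space "Polynomial.smult :: 'k::field \<Rightarrow> 'k poly \<Rightarrow> 'k poly"
  by unfold_locales (simp_all add: smult_add_right smult_add_left)

definition lin_map :: "'k::field poly set \<Rightarrow> 'k poly set \<Rightarrow> ('k poly \<Rightarrow> 'k poly) set" where
  "lin_map U W = {f. (\<forall>x\<in>U. f x \<in> W) \<and> (\<forall>x\<in>U. \<forall>y\<in>U. f (x + y) = f x + f y)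
     \<and> (\<forall>c. \<forall>x\<in>U. f (Polynomial.smult c x) = Polynomial.smult c (f x)) \<and> (\<forall>x. x \<notin> U \<longrightarrow> f x = 0)}"

definition reps :: "('k::field, 'i, 'a) bquiver \<Rightarrow> ('k, 'i, 'a) rep set" where
  "reps A = {M.
     (\<forall>i. polyv.subspace (Sp M i)) \<and> (\<forall>i. i \<notin> verts (quiver A) \<longrightarrow> Sp M i = {0})
   \<and> (\<forall>a\<in>arcs (quiver A).
        Mp M a \<in> lin_map (Sp M (tail (quiver A) a)) (Sp M (head (quiver A) a)))
   \<and> (\<forall>a. a \<notin> arcs (quiver A) \<longrightarrow> Mp M a = (\<lambda>_. 0))
   \<and> (\<forall>(u, \<rho>)\<in>relns A. \<forall>x\<in>Sp M u. (\<Sum>(c, p)\<leftarrow>\<rho>. Polynomial.smult c (fold (Mp M) p x)) = 0)}"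

definition modnil :: "('k::field, 'i, 'a) bquiver \<Rightarrow> ('k, 'i, 'a) rep set" where
  "modnil A = {M \<in> reps A.
     (\<forall>i. \<exists>B. finite B \<and> Sp M i \<subseteq> polyv.span B)
   \<and> (\<forall>u p. p \<noteq> [] \<and> pre_digraph.awalk (quiver A) u p u \<longrightarrow>
        (\<exists>n. \<forall>x\<in>Sp M u. (fold (Mp M) p ^^ n) x = 0))}"

definition Homs :: "('k::field, 'i, 'a) bquiver \<Rightarrow> ('k, 'i, 'a) rep \<Rightarrow> ('k, 'i, 'a) rep
    \<Rightarrow> ('i \<Rightarrow> 'k poly \<Rightarrow> 'k poly) set" where
  "Homs A M N = {f. (\<forall>i. f i \<in> lin_map (Sp M i) (Sp N i))
   \<and> (\<forall>a\<in>arcs (quiver A). \<forall>x\<in>Sp M (tail (quiver A) a).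
        f (head (quiver A) a) (Mp M a x) = Mp N a (f (tail (quiver A) a) x))}"

definition iso_rep :: "('k::field, 'i, 'a) bquiver \<Rightarrow> ('k, 'i, 'a) rep \<Rightarrow> ('k, 'i, 'a) rep \<Rightarrow> bool"
  where
  "iso_rep A M N \<longleftrightarrow> (\<exists>f\<in>Homs A M N. \<forall>i. bij_betw (f i) (Sp M i) (Sp N i))"

definition is_dsum :: "('k::field, 'i, 'a) bquiver \<Rightarrow> ('k, 'i, 'a) rep \<Rightarrow> ('k, 'i, 'a) rep
    \<Rightarrow> ('k, 'i, 'a) rep \<Rightarrow> bool" where
  "is_dsum A X M N \<longleftrightarrow> (\<exists>f\<in>Homs A M X. \<exists>g\<in>Homs A N X.
     \<forall>i. bij_betw (\<lambda>(x, y). f i x + g i y) (Sp M i \<times> Sp N i) (Sp X i))"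

text \<open>Exactness of \<open>0 \<rightarrow> N \<rightarrow> L \<rightarrow> M \<rightarrow> 0\<close> with maps \<open>f\<close> and \<open>g\<close>.\<close>

definition ses :: "('k::field, 'i, 'a) bquiver \<Rightarrow> ('k, 'i, 'a) rep \<Rightarrow> ('i \<Rightarrow> 'k poly \<Rightarrow> 'k poly)
    \<Rightarrow> ('k, 'i, 'a) rep \<Rightarrow> ('i \<Rightarrow> 'k poly \<Rightarrow> 'k poly) \<Rightarrow> ('k, 'i, 'a) rep \<Rightarrow> bool" where
  "ses A N f L g M \<longleftrightarrow> f \<in> Homs A N L \<and> g \<in> Homs A L M
   \<and> (\<forall>i. inj_on (f i) (Sp N i) \<and> f i ` Sp N i = {x \<in> Sp L i. g i x = 0}
        \<and> g i ` Sp L i = Sp M i)"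

definition projective_rep :: "('k::field, 'i, 'a) bquiver \<Rightarrow> ('k, 'i, 'a) rep \<Rightarrow> bool" where
  "projective_rep A P \<longleftrightarrow> P \<in> reps A \<and>
     (\<forall>X\<in>reps A. \<forall>Y\<in>reps A. \<forall>g\<in>Homs A X Y. \<forall>h\<in>Homs A P Y.
        (\<forall>i. g i ` Sp X i = Sp Y i) \<longrightarrow> (\<exists>h'\<in>Homs A P X. \<forall>i. \<forall>x\<in>Sp P i. g i (h' i x) = h i x))"

definition Pd1 :: "('k::field, 'i, 'a) bquiver \<Rightarrow> ('k, 'i, 'a) rep set" where
  "Pd1 A = {K \<in> modnil A. \<exists>P0 P1 f g.
     projective_rep A P0 \<and> projective_rep A P1 \<and> ses A P1 f P0 g K}"

text \<open>Restriction to the subalgebra generated by the vertices and the arrows of \<open>B\<close>.\<close>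

definition restr :: "('k::field, 'i, 'a) bquiver \<Rightarrow> ('k, 'i, 'a) rep \<Rightarrow> ('k, 'i, 'a) rep" where
  "restr B M = \<lparr>Sp = Sp M, Mp = (\<lambda>a. if a \<in> arcs (quiver B) then Mp M a else (\<lambda>_. 0))\<rparr>"


section \<open>Extensions and the Euler form\<close>

type_synonym ('k, 'i, 'a) extn =
  "('i \<Rightarrow> 'k poly \<Rightarrow> 'k poly) \<times> ('k, 'i, 'a) rep \<times> ('i \<Rightarrow> 'k poly \<Rightarrow> 'k poly)"

definition extns :: "('k::field, 'i, 'a) bquiver \<Rightarrow> ('k, 'i, 'a) rep \<Rightarrow> ('k, 'i, 'a) rep
    \<Rightarrow> ('k, 'i, 'a) extn set" where
  "extns A M N = {(f, L, g). L \<in> reps A \<and> ses A N f L g M}"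

definition ext_equiv :: "('k::field, 'i, 'a) bquiver \<Rightarrow> ('k, 'i, 'a) rep \<Rightarrow> ('k, 'i, 'a) rep
    \<Rightarrow> ('k, 'i, 'a) extn rel" where
  "ext_equiv A M N = {((f, L, g), (f', L', g')).
     (f, L, g) \<in> extns A M N \<and> (f', L', g') \<in> extns A M N
   \<and> (\<exists>\<phi>\<in>Homs A L L'. \<forall>i. (\<forall>x\<in>Sp N i. \<phi> i (f i x) = f' i x) \<and> (\<forall>x\<in>Sp L i. g' i (\<phi> i x) = g i x))}"

definition Ext1 :: "('k::field, 'i, 'a) bquiver \<Rightarrow> ('k, 'i, 'a) rep \<Rightarrow> ('k, 'i, 'a) rep
    \<Rightarrow> ('k, 'i, 'a) extn set set" where
  "Ext1 A M N = extns A M N // ext_equiv A M N"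

definition Ext1_mid :: "('k::field, 'i, 'a) bquiver \<Rightarrow> ('k, 'i, 'a) rep \<Rightarrow> ('k, 'i, 'a) rep
    \<Rightarrow> ('k, 'i, 'a) rep \<Rightarrow> ('k, 'i, 'a) extn set set" where
  "Ext1_mid A M N L = {ext_equiv A M N `` {(f, L', g)} | f L' g.
     (f, L', g) \<in> extns A M N \<and> iso_rep A L' L}"

definition ext_split :: "('k::field, 'i, 'a) bquiver \<Rightarrow> ('k, 'i, 'a) rep \<Rightarrow> ('k, 'i, 'a) extn \<Rightarrow> bool"
  where
  "ext_split A M = (\<lambda>(f, L, g). \<exists>s\<in>Homs A M L. \<forall>i. \<forall>x\<in>Sp M i. g i (s i x) = x)"

text \<open>
  The third extension is the Baer sum of the first two: \<open>\<theta>\<close> is a morphism from the fibre product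
  of \<open>L\<close> and \<open>L'\<close> over \<open>M\<close> that exhibits \<open>L''\<close> as the pushout along the addition
  \<open>N \<oplus> N \<rightarrow> N\<close>.
\<close>

definition baer_sum :: "('k::field, 'i, 'a) bquiver \<Rightarrow> ('k, 'i, 'a) rep
    \<Rightarrow> ('k, 'i, 'a) extn \<Rightarrow> ('k, 'i, 'a) extn \<Rightarrow> ('k, 'i, 'a) extn \<Rightarrow> bool" where
  "baer_sum A N = (\<lambda>(f, L, g) (f', L', g') (f'', L'', g'').
     let F = (\<lambda>i. {(x, x'). x \<in> Sp L i \<and> x' \<in> Sp L' i \<and> g i x = g' i x'}) in
     \<exists>\<theta> :: 'i \<Rightarrow> 'k poly \<times> 'k poly \<Rightarrow> 'k poly.
       (\<forall>i. \<forall>(x, x')\<in>F i. \<theta> i (x, x') \<in> Sp L'' i \<and> g'' i (\<theta> i (x, x')) = g i x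
          \<and> (\<forall>c. \<theta> i (Polynomial.smult c x, Polynomial.smult c x') = Polynomial.smult c (\<theta> i (x, x')))
          \<and> (\<forall>(y, y')\<in>F i. \<theta> i (x + y, x' + y') = \<theta> i (x, x') + \<theta> i (y, y')))
     \<and> (\<forall>i. \<forall>n\<in>Sp N i. \<forall>n'\<in>Sp N i. \<theta> i (f i n, f' i n') = f'' i (n + n'))
     \<and> (\<forall>a\<in>arcs (quiver A). \<forall>(x, x')\<in>F (tail (quiver A) a).
          \<theta> (head (quiver A) a) (Mp L a x, Mp L' a x') = Mp L'' a (\<theta> (tail (quiver A) a) (x, x'))))"

text \<open>The second extension is the pushout of the first along multiplication by \<open>c\<close> on \<open>N\<close>.\<close>

definition ext_scale :: "('k::field, 'i, 'a) bquiver \<Rightarrow> ('k, 'i, 'a) rep \<Rightarrow> 'k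
    \<Rightarrow> ('k, 'i, 'a) extn \<Rightarrow> ('k, 'i, 'a) extn \<Rightarrow> bool" where
  "ext_scale A N c = (\<lambda>(f, L, g) (f', L', g').
     \<exists>\<phi>\<in>Homs A L L'. \<forall>i. (\<forall>x\<in>Sp N i. \<phi> i (f i x) = f' i (Polynomial.smult c x))
       \<and> (\<forall>x\<in>Sp L i. g' i (\<phi> i x) = g i x))"

definition Ext1_space :: "('k::field, 'i, 'a) bquiver \<Rightarrow> ('k, 'i, 'a) rep \<Rightarrow> ('k, 'i, 'a) rep
    \<Rightarrow> ('k, ('k, 'i, 'a) extn set) module" where
  "Ext1_space A M N = \<lparr>carrier = Ext1 A M N,
     mult = undefined, one = undefined,
     zero = {\<xi> \<in> extns A M N. ext_split A M \<xi>},
     add = (\<lambda>X Y. {\<zeta> \<in> extns A M N. \<exists>\<xi>\<in>X. \<exists>\<eta>\<in>Y. baer_sum A N \<xi> \<eta> \<zeta>}),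
     smult = (\<lambda>c X. {\<zeta> \<in> extns A M N. \<exists>\<xi>\<in>X. ext_scale A N c \<xi> \<zeta>})\<rparr>"

definition Hom_space :: "('k::field, 'i, 'a) bquiver \<Rightarrow> ('k, 'i, 'a) rep \<Rightarrow> ('k, 'i, 'a) rep
    \<Rightarrow> ('k, 'i \<Rightarrow> 'k poly \<Rightarrow> 'k poly) module" where
  "Hom_space A M N = \<lparr>carrier = Homs A M N,
     mult = undefined, one = undefined,
     zero = (\<lambda>_ _. 0),
     add = (\<lambda>f g i x. f i x + g i x),
     smult = (\<lambda>c f i x. Polynomial.smult c (f i x))\<rparr>"

definition euler :: "('k::field, 'i, 'a) bquiver \<Rightarrow> ('k, 'i, 'a) rep \<Rightarrow> ('k, 'i, 'a) rep \<Rightarrow> int" where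
  "euler A M N = int (vectorspace.dim class_ring (Hom_space A M N))
               - int (vectorspace.dim class_ring (Ext1_space A M N))"


section \<open>The Hall algebra\<close>

definition vq :: "'k::finite itself \<Rightarrow> real" where
  "vq _ = sqrt (real CARD('k))"

text \<open>The subfield \<open>\<rat>(v)\<close> of the reals; it has this form because \<open>v\<^sup>2\<close> is rational.\<close>

definition Qv :: "real \<Rightarrow> real set" where
  "Qv v = {a + b * v | a b. a \<in> \<rat> \<and> b \<in> \<rat>}"

definition isocl :: "('k::field, 'i, 'a) bquiver \<Rightarrow> ('k, 'i, 'a) rep \<Rightarrow> ('k, 'i, 'a) rep set" where
  "isocl A M = {N \<in> modnil A. iso_rep A M N}"

type_synonym ('k, 'i, 'a) hall = "('k, 'i, 'a) rep set \<Rightarrow> real"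

definition hcls :: "('k::field, 'i, 'a) bquiver \<Rightarrow> ('k, 'i, 'a) rep \<Rightarrow> ('k, 'i, 'a) hall" where
  "hcls A M = (\<lambda>X. if X = isocl A M then 1 else 0)"

definition hall_const :: "('k::field, 'i, 'a) bquiver \<Rightarrow> ('k, 'i, 'a) rep \<Rightarrow> ('k, 'i, 'a) rep
    \<Rightarrow> ('k, 'i, 'a) rep \<Rightarrow> real" where
  "hall_const A M N L = real (card (Ext1_mid A M N L)) / real (card (Homs A M N))"

definition zero_rep :: "('k::field, 'i, 'a) rep" where
  "zero_rep = \<lparr>Sp = (\<lambda>_. {0}), Mp = (\<lambda>_ _. 0)\<rparr>"

definition hall :: "('k::{finite,field}, 'i, 'a) bquiver \<Rightarrow> ('k, 'i, 'a) hall ring" where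
  "hall A = \<lparr>carrier = {\<phi>. finite {X. \<phi> X \<noteq> 0} \<and> {X. \<phi> X \<noteq> 0} \<subseteq> isocl A ` modnil A
                          \<and> range \<phi> \<subseteq> Qv (vq TYPE('k))},
     mult = (\<lambda>\<phi> \<psi> Z. if Z \<in> isocl A ` modnil A
        then \<Sum>X | \<phi> X \<noteq> 0. \<Sum>Y | \<psi> Y \<noteq> 0.
               \<phi> X * \<psi> Y * hall_const A (SOME M. M \<in> X) (SOME N. N \<in> Y) (SOME L. L \<in> Z)
        else 0),
     one = hcls A zero_rep,
     zero = (\<lambda>_. 0),
     add = (\<lambda>\<phi> \<psi> X. \<phi> X + \<psi> X)\<rparr>"


section \<open>Two-sided ideals and noncommutative localization\<close>

text \<open>For a ring \<open>R\<close> this is \<open>Idl\<^bsub>R\<^esub> G\<close>, but it does not presuppose that \<open>R\<close> has been shown to be one.\<close>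

inductive_set ideal_gen :: "('b, 'c) ring_scheme \<Rightarrow> 'b set \<Rightarrow> 'b set"
  for R :: "('b, 'c) ring_scheme" and G :: "'b set" where
  gen: "x \<in> G \<Longrightarrow> x \<in> ideal_gen R G"
| zero: "\<zero>\<^bsub>R\<^esub> \<in> ideal_gen R G"
| add: "x \<in> ideal_gen R G \<Longrightarrow> y \<in> ideal_gen R G \<Longrightarrow> x \<oplus>\<^bsub>R\<^esub> y \<in> ideal_gen R G"
| neg: "x \<in> ideal_gen R G \<Longrightarrow> \<ominus>\<^bsub>R\<^esub> x \<in> ideal_gen R G"
| left: "x \<in> ideal_gen R G \<Longrightarrow> a \<in> carrier R \<Longrightarrow> a \<otimes>\<^bsub>R\<^esub> x \<in> ideal_gen R G"
| right: "x \<in> ideal_gen R G \<Longrightarrow> a \<in> carrier R \<Longrightarrow> x \<otimes>\<^bsub>R\<^esub> a \<in> ideal_gen R G"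

text \<open>
  \<open>B[S\<inverse>]\<close> as the universal ring under \<open>B\<close> in which the elements of \<open>S\<close> are invertible: formal ring
  expressions in the elements of \<open>B\<close> and inverses of the elements of \<open>S\<close>, modulo the ring axioms,
  the operations of \<open>B\<close>, and \<open>s s\<inverse> = 1 = s\<inverse> s\<close>. If \<open>S\<close> is an Ore set this is the ring of fractions.
\<close>

datatype 'b loc_term =
  Emb 'b | Inv 'b | Add "'b loc_term" "'b loc_term" | Neg "'b loc_term"
  | Mul "'b loc_term" "'b loc_term"

inductive_set loc_terms :: "('b, 'c) ring_scheme \<Rightarrow> 'b set \<Rightarrow> 'b loc_term set"
  for B :: "('b, 'c) ring_scheme" and S :: "'b set" where
  "b \<in> carrier B \<Longrightarrow> Emb b \<in> loc_terms B S"
| "s \<in> S \<Longrightarrow> Inv s \<in> loc_terms B S"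
| "x \<in> loc_terms B S \<Longrightarrow> y \<in> loc_terms B S \<Longrightarrow> Add x y \<in> loc_terms B S"
| "x \<in> loc_terms B S \<Longrightarrow> Neg x \<in> loc_terms B S"
| "x \<in> loc_terms B S \<Longrightarrow> y \<in> loc_terms B S \<Longrightarrow> Mul x y \<in> loc_terms B S"

inductive loc_eq :: "('b, 'c) ring_scheme \<Rightarrow> 'b set \<Rightarrow> 'b loc_term \<Rightarrow> 'b loc_term \<Rightarrow> bool"
  for B :: "('b, 'c) ring_scheme" and S :: "'b set" where
  refl: "x \<in> loc_terms B S \<Longrightarrow> loc_eq B S x x"
| sym: "loc_eq B S x y \<Longrightarrow> loc_eq B S y x"
| trans: "loc_eq B S x y \<Longrightarrow> loc_eq B S y z \<Longrightarrow> loc_eq B S x z"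
| cong_add: "loc_eq B S x x' \<Longrightarrow> loc_eq B S y y' \<Longrightarrow> loc_eq B S (Add x y) (Add x' y')"
| cong_neg: "loc_eq B S x x' \<Longrightarrow> loc_eq B S (Neg x) (Neg x')"
| cong_mul: "loc_eq B S x x' \<Longrightarrow> loc_eq B S y y' \<Longrightarrow> loc_eq B S (Mul x y) (Mul x' y')"
| add_assoc: "x \<in> loc_terms B S \<Longrightarrow> y \<in> loc_terms B S \<Longrightarrow> z \<in> loc_terms B S \<Longrightarrow>
    loc_eq B S (Add (Add x y) z) (Add x (Add y z))"
| add_comm: "x \<in> loc_terms B S \<Longrightarrow> y \<in> loc_terms B S \<Longrightarrow> loc_eq B S (Add x y) (Add y x)"
| add_zero: "x \<in> loc_terms B S \<Longrightarrow> loc_eq B S (Add (Emb \<zero>\<^bsub>B\<^esub>) x) x"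
| add_neg: "x \<in> loc_terms B S \<Longrightarrow> loc_eq B S (Add (Neg x) x) (Emb \<zero>\<^bsub>B\<^esub>)"
| mul_assoc: "x \<in> loc_terms B S \<Longrightarrow> y \<in> loc_terms B S \<Longrightarrow> z \<in> loc_terms B S \<Longrightarrow>
    loc_eq B S (Mul (Mul x y) z) (Mul x (Mul y z))"
| one_mul: "x \<in> loc_terms B S \<Longrightarrow> loc_eq B S (Mul (Emb \<one>\<^bsub>B\<^esub>) x) x"
| mul_one: "x \<in> loc_terms B S \<Longrightarrow> loc_eq B S (Mul x (Emb \<one>\<^bsub>B\<^esub>)) x"
| distrib_right: "x \<in> loc_terms B S \<Longrightarrow> y \<in> loc_terms B S \<Longrightarrow> z \<in> loc_terms B S \<Longrightarrow>
    loc_eq B S (Mul (Add x y) z) (Add (Mul x z) (Mul y z))"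
| distrib_left: "x \<in> loc_terms B S \<Longrightarrow> y \<in> loc_terms B S \<Longrightarrow> z \<in> loc_terms B S \<Longrightarrow>
    loc_eq B S (Mul x (Add y z)) (Add (Mul x y) (Mul x z))"
| emb_add: "a \<in> carrier B \<Longrightarrow> b \<in> carrier B \<Longrightarrow>
    loc_eq B S (Add (Emb a) (Emb b)) (Emb (a \<oplus>\<^bsub>B\<^esub> b))"
| emb_mul: "a \<in> carrier B \<Longrightarrow> b \<in> carrier B \<Longrightarrow>
    loc_eq B S (Mul (Emb a) (Emb b)) (Emb (a \<otimes>\<^bsub>B\<^esub> b))"
| mul_inv: "s \<in> S \<Longrightarrow> loc_eq B S (Mul (Emb s) (Inv s)) (Emb \<one>\<^bsub>B\<^esub>)"
| inv_mul: "s \<in> S \<Longrightarrow> loc_eq B S (Mul (Inv s) (Emb s)) (Emb \<one>\<^bsub>B\<^esub>)"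

definition loc_rel :: "('b, 'c) ring_scheme \<Rightarrow> 'b set \<Rightarrow> 'b loc_term rel" where
  "loc_rel B S = {(x, y). loc_eq B S x y}"

definition loc_emb :: "('b, 'c) ring_scheme \<Rightarrow> 'b set \<Rightarrow> 'b \<Rightarrow> 'b loc_term set" where
  "loc_emb B S b = loc_rel B S `` {Emb b}"

definition localization :: "('b, 'c) ring_scheme \<Rightarrow> 'b set \<Rightarrow> 'b loc_term set ring" where
  "localization B S = \<lparr>carrier = loc_terms B S // loc_rel B S,
     mult = (\<lambda>X Y. \<Union>x\<in>X. \<Union>y\<in>Y. loc_rel B S `` {Mul x y}),
     one = loc_emb B S \<one>\<^bsub>B\<^esub>,
     zero = loc_emb B S \<zero>\<^bsub>B\<^esub>,
     add = (\<lambda>X Y. \<Union>x\<in>X. \<Union>y\<in>Y. loc_rel B S `` {Add x y})\<rparr>"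


section \<open>The generalized Kronecker iquiver\<close>

datatype vertex = V1 | V2

datatype arrow = Alpha nat | Beta nat | Eps1 | Eps2

primrec src :: "arrow \<Rightarrow> vertex" where
  "src (Alpha s) = V1" | "src (Beta s) = V2" | "src Eps1 = V1" | "src Eps2 = V2"

primrec tgt :: "arrow \<Rightarrow> vertex" where
  "tgt (Alpha s) = V2" | "tgt (Beta s) = V1" | "tgt Eps1 = V2" | "tgt Eps2 = V1"

type_synonym 'k kquiver = "('k, vertex, arrow) bquiver"
type_synonym 'k krep = "('k, vertex, arrow) rep"

definition kron_arrows :: "nat \<Rightarrow> arrow set" where
  "kron_arrows r = Alpha ` {1..r} \<union> Beta ` {1..r}"

definition kQ :: "nat \<Rightarrow> 'k::field kquiver" where
  "kQ r = \<lparr>quiver = \<lparr>verts = UNIV, arcs = kron_arrows r, tail = src, head = tgt\<rparr>, relns = {}\<rparr>"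

definition eps_relns :: "(vertex \<times> ('k::field \<times> arrow list) list) set" where
  "eps_relns = {(V2, [(1, [Eps2, Eps1])]), (V1, [(1, [Eps1, Eps2])])}"

definition HH :: "'k::field kquiver" where
  "HH = \<lparr>quiver = \<lparr>verts = UNIV, arcs = {Eps1, Eps2}, tail = src, head = tgt\<rparr>,
         relns = eps_relns\<rparr>"

definition Lam :: "nat \<Rightarrow> 'k::field kquiver" where
  "Lam r = \<lparr>quiver = \<lparr>verts = UNIV, arcs = kron_arrows r \<union> {Eps1, Eps2}, tail = src, head = tgt\<rparr>,
     relns = eps_relns
       \<union> (\<lambda>s. (V2, [(1, [Eps2, Alpha s]), (-1, [Beta s, Eps1])])) ` {1..r}
       \<union> (\<lambda>s. (V1, [(1, [Eps1, Beta s]), (-1, [Alpha s, Eps2])])) ` {1..r}\<rparr>"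

text \<open>The constant polynomials serve as the one-dimensional space.\<close>

definition line :: "'k::field poly set" where
  "line = range (\<lambda>c. [:c:])"

definition simple_rep :: "vertex \<Rightarrow> 'k::field krep" where
  "simple_rep i = \<lparr>Sp = (\<lambda>j. if j = i then line else {0}), Mp = (\<lambda>_ _. 0)\<rparr>"

definition eps_rep :: "arrow \<Rightarrow> 'k::field krep" where
  "eps_rep e = \<lparr>Sp = (\<lambda>_. line), Mp = (\<lambda>a x. if a = e \<and> x \<in> line then x else 0)\<rparr>"


section \<open>The iHall algebra\<close>

definition hall_rels :: "nat \<Rightarrow> ('k::{finite,field}, vertex, arrow) hall set" where
  "hall_rels r =
     {hcls (Lam r) K \<ominus>\<^bsub>hall (Lam r)\<^esub> hcls (Lam r) K' | K K'.
        K \<in> Pd1 (Lam r) \<and> K' \<in> Pd1 (Lam r) \<and> iso_rep HH (restr HH K) (restr HH K')}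
   \<union> {hcls (Lam r) L \<ominus>\<^bsub>hall (Lam r)\<^esub> hcls (Lam r) X | L X K M f g.
        K \<in> Pd1 (Lam r) \<and> M \<in> modnil (Lam r) \<and> L \<in> modnil (Lam r) \<and> X \<in> modnil (Lam r)
      \<and> ses (Lam r) K f L g M \<and> is_dsum (Lam r) X K M}"

definition hall_ideal :: "nat \<Rightarrow> ('k::{finite,field}, vertex, arrow) hall set" where
  "hall_ideal r = ideal_gen (hall (Lam r)) (hall_rels r)"

definition hall_quot :: "nat \<Rightarrow> ('k::{finite,field}, vertex, arrow) hall set ring" where
  "hall_quot r = hall (Lam r) Quot hall_ideal r"

definition qcls :: "nat \<Rightarrow> real \<Rightarrow> 'k::{finite,field} krep \<Rightarrow> ('k, vertex, arrow) hall set" where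
  "qcls r c M = hall_ideal r +>\<^bsub>hall (Lam r)\<^esub> (\<lambda>X. c * hcls (Lam r) M X)"

definition hall_S :: "nat \<Rightarrow> ('k::{finite,field}, vertex, arrow) hall set set" where
  "hall_S r = {qcls r a K | a K. a \<in> \<rat> \<and> a \<noteq> 0 \<and> K \<in> Pd1 (Lam r)}"

type_synonym 'k ihall = "('k, vertex, arrow) hall set loc_term set"

definition sd_hall :: "nat \<Rightarrow> 'k::{finite,field} ihall ring" where
  "sd_hall r = localization (hall_quot r) (hall_S r)"

definition icls :: "nat \<Rightarrow> 'k::{finite,field} krep \<Rightarrow> 'k ihall" where
  "icls r M = loc_emb (hall_quot r) (hall_S r) (qcls r 1 M)"

definition iscale :: "nat \<Rightarrow> real \<Rightarrow> 'k::{finite,field} ihall \<Rightarrow> 'k ihall" where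
  "iscale r c x = loc_emb (hall_quot r) (hall_S r) (qcls r c zero_rep) \<otimes>\<^bsub>sd_hall r\<^esub> x"

text \<open>
  The space \<open>sd_hall r\<close> is spanned by the elements \<open>[M] \<diamond> [K]\<inverse>\<close>. The twisted product is bilinear, and
  the twist is given on these elements by the Euler form of the classes \<open>[M] - [K]\<close> in the
  Grothendieck group; for \<open>K = 0\<close> this is the factor for \<open>[M]\<close> and \<open>[N]\<close> themselves. A list of triples
  \<open>(c, M, K)\<close> denotes the linear combination of the \<open>[M] \<diamond> [K]\<inverse>\<close> with coefficients \<open>c\<close>.
\<close>

definition frac :: "nat \<Rightarrow> 'k::{finite,field} krep \<Rightarrow> 'k krep \<Rightarrow> 'k ihall" where
  "frac r M K = icls r M \<otimes>\<^bsub>sd_hall r\<^esub> inv\<^bsub>sd_hall r\<^esub> (icls r K)"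

definition fracs :: "nat \<Rightarrow> (real \<times> 'k::{finite,field} krep \<times> 'k krep) set" where
  "fracs r = Qv (vq TYPE('k)) \<times> modnil (Lam r) \<times> Pd1 (Lam r)"

definition twist_exp :: "nat \<Rightarrow> 'k::{finite,field} krep \<Rightarrow> 'k krep \<Rightarrow> 'k krep \<Rightarrow> 'k krep \<Rightarrow> int"
  where
  "twist_exp r M K N L =
     (let e = (\<lambda>X Y. euler (kQ r) (restr (kQ r) X) (restr (kQ r) Y))
      in e M N - e M L - e K N + e K L)"

definition lsum :: "('b, 'c) ring_scheme \<Rightarrow> 'b list \<Rightarrow> 'b" where
  "lsum R xs = foldr (\<oplus>\<^bsub>R\<^esub>) xs \<zero>\<^bsub>R\<^esub>"

definition twist_mult :: "nat \<Rightarrow> 'k::{finite,field} ihall \<Rightarrow> 'k ihall \<Rightarrow> 'k ihall" where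
  "twist_mult r x y = (THE z. \<exists>xs ys. set xs \<subseteq> fracs r \<and> set ys \<subseteq> fracs r
     \<and> x = lsum (sd_hall r) [iscale r c (frac r M K). (c, M, K) \<leftarrow> xs]
     \<and> y = lsum (sd_hall r) [iscale r d (frac r N L). (d, N, L) \<leftarrow> ys]
     \<and> z = lsum (sd_hall r)
         [iscale r (c * d * vq TYPE('k) powi twist_exp r M K N L)
            (frac r M K \<otimes>\<^bsub>sd_hall r\<^esub> frac r N L). (c, M, K) \<leftarrow> xs, (d, N, L) \<leftarrow> ys])"

definition iHall :: "nat \<Rightarrow> 'k::{finite,field} ihall ring" where
  "iHall r = (sd_hall r)\<lparr>mult := twist_mult r\<rparr>"

definition qint :: "real \<Rightarrow> nat \<Rightarrow> real" where
  "qint v n = (v ^ n - v powi (- int n)) / (v - inverse v)"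

definition qfact :: "real \<Rightarrow> nat \<Rightarrow> real" where
  "qfact v n = (\<Prod>s=1..n. qint v s)"

definition qpoch :: "real \<Rightarrow> real \<Rightarrow> nat \<Rightarrow> real" where
  "qpoch a x n = (\<Prod>i<n. 1 - a * x ^ i)"

definition divpow :: "nat \<Rightarrow> 'k::{finite,field} krep \<Rightarrow> nat \<Rightarrow> 'k ihall" where
  "divpow r M l = iscale r (1 / qfact (vq TYPE('k)) l) (icls r M [^]\<^bsub>iHall r\<^esub> l)"

end

theory Submission
 imports Defs "HOL-Library.Function_Algebras" "HOL-Library.FuncSet"
begin

text \<open>
 The product \<open>[M] \<diamond> [N]\<close> is \<open>1/|C\<^sup>0|\<close> times the sum of the middle terms \<open>[E\<^sub>z]\<close> over all cocycles \<open>z\<close>, that is,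
 over all block triangular modules. Hence \<open>[S\<^sub>1]\<^sup>t \<diamond> [S\<^sub>2] \<diamond> [S\<^sub>1]\<^sup>n\<^sup>-\<^sup>t\<close> is a sum over pairs \<open>a : k\<^sup>t \<rightarrow> W\<close>,
 \<open>b : W \<rightarrow> k\<^sup>n\<^sup>-\<^sup>t\<close> with \<open>W = k\<^sup>r\<^sup>+\<^sup>1\<close>, and the isomorphism class depends only on \<open>C = im a\<close> and \<open>D = ker b\<close>.
 The number of pairs with given \<open>C\<close> and \<open>D\<close> is a combination of the functions \<open>q\<^sup>k\<^sup>t\<close> of \<open>t\<close> with
 \<open>|k| \<le> r + 1\<close>, and by the \<open>q\<close>-binomial theorem the alternating sum annihilates all of them except \<open>k = r + 1\<close>
 and \<open>k = - r - 1\<close>. Only \<open>C = D = W\<close> and \<open>C = D = 0\<close> survive; the first module is an extension of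
 \<open>S\<^sub>1\<^sup>2\<^sup>r\<close> by \<open>K\<^sub>1\<close>, and the second becomes equal to \<open>[K\<^sub>2 \<oplus> S\<^sub>1\<^sup>2\<^sup>r]\<close> once \<open>[K\<^sub>1]\<close> is invertible.
\<close>

section \<open>Linear algebra in the space of polynomials\<close>

text \<open>The pair (C, D) is not arbitrary: the relations at vertex 1 force D = W when C = W, and
  C = 0 when D = 0. Without this the extreme functions q^((r+1)t) and q^(-(r+1)t) would also arise
  from pairs in which just one of C and D is extreme. The number of a with image C is a polynomial
  in q^t of degree dim C with leading coefficient 1, and similarly for b with the codimension of D;
  hence each surviving pair contributes with coefficient 1.

  The twisted product is defined through presentations by fractions, and its independence of them
  amounts to a grading of the localization by dimension vectors. The grading comes from a single
  automorphism that multiplies a class by 2^(d_1) 3^(d_2): the eigenvalue determines the degree, and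
  polynomials in the automorphism separate the components.

  For r > 0 the module with C = D = 0 has K_2 as a quotient and not as a submodule, so no defining
  relation identifies it directly with the direct sum. After adding a copy of K_1 there is room to
  switch off \<beta>_r, ..., \<beta>_1 one at a time.\<close>

abbreviation sm :: "'k::field => 'k poly => 'k poly" where "sm == Polynomial.smult"
abbreviation subsp :: "'k::field poly set => bool" where "subsp == polyv.subspace"
abbreviation spn :: "'k::field poly set => 'k poly set" where "spn == polyv.span"
abbreviation dm :: "'k::field poly set => nat" where "dm == polyv.dim"
abbreviation "hv A == head (quiver A)"
abbreviation "tv A == tail (quiver A)"
abbreviation "arrs A == arcs (quiver A)"

lemmas sb_0 = polyv.subspace_0 and sb_add = polyv.subspace_add and sb_diff = polyv.subspace_diff
 and sb_scale = polyv.subspace_scale and rfl = HOL.refl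

interpretation polyp: vector_space_pair "Polynomial.smult :: 'k::field => 'k poly => 'k poly"
  "Polynomial.smult :: 'k::field => 'k poly => 'k poly" by unfold_locales

lemma lmD:
 assumes "f : lin_map U W"
 shows "x : U ==> f x : W" "x : U ==> y : U ==> f (x + y) = f x + f y"
  "x : U ==> f (sm c x) = sm c (f x)" "x ~: U ==> f x = 0" using assms unfolding lin_map_def by blast+

lemma lin_map0: "f : lin_map U W ==> f 0 = 0"
proof (cases "0 : U")
 case True
 assume f: "f : lin_map U W"
 have "f (sm 0 0) = sm 0 (f 0)" by (rule lmD(3)[OF f True])
 then show ?thesis by simp
qed (rule lmD(4))

lemma lin_map_diff:
 assumes "f : lin_map U W" "subsp U" "x : U" "y : U"
 shows "f (x - y) = f x - f y"
proof -
 have "f (x - y + y) = f (x - y) + f y" by (rule lmD(2)[OF assms(1)]) (use assms sb_diff in auto)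
 then show ?thesis by (simp add: algebra_simps)
qed

lemma lin_map_restrict:
 assumes "Vector_Spaces.linear sm sm F" "F ` U <= W" "subsp U"
 shows "(%x. if x : U then F x else 0) : lin_map U W" unfolding lin_map_def using assms(2) polyp.linear_add[OF assms(1)] polyp.linear_scale[OF assms(1)]
  sb_add[OF assms(3)] sb_scale[OF assms(3)] by (simp add: image_subset_iff)

lemma lin_mapI:
 assumes "!!x. x : U ==> f x : W" "!!x y. x : U ==> y : U ==> f (x + y) = f x + f y"
  "!!c x. x : U ==> f (sm c x) = sm c (f x)" "!!x. x ~: U ==> f x = 0"
 shows "f : lin_map U W" using assms unfolding lin_map_def by blast+

lemma lin_map_comp:
 assumes "f : lin_map U V" "g : lin_map V W" "subsp U"
 shows "(%x. g (f x)) : lin_map U W" using lmD[OF assms(1)] lmD[OF assms(2)] lin_map0[OF assms(2)] by (intro lin_mapI) simp_all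

lemma lin_map_add:
 assumes "f : lin_map U W" "g : lin_map U W" "subsp W"
 shows "(%x. f x + g x) : lin_map U W" using lmD[OF assms(1)] lmD[OF assms(2)] sb_add[OF assms(3)] by (intro lin_mapI) (simp_all add: smult_add_right algebra_simps)

lemma lin_map_scale:
 assumes "f : lin_map U W" "subsp W"
 shows "(%x. sm c (f x)) : lin_map U W" using lmD[OF assms(1)] sb_scale[OF assms(2)] by (intro lin_mapI) (simp_all add: smult_add_right mult.commute)

lemma lin_map_sub:
 assumes "f : lin_map U W" "g : lin_map U W" "subsp W"
 shows "(%x. f x - g x) : lin_map U W" using lin_map_add[OF assms(1) lin_map_scale[OF assms(2,3), of "-1"] assms(3)] by simp

lemma lin_map_zero: "subsp W ==> (%x. 0) : lin_map U W" by (rule lin_mapI) (simp_all add: sb_0)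

lemma lin_map_id: "subsp U ==> (%x. if x : U then x else 0) : lin_map U U" by (rule lin_mapI) (simp_all add: sb_add sb_scale)

lemma lin_map_mono: "f : lin_map U W ==> f ` U <= W' ==> f : lin_map U W'" unfolding lin_map_def by blast

lemma lin_map_eqI:
 assumes f: "f : lin_map U W" and g: "g : lin_map U W'" and U: "subsp U"
  and B: "B <= U" "U <= spn B" and eq: "!!b. b : B ==> f b = g b"
 shows "f = g"
proof -
 have "subsp {x : U. f x = g x}" unfolding polyv.subspace_def using U lmD(2,3)[OF f] lmD(2,3)[OF g] lin_map0[OF f] lin_map0[OF g] by (simp add: sb_0 sb_add sb_scale)
 then have "spn B <= {x : U. f x = g x}" using B eq by (intro polyv.span_minimal) auto
 then show ?thesis using B lmD(4)[OF f] lmD(4)[OF g] by (intro ext) (metis (mono_tags, lifting) mem_Collect_eq subsetD)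
qed

lemma lin_map_ex:
 assumes B: "polyv.independent B" "spn B = U" and W: "subsp W"
  and c: "!!b. b : B ==> c b : W"
 obtains f where "f : lin_map U W" "!!b. b : B ==> f b = c b"
proof -
 obtain F where F: "Vector_Spaces.linear sm sm F" "ALL b:B. F b = c b" "range F = spn (c ` B)" using polyp.linear_independent_extend_subspace[OF B(1)] by blast
 have "F ` U <= W" using F(3) c polyv.span_minimal[OF _ W, of "c ` B"] by auto
 from lin_map_restrict[OF F(1) this] have "(%x. if x : U then F x else 0) : lin_map U W" using B(2) by auto
 moreover have "b : B ==> b : U" for b using B(2) polyv.span_base by auto
 ultimately show thesis using that F(2) by auto
qed

lemma subspace_basis_extend:
 assumes "subsp U" "A <= U" "polyv.independent A"
 obtains B where "A <= B" "B <= U" "polyv.independent B" "spn B = U"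
proof -
 obtain B where "A <= B" "B <= U" "polyv.independent B" "U <= spn B" using polyv.maximal_independent_subset_extend[OF assms(2,3)] by blast
 then show thesis using that polyv.span_minimal[OF _ assms(1), of B] by blast
qed

lemma subspace_basis:
 assumes "subsp U"
 obtains B where "B <= U" "polyv.independent B" "spn B = U" using subspace_basis_extend[OF assms, of "{}"] by (auto simp: polyv.independent_empty)

lemma card_subspace:
 fixes U :: "'k::{finite,field} poly set"
 assumes B: "finite B" "polyv.independent B" "spn B = U"
 shows "card U = CARD('k) ^ card B" "finite U"
proof -
 let ?h = "%c. SUM b:B. sm (c b) b"
 have "bij_betw ?h (B \<rightarrow>\<^sub>E (UNIV :: 'k set)) U"
 proof (rule bij_betw_imageI)
  show "inj_on ?h (B \<rightarrow>\<^sub>E UNIV)"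
  proof (rule inj_onI)
   fix c d assume cd: "c : B \<rightarrow>\<^sub>E (UNIV :: 'k set)" "d : B \<rightarrow>\<^sub>E (UNIV :: 'k set)" "?h c = ?h d"
   then have "(SUM b:B. sm (c b - d b) b) = 0" by (simp add: smult_diff_left sum_subtractf)
   with B have "ALL b:B. c b - d b = 0" using polyv.independent_explicit_finite_subsets[of B] by (auto dest!: spec[of _ B])
   then show "c = d" using cd by (auto simp: PiE_iff intro!: extensionalityI[of c B d])
  qed
  have "x : ?h ` (B \<rightarrow>\<^sub>E UNIV)" if xU: "x : U" for x
  proof -
   have "U = range ?h" using B(3) polyv.span_finite[OF B(1)] by simp
   then obtain c where "x = ?h c" using xU by blast
   moreover have "?h (restrict c B) = ?h c" by (rule sum.cong) auto
   moreover have "restrict c B : B \<rightarrow>\<^sub>E UNIV" by simp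
   ultimately show ?thesis by (intro image_eqI[where x = "restrict c B"]) simp_all
  qed
  moreover have "?h c : U" for c unfolding B(3)[symmetric] by (intro polyv.span_sum polyv.span_scale polyv.span_base)
  ultimately show "?h ` (B \<rightarrow>\<^sub>E UNIV) = U" by blast
 qed
 from bij_betw_same_card[OF this] bij_betw_finite[OF this] show "card U = CARD('k) ^ card B" "finite U" using B(1) by (auto simp: card_PiE finite_PiE)
qed

lemma card_poly_subspace:
 fixes U :: "'k::{finite,field} poly set"
 assumes "subsp U" "finite U"
 shows "card U = CARD('k) ^ dm U"
proof -
 obtain B where B: "B <= U" "polyv.independent B" "spn B = U" using subspace_basis[OF assms(1)] .
 then have "dm U = card B" using polyv.dim_span_eq_card_independent by blast
 then show ?thesis using card_subspace(1)[OF finite_subset[OF B(1) assms(2)] B(2,3)] by simp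
qed

lemma CARD_gt1: "CARD('k::{finite,field}) > 1"
proof -
 have "card {0, 1::'k} <= CARD('k)" by (rule card_mono) auto
 then show ?thesis by simp
qed

lemma subspace_lin_kernel:
 assumes f: "f : lin_map U W" and U: "subsp U"
 shows "subsp {x : U. f x = 0}" unfolding polyv.subspace_def using U lmD(2,3)[OF f] lin_map0[OF f] by (simp add: sb_0 sb_add sb_scale)

text \<open>A map that vanishes on the span of \<open>D\<close> amounts to a free choice of values
  on \<open>B - D\<close>. The case of empty \<open>D\<close> gives the finiteness of the whole
  space of maps.\<close>

lemma card_lin_map_basis:
 fixes W :: "'k::{finite,field} poly set"
 assumes B: "finite B" "polyv.independent B" "spn B = U" and D: "D <= B"
  and W: "subsp W" "finite W"
 shows "card {f : lin_map U W. ALL x:spn D. f x = 0} = card W ^ card (B - D)"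
  "finite (lin_map U W)"
proof -
 have U: "subsp U" and BU: "B <= U" using B polyv.span_superset by auto
 have gen: "bij_betw (%f. restrict f (B - D)) {f : lin_map U W. ALL x:spn D. f x = 0} ((B - D) \<rightarrow>\<^sub>E W)" if D: "D <= B" for D
 proof (rule bij_betw_imageI)
  show "inj_on (%f. restrict f (B - D)) {f : lin_map U W. ALL x:spn D. f x = 0}"
  proof (rule inj_onI)
   fix f g assume fg: "f : {f : lin_map U W. ALL x:spn D. f x = 0}"
    "g : {f : lin_map U W. ALL x:spn D. f x = 0}" "restrict f (B - D) = restrict g (B - D)"
   have "f b = g b" if "b : B" for b
   proof (cases "b : D")
    case True
    then have "b : spn D" by (rule polyv.span_base)
    with fg show ?thesis by auto
   next
    case False then show ?thesis using fg(3) that by (metis DiffI restrict_apply')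
   qed
   then show "f = g" using fg lin_map_eqI[OF _ _ U BU] B by auto
  qed
  have "h : (%f. restrict f (B - D)) ` {f : lin_map U W. ALL x:spn D. f x = 0}" if h: "h : (B - D) \<rightarrow>\<^sub>E W" for h
  proof -
   obtain f where f: "f : lin_map U W" "!!b. b : B ==> f b = (if b : D then 0 else h b)"
   proof (rule lin_map_ex[OF B(2,3) W(1), of "%b. if b : D then 0 else h b"])
    show "(if b : D then 0 else h b) : W" if "b : B" for b using h that sb_0[OF W(1)] by (auto simp: PiE_iff)
   qed blast
   have "subsp {x : U. f x = 0}" by (rule subspace_lin_kernel[OF f(1) U])
   then have "spn D <= {x : U. f x = 0}" using f D BU by (intro polyv.span_minimal) auto
   moreover have "restrict f (B - D) = h" using f h by (auto simp: fun_eq_iff PiE_iff extensional_def)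
   ultimately show ?thesis using f by blast
  qed
  moreover have "restrict f (B - D) : (B - D) \<rightarrow>\<^sub>E W" if "f : lin_map U W" for f using that BU by (auto simp: lmD)
  ultimately show "(%f. restrict f (B - D)) ` {f : lin_map U W. ALL x:spn D. f x = 0} = (B - D) \<rightarrow>\<^sub>E W" by blast
 qed
 show "card {f : lin_map U W. ALL x:spn D. f x = 0} = card W ^ card (B - D)" using bij_betw_same_card[OF gen[OF D]] B(1) by (simp add: card_PiE)
 have "{f : lin_map U W. ALL x:spn {}. f x = 0} = lin_map U W" using lin_map0 by (auto simp: polyv.span_empty)
 then show "finite (lin_map U W)" using bij_betw_finite[OF gen[of "{}"]] B(1) W(2) by (auto simp: finite_PiE)
qed

lemma card_lin_map:
 fixes W :: "'k::{finite,field} poly set"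
 assumes U: "subsp U" "finite U" and W: "subsp W" "finite W"
 shows "card (lin_map U W) = card W ^ dm U" "finite (lin_map U W)"
proof -
 obtain B where B: "B <= U" "polyv.independent B" "spn B = U" using subspace_basis[OF U(1)] .
 note c = card_lin_map_basis[OF finite_subset[OF B(1) U(2)] B(2,3) empty_subsetI W]
 have "{f : lin_map U W. ALL x:spn {}. f x = 0} = lin_map U W" using lin_map0 by (auto simp: polyv.span_empty)
 moreover have "dm U = card B" using polyv.dim_span_eq_card_independent[OF B(2)] B(3) by simp
 ultimately show "card (lin_map U W) = card W ^ dm U" "finite (lin_map U W)" using c by simp_all
qed

lemma card_lin_map_dim:
 fixes W :: "'k::{finite,field} poly set"
 assumes U: "subsp U" "finite U" and W: "subsp W" "finite W"
 shows "card (lin_map U W) = CARD('k) ^ (dm U * dm W)" using card_lin_map(1)[OF assms] card_poly_subspace[OF W] by (simp add: mult.commute flip: power_mult)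

lemma card_lin_map_vanishing:
 fixes W :: "'k::{finite,field} poly set"
 assumes U: "subsp U" "finite U" and D: "subsp D" "D <= U"
  and W: "subsp W" "finite W"
 shows "card {f : lin_map U W. ALL x:D. f x = 0} = card W ^ (dm U - dm D)"
proof -
 obtain A where A: "A <= D" "polyv.independent A" "spn A = D" using subspace_basis[OF D(1)] .
 obtain B where B: "A <= B" "B <= U" "polyv.independent B" "spn B = U" using subspace_basis_extend[OF U(1) _ A(2)] A D by blast
 have fB: "finite B" using B U finite_subset by blast
 have "card (B - A) = dm U - dm D" using card_Diff_subset[OF finite_subset[OF B(1) fB] B(1)] A B polyv.dim_span_eq_card_independent by metis
 then show ?thesis using card_lin_map_basis(1)[OF fB B(3,4,1) W] A by simp
qed

section \<open>Sections, extension of isomorphisms and a normal form\<close>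

lemma lin_section:
 assumes g: "g : lin_map U W" and U: "subsp U" and W: "subsp W" and s: "W <= g ` U"
 obtains s where "s : lin_map W U" "!!x. x : W ==> g (s x) = x"
proof -
 obtain B where B: "B <= W" "polyv.independent B" "spn B = W" using subspace_basis[OF W] .
 have "ALL b:B. EX u:U. g u = b" using s B by auto
 then obtain c where c: "!!b. b : B ==> c b : U & g (c b) = b" by metis
 obtain s where s: "s : lin_map W U" "!!b. b : B ==> s b = c b" using lin_map_ex[OF B(2,3) U, of c] c by blast
 have 1: "(%x. g (s x)) : lin_map W W" by (rule lin_map_comp[OF s(1) g W])
 have 2: "(%x. if x : W then x else 0) : lin_map W W" by (rule lin_map_id[OF W])
 have "(%x. g (s x)) = (%x. if x : W then x else 0)" using lin_map_eqI[OF 1 2 W B(1)] B s c by (metis (no_types, lifting) order_refl subsetD)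
 then have "g (s x) = x" if "x : W" for x using that by (metis (full_types))
 with s(1) show thesis using that by blast
qed

lemma lin_map_inj_onI:
 assumes "f : lin_map U W" "subsp U" "!!x. x : U ==> f x = 0 ==> x = 0"
 shows "inj_on f U"
proof (rule inj_onI)
 fix x y assume xy: "x : U" "y : U" "f x = f y"
 then have "f (x - y) = 0" using lin_map_diff[OF assms(1,2)] by simp
 then show "x = y" using assms(3)[of "x - y"] xy sb_diff[OF assms(2)] by auto
qed

lemma lin_map_inverse:
 assumes f: "f : lin_map U W" and U: "subsp U" and b: "bij_betw f U W"
 obtains g where "g : lin_map W U" "bij_betw g W U" "!!x. x : U ==> g (f x) = x" "!!y. y : W ==> f (g y) = y"
proof -
 define g where "g = (%y. if y : W then the_inv_into U f y else 0)"
 have i: "inj_on f U" and im: "f ` U = W" using b by (simp_all add: bij_betw_def)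
 have gf: "g (f x) = x" if "x : U" for x using that im the_inv_into_f_f[OF i that] unfolding g_def by auto
 have gU: "g y : U" if y: "y : W" for y
 proof -
  obtain x where "x : U" "y = f x" using y im by blast
  then show ?thesis using gf[of x] by simp
 qed
 have fg: "f (g y) = y" if y: "y : W" for y
 proof -
  obtain x where "x : U" "y = f x" using y im by blast
  then show ?thesis using gf[of x] by simp
 qed
 have "g : lin_map W U"
 proof (rule lin_mapI)
  fix x y assume xy: "x : W" "y : W"
  have "g (f (g x + g y)) = g x + g y" by (intro gf sb_add[OF U] gU xy)
  then show "g (x + y) = g x + g y" using lmD(2)[OF f gU[OF xy(1)] gU[OF xy(2)]] fg xy by simp
 next
  fix c x assume x: "x : W"
  have "g (f (sm c (g x))) = sm c (g x)" by (intro gf sb_scale[OF U] gU x)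
  then show "g (sm c x) = sm c (g x)" using lmD(3)[OF f gU[OF x]] fg[OF x] by simp
 next
  show "x : W ==> g x : U" for x by (rule gU)
  show "x ~: W ==> g x = 0" for x by (simp add: g_def)
 qed
 moreover have "bij_betw g W U"
 proof (rule bij_betwI[where g = f])
  show "g : W \<rightarrow> U" using gU by blast
  show "f : U \<rightarrow> W" using im by blast
 qed (simp_all add: fg gf)
 ultimately show thesis using that gf fg by blast
qed

text \<open>A basis \<open>A\<close> of \<open>I\<close> and its image under \<open>h\<close> are
  completed to bases of \<open>U\<close> and \<open>U'\<close>. These have the same size because
  \<open>U\<close> and \<open>U'\<close> do, so the remaining basis vectors can be matched by any
  bijection.\<close>

lemma lin_iso_extend:
 fixes U :: "'k::{finite,field} poly set"
 assumes U: "subsp U" "finite U" and U': "subsp U'" "finite U'" and c: "card U = card U'"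
  and I: "subsp I" "I <= U" and h: "h : lin_map I U'" "inj_on h I"
 obtains g where "g : lin_map U U'" "bij_betw g U U'" "!!x. x : I ==> g x = h x"
proof -
 obtain A where A: "A <= I" "polyv.independent A" "spn A = I" using subspace_basis[OF I(1)] .
 obtain B where B: "A <= B" "B <= U" "polyv.independent B" "spn B = U" using subspace_basis_extend[OF U(1) _ A(2)] A I by blast
 obtain H where H: "Vector_Spaces.linear sm sm H" "ALL b:A. H b = h b" using polyp.linear_independent_extend[OF A(2), of h] by blast
 have rH: "(%x. if x : I then H x else 0) = h" by (rule lin_map_eqI[OF lin_map_restrict[OF H(1) order_refl I(1)] h(1) I(1) A(1)]) (use A H in auto)
 have Hh: "H x = h x" if "x : I" for x using fun_cong[OF rH, of x] that by simp
 have "inj_on H I" using h(2) inj_on_cong[of I H h] Hh by blast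
 then have "polyv.independent (H ` A)" using A polyp.linear_independent_injective_image by (metis H(1) linear_iff_module_hom module_hom.independent_injective_image)
 then have iA: "polyv.independent (h ` A)" using H by (metis image_cong)
 have "h ` A <= U'" using A h lmD(1) by blast
 then obtain B' where B': "h ` A <= B'" "B' <= U'" "polyv.independent B'" "spn B' = U'" using subspace_basis_extend[OF U'(1) _ iA] by blast
 have fB: "finite B" "finite B'" using B B' U U' finite_subset by blast+
 have "CARD('k) ^ card B = CARD('k) ^ card B'" using card_subspace(1)[OF fB(1) B(3,4)] card_subspace(1)[OF fB(2) B'(3,4)] c by simp
 then have cB: "card B = card B'" using power_inject_exp[OF CARD_gt1[where ?'k='k]] by blast
 have injA: "inj_on h A" using h(2) A(1) inj_on_subset by blast
 have "card (B - A) = card (B' - h ` A)" using cB fB B(1) B'(1) card_image[OF injA] by (simp add: card_Diff_subset finite_subset)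
 then obtain p where p: "bij_betw p (B - A) (B' - h ` A)" using fB finite_same_card_bij by (metis finite_Diff)
 let ?q = "%b. if b : A then h b else p b"
 have "bij_betw ?q (A \<union> (B - A)) (h ` A \<union> (B' - h ` A))"
 proof (rule bij_betw_combine)
  show "bij_betw ?q A (h ` A)" using injA by (simp add: bij_betw_def inj_on_def image_def)
  show "bij_betw ?q (B - A) (B' - h ` A)" using p by (rule bij_betw_cong[THEN iffD1, rotated]) auto
 qed auto
 then have q: "bij_betw ?q B B'" using B(1) B'(1) by (simp add: Un_absorb1)
 obtain G where G: "Vector_Spaces.linear sm sm G" "ALL b:B. G b = ?q b" using polyp.linear_independent_extend[OF B(3), of ?q] by blast
 have GB: "G ` B = B'" using bij_betw_imp_surj_on[OF q] image_cong[of B B G ?q] G(2) by simp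
 have "inj_on G B" using bij_betw_imp_inj_on[OF q] inj_on_cong[of B G ?q] G(2) by simp
 then have injG: "inj_on G U" using polyp.linear_inj_on_span_iff_independent_image[OF G(1), of B] GB B B' by simp
 have imG: "G ` U = U'" using polyp.linear_span_image[OF G(1), of B] GB B B' by simp
 let ?g = "%x. if x : U then G x else 0"
 have g: "?g : lin_map U U'" using lin_map_restrict[OF G(1) _ U(1)] imG by blast
 have "bij_betw ?g U U'" using injG imG by (simp add: bij_betw_def inj_on_def image_def)
 moreover have "?g x = h x" if "x : I" for x
 proof -
  have r: "(%x. if x : I then G x else 0) = h" by (rule lin_map_eqI[OF lin_map_restrict[OF G(1) order_refl I(1)] h(1) I(1) A(1)]) (use A G B in auto)
  have "(if x : I then G x else 0) = h x" by (rule fun_cong[OF r])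
  then show ?thesis using that I(2) by auto
 qed
 ultimately show thesis using that g by blast
qed

lemma subspace_lin_image:
 assumes "f : lin_map U W" "subsp U"
 shows "subsp (f ` U)"
proof (unfold polyv.subspace_def, intro conjI ballI allI)
 show "0 : f ` U" using assms sb_0 lin_map0 by (metis image_eqI)
 fix x y assume "x : f ` U" "y : f ` U"
 then show "x + y : f ` U" using assms lmD(2)[OF assms(1)] sb_add[OF assms(2)] by (metis (no_types, lifting) imageE image_eqI)
next
 fix c x assume "x : f ` U"
 then show "sm c x : f ` U" using assms lmD(3)[OF assms(1)] sb_scale[OF assms(2)] by (metis (no_types, lifting) imageE image_eqI)
qed

text \<open>All nonempty fibres are translates of the kernel. The setting of subsets of abelian
  groups covers linear maps as well as the coboundary map, whose arguments are families of
  functions.\<close>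

lemma card_additive_image:
 fixes f :: "'a::ab_group_add => 'b::ab_group_add"
 assumes fin: "finite G" and f: "!!x y. x : G ==> y : G ==> f (x - y) = f x - f y"
  and G: "!!x y. x : G ==> y : G ==> x - y : G" "!!x y. x : G ==> y : G ==> x + y : G"
  and f': "!!x y. x : G ==> y : G ==> f (x + y) = f x + f y"
 shows "card G = card (f ` G) * card {x : G. f x = 0}"
proof -
 have "card {x : G. f x = y} = card {x : G. f x = 0}" if yG: "y : f ` G" for y
 proof -
  obtain x0 where x0': "y = f x0" and x0: "x0 : G" using yG by (rule imageE)
  have "bij_betw (%x. x - x0) {x : G. f x = y} {x : G. f x = 0}" by (rule bij_betwI[where g = "%x. x + x0"]) (use x0 x0' f f' G in auto)
  then show ?thesis by (rule bij_betw_same_card)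
 qed
 then have "(SUM y:f ` G. card {x : G. f x = y}) = card (f ` G) * card {x : G. f x = 0}" by simp
 moreover have "card G = (SUM y:f ` G. card {x : G. f x = y})" using card_eq_sum[of G] sum.image_gen[OF fin, of "%_. 1::nat" f] by simp
 ultimately show ?thesis by simp
qed

text \<open>A pair U -> V -> W with composite zero is determined up to automorphisms of V by the
  size of V, the image of the second map and the kernel of the first. The isomorphism is forced on
  the image of \<open>b\<close>, extends from there to the kernels of \<open>a\<close> and
  \<open>a'\<close>, and then to a complement by means of sections.\<close>

lemma lin_pair_normal_form:
 fixes V :: "'k::{finite,field} poly set"
 assumes V: "subsp V" "finite V" and V': "subsp V'" "finite V'" and c: "card V = card V'"
  and W: "subsp W" and U: "subsp U" "finite U"
  and a: "a : lin_map V W" and a': "a' : lin_map V' W" and im: "a ` V = a' ` V'"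
  and b: "b : lin_map U V" and b': "b' : lin_map U V'" and ker: "!!x. x : U ==> b x = 0 \<longleftrightarrow> b' x = 0"
  and ab: "!!x. x : U ==> a (b x) = 0" and ab': "!!x. x : U ==> a' (b' x) = 0"
 obtains g where "g : lin_map V V'" "bij_betw g V V'" "!!x. x : V ==> a' (g x) = a x" "!!x. x : U ==> g (b x) = b' x"
proof -
 let ?C = "a ` V" and ?K = "{x : V. a x = 0}" and ?K' = "{x : V'. a' x = 0}"
 have C: "subsp ?C" by (rule subspace_lin_image[OF a V(1)])
 have K: "subsp ?K" and K': "subsp ?K'" using subspace_lin_kernel a a' V V' by blast+
 have "card V = card ?C * card ?K" by (rule card_additive_image) (use V a in "auto simp: lin_map_diff lmD sb_diff sb_add")
 moreover have "card V' = card ?C * card ?K'" unfolding im by (rule card_additive_image) (use V' a' in "auto simp: lin_map_diff lmD sb_diff sb_add")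
 moreover have "card ?C ~= 0" using V sb_0[OF V(1)] by auto
 ultimately have cK: "card ?K = card ?K'" using c by simp
 have bI: "(%x. b x) : lin_map U ?K" by (rule lin_map_mono[OF b]) (use ab lmD(1)[OF b] in blast)
 have bI': "(%x. b' x) : lin_map U ?K'" by (rule lin_map_mono[OF b']) (use ab' lmD(1)[OF b'] in blast)
 let ?I = "b ` U"
 have I: "subsp ?I" "?I <= ?K" using subspace_lin_image[OF b U(1)] lmD(1)[OF bI] by blast+
 obtain u where u: "u : lin_map ?I U" "!!x. x : ?I ==> b (u x) = x" using lin_section[OF lin_map_mono[OF b order_refl] U(1) I(1)] by blast
 \<comment> \<open>This sends \<open>b x\<close> to \<open>b' x\<close>; equality of the two kernels
   makes it well defined and injective on the image of \<open>b\<close>.\<close>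
 let ?h = "%x. b' (u x)"
 have h: "?h : lin_map ?I ?K'" by (rule lin_map_comp[OF u(1) bI' I(1)])
 have inj: "inj_on ?h ?I"
 proof (rule lin_map_inj_onI[OF h I(1)])
  fix x assume x: "x : ?I" "?h x = 0"
  have "b (u x) = 0" using ker[of "u x"] lmD(1)[OF u(1) x(1)] x(2) by blast
  then show "x = 0" using u(2)[OF x(1)] by simp
 qed
 have hb: "?h (b x) = b' x" if x: "x : U" for x
 proof -
  let ?y = "u (b x)"
  have y: "?y : U" "b ?y = b x" using lmD(1)[OF u(1)] u(2) x by blast+
  have "b (?y - x) = 0" using lin_map_diff[OF b U(1) y(1) x] y by simp
  then have "b' (?y - x) = 0" using ker[of "?y - x"] sb_diff[OF U(1) y(1) x] by blast
  then show ?thesis using lin_map_diff[OF b' U(1) y(1) x] by simp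
 qed
 obtain g0 where g0: "g0 : lin_map ?K ?K'" "bij_betw g0 ?K ?K'" "!!x. x : ?I ==> g0 x = ?h x" using lin_iso_extend[OF K _ K' _ cK I h inj] V V' by auto
 obtain s where s: "s : lin_map ?C V" "!!x. x : ?C ==> a (s x) = x" using lin_section[OF lin_map_mono[OF a order_refl] V(1) C] by blast
 obtain s' where s': "s' : lin_map ?C V'" "!!x. x : ?C ==> a' (s' x) = x" using lin_section[OF lin_map_mono[OF a', of ?C] V'(1) C] im by blast
 let ?r = "%x. (if x : V then x else 0) - s (a x)"
 have idV: "(%x. if x : V then x else 0) : lin_map V V" by (rule lin_map_id[OF V(1)])
 have r1: "?r : lin_map V V" by (rule lin_map_sub[OF idV lin_map_comp[OF lin_map_mono[OF a order_refl] s(1) V(1)] V(1)])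
 have r: "?r : lin_map V ?K"
 proof (rule lin_map_mono[OF r1], rule image_subsetI, intro CollectI conjI)
  fix x assume x: "x : V"
  show "?r x : V" using lmD(1)[OF r1 x] .
  have sx: "s (a x) : V" using lmD(1)[OF s(1)] x by blast
  have "a (x - s (a x)) = 0" using lin_map_diff[OF a V(1) x sx] s(2) x by simp
  then show "a (?r x) = 0" using x by simp
 qed
 \<comment> \<open>\<open>V\<close> is the sum of the kernel of \<open>a\<close> and the image of
   \<open>s\<close>, and \<open>?r\<close> projects to the former. The map is \<open>g0\<close> on
   the kernel and exchanges \<open>s\<close> for \<open>s'\<close> on the complement.\<close>
 let ?g = "%x. g0 (?r x) + s' (a x)"
 have g0V: "g0 : lin_map ?K V'" using lin_map_mono[OF g0(1), of V'] lmD(1)[OF g0(1)] by blast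
 have g: "?g : lin_map V V'" by (rule lin_map_add[OF lin_map_comp[OF r g0V V(1)] lin_map_comp[OF lin_map_mono[OF a order_refl] s'(1) V(1)] V'(1)])
 have ag: "a' (?g x) = a x" if x: "x : V" for x
 proof -
  have 1: "g0 (?r x) : ?K'" using lmD(1)[OF g0(1)] lmD(1)[OF r x] by blast
  have 2: "s' (a x) : V'" using lmD(1)[OF s'(1)] x by blast
  show ?thesis using lmD(2)[OF a' _ 2, of "g0 (?r x)"] 1 s'(2)[of "a x"] x by simp
 qed
 have "inj_on ?g V"
 proof (rule lin_map_inj_onI[OF g V(1)])
  fix x assume x: "x : V" "?g x = 0"
  have "a x = 0" using ag[OF x(1)] x(2) lin_map0[OF a'] by simp
  then have 1: "s' (a x) = 0" "?r x = x" "x : ?K" using lin_map0[OF s'(1)] lin_map0[OF s(1)] x(1) by simp_all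
  then have "g0 x = 0" using x(2) by simp
  then show "x = 0" using g0(2) 1(3) lin_map0[OF g0(1)] sb_0[OF K] by (auto simp: bij_betw_def inj_on_def)
 qed
 moreover have "?g ` V = V'"
 proof (rule card_subset_eq[OF V'(2)])
  show "?g ` V <= V'" using lmD(1)[OF g] by blast
  show "card (?g ` V) = card V'" using card_image[OF \<open>inj_on ?g V\<close>] c by simp
 qed
 ultimately have bij: "bij_betw ?g V V'" by (simp add: bij_betw_def)
 have gb: "?g (b x) = b' x" if x: "x : U" for x
 proof -
  have "b x : V" using lmD(1)[OF b x] .
  then have "?g (b x) = g0 (b x)" using ab[OF x] lin_map0[OF s(1)] lin_map0[OF s'(1)] by simp
  then show ?thesis using g0(3)[of "b x"] hb[OF x] x by auto
 qed
 show thesis by (rule that[OF g bij ag gb])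
qed

section \<open>Extensions and cocycles\<close>

text \<open>Middle terms of extensions have to live in \<open>'k poly\<close> again. Interleaving
  the coefficients identifies pairs of polynomials linearly with polynomials, which gives a direct
  sum inside this one space.\<close>

definition pjoin :: "'k::field poly => 'k poly => 'k poly" where
 "pjoin x y = Abs_poly (%n. if even n then coeff x (n div 2) else coeff y (n div 2))"

definition pfst :: "'k::field poly => 'k poly" where
 "pfst p = Abs_poly (%n. coeff p (2 * n))"

definition psnd :: "'k::field poly => 'k poly" where
 "psnd p = Abs_poly (%n. coeff p (2 * n + 1))"

lemma coeff_pjoin: "coeff (pjoin x y) n = (if even n then coeff x (n div 2) else coeff y (n div 2))" unfolding pjoin_def by (subst coeff_Abs_poly[of "2 * degree x + 2 * degree y + 1"])
  (auto intro!: coeff_eq_0 elim!: evenE oddE)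

lemma coeff_pfst: "coeff (pfst p) n = coeff p (2 * n)" unfolding pfst_def by (subst coeff_Abs_poly[of "degree p"]) (auto intro!: coeff_eq_0)

lemma coeff_psnd: "coeff (psnd p) n = coeff p (2 * n + 1)" unfolding psnd_def by (subst coeff_Abs_poly[of "degree p"]) (auto intro!: coeff_eq_0)

lemma pfst_pjoin [simp]: "pfst (pjoin x y) = x"
 and psnd_pjoin [simp]: "psnd (pjoin x y) = y"
 and pjoin_collapse [simp]: "pjoin (pfst p) (psnd p) = p"
 and pfst_0 [simp]: "pfst 0 = 0" and psnd_0 [simp]: "psnd 0 = 0" and pjoin_0 [simp]: "pjoin 0 0 = 0" by (auto simp: poly_eq_iff coeff_pjoin coeff_pfst coeff_psnd elim!: oddE)

lemma pfst_add: "pfst (p + q) = pfst p + pfst q" and psnd_add: "psnd (p + q) = psnd p + psnd q"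
 and pfst_sm: "pfst (sm c p) = sm c (pfst p)" and psnd_sm: "psnd (sm c p) = sm c (psnd p)"
 and pjoin_add: "pjoin x y + pjoin x' y' = pjoin (x + x') (y + y')"
 and pjoin_sm: "sm c (pjoin x y) = pjoin (sm c x) (sm c y)" by (auto simp: poly_eq_iff coeff_pjoin coeff_pfst coeff_psnd)

lemma pjoin_eq_iff [simp]: "pjoin x y = pjoin x' y' \<longleftrightarrow> x = x' & y = y'" by (metis pfst_pjoin psnd_pjoin)

lemma pjoin_eq_0_iff [simp]: "pjoin x y = 0 \<longleftrightarrow> x = 0 & y = 0" using pjoin_eq_iff[of x y 0 0] by simp

lemma poly_pair_eqI: "pfst p = pfst q ==> psnd p = psnd q ==> p = q" by (metis pjoin_collapse)

definition pprod :: "'k::field poly set => 'k poly set => 'k poly set" where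
 "pprod U W = {p. pfst p : U & psnd p : W}"

lemma pjoin_in_pprod [simp]: "pjoin x y : pprod U W \<longleftrightarrow> x : U & y : W" by (simp add: pprod_def)

lemma pprodD: "p : pprod U W ==> pfst p : U" "p : pprod U W ==> psnd p : W" by (simp_all add: pprod_def)

lemma subspace_pprod: "subsp U ==> subsp W ==> subsp (pprod U W)" by (simp add: polyv.subspace_def pprod_def pfst_add psnd_add pfst_sm psnd_sm)

lemma bij_pprod: "bij_betw (%(x, y). pjoin x y) (U \<times> W) (pprod U W)" by (rule bij_betwI[where g = "%p. (pfst p, psnd p)"]) (auto simp: pprod_def)

lemma pprod_zero: "pprod {0} {0} = {0}"
proof -
 have "p = 0" if "pfst p = 0" "psnd p = 0" for p :: "'k::field poly" using that pjoin_collapse[of p] by simp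
 then show ?thesis by (auto simp: pprod_def)
qed

lemma finite_pprod: "finite U ==> finite W ==> finite (pprod U W)" using bij_betw_finite[OF bij_pprod] by blast

lemma card_pprod: "card (pprod U W) = card U * card W" using bij_betw_same_card[OF bij_pprod, of U W] by (simp add: card_cartesian_product)

lemma dim_eq_iff_card:
 fixes U W :: "'k::{finite,field} poly set"
 assumes "subsp U" "finite U" "subsp W" "finite W"
 shows "dm U = dm W \<longleftrightarrow> card U = card W" using card_poly_subspace[OF assms(1,2)] card_poly_subspace[OF assms(3,4)]
  power_inject_exp[OF CARD_gt1[where ?'k='k]] by simp

lemma dim_pprod:
 fixes U W :: "'k::{finite,field} poly set"
 assumes "subsp U" "finite U" "subsp W" "finite W"
 shows "dm (pprod U W) = dm U + dm W"
proof -
 have "CARD('k) ^ dm (pprod U W) = CARD('k) ^ (dm U + dm W)" using card_poly_subspace[OF assms(1,2)] card_poly_subspace[OF assms(3,4)]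
   card_poly_subspace[OF subspace_pprod finite_pprod, of U W] assms card_pprod[of U W] by (simp add: power_add)
 then show ?thesis using power_inject_exp[OF CARD_gt1[where ?'k='k]] by blast
qed

text \<open>An arc walk without the demand that its start be a vertex, so that inductions can peel
  off the first arrow.\<close>

definition qpath :: "('k, 'i, 'a) bquiver => 'i => 'a list => 'i => bool" where
 "qpath A u p w \<longleftrightarrow> set p <= arrs A & pre_digraph.cas (quiver A) u p w"

lemma qpath_Nil [simp]: "qpath A u [] w \<longleftrightarrow> u = w"
 and qpath_Cons [simp]: "qpath A u (a # p) w \<longleftrightarrow>
  a : arrs A & tv A a = u & qpath A (hv A a) p w" by (auto simp: qpath_def pre_digraph.cas.simps)

text \<open>Representations of the bare quiver. Block triangular families are built at this level,
  and the relations are imposed afterwards.\<close>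

definition prerep :: "('k::field, 'i, 'a) bquiver => ('k, 'i, 'a) rep => bool" where
 "prerep A M \<longleftrightarrow> (ALL i. subsp (Sp M i)) & (ALL i. i ~: verts (quiver A) --> Sp M i = {0})
 & (ALL a:arrs A.
    Mp M a : lin_map (Sp M (tv A a)) (Sp M (hv A a)))
 & (ALL a. a ~: arrs A --> Mp M a = (%_. 0))"

lemma reps_iff: "M : reps A \<longleftrightarrow> prerep A M &
  (ALL (u, rh):relns A. ALL x:Sp M u. (\<Sum>(c, p)\<leftarrow>rh. sm c (fold (Mp M) p x)) = 0)" unfolding reps_def prerep_def by (simp only: mem_Collect_eq conj_assoc)

lemma prD:
 assumes "prerep A M"
 shows "subsp (Sp M i)" "i ~: verts (quiver A) ==> Sp M i = {0}"
  "a : arrs A ==> Mp M a : lin_map (Sp M (tv A a)) (Sp M (hv A a))"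
  "a ~: arrs A ==> Mp M a x = 0"
proof -
 show "subsp (Sp M i)" using assms unfolding prerep_def by (elim conjE) (erule spec)
 show "i ~: verts (quiver A) ==> Sp M i = {0}" using assms unfolding prerep_def by (elim conjE) (drule spec, erule mp)
 show "a : arrs A ==> Mp M a : lin_map (Sp M (tv A a)) (Sp M (hv A a))" using assms unfolding prerep_def by (elim conjE) (erule (1) bspec)
 assume "a ~: arrs A"
 then have "Mp M a = (%_. 0)" using assms unfolding prerep_def by blast
 then show "Mp M a x = 0" by simp
qed

lemma prR: "M : reps A ==> prerep A M" by (simp add: reps_iff)

lemma prerep_Mp0: "prerep A M ==> Mp M a 0 = 0" using lin_map0[OF prD(3)] prD(4) by metis

section \<open>Morphisms, isomorphisms and nilpotency\<close>

lemma HomsD: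
 assumes "f : Homs A M N"
 shows "f i : lin_map (Sp M i) (Sp N i)"
  "a : arrs A ==> x : Sp M (tv A a) ==>
   f (hv A a) (Mp M a x) = Mp N a (f (tv A a) x)" using assms unfolding Homs_def by blast+

lemma Homs_mem: "f : Homs A M N ==> x : Sp M i ==> f i x : Sp N i" using lmD(1)[OF HomsD(1)] .

lemma HomsI:
 assumes "!!i. f i : lin_map (Sp M i) (Sp N i)"
  "!!a x. a : arrs A ==> x : Sp M (tv A a) ==>
   f (hv A a) (Mp M a x) = Mp N a (f (tv A a) x)"
 shows "f : Homs A M N" using assms unfolding Homs_def by blast

lemma prerep_mem: "prerep A M ==> a : arrs A ==> x : Sp M (tv A a) ==> Mp M a x : Sp M (hv A a)" using lmD(1)[OF prD(3)] .

lemma Homs_id: "prerep A M ==> (%i x. if x : Sp M i then x else 0) : Homs A M M" by (rule HomsI) (simp_all add: lin_map_id prD(1) prerep_mem)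

lemma Homs_comp:
 assumes "prerep A L" "f : Homs A L M" "g : Homs A M N"
 shows "(%i x. g i (f i x)) : Homs A L N"
proof (rule HomsI)
 show "(%x. g i (f i x)) : lin_map (Sp L i) (Sp N i)" for i by (rule lin_map_comp[OF HomsD(1)[OF assms(2)] HomsD(1)[OF assms(3)] prD(1)[OF assms(1)]])
qed (simp add: HomsD(2)[OF assms(2)] HomsD(2)[OF assms(3)] Homs_mem[OF assms(2)])

lemma Homs_inverse:
 assumes M: "prerep A M" and f: "f : Homs A M N" and b: "!!i. bij_betw (f i) (Sp M i) (Sp N i)"
 obtains g where "g : Homs A N M" "!!i. bij_betw (g i) (Sp N i) (Sp M i)"
  "!!i x. x : Sp M i ==> g i (f i x) = x" "!!i y. y : Sp N i ==> f i (g i y) = y"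
proof -
 have "ALL i. EX g. g : lin_map (Sp N i) (Sp M i) & bij_betw g (Sp N i) (Sp M i) &
   (ALL x:Sp M i. g (f i x) = x) & (ALL y:Sp N i. f i (g y) = y)" using lin_map_inverse[OF HomsD(1)[OF f] prD(1)[OF M] b] by metis
 then obtain g where g: "!!i. g i : lin_map (Sp N i) (Sp M i)" "!!i. bij_betw (g i) (Sp N i) (Sp M i)"
   "!!i x. x : Sp M i ==> g i (f i x) = x" "!!i y. y : Sp N i ==> f i (g i y) = y" by metis
 have "g : Homs A N M"
 proof (rule HomsI)
  fix a x assume a: "a : arrs A" and x: "x : Sp N (tv A a)"
  have gx: "g (tv A a) x : Sp M (tv A a)" using lmD(1)[OF g(1) x] .
  have "Mp N a x = f (hv A a) (Mp M a (g (tv A a) x))" using HomsD(2)[OF f a gx] g(4)[OF x] by simp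
  then show "g (hv A a) (Mp N a x) = Mp M a (g (tv A a) x)" using g(3) prerep_mem[OF M a gx] by simp
 qed (rule g(1))
 then show thesis using that g by blast
qed

lemma Homs_fold:
 assumes M: "prerep A M" and f: "f : Homs A M N" and p: "qpath A u p w" and x: "x : Sp M u"
 shows "fold (Mp M) p x : Sp M w" "f w (fold (Mp M) p x) = fold (Mp N) p (f u x)"
proof -
 have "fold (Mp M) p x : Sp M w & f w (fold (Mp M) p x) = fold (Mp N) p (f u x)" using p x
 proof (induction p arbitrary: u x)
  case (Cons a p)
  then have a: "a : arrs A" "tv A a = u" "qpath A (hv A a) p w" by simp_all
  have "Mp M a x : Sp M (hv A a)" using prerep_mem[OF M a(1)] a Cons.prems by simp
  from Cons.IH[OF a(3) this] show ?case using HomsD(2)[OF f a(1)] a Cons.prems by simp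
 qed simp
 then show "fold (Mp M) p x : Sp M w" "f w (fold (Mp M) p x) = fold (Mp N) p (f u x)" by simp_all
qed

lemma iso_repI: "f : Homs A M N ==> (!!i. bij_betw (f i) (Sp M i) (Sp N i)) ==> iso_rep A M N" unfolding iso_rep_def by blast

lemma iso_rep_refl:
 assumes M: "prerep A M" shows "iso_rep A M M"
proof (rule iso_repI[OF Homs_id[OF M]])
 show "bij_betw (%x. if x : Sp M i then x else 0) (Sp M i) (Sp M i)" for i by (simp add: bij_betw_def inj_on_def)
qed

lemma iso_rep_sym: "prerep A M ==> iso_rep A M N ==> iso_rep A N M" unfolding iso_rep_def by (metis Homs_inverse)

lemma iso_rep_trans:
 assumes "prerep A L" "iso_rep A L M" "iso_rep A M N" shows "iso_rep A L N"
proof -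
 obtain f g where f: "f : Homs A L M" "!!i. bij_betw (f i) (Sp L i) (Sp M i)"
  and g: "g : Homs A M N" "!!i. bij_betw (g i) (Sp M i) (Sp N i)" using assms(2,3) unfolding iso_rep_def by blast
 show ?thesis by (rule iso_repI[OF Homs_comp[OF assms(1) f(1) g(1)]])
   (use bij_betw_trans[OF f(2) g(2)] in "simp add: comp_def")
qed

text \<open>Over a finite field a space is finite-dimensional exactly if it is a finite set; see
  \<open>modnil_iff\<close>.\<close>

definition fdim :: "('k::field, 'i, 'a) rep => bool" where
 "fdim M \<longleftrightarrow> (ALL i. finite (Sp M i))"

lemma finite_subspace:
 fixes U :: "'k::{finite,field} poly set"
 assumes "subsp U" "finite B" "U <= spn B"
 shows "finite U"
proof -
 obtain B' where B': "B' <= U" "polyv.independent B'" "spn B' = U" using subspace_basis[OF assms(1)] .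
 then have "finite B'" using polyv.independent_span_bound[OF assms(2) B'(2)] assms(3) by blast
 then show ?thesis using card_subspace(2)[OF _ B'(2,3)] by blast
qed

definition nilp :: "('k::field, 'i, 'a) bquiver => ('k, 'i, 'a) rep => bool" where
 "nilp A M \<longleftrightarrow> (ALL u p. p ~= [] & pre_digraph.awalk (quiver A) u p u -->
    (EX n. ALL x:Sp M u. (fold (Mp M) p ^^ n) x = 0))"

lemma modnil_iff: "M : modnil A \<longleftrightarrow> M : reps A & fdim M & nilp A M"
 for M :: "('k::{finite,field}, 'i, 'a) rep"
proof -
 have "(ALL i. EX B. finite B & Sp M i <= spn B) \<longleftrightarrow> fdim M" if "M : reps A" unfolding fdim_def using finite_subspace[OF prD(1)[OF prR[OF that]]] polyv.span_superset by meson
 then show ?thesis unfolding modnil_def nilp_def by blast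
qed

lemma awalk_qpath: "pre_digraph.awalk (quiver A) u p w ==> qpath A u p w" by (simp add: pre_digraph.awalk_def qpath_def)

lemma funpow_Homs:
 assumes M: "prerep A M" and f: "f : Homs A M N" and p: "qpath A u p u" and x: "x : Sp M u"
 shows "(fold (Mp M) p ^^ n) x : Sp M u & f u ((fold (Mp M) p ^^ n) x) = (fold (Mp N) p ^^ n) (f u x)" by (induction n) (use x Homs_fold[OF M f p] in auto)

lemma sesD:
 assumes "ses A N f L g M"
 shows "f : Homs A N L" "g : Homs A L M" "inj_on (f i) (Sp N i)"
  "f i ` Sp N i = {x : Sp L i. g i x = 0}" "g i ` Sp L i = Sp M i" using assms unfolding ses_def by blast+

text \<open>If a cycle acts on \<open>M\<close> with n-th power zero and on \<open>N\<close> with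
  m-th power zero, then n rounds push a vector of \<open>L\<close> into the image of
  \<open>N\<close>, and m more rounds kill it.\<close>

lemma ses_modnil:
 fixes L :: "('k::{finite,field}, 'i, 'a) rep"
 assumes s: "ses A N f L g M" and L: "L : reps A" and N: "N : modnil A" and M: "M : modnil A" and fd: "fdim L"
 shows "L : modnil A" unfolding modnil_iff nilp_def
proof (intro conjI allI impI)
 fix u p assume up: "p ~= [] & pre_digraph.awalk (quiver A) u p u"
 then have p: "qpath A u p u" using awalk_qpath[of A u p u] by simp
 have pL: "prerep A L" and pN: "prerep A N" using L N prR modnil_iff by blast+
 obtain n where n: "ALL x:Sp M u. (fold (Mp M) p ^^ n) x = 0" using M up unfolding modnil_iff nilp_def by blast
 obtain m where m: "ALL x:Sp N u. (fold (Mp N) p ^^ m) x = 0" using N up unfolding modnil_iff nilp_def by blast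
 have "(fold (Mp L) p ^^ (m + n)) x = 0" if x: "x : Sp L u" for x
 proof -
  let ?y = "(fold (Mp L) p ^^ n) x"
  note y = funpow_Homs[OF pL sesD(2)[OF s] p x, of n]
  have "g u ?y = 0" using y n Homs_mem[OF sesD(2)[OF s] x] by simp
  then have "?y : f u ` Sp N u" using sesD(4)[OF s, of u] y by blast
  then obtain w where w: "w : Sp N u" "?y = f u w" by blast
  have "(fold (Mp L) p ^^ m) ?y = 0" using funpow_Homs[OF pN sesD(1)[OF s] p w(1), of m] m w lin_map0[OF HomsD(1)[OF sesD(1)[OF s]], of u] by simp
  then show ?thesis by (simp add: funpow_add)
 qed
 then show "EX n. ALL x:Sp L u. (fold (Mp L) p ^^ n) x = 0" by blast
qed (use L fd in auto)

lemma iso_modnil: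
 fixes M :: "('k::{finite,field}, 'i, 'a) rep"
 assumes M: "M : modnil A" and N: "N : reps A" and i: "iso_rep A M N"
 shows "N : modnil A"
proof -
 have pM: "prerep A M" and pN: "prerep A N" using M N prR modnil_iff by blast+
 obtain f where f: "f : Homs A M N" "!!i. bij_betw (f i) (Sp M i) (Sp N i)" using i unfolding iso_rep_def by blast
 show ?thesis unfolding modnil_iff nilp_def
 proof (intro conjI allI impI)
  show "fdim N" using M f(2) bij_betw_finite unfolding modnil_iff fdim_def by blast
  fix u p assume up: "p ~= [] & pre_digraph.awalk (quiver A) u p u"
  then have p: "qpath A u p u" using awalk_qpath[of A u p u] by simp
  obtain n where n: "ALL x:Sp M u. (fold (Mp M) p ^^ n) x = 0" using M up unfolding modnil_iff nilp_def by blast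
  have "(fold (Mp N) p ^^ n) y = 0" if y: "y : Sp N u" for y
  proof -
   obtain x where x: "x : Sp M u" "y = f u x" using y f(2)[of u] by (auto simp: bij_betw_def)
   show ?thesis using funpow_Homs[OF pM f(1) p x(1), of n] n x lin_map0[OF HomsD(1)[OF f(1)], of u] by simp
  qed
  then show "EX n. ALL x:Sp N u. (fold (Mp N) p ^^ n) x = 0" by blast
 qed (rule N)
qed

text \<open>By \<open>relns_wf\<close> all paths of a relation end at one vertex. The value of a
  relation at a vector then lies in a single space, where morphisms can be applied to it.\<close>

locale fin_bquiver =
 fixes A :: "('k::{finite,field}, 'i, 'a) bquiver"
 assumes fin_verts: "finite (verts (quiver A))" and fin_arcs: "finite (arrs A)"
  and tail_verts: "a : arrs A ==> tv A a : verts (quiver A)"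
  and relns_wf: "(u, rh) : relns A ==> EX w. ALL (c, p):set rh. qpath A u p w"
begin

text \<open>A morphism carries the value of a relation at x to its value at the image of x, which
  vanishes in \<open>L\<close>; injectivity takes this back. This is how families of maps built by
  hand acquire the relations.\<close>

lemma reps_inj:
 assumes E: "prerep A E" and L: "L : reps A" and f: "f : Homs A E L" and inj: "!!i. inj_on (f i) (Sp E i)"
 shows "E : reps A" unfolding reps_iff
proof (intro conjI E ballI, clarify)
 fix u rh x assume r: "(u, rh) : relns A" and x: "x : Sp E u"
 obtain w where w: "ALL (c, p):set rh. qpath A u p w" using relns_wf[OF r] by blast
 let ?s = "%si. (\<Sum>(c, p)\<leftarrow>si. sm c (fold (Mp E) p x))"
 have W: "subsp (Sp E w)" by (rule prD(1)[OF E])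
 have fw: "f w : lin_map (Sp E w) (Sp L w)" by (rule HomsD(1)[OF f])
 have "?s si : Sp E w & f w (?s si) = (\<Sum>(c, p)\<leftarrow>si. sm c (fold (Mp L) p (f u x)))" if "ALL (c, p):set si. qpath A u p w" for si using that
 proof (induction si)
  case Nil
  show ?case using sb_0[OF W] lin_map0[OF fw] by simp
 next
  case (Cons cp si)
  obtain c p where cp: "cp = (c, p)" by force
  have p: "qpath A u p w" using Cons.prems cp by simp
  have IH: "?s si : Sp E w" "f w (?s si) = (\<Sum>(c, p)\<leftarrow>si. sm c (fold (Mp L) p (f u x)))" using Cons by simp_all
  note h = Homs_fold[OF E f p x]
  have 1: "sm c (fold (Mp E) p x) : Sp E w" by (rule sb_scale[OF W h(1)])
  have "?s (cp # si) = sm c (fold (Mp E) p x) + ?s si" using cp by simp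
  then show ?case using sb_add[OF W 1 IH(1)] lmD(2)[OF fw 1 IH(1)] lmD(3)[OF fw h(1), of c] h(2) IH(2) cp by simp
 qed
 from this[OF w] have s: "?s rh : Sp E w" "f w (?s rh) = (\<Sum>(c, p)\<leftarrow>rh. sm c (fold (Mp L) p (f u x)))" by blast+
 have "(\<Sum>(c, p)\<leftarrow>rh. sm c (fold (Mp L) p (f u x))) = 0" using L r Homs_mem[OF f x] unfolding reps_iff by blast
 then have "f w (?s rh) = f w 0" using s(2) lin_map0[OF fw] by simp
 then show "?s rh = 0" using inj_onD[OF inj _ s(1) sb_0[OF W]] by blast
qed

lemma reps_iso:
 assumes M: "M : reps A" and N: "prerep A N" and i: "iso_rep A M N"
 shows "N : reps A"
proof -
 have "iso_rep A N M" by (rule iso_rep_sym[OF prR[OF M] i])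
 then obtain f where "f : Homs A N M" "!!i. bij_betw (f i) (Sp N i) (Sp M i)" unfolding iso_rep_def by blast
 then show ?thesis using reps_inj[OF N M] bij_betw_imp_inj_on by blast
qed

text \<open>\<open>cochain0\<close>, \<open>cochain1\<close> and \<open>cob\<close> form the
  two-term complex with kernel Hom; the cocycles modulo its image are the classes of
  extensions.\<close>

definition cochain0 :: "('k, 'i, 'a) rep => ('k, 'i, 'a) rep => ('i => 'k poly => 'k poly) set" where
 "cochain0 M N = {h. ALL i. h i : lin_map (Sp M i) (Sp N i)}"

definition cochain1 :: "('k, 'i, 'a) rep => ('k, 'i, 'a) rep => ('a => 'k poly => 'k poly) set" where
 "cochain1 M N = {z. (ALL a:arrs A. z a : lin_map (Sp M (tv A a)) (Sp N (hv A a)))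
  & (ALL a. a ~: arrs A --> z a = (%_. 0))}"

definition cob :: "('k, 'i, 'a) rep => ('k, 'i, 'a) rep => ('i => 'k poly => 'k poly) => 'a => 'k poly => 'k poly" where
 "cob M N h = (%a x. Mp N a (h (tv A a) x) - h (hv A a) (Mp M a x))"

definition ext_rep :: "('k, 'i, 'a) rep => ('k, 'i, 'a) rep => ('a => 'k poly => 'k poly) => ('k, 'i, 'a) rep" where
 "ext_rep M N z = \<lparr>Sp = (%i. pprod (Sp N i) (Sp M i)),
  Mp = (%a p. if a : arrs A & p : pprod (Sp N (tv A a)) (Sp M (tv A a))
   then pjoin (Mp N a (pfst p) + z a (psnd p)) (Mp M a (psnd p)) else 0)\<rparr>"

text \<open>The linearized relations stay implicit here: z is a cocycle if the block triangular
  module with off-diagonal block z satisfies the relations. They are made explicit for the iquiver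
  algebra in \<open>cocycles_Lam_iff\<close>.\<close>

definition cocycles :: "('k, 'i, 'a) rep => ('k, 'i, 'a) rep => ('a => 'k poly => 'k poly) set" where
 "cocycles M N = {z : cochain1 M N. ext_rep M N z : reps A}"

definition std_extn :: "('k, 'i, 'a) rep => ('k, 'i, 'a) rep => ('a => 'k poly => 'k poly) => ('k, 'i, 'a) extn" where
 "std_extn M N z = ((%i x. if x : Sp N i then pjoin x 0 else 0), ext_rep M N z,
  (%i p. if p : pprod (Sp N i) (Sp M i) then psnd p else 0))"

lemma Sp_ext_rep [simp]: "Sp (ext_rep M N z) i = pprod (Sp N i) (Sp M i)" by (simp add: ext_rep_def)

lemma Mp_ext_rep: "a : arrs A ==> p : pprod (Sp N (tv A a)) (Sp M (tv A a)) ==>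
  Mp (ext_rep M N z) a p = pjoin (Mp N a (pfst p) + z a (psnd p)) (Mp M a (psnd p))" by (simp add: ext_rep_def)

lemma cochain0D: "h : cochain0 M N ==> h i : lin_map (Sp M i) (Sp N i)" by (simp add: cochain0_def)

lemma cochain1D:
 "z : cochain1 M N ==> a : arrs A ==> z a : lin_map (Sp M (tv A a)) (Sp N (hv A a))"
 "z : cochain1 M N ==> a ~: arrs A ==> z a x = 0" unfolding cochain1_def by auto

lemma cochain1_0: "z : cochain1 M N ==> z a 0 = 0" using lin_map0[OF cochain1D(1)] cochain1D(2) by metis

lemma cochain1_out: "z : cochain1 M N ==> x ~: Sp M (tv A a) ==> z a x = 0" using lmD(4)[OF cochain1D(1)] cochain1D(2) by metis

lemma fdim_ext_rep: "fdim M ==> fdim N ==> fdim (ext_rep M N z)" by (simp add: fdim_def finite_pprod)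

lemma prerep_ext_rep:
 assumes M: "prerep A M" and N: "prerep A N" and z: "z : cochain1 M N"
 shows "prerep A (ext_rep M N z)" unfolding prerep_def
proof (intro conjI allI ballI impI)
 show "subsp (Sp (ext_rep M N z) i)" for i by (simp add: subspace_pprod[OF prD(1)[OF N] prD(1)[OF M]])
 show "Sp (ext_rep M N z) i = {0}" if "i ~: verts (quiver A)" for i using prD(2)[OF M that] prD(2)[OF N that] by (simp add: pprod_zero)
 show "Mp (ext_rep M N z) a = (%_. 0)" if "a ~: arrs A" for a using that by (simp add: ext_rep_def)
next
 fix a assume a: "a : arrs A"
 note n = prD(3)[OF N a] and m = prD(3)[OF M a] and zz = cochain1D(1)[OF z a]
 have sp: "subsp (pprod (Sp N (tv A a)) (Sp M (tv A a)))" by (rule subspace_pprod[OF prD(1)[OF N] prD(1)[OF M]])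
 show "Mp (ext_rep M N z) a : lin_map (Sp (ext_rep M N z) (tv A a)) (Sp (ext_rep M N z) (hv A a))" unfolding Sp_ext_rep
 proof (rule lin_mapI)
  fix x assume x: "x : pprod (Sp N (tv A a)) (Sp M (tv A a))"
  show "Mp (ext_rep M N z) a x : pprod (Sp N (hv A a)) (Sp M (hv A a))" unfolding Mp_ext_rep[OF a x] using pprodD[OF x] lmD(1)[OF n] lmD(1)[OF m] lmD(1)[OF zz] sb_add[OF prD(1)[OF N]] by simp
  fix c
  show "Mp (ext_rep M N z) a (sm c x) = sm c (Mp (ext_rep M N z) a x)" unfolding Mp_ext_rep[OF a x] Mp_ext_rep[OF a sb_scale[OF sp x]] pfst_sm psnd_sm using pprodD[OF x] lmD(3)[OF n] lmD(3)[OF m] lmD(3)[OF zz] by (simp add: pjoin_sm smult_add_right)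
 next
  fix x y assume x: "x : pprod (Sp N (tv A a)) (Sp M (tv A a))"
   and y: "y : pprod (Sp N (tv A a)) (Sp M (tv A a))"
  show "Mp (ext_rep M N z) a (x + y) = Mp (ext_rep M N z) a x + Mp (ext_rep M N z) a y" unfolding Mp_ext_rep[OF a x] Mp_ext_rep[OF a y] Mp_ext_rep[OF a sb_add[OF sp x y]] pfst_add psnd_add using pprodD[OF x] pprodD[OF y] lmD(2)[OF n] lmD(2)[OF m] lmD(2)[OF zz] by (simp add: pjoin_add algebra_simps)
 qed (simp add: ext_rep_def)
qed

lemma std_extn_homs:
 assumes M: "prerep A M" and N: "prerep A N" and z: "z : cochain1 M N"
 shows "(%i x. if x : Sp N i then pjoin x 0 else 0) : Homs A N (ext_rep M N z)"
  "(%i p. if p : pprod (Sp N i) (Sp M i) then psnd p else 0) : Homs A (ext_rep M N z) M"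
proof -
 note [simp] = sb_0[OF prD(1)[OF M]] sb_0[OF prD(1)[OF N]]
  prerep_mem[OF N] prerep_mem[OF M] prerep_Mp0[OF M] prerep_Mp0[OF N] cochain1_0[OF z]
 show "(%i x. if x : Sp N i then pjoin x 0 else 0) : Homs A N (ext_rep M N z)"
 proof (rule HomsI)
  show "(%x. if x : Sp N i then pjoin x 0 else 0) : lin_map (Sp N i) (Sp (ext_rep M N z) i)" for i by (rule lin_mapI) (simp_all add: pjoin_add pjoin_sm sb_add[OF prD(1)[OF N]]
    sb_scale[OF prD(1)[OF N]])
 qed (simp add: Mp_ext_rep)
 show "(%i p. if p : pprod (Sp N i) (Sp M i) then psnd p else 0) : Homs A (ext_rep M N z) M"
 proof (rule HomsI)
  have sp: "subsp (pprod (Sp N i) (Sp M i))" for i by (rule subspace_pprod[OF prD(1)[OF N] prD(1)[OF M]])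
  show "(%p. if p : pprod (Sp N i) (Sp M i) then psnd p else 0) : lin_map (Sp (ext_rep M N z) i) (Sp M i)" for i unfolding Sp_ext_rep by (rule lin_mapI) (simp_all add: pprodD psnd_add psnd_sm sb_add[OF sp] sb_scale[OF sp])
  fix a x assume a: "a : arrs A" and x: "x : Sp (ext_rep M N z) (tv A a)"
  have "Mp (ext_rep M N z) a x : pprod (Sp N (hv A a)) (Sp M (hv A a))" using prerep_mem[OF prerep_ext_rep[OF M N z] a x] by simp
  then show "(if Mp (ext_rep M N z) a x : pprod (Sp N (hv A a)) (Sp M (hv A a))
    then psnd (Mp (ext_rep M N z) a x) else 0)
   = Mp M a (if x : pprod (Sp N (tv A a)) (Sp M (tv A a)) then psnd x else 0)" using x a by (simp add: Mp_ext_rep)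
 qed
qed

lemma std_extn_ses:
 assumes M: "prerep A M" and N: "prerep A N" and z: "z : cochain1 M N"
 shows "ses A N (%i x. if x : Sp N i then pjoin x 0 else 0) (ext_rep M N z)
  (%i p. if p : pprod (Sp N i) (Sp M i) then psnd p else 0) M" unfolding ses_def
proof (intro conjI allI std_extn_homs[OF assms])
 note z0 = sb_0[OF prD(1)[OF M]] sb_0[OF prD(1)[OF N]]
 fix i
 show "inj_on (%x. if x : Sp N i then pjoin x 0 else 0) (Sp N i)" by (auto simp: inj_on_def)
 have "x : (%x. if x : Sp N i then pjoin x 0 else 0) ` Sp N i" if x: "x : pprod (Sp N i) (Sp M i)" "psnd x = 0" for x
 proof -
  have "x = pjoin (pfst x) 0" using x(2) pjoin_collapse[of x] by simp
  then show ?thesis using pprodD[OF x(1)] by (intro image_eqI[where x = "pfst x"]) simp_all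
 qed
 then show "(%x. if x : Sp N i then pjoin x 0 else 0) ` Sp N i = {x : Sp (ext_rep M N z) i.
   (if x : pprod (Sp N i) (Sp M i) then psnd x else 0) = 0}" using z0 by auto
 have "y : (%p. if p : pprod (Sp N i) (Sp M i) then psnd p else 0) ` Sp (ext_rep M N z) i" if "y : Sp M i" for y using z0 that by (intro image_eqI[where x = "pjoin 0 y"]) simp_all
 then show "(%p. if p : pprod (Sp N i) (Sp M i) then psnd p else 0) ` Sp (ext_rep M N z) i = Sp M i" by (auto simp: pprodD)
qed

lemma std_extn_extns:
 assumes M: "M : reps A" and N: "N : reps A" and z: "z : cocycles M N"
 shows "std_extn M N z : extns A M N" using std_extn_ses[OF prR[OF M] prR[OF N], of z] z unfolding extns_def std_extn_def cocycles_def by simp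

lemma ext_equivI:
 assumes "(f, L, g) : extns A M N" "(f', L', g') : extns A M N" "fi : Homs A L L'"
  "!!i x. x : Sp N i ==> fi i (f i x) = f' i x" "!!i x. x : Sp L i ==> g' i (fi i x) = g i x"
 shows "((f, L, g), (f', L', g')) : ext_equiv A M N" using assms unfolding ext_equiv_def by blast

text \<open>The five lemma for a map of extensions that is the identity on both ends. It gives the
  symmetry of \<open>ext_equiv\<close> and the invariance of the middle term.\<close>

lemma extn_map_bij:
 assumes s: "ses A N f L g M" "ses A N f' L' g' M" and L: "prerep A L" "prerep A L'" and N: "prerep A N"
  and fi: "fi : Homs A L L'"
  and c: "!!i x. x : Sp N i ==> fi i (f i x) = f' i x" "!!i x. x : Sp L i ==> g' i (fi i x) = g i x"
 shows "bij_betw (fi i) (Sp L i) (Sp L' i)"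
proof -
 have ph: "fi i : lin_map (Sp L i) (Sp L' i)" and g': "g' i : lin_map (Sp L' i) (Sp M i)" by (rule HomsD(1)[OF fi], rule HomsD(1)[OF sesD(2)[OF s(2)]])
 have f0: "f i 0 = 0" "f' i 0 = 0"  by (rule lin_map0[OF HomsD(1)[OF sesD(1)[OF s(1)]]], rule lin_map0[OF HomsD(1)[OF sesD(1)[OF s(2)]]])
 have "inj_on (fi i) (Sp L i)"
 proof (rule lin_map_inj_onI[OF ph prD(1)[OF L(1)]])
  fix x assume x: "x : Sp L i" "fi i x = 0"
  have "g i x = 0" using c(2)[OF x(1)] x(2) lin_map0[OF g'] by simp
  then obtain n where n: "n : Sp N i" "x = f i n" using sesD(4)[OF s(1), of i] x(1) by blast
  have "f' i n = f' i 0" using c(1)[OF n(1)] n(2) x(2) f0 by simp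
  then have "n = 0" using inj_onD[OF sesD(3)[OF s(2)] _ n(1) sb_0[OF prD(1)[OF N]]] by blast
  then show "x = 0" using n f0 by simp
 qed
 moreover have "fi i ` Sp L i = Sp L' i"
 proof (intro equalityI subsetI)
  fix y assume y: "y : Sp L' i"
  obtain x where x: "x : Sp L i" "g i x = g' i y" using sesD(5)[OF s(1), of i] Homs_mem[OF sesD(2)[OF s(2)] y] by (metis imageE)
  have px: "fi i x : Sp L' i" using lmD(1)[OF ph x(1)] .
  have "g' i (y - fi i x) = 0" using lin_map_diff[OF g' prD(1)[OF L(2)] y px] c(2)[OF x(1)] x(2) by simp
  then have "y - fi i x : f' i ` Sp N i" using sesD(4)[OF s(2), of i] sb_diff[OF prD(1)[OF L(2)] y px] by blast
  then obtain n where n: "n : Sp N i" "y - fi i x = f' i n" by blast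
  have fn: "f i n : Sp L i" using Homs_mem[OF sesD(1)[OF s(1)] n(1)] .
  have "fi i (f i n + x) = y" using lmD(2)[OF ph fn x(1)] c(1)[OF n(1)] n(2) by (simp add: algebra_simps)
  then show "y : fi i ` Sp L i" using sb_add[OF prD(1)[OF L(1)] fn x(1)] by blast
 qed (use lmD(1)[OF ph] in blast)
 ultimately show ?thesis by (simp add: bij_betw_def)
qed

lemma ext_equiv_iso:
 assumes e: "((f, L, g), (f', L', g')) : ext_equiv A M N" and N: "N : reps A"
 shows "iso_rep A L L'"
proof -
 from e obtain fi where fi: "fi : Homs A L L'" "ALL i. (ALL x:Sp N i. fi i (f i x) = f' i x) & (ALL x:Sp L i. g' i (fi i x) = g i x)"
  and s: "ses A N f L g M" "ses A N f' L' g' M" "L : reps A" "L' : reps A" unfolding ext_equiv_def extns_def by blast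
 show ?thesis
 proof (rule iso_repI[OF fi(1)])
  show "bij_betw (fi i) (Sp L i) (Sp L' i)" for i by (rule extn_map_bij[of N f L g M f' L' g' fi]) (simp_all add: fi s N prR)
 qed
qed

lemma ext_equiv_equiv:
 assumes N: "N : reps A"
 shows "equiv (extns A M N) (ext_equiv A M N)"
proof (rule equivI)
 show "ext_equiv A M N <= extns A M N \<times> extns A M N" unfolding ext_equiv_def by blast
 show "refl_on (extns A M N) (ext_equiv A M N)"
 proof (rule refl_onI, clarify)
  fix f L g assume e: "(f, L, g) : extns A M N"
  then have L: "prerep A L" and s: "ses A N f L g M" unfolding extns_def using prR by auto
  show "((f, L, g), (f, L, g)) : ext_equiv A M N" by (rule ext_equivI[OF e e Homs_id[OF L]]) (use Homs_mem[OF sesD(1)[OF s]] in auto)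
 qed
 show "sym (ext_equiv A M N)"
 proof (rule symI, clarify)
  fix f L g f' L' g' assume "((f, L, g), (f', L', g')) : ext_equiv A M N"
  then obtain fi where fi: "fi : Homs A L L'" "ALL i. (ALL x:Sp N i. fi i (f i x) = f' i x) & (ALL x:Sp L i. g' i (fi i x) = g i x)"
   and e: "(f, L, g) : extns A M N" "(f', L', g') : extns A M N" unfolding ext_equiv_def by blast
  have s: "ses A N f L g M" "ses A N f' L' g' M" "prerep A L" "prerep A L'" "prerep A N" using e N unfolding extns_def by (auto simp: prR)
  have b: "bij_betw (fi i) (Sp L i) (Sp L' i)" for i by (rule extn_map_bij[of N f L g M f' L' g' fi]) (simp_all add: s fi)
  obtain gi where gi: "gi : Homs A L' L" "!!i x. x : Sp L i ==> gi i (fi i x) = x" "!!i y. y : Sp L' i ==> fi i (gi i y) = y" using Homs_inverse[OF s(3) fi(1) b] by metis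
  show "((f', L', g'), (f, L, g)) : ext_equiv A M N"
  proof (rule ext_equivI[OF e(2,1) gi(1)])
   show "gi i (f' i x) = f i x" if "x : Sp N i" for i x using fi(2) gi(2)[OF Homs_mem[OF sesD(1)[OF s(1)] that]] that by metis
   show "g i (gi i x) = g' i x" if "x : Sp L' i" for i x using fi(2) gi(3)[OF that] Homs_mem[OF gi(1) that] by metis
  qed
 qed
 show "trans (ext_equiv A M N)"
 proof (rule transI, clarify)
  fix f L g f' L' g' f'' L'' g''
  assume "((f, L, g), (f', L', g')) : ext_equiv A M N" "((f', L', g'), (f'', L'', g'')) : ext_equiv A M N"
  then obtain fi gi where fi: "fi : Homs A L L'" "ALL i. (ALL x:Sp N i. fi i (f i x) = f' i x) & (ALL x:Sp L i. g' i (fi i x) = g i x)"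
   and gi: "gi : Homs A L' L''" "ALL i. (ALL x:Sp N i. gi i (f' i x) = f'' i x) & (ALL x:Sp L' i. g'' i (gi i x) = g' i x)"
   and e: "(f, L, g) : extns A M N" "(f'', L'', g'') : extns A M N" unfolding ext_equiv_def by blast
  have "prerep A L" using e unfolding extns_def by (auto simp: prR)
  from Homs_comp[OF this fi(1) gi(1)] show "((f, L, g), (f'', L'', g'')) : ext_equiv A M N" by (rule ext_equivI[OF e]) (simp_all add: fi(2) gi(2) Homs_mem[OF fi(1)])
 qed
qed

end

section \<open>The coboundary map and the classification of extensions by cocycles\<close>

context fin_bquiver
begin

lemma coboundary_in: 
 assumes M: "prerep A M" and N: "prerep A N" and h: "h : cochain0 M N"
 shows "cob M N h : cochain1 M N" unfolding cochain1_def
proof (intro CollectI conjI ballI allI impI)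
 fix a assume a: "a : arrs A"
 show "cob M N h a : lin_map (Sp M (tv A a)) (Sp N (hv A a))" unfolding cob_def by (intro lin_map_sub lin_map_comp[OF cochain0D[OF h] prD(3)[OF N a]]
   lin_map_comp[OF prD(3)[OF M a] cochain0D[OF h]] prD(1)[OF M] prD(1)[OF N])
next
 fix a assume a: "a ~: arrs A"
 show "cob M N h a = (%_. 0)" using prD(4)[OF M a] prD(4)[OF N a] lin_map0[OF cochain0D[OF h]] by (simp add: cob_def)
qed

lemma cochain0_add: "prerep A N ==> h : cochain0 M N ==> h' : cochain0 M N ==> h + h' : cochain0 M N" by (simp add: cochain0_def plus_fun_def lin_map_add prD(1))

lemma cochain0_diff: "prerep A N ==> h : cochain0 M N ==> h' : cochain0 M N ==> h - h' : cochain0 M N" by (simp add: cochain0_def fun_diff_def lin_map_sub prD(1))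

lemma cochain1_add: "prerep A N ==> h : cochain1 M N ==> h' : cochain1 M N ==> h + h' : cochain1 M N" by (simp add: cochain1_def plus_fun_def lin_map_add prD(1))

lemma coboundary_add:
 assumes M: "prerep A M" and N: "prerep A N" and h: "h : cochain0 M N" "h' : cochain0 M N"
 shows "cob M N (h + h') = cob M N h + cob M N h'"
proof (intro ext)
 fix a x
 show "cob M N (h + h') a x = (cob M N h + cob M N h') a x"
 proof (cases "a : arrs A & x : Sp M (tv A a)")
  case True
  then show ?thesis using lmD(2)[OF prD(3)[OF N, of a] lmD(1)[OF cochain0D[OF h(1)]] lmD(1)[OF cochain0D[OF h(2)]]] by (simp add: cob_def)
 next
  case False
  have "cob M N k a x = 0" if k: "k : cochain0 M N" for k using False cochain1D(2)[OF coboundary_in[OF M N k]] cochain1_out[OF coboundary_in[OF M N k]] by blast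
  then show ?thesis using h cochain0_add[OF N h] by simp
 qed
qed

lemma coboundary_diff:
 assumes M: "prerep A M" and N: "prerep A N" and h: "h : cochain0 M N" "h' : cochain0 M N"
 shows "cob M N (h - h') = cob M N h - cob M N h'" using coboundary_add[OF M N cochain0_diff[OF N h] h(2)] by (simp add: algebra_simps)

lemma Homs_eq_kernel:
 assumes M: "prerep A M" and N: "prerep A N"
 shows "Homs A M N = {h : cochain0 M N. cob M N h = 0}"
proof (intro equalityI subsetI CollectI conjI)
 fix h assume h: "h : Homs A M N"
 then show h0: "h : cochain0 M N" unfolding Homs_def cochain0_def by blast
 show "cob M N h = 0"
 proof (intro ext)
  fix a x
  show "cob M N h a x = 0 a x"
  proof (cases "a : arrs A & x : Sp M (tv A a)")
   case True
   then show ?thesis using HomsD(2)[OF h] by (simp add: cob_def)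
  next
   case False
   then show ?thesis using cochain1D(2)[OF coboundary_in[OF M N h0]] cochain1_out[OF coboundary_in[OF M N h0]] by auto
  qed
 qed
next
 fix h assume h: "h : {h : cochain0 M N. cob M N h = 0}"
 show "h : Homs A M N"
 proof (rule HomsI)
  show "h i : lin_map (Sp M i) (Sp N i)" for i using h cochain0D by blast
  fix a x
  have "cob M N h a x = 0" using h by simp
  then show "h (hv A a) (Mp M a x) = Mp N a (h (tv A a) x)" by (simp add: cob_def)
 qed
qed

lemma finite_card_cochain0:
 assumes M: "prerep A M" "fdim M" and N: "prerep A N" "fdim N"
 shows "finite (cochain0 M N)"
  "card (cochain0 M N) = CARD('k) ^ (SUM i:verts (quiver A). dm (Sp M i) * dm (Sp N i))"
proof -
 let ?V = "verts (quiver A)"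
 have zero: "f x = 0" if f: "f : lin_map (Sp M i) (Sp N i)" and i: "i ~: ?V" for f i x using prD(2)[OF M(1) i] lmD(4)[OF f, of x] lin_map0[OF f] by (cases "x = 0") auto
 have b: "bij_betw (%h. restrict h ?V) (cochain0 M N) (\<Pi>\<^sub>E i\<in>?V. lin_map (Sp M i) (Sp N i))"
 proof (rule bij_betwI[where g = "%g i. if i : ?V then g i else (%_. 0)"])
  show "(%h. restrict h ?V) : cochain0 M N \<rightarrow> (\<Pi>\<^sub>E i\<in>?V. lin_map (Sp M i) (Sp N i))" by (auto simp: cochain0_def)
  show "(%g i. if i : ?V then g i else (%_. 0)) : (\<Pi>\<^sub>E i\<in>?V. lin_map (Sp M i) (Sp N i)) \<rightarrow> cochain0 M N" using lin_map_zero[OF prD(1)[OF N(1)]] by (auto simp: cochain0_def PiE_iff)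
  show "(%i. if i : ?V then restrict h ?V i else (%_. 0)) = h" if "h : cochain0 M N" for h using zero[OF cochain0D[OF that]] by (auto simp: fun_eq_iff)
  show "restrict (%i. if i : ?V then g i else (%_. 0)) ?V = g" if "g : (\<Pi>\<^sub>E i\<in>?V. lin_map (Sp M i) (Sp N i))" for g using that by (auto simp: fun_eq_iff PiE_iff extensional_def)
 qed
 have c: "card (lin_map (Sp M i) (Sp N i)) = CARD('k) ^ (dm (Sp M i) * dm (Sp N i))"
  "finite (lin_map (Sp M i) (Sp N i))" for i by (intro card_lin_map_dim card_lin_map(2) prD(1)[OF M(1)] prD(1)[OF N(1)]
   M(2)[unfolded fdim_def, rule_format] N(2)[unfolded fdim_def, rule_format])+
 show "finite (cochain0 M N)" using bij_betw_finite[OF b] fin_verts c(2) by (simp add: finite_PiE)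
 show "card (cochain0 M N) = CARD('k) ^ (SUM i:?V. dm (Sp M i) * dm (Sp N i))" using bij_betw_same_card[OF b] fin_verts by (simp add: card_PiE c power_sum)
qed

lemma finite_card_cochain1:
 assumes M: "prerep A M" "fdim M" and N: "prerep A N" "fdim N"
 shows "finite (cochain1 M N)"
  "card (cochain1 M N) = CARD('k) ^ (SUM a:arrs A.
   dm (Sp M (tv A a)) * dm (Sp N (hv A a)))"
proof -
 let ?V = "arrs A"
 let ?l = "%a. lin_map (Sp M (tv A a)) (Sp N (hv A a))"
 have b: "bij_betw (%h. restrict h ?V) (cochain1 M N) (\<Pi>\<^sub>E a\<in>?V. ?l a)"
 proof (rule bij_betwI[where g = "%g i. if i : ?V then g i else (%_. 0)"])
  show "(%h. restrict h ?V) : cochain1 M N \<rightarrow> (\<Pi>\<^sub>E a\<in>?V. ?l a)" by (auto simp: cochain1_def)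
  show "(%g i. if i : ?V then g i else (%_. 0)) : (\<Pi>\<^sub>E a\<in>?V. ?l a) \<rightarrow> cochain1 M N" by (auto simp: cochain1_def PiE_iff)
  show "(%i. if i : ?V then restrict h ?V i else (%_. 0)) = h" if "h : cochain1 M N" for h using that by (auto simp: fun_eq_iff cochain1_def)
  show "restrict (%i. if i : ?V then g i else (%_. 0)) ?V = g" if "g : (\<Pi>\<^sub>E a\<in>?V. ?l a)" for g using that by (auto simp: fun_eq_iff PiE_iff extensional_def)
 qed
 have c: "card (lin_map (Sp M i) (Sp N j)) = CARD('k) ^ (dm (Sp M i) * dm (Sp N j))"
  "finite (lin_map (Sp M i) (Sp N j))" for i j by (intro card_lin_map_dim card_lin_map(2) prD(1)[OF M(1)] prD(1)[OF N(1)]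
   M(2)[unfolded fdim_def, rule_format] N(2)[unfolded fdim_def, rule_format])+
 show "finite (cochain1 M N)" using bij_betw_finite[OF b] fin_arcs c(2) by (simp add: finite_PiE)
 show "card (cochain1 M N) = CARD('k) ^ (SUM a:?V. dm (Sp M (tv A a)) * dm (Sp N (hv A a)))" using bij_betw_same_card[OF b] fin_arcs by (simp add: card_PiE c power_sum)
qed

lemma card_cochain0_Homs:
 assumes M: "prerep A M" "fdim M" and N: "prerep A N" "fdim N"
 shows "card (cochain0 M N) = card (cob M N ` cochain0 M N) * card (Homs A M N)" unfolding Homs_eq_kernel[OF M(1) N(1)] by (rule card_additive_image) (simp_all add: finite_card_cochain0[OF assms] coboundary_add coboundary_diff
   cochain0_add cochain0_diff M N)

text \<open>The unipotent block matrix with off-diagonal block h. It commutes with the arrows of two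
  block triangular modules exactly when their cocycles differ by \<open>cob M N h\<close>.\<close>

definition shear :: "('k, 'i, 'a) rep => ('k, 'i, 'a) rep => ('i => 'k poly => 'k poly) => 'i => 'k poly => 'k poly" where
 "shear M N h = (%i p. if p : pprod (Sp N i) (Sp M i) then pjoin (pfst p + h i (psnd p)) (psnd p) else 0)"

lemma shear_Homs:
 assumes M: "prerep A M" and N: "prerep A N" and z: "z : cochain1 M N" "z' : cochain1 M N"
  and h: "h : cochain0 M N" and eq: "z = z' + cob M N h"
 shows "shear M N h : Homs A (ext_rep M N z) (ext_rep M N z')"
proof (rule HomsI)
 have sp: "subsp (pprod (Sp N i) (Sp M i))" for i by (rule subspace_pprod[OF prD(1)[OF N] prD(1)[OF M]])
 note hh = cochain0D[OF h]
 fix i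
 show "shear M N h i : lin_map (Sp (ext_rep M N z) i) (Sp (ext_rep M N z') i)" unfolding Sp_ext_rep
 proof (rule lin_mapI)
  fix p assume p: "p : pprod (Sp N i) (Sp M i)"
  show "shear M N h i p : pprod (Sp N i) (Sp M i)" using p pprodD[OF p] lmD(1)[OF hh] sb_add[OF prD(1)[OF N]] by (simp add: shear_def)
  fix c
  show "shear M N h i (sm c p) = sm c (shear M N h i p)" using p pprodD[OF p] lmD(3)[OF hh] sb_scale[OF sp p] by (simp add: shear_def pfst_sm psnd_sm pjoin_sm smult_add_right)
  fix q assume q: "q : pprod (Sp N i) (Sp M i)"
  show "shear M N h i (p + q) = shear M N h i p + shear M N h i q" using p q pprodD[OF p] pprodD[OF q] lmD(2)[OF hh] sb_add[OF sp p q] by (simp add: shear_def pfst_add psnd_add pjoin_add algebra_simps)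
 qed (simp add: shear_def)
next
 fix a p assume a: "a : arrs A" and p: "p : Sp (ext_rep M N z) (tv A a)"
 then have p': "p : pprod (Sp N (tv A a)) (Sp M (tv A a))" by simp
 have m: "Mp (ext_rep M N z) a p : pprod (Sp N (hv A a)) (Sp M (hv A a))" using prerep_mem[OF prerep_ext_rep[OF M N z(1)] a p] by simp
 have sh: "pjoin (pfst p + h (tv A a) (psnd p)) (psnd p) : pprod (Sp N (tv A a)) (Sp M (tv A a))" using pprodD[OF p'] lmD(1)[OF cochain0D[OF h]] sb_add[OF prD(1)[OF N]] by simp
 have Nadd: "Mp N a (pfst p + h (tv A a) (psnd p)) = Mp N a (pfst p) + Mp N a (h (tv A a) (psnd p))" using lmD(2)[OF prD(3)[OF N a]] pprodD[OF p'] lmD(1)[OF cochain0D[OF h]] by simp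
 show "shear M N h (hv A a) (Mp (ext_rep M N z) a p) = Mp (ext_rep M N z') a (shear M N h (tv A a) p)" using m p' sh Nadd by (simp add: shear_def Mp_ext_rep[OF a] eq cob_def algebra_simps)
qed

lemma shear_bij:
 assumes M: "prerep A M" and N: "prerep A N" and h: "h : cochain0 M N"
 shows "bij_betw (shear M N h i) (pprod (Sp N i) (Sp M i)) (pprod (Sp N i) (Sp M i))" by (rule bij_betwI[where g = "%p. pjoin (pfst p - h i (psnd p)) (psnd p)"])
  (auto simp: shear_def pprodD lmD(1)[OF cochain0D[OF h]] sb_add[OF prD(1)[OF N]]
   sb_diff[OF prD(1)[OF N]])

lemma cocycles_shift:
 assumes M: "M : reps A" and N: "N : reps A" and z: "z : cocycles M N" and h: "h : cochain0 M N"
 shows "z + cob M N h : cocycles M N" "iso_rep A (ext_rep M N (z + cob M N h)) (ext_rep M N z)"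
proof -
 note pM = prR[OF M] and pN = prR[OF N]
 have z1: "z : cochain1 M N" "ext_rep M N z : reps A" using z unfolding cocycles_def by auto
 have z': "z + cob M N h : cochain1 M N" using cochain1_add[OF pN z1(1) coboundary_in[OF pM pN h]] .
 note s = shear_Homs[OF pM pN z' z1(1) h rfl]
 show i: "iso_rep A (ext_rep M N (z + cob M N h)) (ext_rep M N z)" by (rule iso_repI[OF s]) (simp add: shear_bij[OF pM pN h])
 have "inj_on (shear M N h i) (Sp (ext_rep M N (z + cob M N h)) i)" for i using bij_betw_imp_inj_on[OF shear_bij[OF pM pN h]] by simp
 from reps_inj[OF prerep_ext_rep[OF pM pN z'] z1(2) s this]
 show "z + cob M N h : cocycles M N" using z' unfolding cocycles_def by blast
qed

lemma std_extn_equiv_iff: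
 assumes M: "M : reps A" and N: "N : reps A" and z: "z : cocycles M N" "z' : cocycles M N"
 shows "(std_extn M N z, std_extn M N z') : ext_equiv A M N \<longleftrightarrow> (EX h:cochain0 M N. z = z' + cob M N h)"
proof
 note pM = prR[OF M] and pN = prR[OF N]
 note zero = sb_0[OF prD(1)[OF pM]] sb_0[OF prD(1)[OF pN]]
 have zz: "z : cochain1 M N" "z' : cochain1 M N" using z unfolding cocycles_def by auto
 {
  assume "(std_extn M N z, std_extn M N z') : ext_equiv A M N"
  then obtain fi where fi: "fi : Homs A (ext_rep M N z) (ext_rep M N z')"
   and c': "ALL i. (ALL x:Sp N i. fi i (if x : Sp N i then pjoin x 0 else 0) = (if x : Sp N i then pjoin x 0 else 0)) &
    (ALL x:Sp (ext_rep M N z) i. (if fi i x : pprod (Sp N i) (Sp M i) then psnd (fi i x) else 0) =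
     (if x : pprod (Sp N i) (Sp M i) then psnd x else 0))" unfolding ext_equiv_def std_extn_def by blast
  have c: "fi i (pjoin x 0) = pjoin x 0" if "x : Sp N i" for i x using that c' by auto
  have c2: "psnd (fi i p) = psnd p" if "p : pprod (Sp N i) (Sp M i)" for i p using that bspec[OF conjunct2[OF spec[OF c', of i]], of p] Homs_mem[OF fi, of p i] by simp
  \<comment> \<open>An equivalence is the identity on \<open>N\<close> and modulo \<open>N\<close>,
    so it is unipotent; h is its off-diagonal block.\<close>
  define h where "h = (%i y. if y : Sp M i then pfst (fi i (pjoin 0 y)) else 0)"
  note ph = HomsD(1)[OF fi, unfolded Sp_ext_rep]
  have phm: "fi i (pjoin 0 y) = pjoin (h i y) y" if y: "y : Sp M i" for i y by (rule poly_pair_eqI) (use y c2[of "pjoin 0 y" i] zero in "simp_all add: h_def")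
  have hN: "h i y : Sp N i" if y: "y : Sp M i" for i y using lmD(1)[OF ph, of "pjoin 0 y" i] phm[OF y] y zero by simp
  have phi: "fi i (pjoin x y) = pjoin (x + h i y) y" if x: "x : Sp N i" and y: "y : Sp M i" for i x y
  proof -
   have "fi i (pjoin x 0 + pjoin 0 y) = fi i (pjoin x 0) + fi i (pjoin 0 y)" by (rule lmD(2)[OF ph]) (use x y zero in simp_all)
   then show ?thesis using c[OF x] phm[OF y] by (simp add: pjoin_add)
  qed
  have h: "h : cochain0 M N" unfolding cochain0_def
  proof (intro CollectI allI lin_mapI)
   fix i x y assume x: "x : Sp M i" and y: "y : Sp M i"
   have "fi i (pjoin 0 x + pjoin 0 y) = fi i (pjoin 0 x) + fi i (pjoin 0 y)" by (rule lmD(2)[OF ph]) (use x y zero in simp_all)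
   then show "h i (x + y) = h i x + h i y" using phm[OF x] phm[OF y] phm[OF sb_add[OF prD(1)[OF pM] x y]] by (simp add: pjoin_add)
  next
   fix i c x assume x: "x : Sp M i"
   have "fi i (sm c (pjoin 0 x)) = sm c (fi i (pjoin 0 x))" by (rule lmD(3)[OF ph]) (use x zero in simp)
   then show "h i (sm c x) = sm c (h i x)" using phm[OF x] phm[OF sb_scale[OF prD(1)[OF pM] x]] by (simp add: pjoin_sm)
  qed (use hN in "auto simp: h_def")
  have "z a y = (z' + cob M N h) a y" for a y
  proof (cases "a : arrs A & y : Sp M (tv A a)")
   case True
   then have a: "a : arrs A" and y: "y : Sp M (tv A a)" by auto
   have p: "pjoin 0 y : Sp (ext_rep M N z) (tv A a)" using y zero by simp
   have "fi (hv A a) (Mp (ext_rep M N z) a (pjoin 0 y)) = Mp (ext_rep M N z') a (fi (tv A a) (pjoin 0 y))" by (rule HomsD(2)[OF fi a p])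
   moreover have "Mp (ext_rep M N z) a (pjoin 0 y) = pjoin (z a y) (Mp M a y)" using p by (simp add: Mp_ext_rep[OF a] prerep_Mp0[OF pN])
   moreover have "fi (hv A a) (pjoin (z a y) (Mp M a y)) = pjoin (z a y + h (hv A a) (Mp M a y)) (Mp M a y)" by (rule phi) (use lmD(1)[OF cochain1D(1)[OF zz(1) a] y] prerep_mem[OF pM a y] in auto)
   moreover have "Mp (ext_rep M N z') a (fi (tv A a) (pjoin 0 y)) = pjoin (Mp N a (h (tv A a) y) + z' a y) (Mp M a y)" unfolding phm[OF y] using hN[OF y] y by (simp add: Mp_ext_rep[OF a])
   ultimately show ?thesis by (simp add: cob_def algebra_simps)
  next
   case False
   have "z' + cob M N h : cochain1 M N" by (rule cochain1_add[OF pN zz(2) coboundary_in[OF pM pN h]])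
   then show ?thesis using False zz cochain1D(2) cochain1_out by metis
  qed
  then have "z = z' + cob M N h" by (intro ext)
  with h show "EX h:cochain0 M N. z = z' + cob M N h" by blast
 }
 assume "EX h:cochain0 M N. z = z' + cob M N h"
 then obtain h where h: "h : cochain0 M N" "z = z' + cob M N h" by blast
 note s = shear_Homs[OF pM pN zz h]
 note e = std_extn_extns[OF M N z(1)] std_extn_extns[OF M N z(2)]
 show "(std_extn M N z, std_extn M N z') : ext_equiv A M N" unfolding std_extn_def
 proof (rule ext_equivI[OF e[unfolded std_extn_def] s])
  show "shear M N h i (if x : Sp N i then pjoin x 0 else 0) = (if x : Sp N i then pjoin x 0 else 0)" if "x : Sp N i" for i x using that zero lin_map0[OF cochain0D[OF h(1)]] by (simp add: shear_def)
  show "(if shear M N h i x : pprod (Sp N i) (Sp M i) then psnd (shear M N h i x) else 0) =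
    (if x : pprod (Sp N i) (Sp M i) then psnd x else 0)" if "x : Sp (ext_rep M N z) i" for i x using that Homs_mem[OF s that] by (simp add: shear_def)
 qed
qed

text \<open>A linear section \<open>si\<close> of g, in general not a morphism, gives coordinates in
  which \<open>L\<close> is block triangular. The failure of \<open>si\<close> to commute with the
  arrows is the off-diagonal block.\<close>

lemma section_extn:
 assumes M: "M : reps A" and N: "N : reps A" and e: "(f, L, g) : extns A M N" and zc: "z : cochain1 M N"
  and sg: "!!i. si i : lin_map (Sp M i) (Sp L i)" "!!i x. x : Sp M i ==> g i (si i x) = x"
  and z': "!!a y. a : arrs A ==> y : Sp M (tv A a) ==>
   Mp L a (si (tv A a) y) = f (hv A a) (z a y) + si (hv A a) (Mp M a y)"
 shows "z : cocycles M N" "(std_extn M N z, (f, L, g)) : ext_equiv A M N"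
proof -
 note pM = prR[OF M] and pN = prR[OF N]
 have L: "L : reps A" and s: "ses A N f L g M" using e unfolding extns_def by auto
 note pL = prR[OF L]
 note fl = HomsD(1)[OF sesD(1)[OF s]] and gl = HomsD(1)[OF sesD(2)[OF s]]
 note zero = sb_0[OF prD(1)[OF pM]] sb_0[OF prD(1)[OF pN]]
 have z: "z a y : Sp N (hv A a) &
   f (hv A a) (z a y) = Mp L a (si (tv A a) y) - si (hv A a) (Mp M a y)" if a: "a : arrs A" and y: "y : Sp M (tv A a)" for a y using z'[OF a y] lmD(1)[OF cochain1D(1)[OF zc a] y] by simp
 note pE = prerep_ext_rep[OF pM pN zc]
 define fi where "fi = (%i p. if p : pprod (Sp N i) (Sp M i) then f i (pfst p) + si i (psnd p) else 0)"
 have sp: "subsp (pprod (Sp N i) (Sp M i))" for i by (rule subspace_pprod[OF prD(1)[OF pN] prD(1)[OF pM]])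
 have phi: "fi : Homs A (ext_rep M N z) L"
 proof (rule HomsI)
  fix i
  show "fi i : lin_map (Sp (ext_rep M N z) i) (Sp L i)" unfolding Sp_ext_rep
  proof (rule lin_mapI)
   fix p assume p: "p : pprod (Sp N i) (Sp M i)"
   show "fi i p : Sp L i" using p sb_add[OF prD(1)[OF pL] lmD(1)[OF fl pprodD(1)[OF p]] lmD(1)[OF sg(1) pprodD(2)[OF p]]] by (simp add: fi_def)
   fix c
   show "fi i (sm c p) = sm c (fi i p)" using p pprodD[OF p] lmD(3)[OF fl] lmD(3)[OF sg(1)] sb_scale[OF sp p] by (simp add: fi_def pfst_sm psnd_sm smult_add_right)
   fix q assume q: "q : pprod (Sp N i) (Sp M i)"
   show "fi i (p + q) = fi i p + fi i q" using p q pprodD[OF p] pprodD[OF q] lmD(2)[OF fl] lmD(2)[OF sg(1)] sb_add[OF sp p q] by (simp add: fi_def pfst_add psnd_add algebra_simps)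
  qed (simp add: fi_def)
 next
  fix a p assume a: "a : arrs A" and p: "p : Sp (ext_rep M N z) (tv A a)"
  let ?h = "hv A a" and ?t = "tv A a"
  have p': "p : pprod (Sp N ?t) (Sp M ?t)" using p by simp
  note pp = pprodD[OF p']
  have m: "Mp (ext_rep M N z) a p : pprod (Sp N ?h) (Sp M ?h)" using prerep_mem[OF pE a p] by simp
  have "fi ?h (Mp (ext_rep M N z) a p) = f ?h (Mp N a (pfst p) + z a (psnd p)) + si ?h (Mp M a (psnd p))" using m by (simp add: fi_def Mp_ext_rep[OF a p'])
  also have "... = f ?h (Mp N a (pfst p)) + f ?h (z a (psnd p)) + si ?h (Mp M a (psnd p))" using lmD(2)[OF fl prerep_mem[OF pN a pp(1)]] z[OF a pp(2)] by simp
  also have "... = Mp L a (f ?t (pfst p)) + Mp L a (si ?t (psnd p))" using HomsD(2)[OF sesD(1)[OF s] a pp(1)] z[OF a pp(2)] by simp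
  also have "... = Mp L a (f ?t (pfst p) + si ?t (psnd p))" using lmD(2)[OF prD(3)[OF pL a] lmD(1)[OF fl pp(1)] lmD(1)[OF sg(1) pp(2)]] by simp
  finally show "fi ?h (Mp (ext_rep M N z) a p) = Mp L a (fi ?t p)" using p' by (simp add: fi_def)
 qed
 have c1: "fi i (if x : Sp N i then pjoin x 0 else 0) = f i x" if "x : Sp N i" for i x using that zero lin_map0[OF sg(1)] by (simp add: fi_def)
 have c2: "g i (fi i p) = (if p : pprod (Sp N i) (Sp M i) then psnd p else 0)" if p: "p : Sp (ext_rep M N z) i" for i p
 proof -
  have p': "p : pprod (Sp N i) (Sp M i)" using p by simp
  have "f i (pfst p) : {x : Sp L i. g i x = 0}" using sesD(4)[OF s, of i] pprodD(1)[OF p'] by blast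
  then have gf: "g i (f i (pfst p)) = 0" by simp
  show ?thesis using lmD(2)[OF gl lmD(1)[OF fl pprodD(1)[OF p']] lmD(1)[OF sg(1) pprodD(2)[OF p']]]
    gf sg(2)[OF pprodD(2)[OF p']] p' by (simp add: fi_def)
 qed
 have "inj_on (fi i) (Sp (ext_rep M N z) i)" for i using extn_map_bij[of N "%i x. if x : Sp N i then pjoin x 0 else 0" "ext_rep M N z"
    "%i p. if p : pprod (Sp N i) (Sp M i) then psnd p else 0" M f L g fi,
    OF std_extn_ses[OF pM pN zc] s pE pL pN phi c1 c2] bij_betw_imp_inj_on by blast
 then have zz: "z : cocycles M N" using reps_inj[OF pE L phi] zc unfolding cocycles_def by blast
 have "(std_extn M N z, (f, L, g)) : ext_equiv A M N" unfolding std_extn_def by (rule ext_equivI[OF std_extn_extns[OF M N zz, unfolded std_extn_def] e phi c1 c2])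
 with zz show "z : cocycles M N" "(std_extn M N z, (f, L, g)) : ext_equiv A M N" by blast+
qed

text \<open>Vector spaces split, so a section exists vertex by vertex. Its defect of commuting with
  an arrow is killed by g, hence comes from a unique element of \<open>N\<close>; these elements
  form the cocycle.\<close>

lemma extn_std:
 assumes M: "M : reps A" and N: "N : reps A" and e: "(f, L, g) : extns A M N"
 obtains z where "z : cocycles M N" "(std_extn M N z, (f, L, g)) : ext_equiv A M N"
proof -
 note pM = prR[OF M] and pN = prR[OF N]
 have L: "L : reps A" and s: "ses A N f L g M" using e unfolding extns_def by auto
 note pL = prR[OF L]
 note fl = HomsD(1)[OF sesD(1)[OF s]] and gl = HomsD(1)[OF sesD(2)[OF s]]
 note zero = sb_0[OF prD(1)[OF pM]] sb_0[OF prD(1)[OF pN]]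
 have "ALL i. EX si. si : lin_map (Sp M i) (Sp L i) & (ALL x:Sp M i. g i (si x) = x)" using lin_section[OF gl prD(1)[OF pL] prD(1)[OF pM]] sesD(5)[OF s] by (metis order_refl)
 then obtain si where sg: "!!i. si i : lin_map (Sp M i) (Sp L i)" "!!i x. x : Sp M i ==> g i (si i x) = x" by metis
 define z where "z = (%a y. if a : arrs A & y : Sp M (tv A a)
  then the_inv_into (Sp N (hv A a)) (f (hv A a))
   (Mp L a (si (tv A a) y) - si (hv A a) (Mp M a y)) else 0)"
 have z: "z a y : Sp N (hv A a) &
   f (hv A a) (z a y) = Mp L a (si (tv A a) y) - si (hv A a) (Mp M a y)" if a: "a : arrs A" and y: "y : Sp M (tv A a)" for a y
 proof -
  let ?h = "hv A a" and ?t = "tv A a"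
  have 1: "si ?t y : Sp L ?t" by (rule lmD(1)[OF sg(1) y])
  have 2: "Mp L a (si ?t y) : Sp L ?h" "si ?h (Mp M a y) : Sp L ?h" using prerep_mem[OF pL a 1] lmD(1)[OF sg(1) prerep_mem[OF pM a y]] by auto
  have "g ?h (Mp L a (si ?t y) - si ?h (Mp M a y)) = 0" using lin_map_diff[OF gl prD(1)[OF pL] 2] HomsD(2)[OF sesD(2)[OF s] a 1] sg(2)[OF y] sg(2)[OF prerep_mem[OF pM a y]] by simp
  then have "Mp L a (si ?t y) - si ?h (Mp M a y) : f ?h ` Sp N ?h" using sesD(4)[OF s, of ?h] sb_diff[OF prD(1)[OF pL] 2] by blast
  then show ?thesis using the_inv_into_into[OF sesD(3)[OF s] _ order_refl] f_the_inv_into_f[OF sesD(3)[OF s]] a y unfolding z_def by auto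
 qed
 have zc: "z : cochain1 M N" unfolding cochain1_def
 proof (intro CollectI conjI ballI allI impI lin_mapI)
  fix a x y assume a: "a : arrs A" and x: "x : Sp M (tv A a)" and y: "y : Sp M (tv A a)"
  let ?h = "hv A a" and ?t = "tv A a"
  have xy: "x + y : Sp M ?t" by (rule sb_add[OF prD(1)[OF pM] x y])
  have zxy: "z a x + z a y : Sp N ?h" using sb_add[OF prD(1)[OF pN]] z[OF a x] z[OF a y] by blast
  have "f ?h (z a (x + y)) = f ?h (z a x) + f ?h (z a y)" using z[OF a xy] z[OF a x] z[OF a y] lmD(2)[OF sg(1) x y] lmD(2)[OF prD(3)[OF pM a] x y]
    lmD(2)[OF prD(3)[OF pL a] lmD(1)[OF sg(1) x] lmD(1)[OF sg(1) y]]
    lmD(2)[OF sg(1) prerep_mem[OF pM a x] prerep_mem[OF pM a y]] by simp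
  also have "... = f ?h (z a x + z a y)" using lmD(2)[OF fl] z[OF a x] z[OF a y] by simp
  finally show "z a (x + y) = z a x + z a y" using inj_onD[OF sesD(3)[OF s] _ _ zxy] z[OF a xy] by blast
 next
  fix a c x assume a: "a : arrs A" and x: "x : Sp M (tv A a)"
  let ?h = "hv A a" and ?t = "tv A a"
  have cx: "sm c x : Sp M ?t" by (rule sb_scale[OF prD(1)[OF pM] x])
  have zcx: "sm c (z a x) : Sp N ?h" using sb_scale[OF prD(1)[OF pN]] z[OF a x] by blast
  have "f ?h (z a (sm c x)) = sm c (f ?h (z a x))" using z[OF a cx] z[OF a x] lmD(3)[OF sg(1) x] lmD(3)[OF prD(3)[OF pM a] x]
    lmD(3)[OF prD(3)[OF pL a] lmD(1)[OF sg(1) x]]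
    lmD(3)[OF sg(1) prerep_mem[OF pM a x]] by (simp add: smult_diff_right)
  also have "... = f ?h (sm c (z a x))" using lmD(3)[OF fl] z[OF a x] by simp
  finally show "z a (sm c x) = sm c (z a x)" using inj_onD[OF sesD(3)[OF s] _ _ zcx] z[OF a cx] by blast
 qed (use z in "auto simp: z_def")
 have z': "Mp L a (si (tv A a) y) = f (hv A a) (z a y) + si (hv A a) (Mp M a y)" if "a : arrs A" "y : Sp M (tv A a)" for a y using z[OF that] by simp
 have "z : cocycles M N & (std_extn M N z, (f, L, g)) : ext_equiv A M N" by (intro conjI; rule section_extn[OF M N e zc, of si]) (use sg z' in simp_all)
 then show thesis using that by blast
qed

definition ecl :: "('k, 'i, 'a) rep => ('k, 'i, 'a) rep => ('a => 'k poly => 'k poly) => ('k, 'i, 'a) extn set" where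
 "ecl M N z = ext_equiv A M N `` {std_extn M N z}"

lemma extn_class_eq_iff:
 assumes M: "M : reps A" and N: "N : reps A" and z: "z : cocycles M N" "z' : cocycles M N"
 shows "ecl M N z = ecl M N z' \<longleftrightarrow> (EX h:cochain0 M N. z = z' + cob M N h)" unfolding ecl_def std_extn_equiv_iff[OF assms, symmetric] by (rule eq_equiv_class_iff[OF ext_equiv_equiv[OF N] std_extn_extns[OF M N z(1)] std_extn_extns[OF M N z(2)]])

lemma extn_class_image:
 assumes M: "M : reps A" and N: "N : reps A"
 shows "Ext1 A M N = ecl M N ` cocycles M N"
  "Ext1_mid A M N L = ecl M N ` {z : cocycles M N. iso_rep A (ext_rep M N z) L}"
proof -
 note eqv = ext_equiv_equiv[OF N, of M]
 have cl: "EX z:cocycles M N. ext_equiv A M N `` {(f, L', g)} = ecl M N z & (iso_rep A L' L --> iso_rep A (ext_rep M N z) L)" if e: "(f, L', g) : extns A M N" for f L' g L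
 proof -
  obtain z where z: "z : cocycles M N" "(std_extn M N z, (f, L', g)) : ext_equiv A M N" using extn_std[OF M N e] .
  have 1: "ecl M N z = ext_equiv A M N `` {(f, L', g)}" unfolding ecl_def by (rule equiv_class_eq[OF eqv z(2)])
  have "iso_rep A (ext_rep M N z) L'" using ext_equiv_iso[OF z(2)[unfolded std_extn_def] N] .
  then have "iso_rep A L' L --> iso_rep A (ext_rep M N z) L" using iso_rep_trans[OF prerep_ext_rep[OF prR[OF M] prR[OF N]]] z(1) unfolding cocycles_def by blast
  then show ?thesis using z(1) 1 by metis
 qed
 show "Ext1 A M N = ecl M N ` cocycles M N"
 proof (intro equalityI subsetI)
  fix X assume "X : Ext1 A M N"
  then obtain f L' g where "(f, L', g) : extns A M N" "X = ext_equiv A M N `` {(f, L', g)}" unfolding Ext1_def by (auto elim!: quotientE)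
  then show "X : ecl M N ` cocycles M N" using cl by blast
 next
  fix X assume "X : ecl M N ` cocycles M N"
  then show "X : Ext1 A M N" unfolding Ext1_def ecl_def by (auto intro!: quotientI std_extn_extns[OF M N])
 qed
 show "Ext1_mid A M N L = ecl M N ` {z : cocycles M N. iso_rep A (ext_rep M N z) L}"
 proof (intro equalityI subsetI)
  fix X assume "X : Ext1_mid A M N L"
  then obtain f L' g where e: "(f, L', g) : extns A M N" and X: "X = ext_equiv A M N `` {(f, L', g)}" "iso_rep A L' L" unfolding Ext1_mid_def by blast
  show "X : ecl M N ` {z : cocycles M N. iso_rep A (ext_rep M N z) L}" using cl[OF e, of L] X by blast
 next
  fix X assume "X : ecl M N ` {z : cocycles M N. iso_rep A (ext_rep M N z) L}"
  then obtain z where z: "z : cocycles M N" "iso_rep A (ext_rep M N z) L" "X = ecl M N z" by blast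
  then show "X : Ext1_mid A M N L" using std_extn_extns[OF M N z(1)] unfolding Ext1_mid_def ecl_def std_extn_def by blast
 qed
qed

text \<open>Each class meets \<open>Z\<close> in a coset of the coboundaries. The set
  \<open>Z\<close> may be that of all cocycles or of those with a prescribed middle term, since both
  are stable under coboundaries.\<close>

lemma card_extn_class:
 assumes M: "M : reps A" "fdim M" and N: "N : reps A" "fdim N" and Z: "Z <= cocycles M N"
  and shift: "!!z h. z : Z ==> h : cochain0 M N ==> z + cob M N h : Z"
 shows "card Z = card (ecl M N ` Z) * card (cob M N ` cochain0 M N)"
proof -
 note pM = prR[OF M(1)] and pN = prR[OF N(1)]
 have fin: "finite Z"  by (rule finite_subset[OF _ finite_card_cochain1(1)[OF pM M(2) pN N(2)]]) (use Z in "auto simp: cocycles_def")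
 have "card {z : Z. ecl M N z = X} = card (cob M N ` cochain0 M N)" if X: "X : ecl M N ` Z" for X
 proof -
  obtain z0 where z0: "z0 : Z" "X = ecl M N z0" using X by blast
  have iff: "ecl M N z = X \<longleftrightarrow> (EX h:cochain0 M N. z = z0 + cob M N h)" if "z : Z" for z using extn_class_eq_iff[OF M(1) N(1), of z z0] that z0 Z by blast
  have "bij_betw (%b. z0 + b) (cob M N ` cochain0 M N) {z : Z. ecl M N z = X}"
  proof (rule bij_betw_imageI)
   show "(+) z0 ` cob M N ` cochain0 M N = {z : Z. ecl M N z = X}" using iff shift[OF z0(1)] by blast
  qed (simp add: inj_on_def)
  from bij_betw_same_card[OF this] show ?thesis by simp
 qed
 then have "(SUM X:ecl M N ` Z. card {z : Z. ecl M N z = X}) =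
   card (ecl M N ` Z) * card (cob M N ` cochain0 M N)" by simp
 moreover have "card Z = (SUM X:ecl M N ` Z. card {z : Z. ecl M N z = X})" using card_eq_sum[of Z] sum.image_gen[OF fin, of "%_. 1::nat" "ecl M N"] by simp
 ultimately show ?thesis by simp
qed

text \<open>Each class of extensions with middle term \<open>L\<close> is represented by a coset of coboundaries, and
 \<open>|Hom|\<close> is the number of cochains per coboundary, so the quotient defining the Hall constant is a count of cocycles.\<close>

lemma hall_const_cocycles:
 assumes M: "M : reps A" "fdim M" and N: "N : reps A" "fdim N"
 shows "hall_const A M N L = card {z : cocycles M N. iso_rep A (ext_rep M N z) L} / card (cochain0 M N)"
proof -
 note pM = prR[OF M(1)] and pN = prR[OF N(1)]
 let ?Z = "{z : cocycles M N. iso_rep A (ext_rep M N z) L}"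
 have shift: "z + cob M N h : ?Z" if z: "z : ?Z" and h: "h : cochain0 M N" for z h
 proof -
  note s = cocycles_shift[OF M(1) N(1) _ h, of z]
  have "prerep A (ext_rep M N (z + cob M N h))" using s z unfolding cocycles_def by (auto simp: prR)
  then show ?thesis using s z iso_rep_trans by blast
 qed
 have c: "card ?Z = card (Ext1_mid A M N L) * card (cob M N ` cochain0 M N)" using card_extn_class[OF M N, of ?Z] shift extn_class_image(2)[OF M(1) N(1), of L] by auto
 note k = card_cochain0_Homs[OF pM M(2) pN N(2)]
 have "card (cochain0 M N) > 0" using finite_card_cochain0(2)[OF pM M(2) pN N(2)] by simp
 then have "card (cob M N ` cochain0 M N) > 0" using k by (metis gr0I mult_0)
 then show ?thesis unfolding hall_const_def c k by simp
qed

text \<open>The multiplicative Euler characteristic of the complex of cochains and cocycles: |Ext| /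
  |Hom| is the ratio of the numbers of cocycles and of 0-cochains. This computes the Euler form
  below.\<close>

lemma card_Ext1_Homs:
 assumes M: "M : reps A" "fdim M" and N: "N : reps A" "fdim N"
 shows "card (Ext1 A M N) * card (cochain0 M N) = card (cocycles M N) * card (Homs A M N)" using card_extn_class[OF M N, of "cocycles M N"] cocycles_shift(1)[OF M(1) N(1)] extn_class_image(1)[OF M(1) N(1)]
  card_cochain0_Homs[OF prR[OF M(1)] M(2) prR[OF N(1)] N(2)] by simp

end

section \<open>Products in the Hall algebra\<close>

context fin_bquiver
begin

definition transport :: "('i => 'k poly => 'k poly) => ('i => 'k poly => 'k poly) => ('a => 'k poly => 'k poly)
  => 'a => 'k poly => 'k poly" where
 "transport gi fi' z = (%a x. gi (hv A a) (z a (fi' (tv A a) x)))"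

lemma transport_cocycles:
 assumes M: "M : reps A" "M' : reps A" and N: "N : reps A" "N' : reps A"
  and fi: "fi : Homs A M M'" "!!i. bij_betw (fi i) (Sp M i) (Sp M' i)"
  and fi': "fi' : Homs A M' M" "!!i y. y : Sp M' i ==> fi i (fi' i y) = y" "!!i x. x : Sp M i ==> fi' i (fi i x) = x"
  and gi: "gi : Homs A N N'" "!!i. bij_betw (gi i) (Sp N i) (Sp N' i)"
  and z: "z : cocycles M N"
 shows "transport gi fi' z : cocycles M' N'" "iso_rep A (ext_rep M N z) (ext_rep M' N' (transport gi fi' z))"
proof -
 note pM = prR[OF M(1)] prR[OF M(2)] and pN = prR[OF N(1)] prR[OF N(2)]
 have zc: "z : cochain1 M N" and zr: "ext_rep M N z : reps A" using z unfolding cocycles_def by auto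
 have zc': "transport gi fi' z : cochain1 M' N'" unfolding cochain1_def
 proof (intro CollectI conjI ballI allI impI)
  fix a assume a: "a : arrs A"
  show "transport gi fi' z a : lin_map (Sp M' (tv A a)) (Sp N' (hv A a))" unfolding transport_def by (rule lin_map_comp[OF lin_map_comp[OF HomsD(1)[OF fi'(1)] cochain1D(1)[OF zc a]] HomsD(1)[OF gi(1)]])
    (rule prD(1)[OF pM(2)])+
 next
  fix a assume "a ~: arrs A"
  then show "transport gi fi' z a = (%_. 0)" using cochain1D(2)[OF zc] lin_map0[OF HomsD(1)[OF gi(1)]] by (simp add: transport_def)
 qed
 define ti where "ti = (%i p. if p : pprod (Sp N i) (Sp M i) then pjoin (gi i (pfst p)) (fi i (psnd p)) else 0)"
 note ph = HomsD(1)[OF fi(1)] and ps = HomsD(1)[OF gi(1)]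
 have sp: "subsp (pprod (Sp N i) (Sp M i))" for i by (rule subspace_pprod[OF prD(1)[OF pN(1)] prD(1)[OF pM(1)]])
 have th: "ti : Homs A (ext_rep M N z) (ext_rep M' N' (transport gi fi' z))"
 proof (rule HomsI)
  fix i
  show "ti i : lin_map (Sp (ext_rep M N z) i) (Sp (ext_rep M' N' (transport gi fi' z)) i)" unfolding Sp_ext_rep
  proof (rule lin_mapI)
   fix p assume p: "p : pprod (Sp N i) (Sp M i)"
   show "ti i p : pprod (Sp N' i) (Sp M' i)" using p pprodD[OF p] lmD(1)[OF ph] lmD(1)[OF ps] by (simp add: ti_def)
   fix c
   show "ti i (sm c p) = sm c (ti i p)" using p pprodD[OF p] lmD(3)[OF ph] lmD(3)[OF ps] sb_scale[OF sp p] by (simp add: ti_def pfst_sm psnd_sm pjoin_sm)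
   fix q assume q: "q : pprod (Sp N i) (Sp M i)"
   show "ti i (p + q) = ti i p + ti i q" using p q pprodD[OF p] pprodD[OF q] lmD(2)[OF ph] lmD(2)[OF ps] sb_add[OF sp p q] by (simp add: ti_def pfst_add psnd_add pjoin_add)
  qed (simp add: ti_def)
 next
  fix a p assume a: "a : arrs A" and p: "p : Sp (ext_rep M N z) (tv A a)"
  let ?h = "hv A a" and ?t = "tv A a"
  have p': "p : pprod (Sp N ?t) (Sp M ?t)" using p by simp
  note pp = pprodD[OF p']
  have m: "Mp (ext_rep M N z) a p : pprod (Sp N ?h) (Sp M ?h)" using prerep_mem[OF prerep_ext_rep[OF pM(1) pN(1) zc] a p] by simp
  have t: "pjoin (gi ?t (pfst p)) (fi ?t (psnd p)) : pprod (Sp N' ?t) (Sp M' ?t)" using lmD(1)[OF ph pp(2)] lmD(1)[OF ps pp(1)] by simp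
  have "gi ?h (Mp N a (pfst p) + z a (psnd p)) = Mp N' a (gi ?t (pfst p)) + gi ?h (z a (psnd p))" using lmD(2)[OF ps prerep_mem[OF pN(1) a pp(1)] lmD(1)[OF cochain1D(1)[OF zc a] pp(2)]] HomsD(2)[OF gi(1) a pp(1)] by simp
  then show "ti ?h (Mp (ext_rep M N z) a p) = Mp (ext_rep M' N' (transport gi fi' z)) a (ti ?t p)" using m p' t HomsD(2)[OF fi(1) a pp(2)] fi'(3)[OF pp(2)] by (simp add: ti_def Mp_ext_rep[OF a] transport_def)
 qed
 have bij: "bij_betw (ti i) (pprod (Sp N i) (Sp M i)) (pprod (Sp N' i) (Sp M' i))" for i
 proof -
  have "bij_betw (map_prod (gi i) (fi i)) (Sp N i \<times> Sp M i) (Sp N' i \<times> Sp M' i)" by (rule bij_betw_map_prod[OF gi(2) fi(2)])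
  then have "bij_betw ((%(x, y). pjoin x y) \<circ> (map_prod (gi i) (fi i) \<circ> (%p. (pfst p, psnd p))))
    (pprod (Sp N i) (Sp M i)) (pprod (Sp N' i) (Sp M' i))" by (intro bij_betw_trans[OF bij_betw_trans[OF _ _] bij_pprod])
    (auto intro!: bij_betwI[where g = "%(x, y). pjoin x y"] simp: pprod_def)
  then show ?thesis by (rule bij_betw_cong[THEN iffD1, rotated]) (simp add: ti_def)
 qed
 show i: "iso_rep A (ext_rep M N z) (ext_rep M' N' (transport gi fi' z))" by (rule iso_repI[OF th]) (simp add: bij)
 show "transport gi fi' z : cocycles M' N'" using reps_iso[OF zr prerep_ext_rep[OF pM(2) pN(2) zc'] i] zc' unfolding cocycles_def by blast
qed

text \<open>Transport along isomorphisms of both ends is injective and keeps the middle term up to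
  isomorphism. Equality follows by applying this in both directions.\<close>

lemma card_cocycles_le:
 assumes M: "M : reps A" "fdim M" "M' : reps A" "fdim M'" and N: "N : reps A" "fdim N" "N' : reps A" "fdim N'"
  and i: "iso_rep A M M'" "iso_rep A N N'"
 shows "card {z : cocycles M N. iso_rep A (ext_rep M N z) L} <= card {z : cocycles M' N'. iso_rep A (ext_rep M' N' z) L}"
proof -
 obtain fi where fi: "fi : Homs A M M'" "!!i. bij_betw (fi i) (Sp M i) (Sp M' i)" using i(1) unfolding iso_rep_def by blast
 obtain gi where gi: "gi : Homs A N N'" "!!i. bij_betw (gi i) (Sp N i) (Sp N' i)" using i(2) unfolding iso_rep_def by blast
 obtain fi' where fi': "fi' : Homs A M' M" "!!i y. y : Sp M' i ==> fi i (fi' i y) = y" "!!i x. x : Sp M i ==> fi' i (fi i x) = x" using Homs_inverse[OF prR[OF M(1)] fi] by metis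
 have T: "transport gi fi' z : cocycles M' N'" "iso_rep A (ext_rep M N z) (ext_rep M' N' (transport gi fi' z))" if "z : cocycles M N" for z by (rule transport_cocycles[where M = M and N = N and fi = fi and M' = M' and N' = N'];
   use M N fi fi' gi that in simp)+
 show ?thesis
 proof (rule card_inj_on_le[where f = "transport gi fi'"])
  show "inj_on (transport gi fi') {z : cocycles M N. iso_rep A (ext_rep M N z) L}"
  proof (rule inj_onI)
   fix z z' assume zz: "z : {z : cocycles M N. iso_rep A (ext_rep M N z) L}"
    "z' : {z : cocycles M N. iso_rep A (ext_rep M N z) L}" and eq: "transport gi fi' z = transport gi fi' z'"
   have zc: "z : cochain1 M N" "z' : cochain1 M N" using zz unfolding cocycles_def by auto
   show "z = z'"
   proof (intro ext)
    fix a x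
    show "z a x = z' a x"
    proof (cases "a : arrs A & x : Sp M (tv A a)")
     case True
     then have a: "a : arrs A" and x: "x : Sp M (tv A a)" by auto
     have "gi (hv A a) (z a x) = gi (hv A a) (z' a x)" using fun_cong[OF fun_cong[OF eq, of a], of "fi (tv A a) x"] fi'(3)[OF x] by (simp add: transport_def)
     then show ?thesis using inj_onD[OF bij_betw_imp_inj_on[OF gi(2)]] lmD(1)[OF cochain1D(1)[OF zc(1) a] x]
       lmD(1)[OF cochain1D(1)[OF zc(2) a] x] by blast
    next
     case False
     have "z'' a x = 0" if c: "z'' : cochain1 M N" for z'' using False cochain1D(2)[OF c] cochain1_out[OF c] by blast
     from this[OF zc(1)] this[OF zc(2)] show ?thesis by simp
    qed
   qed
  qed
  show "transport gi fi' ` {z : cocycles M N. iso_rep A (ext_rep M N z) L} <= {z : cocycles M' N'. iso_rep A (ext_rep M' N' z) L}"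
  proof (intro image_subsetI CollectI conjI)
   fix z assume z: "z : {z : cocycles M N. iso_rep A (ext_rep M N z) L}"
   then have zc: "z : cocycles M N" by simp
   show "transport gi fi' z : cocycles M' N'" by (rule T(1)[OF zc])
   have r: "ext_rep M N z : reps A" "ext_rep M' N' (transport gi fi' z) : reps A" using T(1)[OF zc] zc unfolding cocycles_def by auto
   have "iso_rep A (ext_rep M' N' (transport gi fi' z)) (ext_rep M N z)" by (rule iso_rep_sym[OF prR[OF r(1)] T(2)[OF zc]])
   then show "iso_rep A (ext_rep M' N' (transport gi fi' z)) L" using z iso_rep_trans[OF prR[OF r(2)]] by blast
  qed
  show "finite {z : cocycles M' N'. iso_rep A (ext_rep M' N' z) L}" by (rule finite_subset[OF _ finite_card_cochain1(1)[OF prR[OF M(3)] M(4) prR[OF N(3)] N(4)]])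
    (auto simp: cocycles_def)
 qed
qed

lemma iso_dim:
 assumes "prerep A M" "fdim M" "prerep A M'" "iso_rep A M M'"
 shows "dm (Sp M i) = dm (Sp M' i)" "fdim M'"
proof -
 obtain fi where fi: "!!i. bij_betw (fi i) (Sp M i) (Sp M' i)" using assms(4) unfolding iso_rep_def by blast
 show fd: "fdim M'" using assms(2) bij_betw_finite[OF fi] unfolding fdim_def by blast
 show "dm (Sp M i) = dm (Sp M' i)" using dim_eq_iff_card[OF prD(1)[OF assms(1)] assms(2)[unfolded fdim_def, rule_format]
    prD(1)[OF assms(3)] fd[unfolded fdim_def, rule_format]] bij_betw_same_card[OF fi] by blast
qed

text \<open>The product in \<open>hall\<close> evaluates its structure constants at representatives
  chosen by \<open>SOME\<close>; this invariance allows them to be replaced by the modules at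
  hand.\<close>

lemma hall_const_iso:
 assumes M: "M : reps A" "fdim M" "M' : reps A" and N: "N : reps A" "fdim N" "N' : reps A"
  and i: "iso_rep A M M'" "iso_rep A N N'" and L: "L : reps A" "iso_rep A L L'"
 shows "hall_const A M N L = hall_const A M' N' L'"
proof -
 note pM = prR[OF M(1)] prR[OF M(3)] and pN = prR[OF N(1)] prR[OF N(3)]
 note dM = iso_dim[OF pM(1) M(2) pM(2) i(1)] and dN = iso_dim[OF pN(1) N(2) pN(2) i(2)]
 have c: "card {z : cocycles M N. iso_rep A (ext_rep M N z) L'} = card {z : cocycles M' N'. iso_rep A (ext_rep M' N' z) L'}" by (intro antisym card_cocycles_le M N dM dN i iso_rep_sym[OF pM(1)] iso_rep_sym[OF pN(1)])
 have "iso_rep A (ext_rep M N z) L \<longleftrightarrow> iso_rep A (ext_rep M N z) L'" if "z : cocycles M N" for z using iso_rep_trans[OF prR, of "ext_rep M N z"] that L iso_rep_sym[OF prR[OF L(1)]] unfolding cocycles_def by blast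
 then have "{z : cocycles M N. iso_rep A (ext_rep M N z) L} = {z : cocycles M N. iso_rep A (ext_rep M N z) L'}" by blast
 then show ?thesis using c hall_const_cocycles[OF M(1,2) N(1,2), of L] hall_const_cocycles[OF M(3) dM(2) N(3) dN(2), of L']
   finite_card_cochain0(2)[OF pM(1) M(2) pN(1) N(2)] finite_card_cochain0(2)[OF pM(2) dM(2) pN(2) dN(2)] dM(1) dN(1) by simp
qed

lemma mnD:
 assumes "M : modnil A"
 shows "M : reps A" "fdim M" "prerep A M" using assms prR unfolding modnil_iff by blast+

lemma isocl_self: "M : modnil A ==> M : isocl A M" using iso_rep_refl mnD(3) unfolding isocl_def by blast

lemma isocl_eq_iff:
 assumes M: "M : modnil A" and N: "N : modnil A"
 shows "isocl A M = isocl A N \<longleftrightarrow> iso_rep A M N"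
proof
 assume "isocl A M = isocl A N"
 then show "iso_rep A M N" using isocl_self[OF N] unfolding isocl_def by blast
next
 assume i: "iso_rep A M N"
 then have i': "iso_rep A N M" using iso_rep_sym[OF mnD(3)[OF M]] by blast
 show "isocl A M = isocl A N" unfolding isocl_def using iso_rep_trans[OF mnD(3)[OF M] i] iso_rep_trans[OF mnD(3)[OF N] i'] by blast
qed

lemma some_isocl:
 assumes M: "M : modnil A"
 shows "(SOME N. N : isocl A M) : modnil A" "iso_rep A M (SOME N. N : isocl A M)"
proof -
 have "(SOME N. N : isocl A M) : isocl A M" using isocl_self[OF M] by (rule someI)
 then show "(SOME N. N : isocl A M) : modnil A" "iso_rep A M (SOME N. N : isocl A M)" unfolding isocl_def by auto
qed

lemma isocl_some:
 assumes X: "X : isocl A ` modnil A"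
 shows "(SOME M. M : X) : modnil A" "isocl A (SOME M. M : X) = X"
proof -
 obtain M where M: "M : modnil A" "X = isocl A M" using X by blast
 show "(SOME M. M : X) : modnil A" "isocl A (SOME M. M : X) = X" using some_isocl[OF M(1)] isocl_eq_iff[OF M(1) some_isocl(1)[OF M(1)]] M(2) by auto
qed

lemma hall_const_some:
 assumes M: "M : modnil A" and N: "N : modnil A" and L: "L : modnil A"
 shows "hall_const A (SOME M'. M' : isocl A M) (SOME N'. N' : isocl A N) (SOME L'. L' : isocl A L) = hall_const A M N L" using hall_const_iso[OF mnD(1,2)[OF M] mnD(1)[OF some_isocl(1)[OF M]]
   mnD(1,2)[OF N] mnD(1)[OF some_isocl(1)[OF N]] some_isocl(2)[OF M] some_isocl(2)[OF N] mnD(1)[OF L]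
   some_isocl(2)[OF L]] by simp

lemma ext_rep_modnil:
 assumes M: "M : modnil A" and N: "N : modnil A" and z: "z : cocycles M N"
 shows "ext_rep M N z : modnil A"
proof -
 have r: "ext_rep M N z : reps A" "z : cochain1 M N" using z unfolding cocycles_def by auto
 show ?thesis by (rule ses_modnil[OF std_extn_ses[OF mnD(3)[OF M] mnD(3)[OF N] r(2)] r(1) N M
   fdim_ext_rep[OF mnD(2)[OF M] mnD(2)[OF N]]])
qed

lemma finite_cocycles: "M : modnil A ==> N : modnil A ==> finite (cocycles M N)" by (rule finite_subset[OF _ finite_card_cochain1(1)]) (auto simp: cocycles_def mnD)

lemma hall_simps:
 "carrier (hall A) = {fi. finite {X. fi X ~= 0} & {X. fi X ~= 0} <= isocl A ` modnil A & range fi <= Qv (vq TYPE('k))}"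
 "\<one>\<^bsub>hall A\<^esub> = hcls A zero_rep" "\<zero>\<^bsub>hall A\<^esub> = (%_. 0)" "fi \<oplus>\<^bsub>hall A\<^esub> gi = (%X. fi X + gi X)" by (simp_all add: hall_def)

lemma hall_mult_eq:
 assumes F: "finite F" "{X. fi X ~= 0} <= F" and G: "finite G" "{Y. gi Y ~= 0} <= G"
 shows "(fi \<otimes>\<^bsub>hall A\<^esub> gi) Z = (if Z : isocl A ` modnil A then SUM X:F. SUM Y:G.
  fi X * gi Y * hall_const A (SOME M. M : X) (SOME N. N : Y) (SOME L. L : Z) else 0)"
proof -
 let ?H = "%X Y. hall_const A (SOME M. M : X) (SOME N. N : Y) (SOME L. L : Z)"
 have "(\<Sum>X | fi X ~= 0. \<Sum>Y | gi Y ~= 0. fi X * gi Y * ?H X Y) = (SUM X:F. \<Sum>Y | gi Y ~= 0. fi X * gi Y * ?H X Y)" by (rule sum.mono_neutral_left[OF F]) simp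
 also have "... = (SUM X:F. SUM Y:G. fi X * gi Y * ?H X Y)" by (rule sum.cong[OF rfl], rule sum.mono_neutral_left[OF G]) simp
 finally show ?thesis by (simp add: hall_def)
qed

lemma hall_mult_hcls:
 assumes M: "M : modnil A" and N: "N : modnil A"
 shows "hcls A M \<otimes>\<^bsub>hall A\<^esub> hcls A N =
  (%Z. (SUM z:cocycles M N. hcls A (ext_rep M N z) Z) / card (cochain0 M N))"
proof
 fix Z
 have eq: "(hcls A M \<otimes>\<^bsub>hall A\<^esub> hcls A N) Z = (if Z : isocl A ` modnil A then
   hall_const A (SOME M'. M' : isocl A M) (SOME N'. N' : isocl A N) (SOME L. L : Z) else 0)" using hall_mult_eq[of "{isocl A M}" "hcls A M" "{isocl A N}" "hcls A N" Z] by (auto simp: hcls_def)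
 note er = ext_rep_modnil[OF M N]
 show "(hcls A M \<otimes>\<^bsub>hall A\<^esub> hcls A N) Z = (SUM z:cocycles M N. hcls A (ext_rep M N z) Z) / card (cochain0 M N)"
 proof (cases "Z : isocl A ` modnil A")
  case False
  then have "(SUM z:cocycles M N. hcls A (ext_rep M N z) Z) = 0" by (intro sum.neutral) (use er in "auto simp: hcls_def")
  then show ?thesis using eq False by simp
 next
  case True
  then obtain L where L: "L : modnil A" "Z = isocl A L" by blast
  have "(SUM z:cocycles M N. hcls A (ext_rep M N z) Z) = (SUM z:cocycles M N. if iso_rep A (ext_rep M N z) L then 1 else 0)" by (rule sum.cong[OF rfl]) (use isocl_eq_iff[OF er L(1)] L(2) in "auto simp: hcls_def")
  also have "... = card {z : cocycles M N. iso_rep A (ext_rep M N z) L}" using finite_cocycles[OF M N] by (simp add: sum.If_cases Int_def)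
  finally show ?thesis using eq True L hall_const_some[OF M N L(1)] hall_const_cocycles[OF mnD(1,2)[OF M] mnD(1,2)[OF N]] by simp
 qed
qed

text \<open>Bilinearity for indexed families in which isoclasses may repeat; the indices will be
  linear maps, many of which give isomorphic modules.\<close>

lemma hall_mult_sums:
 assumes J: "finite J" "!!j. j : J ==> M j : modnil A" and K: "finite K" "!!k. k : K ==> N k : modnil A"
 shows "(%X. SUM j:J. c j * hcls A (M j) X) \<otimes>\<^bsub>hall A\<^esub> (%X. SUM k:K. d k * hcls A (N k) X) =
  (%Z. SUM j:J. SUM k:K. c j * d k * (hcls A (M j) \<otimes>\<^bsub>hall A\<^esub> hcls A (N k)) Z)"
proof
 fix Z
 let ?F = "(%j. isocl A (M j)) ` J" and ?G = "(%k. isocl A (N k)) ` K"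
 let ?H = "%X Y. hall_const A (SOME M. M : X) (SOME N. N : Y) (SOME L. L : Z)"
 have sF: "{X. (SUM j:J. c j * hcls A (M j) X) ~= 0} <= ?F"
 proof (clarify, rule ccontr)
  fix X assume "X ~: ?F" "(SUM j:J. c j * hcls A (M j) X) ~= 0"
  moreover have "(SUM j:J. c j * hcls A (M j) X) = 0" using \<open>X ~: ?F\<close> by (intro sum.neutral) (auto simp: hcls_def)
  ultimately show False by simp
 qed
 have sG: "{X. (SUM j:K. d j * hcls A (N j) X) ~= 0} <= ?G"
 proof (clarify, rule ccontr)
  fix X assume "X ~: ?G" "(SUM j:K. d j * hcls A (N j) X) ~= 0"
  moreover have "(SUM j:K. d j * hcls A (N j) X) = 0" using \<open>X ~: ?G\<close> by (intro sum.neutral) (auto simp: hcls_def)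
  ultimately show False by simp
 qed
 have single: "(hcls A (M j) \<otimes>\<^bsub>hall A\<^esub> hcls A (N k)) Z =
   (if Z : isocl A ` modnil A then ?H (isocl A (M j)) (isocl A (N k)) else 0)" for j k using hall_mult_eq[of "{isocl A (M j)}" "hcls A (M j)" "{isocl A (N k)}" "hcls A (N k)" Z] by (auto simp: hcls_def)
 have "(SUM X:?F. SUM Y:?G. (SUM j:J. c j * hcls A (M j) X) * (SUM k:K. d k * hcls A (N k) Y) * ?H X Y)
  = (SUM X:?F. SUM Y:?G. SUM j:J. SUM k:K. c j * d k * (hcls A (M j) X * hcls A (N k) Y * ?H X Y))" by (intro sum.cong[OF rfl], simp only: sum_product sum_distrib_right, intro sum.cong[OF rfl])
   (simp add: sum_distrib_left sum_distrib_right mult_ac)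
 also have "... = (SUM j:J. SUM k:K. SUM X:?F. SUM Y:?G. c j * d k * (hcls A (M j) X * hcls A (N k) Y * ?H X Y))"
 proof -
  have "(SUM X:?F. SUM Y:?G. SUM j:J. SUM k:K. f X Y j k) = (SUM j:J. SUM k:K. SUM X:?F. SUM Y:?G. f X Y j k)" for f :: "_ => _ => _ => _ => real"
  proof -
   have "(SUM X:?F. SUM Y:?G. SUM j:J. SUM k:K. f X Y j k) = (SUM X:?F. SUM j:J. SUM k:K. SUM Y:?G. f X Y j k)" by (rule sum.cong[OF rfl]) (subst sum.swap, rule sum.cong[OF rfl], rule sum.swap)
   also have "... = (SUM j:J. SUM k:K. SUM X:?F. SUM Y:?G. f X Y j k)" by (subst sum.swap, rule sum.cong[OF rfl], rule sum.swap)
   finally show ?thesis .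
  qed
  then show ?thesis .
 qed
 also have "... = (SUM j:J. SUM k:K. c j * d k * ?H (isocl A (M j)) (isocl A (N k)))"
 proof (intro sum.cong[OF rfl])
  fix j k assume j: "j : J" and k: "k : K"
  have "(SUM X:?F. SUM Y:?G. c j * d k * (hcls A (M j) X * hcls A (N k) Y * ?H X Y)) =
   (SUM X:?F. if X = isocl A (M j) then (SUM Y:?G. if Y = isocl A (N k) then c j * d k * ?H X Y else 0) else 0)"
  proof (rule sum.cong[OF rfl])
   fix X show "(SUM Y:?G. c j * d k * (hcls A (M j) X * hcls A (N k) Y * ?H X Y)) =
     (if X = isocl A (M j) then (SUM Y:?G. if Y = isocl A (N k) then c j * d k * ?H X Y else 0) else 0)" by (cases "X = isocl A (M j)") (auto simp: hcls_def intro!: sum.cong)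
  qed
  also have "... = c j * d k * ?H (isocl A (M j)) (isocl A (N k))" using J K j k by (simp add: sum.delta)
  finally show "(SUM X:?F. SUM Y:?G. c j * d k * (hcls A (M j) X * hcls A (N k) Y * ?H X Y)) = c j * d k * ?H (isocl A (M j)) (isocl A (N k))" .
 qed
 finally show "((%X. SUM j:J. c j * hcls A (M j) X) \<otimes>\<^bsub>hall A\<^esub> (%X. SUM k:K. d k * hcls A (N k) X)) Z =
   (SUM j:J. SUM k:K. c j * d k * (hcls A (M j) \<otimes>\<^bsub>hall A\<^esub> hcls A (N k)) Z)" using hall_mult_eq[OF finite_imageI[OF J(1)] sF finite_imageI[OF K(1)] sG, of Z] by (simp add: single)
qed

end

section \<open>The field \<rat>(v)\<close>

lemma Qv_add: "x : Qv v ==> y : Qv v ==> x + y : Qv v"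
proof -
 assume "x : Qv v" "y : Qv v"
 then obtain a b c d where "x = a + b * v" "y = c + d * v" "a : \<rat>" "b : \<rat>" "c : \<rat>" "d : \<rat>" unfolding Qv_def by blast
 then have "x + y = (a + c) + (b + d) * v" "a + c : \<rat>" "b + d : \<rat>" by (simp_all add: algebra_simps)
 then show ?thesis unfolding Qv_def by blast
qed

lemma Qv_rat: "x : \<rat> ==> x : Qv v"
proof -
 assume "x : \<rat>"
 then have "x = x + 0 * v & x : \<rat> & (0::real) : \<rat>" by simp
 then show ?thesis unfolding Qv_def by blast
qed

lemma Qv_self: "v : Qv v"
proof -
 have "v = 0 + 1 * v & (0::real) : \<rat> & (1::real) : \<rat>" by simp
 then show ?thesis unfolding Qv_def by blast
qed

lemma Qv_mult:
 assumes v: "v * v : \<rat>" and "x : Qv v" "y : Qv v"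
 shows "x * y : Qv v"
proof -
 obtain a b c d where "x = a + b * v" "y = c + d * v" "a : \<rat>" "b : \<rat>" "c : \<rat>" "d : \<rat>" using assms unfolding Qv_def by blast
 moreover from this have "x * y = (a * c + b * d * (v * v)) + (a * d + b * c) * v" by (simp add: algebra_simps)
 moreover have "a * c + b * d * (v * v) : \<rat>" "a * d + b * c : \<rat>" using calculation v by simp_all
 ultimately show ?thesis unfolding Qv_def by blast
qed

lemma Qv_neg: "x : Qv v ==> - x : Qv v"
proof -
 assume "x : Qv v"
 then obtain a b where "x = a + b * v" "a : \<rat>" "b : \<rat>" unfolding Qv_def by blast
 then have "- x = (- a) + (- b) * v" "- a : \<rat>" "- b : \<rat>" by (simp_all add: algebra_simps)
 then show ?thesis unfolding Qv_def by blast
qed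

lemma Qv_diff: "x : Qv v ==> y : Qv v ==> x - y : Qv v" using Qv_add[OF _ Qv_neg, of x v y] by simp

lemma Qv_inverse:
 assumes v: "v * v : \<rat>" and x: "x : Qv v"
 shows "inverse x : Qv v"
proof -
 obtain a b where ab: "x = a + b * v" "a : \<rat>" "b : \<rat>" using x unfolding Qv_def by blast
 show ?thesis
 \<comment> \<open>If q is a square then v is rational, and the conjugate a - b v may vanish
   although x does not; the inverse is then rational anyway.\<close>
 proof (cases "x = 0 \<or> v : \<rat>")
  case True
  then have "inverse x : \<rat>" using ab by auto
  then show ?thesis by (rule Qv_rat)
 next
  case False
  have "a - b * v ~= 0"
  proof
   assume 0: "a - b * v = 0"
   then have "b ~= 0" using False ab(1) by auto
   then have "v = a / b" using 0 by (simp add: field_simps)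
   then show False using False ab by simp
  qed
  then have n: "(a + b * v) * (a - b * v) ~= 0" using False ab(1) by simp
  have e: "(a + b * v) * (a - b * v) = a * a - b * b * (v * v)" by (simp add: algebra_simps)
  have "inverse x = (a - b * v) * inverse ((a + b * v) * (a - b * v))" unfolding ab(1) using \<open>a - b * v ~= 0\<close> by (simp add: inverse_mult_distrib mult.left_commute)
  moreover have "a - b * v : Qv v" using ab(2,3) by (intro Qv_diff Qv_mult[OF v] Qv_rat Qv_self)
  moreover have "inverse ((a + b * v) * (a - b * v)) : Qv v" unfolding e using ab v by (intro Qv_rat) simp
  ultimately show ?thesis using Qv_mult[OF v] by simp
 qed
qed

lemma Qv_sum: "(!!i. i : I ==> f i : Qv v) ==> sum f I : Qv v"
proof (induction I rule: infinite_finite_induct)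
 case (insert x F)
 then show ?case by (simp add: Qv_add)
qed (auto intro: Qv_rat)

lemma Qv_power: "v * v : \<rat> ==> x : Qv v ==> x ^ n : Qv v" by (induction n) (auto intro: Qv_rat Qv_mult)

lemma Qv_powi: "v * v : \<rat> ==> x : Qv v ==> x powi n : Qv v" by (simp add: power_int_def Qv_power Qv_inverse)

lemma vq_square: "vq TYPE('k::finite) * vq TYPE('k) = CARD('k)" by (simp add: vq_def)

lemma vq_rat: "vq TYPE('k::finite) * vq TYPE('k) : \<rat>" by (simp add: vq_square)

section \<open>The Euler form of a quiver without relations\<close>

text \<open>The Euler form is defined with the dimension of abstract vector spaces. Over a finite
  field this dimension can be read off from the number of elements, which the cocycle counts
  provide.\<close>

lemma card_vectorspace:
 fixes V :: "('k::{finite,field}, 'v) module"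
 assumes V: "vectorspace class_ring V" and finV: "finite (carrier V)"
 shows "card (carrier V) = CARD('k) ^ vectorspace.dim class_ring V"
proof -
 interpret vectorspace "class_ring :: 'k ring" V by (rule V)
 have g: "gen_set (carrier V)"
 proof
  show "span (carrier V) <= carrier V" by (rule span_is_subset2) simp
  show "carrier V <= span (carrier V)" by (rule in_own_span) simp
 qed
 then have "fin_dim" unfolding fin_dim_def using finV g by (intro exI[of _ "carrier V"]) simp
 then obtain B where B: "finite B" "basis B" using finite_basis_exists by blast
 then have BV: "B <= carrier V" unfolding basis_def by blast
 let ?f = "%a. lincomb a B"
 have uni: "EX! a. a : B \<rightarrow>\<^sub>E (UNIV :: 'k set) & lincomb a B = v" if "v : carrier V" for v using basis_criterion[OF B(1) BV] B(2) that by simp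
 have cl: "lincomb a B : carrier V" for a :: "'v => 'k" by (rule lincomb_closed[OF BV]) simp
 have "bij_betw ?f (B \<rightarrow>\<^sub>E (UNIV :: 'k set)) (carrier V)"
 proof (rule bij_betw_imageI)
  show "inj_on ?f (B \<rightarrow>\<^sub>E (UNIV :: 'k set))" using uni cl by (intro inj_onI) blast
  show "?f ` (B \<rightarrow>\<^sub>E (UNIV :: 'k set)) = carrier V" using uni cl by blast
 qed
 then show ?thesis using bij_betw_same_card B(1) dim_basis[OF B] by (fastforce simp: card_PiE)
qed

lemma set_eqI3: "(!!a b c. (a, b, c) : A \<longleftrightarrow> (a, b, c) : B) ==> A = B" by auto

text \<open>The vector space axioms pass to the image of any map that is compatible with the
  operations. It is applied to \<Phi> = \<open>ecl\<close>, whose image is Ext^1, and to the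
  identity for Hom.\<close>

lemma vectorspace_hom_image:
 fixes V :: "('k::field, 'v) module" and \<Phi> :: "'z::ab_group_add => 'v"
 assumes Z: "0 : Z" "!!x y. x : Z ==> y : Z ==> x + y : Z" "!!c x. x : Z ==> sc c x : Z"
  and sc: "!!c x y. sc c (x + y) = sc c x + sc c y" "!!c d x. sc (c + d) x = sc c x + sc d x"
   "!!c d x. sc (c * d) x = sc c (sc d x)" "!!x. sc 1 x = x"
  and V: "carrier V = \<Phi> ` Z" "\<zero>\<^bsub>V\<^esub> = \<Phi> 0" "!!x y. x : Z ==> y : Z ==> \<Phi> x \<oplus>\<^bsub>V\<^esub> \<Phi> y = \<Phi> (x + y)"
   "!!c x. x : Z ==> c \<odot>\<^bsub>V\<^esub> \<Phi> x = \<Phi> (sc c x)"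
 shows "vectorspace class_ring V"
proof -
 have F: "field (class_ring :: 'k ring)" by unfold_locales
 then interpret F: field "class_ring :: 'k ring" .
 have sc0: "sc 0 x = 0" for x using sc(2)[of 0 0 x] by simp
 have neg: "sc (-1) x + x = 0" for x using sc(2)[of "-1" 1 x] sc(4)[of x] sc0 by simp
 have "module (class_ring :: 'k ring) V"
 proof (rule moduleI)
  show "cring (class_ring :: 'k ring)" using F by (simp add: field_def domain_def)
  show "abelian_group V"
  proof (rule abelian_groupI)
   fix x assume "x : carrier V"
   then obtain a where a: "a : Z" "x = \<Phi> a" using V(1) by blast
   have "\<Phi> (sc (-1) a) \<oplus>\<^bsub>V\<^esub> x = \<zero>\<^bsub>V\<^esub>" using V(3)[OF Z(3) a(1)] a V(2) neg by simp
   then show "EX y:carrier V. y \<oplus>\<^bsub>V\<^esub> x = \<zero>\<^bsub>V\<^esub>" using V(1) Z(3)[OF a(1)] by blast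
  qed (use Z V in "auto simp: add.assoc add.commute add.left_commute")
 qed (use Z V sc in "auto")
 then show ?thesis using F unfolding vectorspace_def by blast
qed

context fin_bquiver
begin

text \<open>An extension has class z if and only if some linear section has defect z. In this form
  the Baer sum and the scaling of extensions become operations on sections, and so the addition and
  scaling of cocycles.\<close>

lemma extn_class_section:
 assumes M: "M : reps A" and N: "N : reps A" and z: "z : cocycles M N"
 shows "(f, L, g) : ecl M N z \<longleftrightarrow> (f, L, g) : extns A M N & (EX si. (ALL i. si i : lin_map (Sp M i) (Sp L i)) &
  (ALL i. ALL y:Sp M i. g i (si i y) = y) & (ALL a:arrs A. ALL y:Sp M (tv A a).
   Mp L a (si (tv A a) y) = f (hv A a) (z a y) + si (hv A a) (Mp M a y)))"
  (is "_ \<longleftrightarrow> _ & ?S")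
proof
 note pM = prR[OF M] and pN = prR[OF N]
 have zc: "z : cochain1 M N" using z unfolding cocycles_def by blast
 note zero = sb_0[OF prD(1)[OF pM]] sb_0[OF prD(1)[OF pN]]
 {
  assume "(f, L, g) : ecl M N z"
  then have eqv: "(std_extn M N z, (f, L, g)) : ext_equiv A M N" unfolding ecl_def by blast
  then obtain fi where e: "(f, L, g) : extns A M N" and fi: "fi : Homs A (ext_rep M N z) L"
   and c': "ALL i. (ALL x:Sp N i. fi i (if x : Sp N i then pjoin x 0 else 0) = f i x) &
    (ALL x:Sp (ext_rep M N z) i. g i (fi i x) = (if x : pprod (Sp N i) (Sp M i) then psnd x else 0))" unfolding ext_equiv_def std_extn_def by blast
  have c1: "fi i (pjoin x 0) = f i x" if "x : Sp N i" for i x using that bspec[OF conjunct1[OF spec[OF c', of i]], of x] by simp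
  have c2: "g i (fi i (pjoin x y)) = y" if "x : Sp N i" "y : Sp M i" for i x y using that bspec[OF conjunct2[OF spec[OF c', of i]], of "pjoin x y"] by simp
  note ph = HomsD(1)[OF fi, unfolded Sp_ext_rep]
  define si where "si = (%i y. if y : Sp M i then fi i (pjoin 0 y) else 0)"
  have "si i : lin_map (Sp M i) (Sp L i)" for i
  proof (rule lin_mapI)
   fix x y assume x: "x : Sp M i" and y: "y : Sp M i"
   have "fi i (pjoin 0 x + pjoin 0 y) = fi i (pjoin 0 x) + fi i (pjoin 0 y)" by (rule lmD(2)[OF ph]) (use x y zero in simp_all)
   then show "si i (x + y) = si i x + si i y" using x y sb_add[OF prD(1)[OF pM] x y] by (simp add: si_def pjoin_add)
  next
   fix c x assume x: "x : Sp M i"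
   have "fi i (sm c (pjoin 0 x)) = sm c (fi i (pjoin 0 x))" by (rule lmD(3)[OF ph]) (use x zero in simp_all)
   then show "si i (sm c x) = sm c (si i x)" using x sb_scale[OF prD(1)[OF pM] x] by (simp add: si_def pjoin_sm)
  next
   fix x assume x: "x : Sp M i"
   show "si i x : Sp L i" using lmD(1)[OF ph, of "pjoin 0 x"] x zero by (simp add: si_def)
  qed (simp add: si_def)
  moreover have "g i (si i y) = y" if "y : Sp M i" for i y using c2[OF zero(2) that] that by (simp add: si_def)
  moreover have "Mp L a (si (tv A a) y) = f (hv A a) (z a y) + si (hv A a) (Mp M a y)" if a: "a : arrs A" and y: "y : Sp M (tv A a)" for a y
  proof -
   have p: "pjoin 0 y : Sp (ext_rep M N z) (tv A a)" using y zero by simp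
   note zy = lmD(1)[OF cochain1D(1)[OF zc a] y] and my = prerep_mem[OF pM a y]
   have "Mp L a (fi (tv A a) (pjoin 0 y)) = fi (hv A a) (pjoin (z a y) (Mp M a y))" using HomsD(2)[OF fi a p] p by (simp add: Mp_ext_rep[OF a] prerep_Mp0[OF pN])
   also have "pjoin (z a y) (Mp M a y) = pjoin (z a y) 0 + pjoin 0 (Mp M a y)" by (simp add: pjoin_add)
   also have "fi (hv A a) ... = f (hv A a) (z a y) + fi (hv A a) (pjoin 0 (Mp M a y))" using lmD(2)[OF ph, of "pjoin (z a y) 0" "hv A a" "pjoin 0 (Mp M a y)"] c1[OF zy] zy my zero by simp
   finally show ?thesis using y my by (simp add: si_def)
  qed
  ultimately show "(f, L, g) : extns A M N & ?S" using e by blast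
 }
 assume "(f, L, g) : extns A M N & ?S"
 then obtain si where e: "(f, L, g) : extns A M N" and sg: "ALL i. si i : lin_map (Sp M i) (Sp L i)"
  "ALL i. ALL y:Sp M i. g i (si i y) = y" "ALL a:arrs A. ALL y:Sp M (tv A a).
   Mp L a (si (tv A a) y) = f (hv A a) (z a y) + si (hv A a) (Mp M a y)" by blast
 have "(std_extn M N z, (f, L, g)) : ext_equiv A M N" by (rule section_extn(2)[OF M N e zc, of si]) (use sg in simp_all)
 then show "(f, L, g) : ecl M N z" unfolding ecl_def by blast
qed

section \<open>The vector spaces Hom and Ext^1 without relations\<close>

definition cscale :: "'k => ('b => 'k poly => 'k poly) => 'b => 'k poly => 'k poly" where
 "cscale c z = (%a x. sm c (z a x))"

lemma extnsD:
 assumes "(f, L, g) : extns A M N"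
 shows "prerep A L" "ses A N f L g M" using assms prR unfolding extns_def by auto

context
 fixes M N
 assumes M: "M : reps A" and N: "N : reps A" and no_relns: "relns A = {}"
begin

lemma cocycles_no_relns: "cocycles M N = cochain1 M N" unfolding cocycles_def reps_iff using prerep_ext_rep[OF prR[OF M] prR[OF N]] no_relns by auto

lemma cochain1_zero: "0 : cochain1 M N" unfolding cochain1_def by (simp add: zero_fun_def lin_map_zero[OF prD(1)[OF prR[OF N]]])

lemma cochain1_scale: "z : cochain1 M N ==> cscale c z : cochain1 M N" unfolding cochain1_def cscale_def using lin_map_scale[OF _ prD(1)[OF prR[OF N]]] by simp

lemma split_class: "{xx0 : extns A M N. ext_split A M xx0} = ecl M N 0"
proof (rule set_eqI3)
 fix f L g
 have f0: "f i 0 = 0" if "(f, L, g) : extns A M N" for i by (rule lin_map0[OF HomsD(1)[OF sesD(1)[OF extnsD(2)[OF that]]]])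
 have z: "0 : cocycles M N" using cochain1_zero cocycles_no_relns by simp
 show "(f, L, g) : {xx0 : extns A M N. ext_split A M xx0} \<longleftrightarrow> (f, L, g) : ecl M N 0" unfolding extn_class_section[OF M N z] mem_Collect_eq ext_split_def prod.case by (rule conj_cong[OF rfl]) (use f0 in "auto simp: Homs_def")
qed

text \<open>In one direction the map of extensions is composed with a section. In the other the
  standard extension of x is taken as source, and a section of the target defines the map on its
  second summand.\<close>

lemma scale_class:
 assumes x: "x : cochain1 M N"
 shows "{zt : extns A M N. EX xx0:ecl M N x. ext_scale A N c xx0 zt} = ecl M N (cscale c x)"
proof (rule set_eqI3)
 fix f' L' g'
 note pM = prR[OF M] and pN = prR[OF N]
 note zero = sb_0[OF prD(1)[OF pM]] sb_0[OF prD(1)[OF pN]]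
 have xz: "x : cocycles M N" and cz: "cscale c x : cocycles M N" using x cochain1_scale cocycles_no_relns by auto
 show "(f', L', g') : {zt : extns A M N. EX xx0:ecl M N x. ext_scale A N c xx0 zt} \<longleftrightarrow> (f', L', g') : ecl M N (cscale c x)"
 proof
  assume "(f', L', g') : {zt : extns A M N. EX xx0:ecl M N x. ext_scale A N c xx0 zt}"
  then obtain f L g where e': "(f', L', g') : extns A M N" and e: "(f, L, g) : ecl M N x"
   and sc: "ext_scale A N c (f, L, g) (f', L', g')" by auto
  obtain si where eL: "(f, L, g) : extns A M N" and sg: "!!i. si i : lin_map (Sp M i) (Sp L i)" "!!i y. y : Sp M i ==> g i (si i y) = y"
   "!!a y. a : arrs A ==> y : Sp M (tv A a) ==>
   Mp L a (si (tv A a) y) = f (hv A a) (x a y) + si (hv A a) (Mp M a y)" using e unfolding extn_class_section[OF M N xz] by blast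
  obtain fi where fi: "fi : Homs A L L'" "!!i n. n : Sp N i ==> fi i (f i n) = f' i (sm c n)"
   "!!i p. p : Sp L i ==> g' i (fi i p) = g i p" using sc unfolding ext_scale_def by auto
  note ph = HomsD(1)[OF fi(1)]
  have "Mp L' a (fi (tv A a) (si (tv A a) y)) = f' (hv A a) (cscale c x a y) + fi (hv A a) (si (hv A a) (Mp M a y))" if a: "a : arrs A" and y: "y : Sp M (tv A a)" for a y
  proof -
   note xy = lmD(1)[OF cochain1D(1)[OF x a] y] and my = prerep_mem[OF pM a y]
   show ?thesis using HomsD(2)[OF fi(1) a lmD(1)[OF sg(1) y]] sg(3)[OF a y] fi(2)[OF xy]
     lmD(2)[OF ph Homs_mem[OF sesD(1)[OF extnsD(2)[OF eL]] xy] lmD(1)[OF sg(1) my]] by (simp add: cscale_def)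
  qed
  moreover have "(%y. fi i (si i y)) : lin_map (Sp M i) (Sp L' i)" for i by (rule lin_map_comp[OF sg(1) ph prD(1)[OF pM]])
  moreover have "g' i (fi i (si i y)) = y" if "y : Sp M i" for i y using fi(3)[OF lmD(1)[OF sg(1) that]] sg(2)[OF that] by simp
  ultimately show "(f', L', g') : ecl M N (cscale c x)" unfolding extn_class_section[OF M N cz] using e' by (intro conjI exI[of _ "%i y. fi i (si i y)"]) auto
 next
  assume "(f', L', g') : ecl M N (cscale c x)"
  then obtain si where e': "(f', L', g') : extns A M N" and sg: "!!i. si i : lin_map (Sp M i) (Sp L' i)" "!!i y. y : Sp M i ==> g' i (si i y) = y"
   "!!a y. a : arrs A ==> y : Sp M (tv A a) ==>
   Mp L' a (si (tv A a) y) = f' (hv A a) (cscale c x a y) + si (hv A a) (Mp M a y)" unfolding extn_class_section[OF M N cz] by blast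
  note s' = extnsD(2)[OF e'] and pL' = extnsD(1)[OF e']
  note fl = HomsD(1)[OF sesD(1)[OF s']] and gl = HomsD(1)[OF sesD(2)[OF s']]
  have sp: "subsp (pprod (Sp N i) (Sp M i))" for i by (rule subspace_pprod[OF prD(1)[OF pN] prD(1)[OF pM]])
  define fi where "fi = (%i p. if p : pprod (Sp N i) (Sp M i) then f' i (sm c (pfst p)) + si i (psnd p) else 0)"
  note cN = sb_scale[OF prD(1)[OF pN]]
  have ph: "fi : Homs A (ext_rep M N x) L'"
  proof (rule HomsI)
   fix i
   show "fi i : lin_map (Sp (ext_rep M N x) i) (Sp L' i)" unfolding Sp_ext_rep
   proof (rule lin_mapI)
    fix p assume p: "p : pprod (Sp N i) (Sp M i)"
    show "fi i p : Sp L' i" using p sb_add[OF prD(1)[OF pL'] lmD(1)[OF fl cN[OF pprodD(1)[OF p], of c]] lmD(1)[OF sg(1) pprodD(2)[OF p]]] by (simp add: fi_def)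
    fix d
    show "fi i (sm d p) = sm d (fi i p)" using p pprodD[OF p] lmD(3)[OF fl] lmD(3)[OF sg(1)] sb_scale[OF sp p] by (simp add: fi_def pfst_sm psnd_sm smult_add_right mult.commute)
    fix q assume q: "q : pprod (Sp N i) (Sp M i)"
    show "fi i (p + q) = fi i p + fi i q" using p q pprodD[OF p] pprodD[OF q] lmD(2)[OF fl] lmD(2)[OF sg(1)] sb_add[OF sp p q] cN by (simp add: fi_def pfst_add psnd_add smult_add_right algebra_simps)
   qed (simp add: fi_def)
  next
   fix a p assume a: "a : arrs A" and p: "p : Sp (ext_rep M N x) (tv A a)"
   let ?h = "hv A a" and ?t = "tv A a"
   have p': "p : pprod (Sp N ?t) (Sp M ?t)" using p by simp
   note pp = pprodD[OF p']
   have m: "Mp (ext_rep M N x) a p : pprod (Sp N ?h) (Sp M ?h)" using prerep_mem[OF prerep_ext_rep[OF pM pN x] a p] by simp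
   note xp = lmD(1)[OF cochain1D(1)[OF x a] pp(2)] and np = prerep_mem[OF pN a pp(1)]
   have "fi ?h (Mp (ext_rep M N x) a p) = f' ?h (sm c (Mp N a (pfst p) + x a (psnd p))) + si ?h (Mp M a (psnd p))" using m by (simp add: fi_def Mp_ext_rep[OF a p'])
   also have "... = f' ?h (sm c (Mp N a (pfst p))) + f' ?h (cscale c x a (psnd p)) + si ?h (Mp M a (psnd p))" using lmD(2)[OF fl cN[OF np] cN[OF xp]] by (simp add: smult_add_right cscale_def)
   also have "... = Mp L' a (f' ?t (sm c (pfst p))) + Mp L' a (si ?t (psnd p))" using HomsD(2)[OF sesD(1)[OF s'] a cN[OF pp(1), of c]] sg(3)[OF a pp(2)] lmD(3)[OF prD(3)[OF pN a] pp(1), of c] by simp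
   also have "... = Mp L' a (f' ?t (sm c (pfst p)) + si ?t (psnd p))" using lmD(2)[OF prD(3)[OF pL' a] lmD(1)[OF fl cN[OF pp(1), of c]] lmD(1)[OF sg(1) pp(2)]] by simp
   finally show "fi ?h (Mp (ext_rep M N x) a p) = Mp L' a (fi ?t p)" using p' by (simp add: fi_def)
  qed
  have c1: "fi i (if n : Sp N i then pjoin n 0 else 0) = f' i (sm c n)" if "n : Sp N i" for i n using that zero lin_map0[OF sg(1)] by (simp add: fi_def)
  have c2: "g' i (fi i p) = (if p : pprod (Sp N i) (Sp M i) then psnd p else 0)" if p: "p : Sp (ext_rep M N x) i" for i p
  proof -
   have p': "p : pprod (Sp N i) (Sp M i)" using p by simp
   note cp = cN[OF pprodD(1)[OF p'], of c]
   have "f' i (sm c (pfst p)) : {x : Sp L' i. g' i x = 0}" using sesD(4)[OF s', of i] cp by blast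
   then have gf: "g' i (f' i (sm c (pfst p))) = 0" by simp
   show ?thesis using lmD(2)[OF gl lmD(1)[OF fl cp] lmD(1)[OF sg(1) pprodD(2)[OF p']]]
     gf sg(2)[OF pprodD(2)[OF p']] p' by (simp add: fi_def)
  qed
  have "ext_scale A N c (std_extn M N x) (f', L', g')" unfolding ext_scale_def std_extn_def prod.case using ph c1 c2 by blast
  moreover have "std_extn M N x : ecl M N x" unfolding ecl_def using equiv_class_self[OF ext_equiv_equiv[OF N] std_extn_extns[OF M N xz]] by blast
  ultimately show "(f', L', g') : {zt : extns A M N. EX xx0:ecl M N x. ext_scale A N c xx0 zt}" using e' by blast
 qed
qed

lemma baer_class:
 assumes x: "x : cochain1 M N" and x': "x' : cochain1 M N"
 shows "{zt : extns A M N. EX xx0:ecl M N x. EX yy0:ecl M N x'. baer_sum A N xx0 yy0 zt} = ecl M N (x + x')"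
proof (rule set_eqI3)
 fix f'' L'' g''
 note pM = prR[OF M] and pN = prR[OF N]
 note zero = sb_0[OF prD(1)[OF pM]] sb_0[OF prD(1)[OF pN]]
 have xx: "x + x' : cochain1 M N" by (rule cochain1_add[OF pN x x'])
 have xz: "x : cocycles M N" "x' : cocycles M N" "x + x' : cocycles M N" using x x' xx cocycles_no_relns by auto
 show "(f'', L'', g'') : {zt : extns A M N. EX xx0:ecl M N x. EX yy0:ecl M N x'. baer_sum A N xx0 yy0 zt}
  \<longleftrightarrow> (f'', L'', g'') : ecl M N (x + x')"
 proof
  assume "(f'', L'', g'') : {zt : extns A M N. EX xx0:ecl M N x. EX yy0:ecl M N x'. baer_sum A N xx0 yy0 zt}"
  then obtain f L g f' L' g' where e'': "(f'', L'', g'') : extns A M N" and e1: "(f, L, g) : ecl M N x"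
   and e2: "(f', L', g') : ecl M N x'" and b: "baer_sum A N (f, L, g) (f', L', g') (f'', L'', g'')" by auto
  obtain si where e: "(f, L, g) : extns A M N" and sg: "!!i. si i : lin_map (Sp M i) (Sp L i)" "!!i y. y : Sp M i ==> g i (si i y) = y"
   "!!a y. a : arrs A ==> y : Sp M (tv A a) ==>
   Mp L a (si (tv A a) y) = f (hv A a) (x a y) + si (hv A a) (Mp M a y)" using e1 unfolding extn_class_section[OF M N xz(1)] by blast
  obtain si' where e': "(f', L', g') : extns A M N" and sg': "!!i. si' i : lin_map (Sp M i) (Sp L' i)" "!!i y. y : Sp M i ==> g' i (si' i y) = y"
   "!!a y. a : arrs A ==> y : Sp M (tv A a) ==>
   Mp L' a (si' (tv A a) y) = f' (hv A a) (x' a y) + si' (hv A a) (Mp M a y)" using e2 unfolding extn_class_section[OF M N xz(2)] by blast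
  note s = extnsD(2)[OF e] and s' = extnsD(2)[OF e'] and pL = extnsD(1)[OF e] and pL' = extnsD(1)[OF e']
  define F where "F = (%i. {(p, p'). p : Sp L i & p' : Sp L' i & g i p = g' i p'})"
  obtain ti where th: "ALL i. ALL (p, p'):F i. ti i (p, p') : Sp L'' i & g'' i (ti i (p, p')) = g i p
     & (ALL c. ti i (sm c p, sm c p') = sm c (ti i (p, p'))) & (ALL (y, y'):F i. ti i (p + y, p' + y') = ti i (p, p') + ti i (y, y'))"
   and thf: "ALL i. ALL n:Sp N i. ALL n':Sp N i. ti i (f i n, f' i n') = f'' i (n + n')"
   and tha: "ALL a:arrs A. ALL (p, p'):F (tv A a).
     ti (hv A a) (Mp L a p, Mp L' a p') = Mp L'' a (ti (tv A a) (p, p'))" using b unfolding baer_sum_def Let_def prod.case F_def by blast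
  have FI: "(si i y, si' i y) : F i" if "y : Sp M i" for i y unfolding F_def using lmD(1)[OF sg(1) that] lmD(1)[OF sg'(1) that] sg(2)[OF that] sg'(2)[OF that] by simp
  have FN: "(f i n, f' i n') : F i" if "n : Sp N i" "n' : Sp N i" for i n n'
  proof -
   have "f i n : {p : Sp L i. g i p = 0}" "f' i n' : {p : Sp L' i. g' i p = 0}" using sesD(4)[OF s, of i] sesD(4)[OF s', of i] that by blast+
   then show ?thesis unfolding F_def by simp
  qed
  have th1: "ti i (p, p') : Sp L'' i" "g'' i (ti i (p, p')) = g i p" "ti i (sm c p, sm c p') = sm c (ti i (p, p'))" if "(p, p') : F i" for i p p' c using th that by blast+
  have th2: "ti i (p + y, p' + y') = ti i (p, p') + ti i (y, y')" if "(p, p') : F i" "(y, y') : F i" for i p p' y y' using th that by blast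
  have sm_: "x : Sp M i ==> sm c x : Sp M i" "x : Sp M i ==> y : Sp M i ==> x + y : Sp M i" for c i x y using sb_scale[OF prD(1)[OF pM]] sb_add[OF prD(1)[OF pM]] by blast+
  \<comment> \<open>The pair of sections lands in the fibre product over \<open>M\<close>. Its image
    under \<open>ti\<close> is a section of the Baer sum, whose defect is the sum of the two
    defects.\<close>
  define \<tau> where "\<tau> = (%i y. if y : Sp M i then ti i (si i y, si' i y) else 0)"
  have "\<tau> i : lin_map (Sp M i) (Sp L'' i)" for i
  proof (rule lin_mapI)
   fix p q assume p: "p : Sp M i" and q: "q : Sp M i"
   show "\<tau> i (p + q) = \<tau> i p + \<tau> i q" using p q sm_ th2[OF FI[OF p] FI[OF q]] lmD(2)[OF sg(1) p q] lmD(2)[OF sg'(1) p q] by (simp add: \<tau>_def)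
  next
   fix c p assume p: "p : Sp M i"
   show "\<tau> i (sm c p) = sm c (\<tau> i p)" using p sm_ th1(3)[OF FI[OF p]] lmD(3)[OF sg(1) p] lmD(3)[OF sg'(1) p] by (simp add: \<tau>_def)
  qed (use th1(1)[OF FI] in \<open>auto simp: \<tau>_def\<close>)
  moreover have "g'' i (\<tau> i y) = y" if "y : Sp M i" for i y using th1(2)[OF FI[OF that]] sg(2)[OF that] that by (simp add: \<tau>_def)
  moreover have "Mp L'' a (\<tau> (tv A a) y) = f'' (hv A a) ((x + x') a y) + \<tau> (hv A a) (Mp M a y)" if a: "a : arrs A" and y: "y : Sp M (tv A a)" for a y
  proof -
   note xy = lmD(1)[OF cochain1D(1)[OF x a] y] and xy' = lmD(1)[OF cochain1D(1)[OF x' a] y] and my = prerep_mem[OF pM a y]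
   have "Mp L'' a (\<tau> (tv A a) y) = ti (hv A a) (Mp L a (si (tv A a) y), Mp L' a (si' (tv A a) y))" using bspec[OF bspec[OF tha a] FI[OF y]] y by (simp add: \<tau>_def)
   also have "... = ti (hv A a) (f (hv A a) (x a y), f' (hv A a) (x' a y)) +
     ti (hv A a) (si (hv A a) (Mp M a y), si' (hv A a) (Mp M a y))" using sg(3)[OF a y] sg'(3)[OF a y] th2[OF FN[OF xy xy'] FI[OF my]] by simp
   finally show ?thesis using thf xy xy' my by (simp add: \<tau>_def)
  qed
  ultimately show "(f'', L'', g'') : ecl M N (x + x')" unfolding extn_class_section[OF M N xz(3)] using e'' by (intro conjI exI[of _ \<tau>]) auto
 next
  assume "(f'', L'', g'') : ecl M N (x + x')"
  then obtain si where e': "(f'', L'', g'') : extns A M N" and sg: "!!i. si i : lin_map (Sp M i) (Sp L'' i)" "!!i y. y : Sp M i ==> g'' i (si i y) = y"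
   "!!a y. a : arrs A ==> y : Sp M (tv A a) ==>
   Mp L'' a (si (tv A a) y) = f'' (hv A a) ((x + x') a y) + si (hv A a) (Mp M a y)" unfolding extn_class_section[OF M N xz(3)] by blast
  note s' = extnsD(2)[OF e'] and pL' = extnsD(1)[OF e']
  note fl = HomsD(1)[OF sesD(1)[OF s']] and gl = HomsD(1)[OF sesD(2)[OF s']]
  note aN = sb_add[OF prD(1)[OF pN]] and aL = sb_add[OF prD(1)[OF pL']]
  \<comment> \<open>For two standard extensions a point of the fibre product has two coordinates in
    \<open>N\<close> and a common one in \<open>M\<close>. The former are added and included, the
    latter is lifted by the section.\<close>
  define ti where "ti = (%i (p, p'). f'' i (pfst p + pfst p') + si i (psnd p))"
  define F where "F = (%i. {(p, p'). p : Sp (ext_rep M N x) i & p' : Sp (ext_rep M N x') i &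
   (if p : pprod (Sp N i) (Sp M i) then psnd p else 0) = (if p' : pprod (Sp N i) (Sp M i) then psnd p' else 0)})"
  have FD: "p : pprod (Sp N i) (Sp M i)" "p' : pprod (Sp N i) (Sp M i)" "psnd p' = psnd p" "pfst p : Sp N i" "pfst p' : Sp N i"
   "psnd p : Sp M i" if "(p, p') : F i" for p p' i
  proof -
   have h: "p : pprod (Sp N i) (Sp M i)" "p' : pprod (Sp N i) (Sp M i)" "psnd p' = psnd p" using that unfolding F_def by (auto split: if_splits)
   then show "p : pprod (Sp N i) (Sp M i)" "p' : pprod (Sp N i) (Sp M i)" "psnd p' = psnd p" "pfst p : Sp N i" "pfst p' : Sp N i"
    "psnd p : Sp M i" using pprodD[OF h(1)] pprodD[OF h(2)] by simp_all
  qed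
  have Fi: "F i = {(p, p'). p : Sp (ext_rep M N x) i & p' : Sp (ext_rep M N x') i &
   (if p : pprod (Sp N i) (Sp M i) then psnd p else 0) = (if p' : pprod (Sp N i) (Sp M i) then psnd p' else 0)}" for i by (simp add: F_def)
  have sp: "subsp (pprod (Sp N i) (Sp M i))" for i by (rule subspace_pprod[OF prD(1)[OF pN] prD(1)[OF pM]])
  have gf: "g'' i (f'' i n) = 0" if "n : Sp N i" for i n
  proof -
   have "f'' i n : {x : Sp L'' i. g'' i x = 0}" using sesD(4)[OF s', of i] that by blast
   then show ?thesis by simp
  qed
  have t1: "ti i (p, p') : Sp L'' i" "g'' i (ti i (p, p')) = psnd p" "ti i (sm c p, sm c p') = sm c (ti i (p, p'))" if h: "(p, p') : F i" for i p p' c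
  proof -
   note d = FD[OF h]
   note m1 = lmD(1)[OF fl aN[OF d(4,5)]] and m2 = lmD(1)[OF sg(1) d(6)]
   show "ti i (p, p') : Sp L'' i" using aL[OF m1 m2] by (simp add: ti_def)
   show "g'' i (ti i (p, p')) = psnd p" using lmD(2)[OF gl m1 m2] gf[OF aN[OF d(4,5)]] sg(2)[OF d(6)] by (simp add: ti_def)
   show "ti i (sm c p, sm c p') = sm c (ti i (p, p'))" using lmD(3)[OF fl aN[OF d(4,5)], of c] lmD(3)[OF sg(1) d(6), of c] by (simp add: ti_def pfst_sm psnd_sm smult_add_right)
  qed
  have t2: "ti i (p + q, p' + q') = ti i (p, p') + ti i (q, q')" if h: "(p, p') : F i" and k: "(q, q') : F i" for i p p' q q'
  proof -
   note d = FD[OF h] and d' = FD[OF k]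
   have "pfst (p + q) + pfst (p' + q') = (pfst p + pfst p') + (pfst q + pfst q')" by (simp add: pfst_add)
   then show ?thesis using lmD(2)[OF fl aN[OF d(4,5)] aN[OF d'(4,5)]] lmD(2)[OF sg(1) d(6) d'(6)] by (simp add: ti_def psnd_add add_ac)
  qed
  have t3: "ti i (if n : Sp N i then pjoin n 0 else 0, if n' : Sp N i then pjoin n' 0 else 0) = f'' i (n + n')" if "n : Sp N i" "n' : Sp N i" for i n n' using that lin_map0[OF sg(1)] by (simp add: ti_def)
  have t4: "ti (hv A a) (Mp (ext_rep M N x) a p, Mp (ext_rep M N x') a p') = Mp L'' a (ti (tv A a) (p, p'))" if a: "a : arrs A" and h: "(p, p') : F (tv A a)" for a p p'
  proof -
   let ?h = "hv A a" and ?t = "tv A a"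
   note d = FD[OF h]
   note xp = lmD(1)[OF cochain1D(1)[OF x a] d(6)] and xp' = lmD(1)[OF cochain1D(1)[OF x' a] d(6)]
   note np = prerep_mem[OF pN a d(4)] and np' = prerep_mem[OF pN a d(5)] and nn = prerep_mem[OF pN a aN[OF d(4,5)]]
   have e1: "Mp N a (pfst p) + x a (psnd p) + (Mp N a (pfst p') + x' a (psnd p)) = Mp N a (pfst p + pfst p') + (x + x') a (psnd p)" using lmD(2)[OF prD(3)[OF pN a] d(4,5)] by simp
   have "ti ?h (Mp (ext_rep M N x) a p, Mp (ext_rep M N x') a p') =
     f'' ?h (Mp N a (pfst p) + x a (psnd p) + (Mp N a (pfst p') + x' a (psnd p))) + si ?h (Mp M a (psnd p))" using d by (simp add: ti_def Mp_ext_rep[OF a])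
   also have "... = f'' ?h (Mp N a (pfst p + pfst p') + (x + x') a (psnd p)) + si ?h (Mp M a (psnd p))" by (simp only: e1)
   also have "... = f'' ?h (Mp N a (pfst p + pfst p')) + f'' ?h ((x + x') a (psnd p)) + si ?h (Mp M a (psnd p))" using lmD(2)[OF fl nn lmD(1)[OF cochain1D(1)[OF xx a] d(6)]] by simp
   also have "... = Mp L'' a (f'' ?t (pfst p + pfst p')) + Mp L'' a (si ?t (psnd p))" using HomsD(2)[OF sesD(1)[OF s'] a aN[OF d(4,5)]] sg(3)[OF a d(6)] by simp
   also have "... = Mp L'' a (f'' ?t (pfst p + pfst p') + si ?t (psnd p))" using lmD(2)[OF prD(3)[OF pL' a] lmD(1)[OF fl aN[OF d(4,5)]] lmD(1)[OF sg(1) d(6)]] by simp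
   finally show ?thesis by (simp add: ti_def)
  qed
  have psF: "(if p : pprod (Sp N i) (Sp M i) then psnd p else 0) = psnd p" if "(p, p') : F i" for i p p' using FD[OF that] by simp
  have "baer_sum A N (std_extn M N x) (std_extn M N x') (f'', L'', g'')" unfolding baer_sum_def std_extn_def Let_def prod.case Fi[symmetric]
  proof (intro exI[of _ ti] conjI allI ballI)
   fix i and pp assume pp: "pp : F i"
   show "case pp of (p, p') => ti i (p, p') : Sp L'' i & g'' i (ti i (p, p')) = (if p : pprod (Sp N i) (Sp M i) then psnd p else 0) &
    (ALL c. ti i (sm c p, sm c p') = sm c (ti i (p, p'))) & (ALL (y, y'):F i. ti i (p + y, p' + y') = ti i (p, p') + ti i (y, y'))" using pp t1 t2 psF by auto
  next
   fix a pp assume "a : arrs A" "pp : F (tv A a)"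
   then show "case pp of (p, p') => ti (hv A a) (Mp (ext_rep M N x) a p, Mp (ext_rep M N x') a p') = Mp L'' a (ti (tv A a) (p, p'))" using t4 by auto
  qed (rule t3)
  moreover have "std_extn M N x : ecl M N x" "std_extn M N x' : ecl M N x'" unfolding ecl_def using equiv_class_self[OF ext_equiv_equiv[OF N] std_extn_extns[OF M N xz(1)]]
    equiv_class_self[OF ext_equiv_equiv[OF N] std_extn_extns[OF M N xz(2)]] by blast+
  ultimately show "(f'', L'', g'') : {zt : extns A M N. EX xx0:ecl M N x. EX yy0:ecl M N x'. baer_sum A N xx0 yy0 zt}" using e' by blast
 qed
qed

lemma vectorspace_Ext1: "vectorspace class_ring (Ext1_space A M N)"
proof (rule vectorspace_hom_image[where Z = "cochain1 M N" and sc = cscale and \<Phi> = "ecl M N"])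
 note pN = prR[OF N]
 show "0 : cochain1 M N" by (rule cochain1_zero)
 show "x + y : cochain1 M N" if "x : cochain1 M N" "y : cochain1 M N" for x y by (rule cochain1_add[OF pN that])
 show "carrier (Ext1_space A M N) = ecl M N ` cochain1 M N" using extn_class_image(1)[OF M N] cocycles_no_relns by (simp add: Ext1_space_def)
 show "\<zero>\<^bsub>Ext1_space A M N\<^esub> = ecl M N 0" using split_class by (simp add: Ext1_space_def)
 show "ecl M N x \<oplus>\<^bsub>Ext1_space A M N\<^esub> ecl M N y = ecl M N (x + y)" if "x : cochain1 M N" "y : cochain1 M N" for x y using baer_class[OF that] by (simp add: Ext1_space_def)
 show "c \<odot>\<^bsub>Ext1_space A M N\<^esub> ecl M N x = ecl M N (cscale c x)" if "x : cochain1 M N" for c x using scale_class[OF that] by (simp add: Ext1_space_def)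
 show "cscale c x : cochain1 M N" if "x : cochain1 M N" for c x by (rule cochain1_scale[OF that])
qed (auto simp: cscale_def smult_add_right smult_add_left fun_eq_iff)

lemma vectorspace_Hom: "vectorspace class_ring (Hom_space A M N)"
proof (rule vectorspace_hom_image[where Z = "Homs A M N" and sc = cscale and \<Phi> = "%x. x"])
 note pM = prR[OF M] and pN = prR[OF N]
 have c0: "0 : cochain0 M N" unfolding cochain0_def by (simp add: zero_fun_def lin_map_zero[OF prD(1)[OF pN]])
 show "0 : Homs A M N" unfolding Homs_eq_kernel[OF pM pN] using c0 by (simp add: cob_def prerep_Mp0[OF pN] fun_eq_iff)
 show "x + y : Homs A M N" if "x : Homs A M N" "y : Homs A M N" for x y using that unfolding Homs_eq_kernel[OF pM pN] by (simp add: coboundary_add[OF pM pN] cochain0_add[OF pN])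
 show "cscale c x : Homs A M N" if x: "x : Homs A M N" for c x
 proof (rule HomsI)
  show "cscale c x i : lin_map (Sp M i) (Sp N i)" for i unfolding cscale_def by (rule lin_map_scale[OF HomsD(1)[OF x] prD(1)[OF pN]])
  show "cscale c x (hv A a) (Mp M a y) = Mp N a (cscale c x (tv A a) y)" if "a : arrs A" "y : Sp M (tv A a)" for a y using HomsD(2)[OF x that] lmD(3)[OF prD(3)[OF pN that(1)] Homs_mem[OF x that(2)]] by (simp add: cscale_def)
 qed
qed (auto simp: cscale_def smult_add_right smult_add_left Hom_space_def fun_eq_iff)

text \<open>Without relations every 1-cochain is a cocycle. Comparing exponents of q in
  \<open>card_Ext1_Homs\<close> turns the Euler form into the difference of the dimensions of
  0-cochains and 1-cochains.\<close>

lemma euler_eq: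
 assumes fM: "fdim M" and fN: "fdim N"
 shows "euler A M N = (SUM i:verts (quiver A). int (dm (Sp M i) * dm (Sp N i))) -
  (SUM a:arrs A. int (dm (Sp M (tv A a)) * dm (Sp N (hv A a))))"
proof -
 note pM = prR[OF M] and pN = prR[OF N]
 let ?h = "vectorspace.dim class_ring (Hom_space A M N)" and ?e = "vectorspace.dim class_ring (Ext1_space A M N)"
 have fin: "finite (Homs A M N)" using finite_card_cochain0(1)[OF pM fM pN fN] unfolding Homs_eq_kernel[OF pM pN] by simp
 have fin': "finite (Ext1 A M N)" using finite_card_cochain1(1)[OF pM fM pN fN] unfolding extn_class_image(1)[OF M N] cocycles_no_relns by simp
 have h: "card (Homs A M N) = CARD('k) ^ ?h" using card_vectorspace[OF vectorspace_Hom] fin by (simp add: Hom_space_def)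
 have e: "card (Ext1 A M N) = CARD('k) ^ ?e" using card_vectorspace[OF vectorspace_Ext1] fin' by (simp add: Ext1_space_def)
 have "CARD('k) ^ (?e + (SUM i:verts (quiver A). dm (Sp M i) * dm (Sp N i))) =
  CARD('k) ^ ((SUM a:arrs A. dm (Sp M (tv A a)) * dm (Sp N (hv A a))) + ?h)" using card_Ext1_Homs[OF M fM N fN] finite_card_cochain1(2)[OF pM fM pN fN] finite_card_cochain0(2)[OF pM fM pN fN] unfolding h e cocycles_no_relns by (simp add: power_add)
 then have "?e + (SUM i:verts (quiver A). dm (Sp M i) * dm (Sp N i)) =
  (SUM a:arrs A. dm (Sp M (tv A a)) * dm (Sp N (hv A a))) + ?h" using power_inject_exp[OF CARD_gt1[where ?'k='k]] by blast
 then have "int ?e + (SUM i:verts (quiver A). int (dm (Sp M i) * dm (Sp N i))) =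
  (SUM a:arrs A. int (dm (Sp M (tv A a)) * dm (Sp N (hv A a)))) + int ?h" unfolding of_nat_add[symmetric] of_nat_sum[symmetric] by (rule arg_cong)
 then show ?thesis unfolding euler_def by simp
qed

end

end

section \<open>Noncommutative localization\<close>

text \<open>The ring axioms of the localization are built into \<open>loc_eq\<close>; the
  assumptions on \<open>B\<close> and \<open>S\<close> ensure that related terms stay well
  formed.\<close>

locale loc_setup =
 fixes B :: "('b, 'c) ring_scheme" and S :: "'b set"
 assumes zero_closed: "\<zero>\<^bsub>B\<^esub> : carrier B" and one_closed: "\<one>\<^bsub>B\<^esub> : carrier B"
  and add_closed: "a : carrier B ==> b : carrier B ==> a \<oplus>\<^bsub>B\<^esub> b : carrier B"
  and mult_closed: "a : carrier B ==> b : carrier B ==> a \<otimes>\<^bsub>B\<^esub> b : carrier B"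
  and S_closed: "s : S ==> s : carrier B"
begin

abbreviation "LT == loc_terms B S"
abbreviation "LR == localization B S"
abbreviation mulL (infixl "*L" 70) where "x *L y == x \<otimes>\<^bsub>LR\<^esub> y"
definition cl :: "'b loc_term => 'b loc_term set" where "cl x = loc_rel B S `` {x}"

lemma loc_eq_terms: "loc_eq B S x y ==> x : LT & y : LT" by (induction rule: loc_eq.induct)
  (auto intro: loc_terms.intros zero_closed one_closed add_closed mult_closed S_closed)

lemma cl_eq_iff: "x : LT ==> y : LT ==> cl x = cl y \<longleftrightarrow> loc_eq B S x y" unfolding cl_def loc_rel_def using loc_eq.refl loc_eq.sym loc_eq.trans by blast

lemma mem_cl: "y : cl x \<longleftrightarrow> loc_eq B S x y" by (simp add: cl_def loc_rel_def)

lemma carrier_LR: "carrier LR = cl ` LT" by (auto simp: localization_def quotient_def cl_def)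

lemma LR_mult: "x : LT ==> y : LT ==> cl x *L cl y = cl (Mul x y)"
proof -
 assume x: "x : LT" and y: "y : LT"
 have "cl (Mul x' y') = cl (Mul x y)" if "x' : cl x" "y' : cl y" for x' y'
 proof -
  have "loc_eq B S (Mul x y) (Mul x' y')" using that unfolding mem_cl by (rule loc_eq.cong_mul)
  then show ?thesis using cl_eq_iff loc_eq_terms by metis
 qed
 moreover have "x : cl x" "y : cl y" using x y loc_eq.refl mem_cl by blast+
 ultimately have "(\<Union>x\<in>cl x. \<Union>y\<in>cl y. cl (Mul x y)) = cl (Mul x y)" by blast
 then show ?thesis unfolding localization_def by (simp flip: cl_def)
qed

lemma LR_add: "x : LT ==> y : LT ==> cl x \<oplus>\<^bsub>LR\<^esub> cl y = cl (Add x y)"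
proof -
 assume x: "x : LT" and y: "y : LT"
 have "cl (Add x' y') = cl (Add x y)" if "x' : cl x" "y' : cl y" for x' y'
 proof -
  have "loc_eq B S (Add x y) (Add x' y')" using that unfolding mem_cl by (rule loc_eq.cong_add)
  then show ?thesis using cl_eq_iff loc_eq_terms by metis
 qed
 moreover have "x : cl x" "y : cl y" using x y loc_eq.refl mem_cl by blast+
 ultimately have "(\<Union>x\<in>cl x. \<Union>y\<in>cl y. cl (Add x y)) = cl (Add x y)" by blast
 then show ?thesis unfolding localization_def by (simp flip: cl_def)
qed

lemma LR_zero: "\<zero>\<^bsub>LR\<^esub> = cl (Emb \<zero>\<^bsub>B\<^esub>)" and LR_one: "\<one>\<^bsub>LR\<^esub> = cl (Emb \<one>\<^bsub>B\<^esub>)" by (simp_all add: localization_def loc_emb_def cl_def)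

lemma cl_eqI: "loc_eq B S x y ==> cl x = cl y" using cl_eq_iff loc_eq_terms by blast

lemmas LTI = loc_terms.intros

lemma ring_LR: "ring LR"
proof (rule ringI)
 note [simp] = LR_mult LR_add LR_zero LR_one
 note i = LTI zero_closed one_closed
 show "abelian_group LR"
 proof (rule abelian_groupI)
  fix x assume "x : carrier LR"
  then obtain a where a: "a : LT" "x = cl a" unfolding carrier_LR by blast
  show "EX y:carrier LR. y \<oplus>\<^bsub>LR\<^esub> x = \<zero>\<^bsub>LR\<^esub>" unfolding carrier_LR
  proof (intro bexI[of _ "cl (Neg a)"] imageI)
   show "cl (Neg a) \<oplus>\<^bsub>LR\<^esub> x = \<zero>\<^bsub>LR\<^esub>" using a cl_eqI[OF loc_eq.add_neg[OF a(1)]] by (simp add: i)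
  qed (simp add: i a)
 next
  fix x y z assume "x : carrier LR" "y : carrier LR" "z : carrier LR"
  then show "x \<oplus>\<^bsub>LR\<^esub> y \<oplus>\<^bsub>LR\<^esub> z = x \<oplus>\<^bsub>LR\<^esub> (y \<oplus>\<^bsub>LR\<^esub> z)" by (clarsimp simp: carrier_LR i) (intro cl_eqI loc_eq.add_assoc)
 next
  fix x y assume "x : carrier LR" "y : carrier LR"
  then show "x \<oplus>\<^bsub>LR\<^esub> y = y \<oplus>\<^bsub>LR\<^esub> x" by (clarsimp simp: carrier_LR i) (intro cl_eqI loc_eq.add_comm)
 next
  fix x assume "x : carrier LR"
  then show "\<zero>\<^bsub>LR\<^esub> \<oplus>\<^bsub>LR\<^esub> x = x" by (clarsimp simp: carrier_LR i) (intro cl_eqI loc_eq.add_zero)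
 qed (auto simp: carrier_LR i)
 show "monoid LR"
 proof (rule monoidI)
  fix x y z assume "x : carrier LR" "y : carrier LR" "z : carrier LR"
  then show "x *L y *L z = x *L (y *L z)" by (clarsimp simp: carrier_LR i) (intro cl_eqI loc_eq.mul_assoc)
 next
  fix x assume "x : carrier LR"
  then show "\<one>\<^bsub>LR\<^esub> *L x = x" by (clarsimp simp: carrier_LR i) (intro cl_eqI loc_eq.one_mul)
 next
  fix x assume "x : carrier LR"
  then show "x *L \<one>\<^bsub>LR\<^esub> = x" by (clarsimp simp: carrier_LR i) (intro cl_eqI loc_eq.mul_one)
 qed (auto simp: carrier_LR i)
 fix x y z assume "x : carrier LR" "y : carrier LR" "z : carrier LR"
 then show "(x \<oplus>\<^bsub>LR\<^esub> y) *L z = x *L z \<oplus>\<^bsub>LR\<^esub> y *L z" by (clarsimp simp: carrier_LR i) (intro cl_eqI loc_eq.distrib_right)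
next
 fix x y z assume "x : carrier LR" "y : carrier LR" "z : carrier LR"
 then show "z *L (x \<oplus>\<^bsub>LR\<^esub> y) = z *L x \<oplus>\<^bsub>LR\<^esub> z *L y" by (clarsimp simp: carrier_LR LR_mult LR_add LTI) (intro cl_eqI loc_eq.distrib_left)
qed

lemma loc_emb_cl: "loc_emb B S b = cl (Emb b)" by (simp add: loc_emb_def cl_def)

lemma loc_emb_closed: "b : carrier B ==> loc_emb B S b : carrier LR" by (simp add: loc_emb_cl carrier_LR LTI)

lemma loc_emb_add: "a : carrier B ==> b : carrier B ==> loc_emb B S (a \<oplus>\<^bsub>B\<^esub> b) = loc_emb B S a \<oplus>\<^bsub>LR\<^esub> loc_emb B S b" unfolding loc_emb_cl by (simp add: LR_add LTI, rule cl_eqI, rule loc_eq.sym, rule loc_eq.emb_add)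

lemma loc_emb_mult: "a : carrier B ==> b : carrier B ==> loc_emb B S (a \<otimes>\<^bsub>B\<^esub> b) = loc_emb B S a *L loc_emb B S b" unfolding loc_emb_cl by (simp add: LR_mult LTI, rule cl_eqI, rule loc_eq.sym, rule loc_eq.emb_mul)

lemma loc_emb_zero: "loc_emb B S \<zero>\<^bsub>B\<^esub> = \<zero>\<^bsub>LR\<^esub>" and loc_emb_one: "loc_emb B S \<one>\<^bsub>B\<^esub> = \<one>\<^bsub>LR\<^esub>" by (simp_all add: loc_emb_cl LR_zero LR_one)

lemma loc_emb_Units: "s : S ==> loc_emb B S s : Units LR" unfolding Units_def loc_emb_cl
proof (intro CollectI conjI bexI[of _ "cl (Inv s)"])
 assume s: "s : S"
 then show "cl (Emb s) : carrier LR" "cl (Inv s) : carrier LR" by (auto simp: carrier_LR LTI S_closed)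
 show "cl (Inv s) *L cl (Emb s) = \<one>\<^bsub>LR\<^esub>" "cl (Emb s) *L cl (Inv s) = \<one>\<^bsub>LR\<^esub>" using s by (simp_all add: LR_mult LR_one LTI S_closed loc_eq.inv_mul loc_eq.mul_inv cl_eqI)
qed

text \<open>Functoriality of the localization for an endomorphism of \<open>B\<close> that preserves
  \<open>S\<close>, acting on the symbols of a representative term. It carries the degree
  automorphism of the quotient over to the localization.\<close>

definition loc_map :: "('b => 'b) => 'b loc_term set => 'b loc_term set" where
 "loc_map h X = cl (map_loc_term h (SOME t. t : X))"

context
 fixes h :: "'b => 'b"
 assumes h_closed: "!!a. a : carrier B ==> h a : carrier B"
  and h_S: "!!s. s : S ==> h s : S"
  and h_zero: "h \<zero>\<^bsub>B\<^esub> = \<zero>\<^bsub>B\<^esub>" and h_one: "h \<one>\<^bsub>B\<^esub> = \<one>\<^bsub>B\<^esub>"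
  and h_add: "!!a b. a : carrier B ==> b : carrier B ==> h (a \<oplus>\<^bsub>B\<^esub> b) = h a \<oplus>\<^bsub>B\<^esub> h b"
  and h_mult: "!!a b. a : carrier B ==> b : carrier B ==> h (a \<otimes>\<^bsub>B\<^esub> b) = h a \<otimes>\<^bsub>B\<^esub> h b"
begin

lemma map_loc_terms: "t : LT ==> map_loc_term h t : LT" by (induction rule: loc_terms.induct) (auto intro: LTI h_closed h_S)

lemma map_loc_eq: "loc_eq B S x y ==> loc_eq B S (map_loc_term h x) (map_loc_term h y)"
proof (induction rule: loc_eq.induct)
 case (trans x y z)
 from trans.IH show ?case by (rule loc_eq.trans)
qed (auto simp: h_zero h_one h_add h_mult intro: loc_eq.intros(1,2,4-) map_loc_terms h_closed h_S)

lemma loc_map_cl: "x : LT ==> loc_map h (cl x) = cl (map_loc_term h x)"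
proof -
 assume x: "x : LT"
 then have "x : cl x" using loc_eq.refl mem_cl by blast
 then have "(SOME t. t : cl x) : cl x" by (rule someI)
 then have "loc_eq B S x (SOME t. t : cl x)" unfolding mem_cl .
 from map_loc_eq[OF this] show ?thesis unfolding loc_map_def by (metis cl_eqI)
qed

lemma loc_map_emb: "b : carrier B ==> loc_map h (loc_emb B S b) = loc_emb B S (h b)" by (simp add: loc_emb_cl loc_map_cl LTI)

lemma loc_map_ring_hom: "loc_map h : Ring.ring_hom LR LR" by (rule ring_hom_memI)
  (auto simp: carrier_LR loc_map_cl map_loc_terms LR_mult LR_add LTI LR_one one_closed h_one)

end

end

section \<open>Quotients of Hall algebras\<close>

context fin_bquiver
begin

abbreviation "HA == hall A"
abbreviation mulH (infixl "*H" 70) where "x *H y == x \<otimes>\<^bsub>HA\<^esub> y"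

lemma Kv_closed:
 "x : Qv (vq TYPE('k)) ==> y : Qv (vq TYPE('k)) ==> x + y : Qv (vq TYPE('k))" "x : Qv (vq TYPE('k)) ==> y : Qv (vq TYPE('k)) ==> x - y : Qv (vq TYPE('k))"
 "x : Qv (vq TYPE('k)) ==> y : Qv (vq TYPE('k)) ==> x * y : Qv (vq TYPE('k))" "x : Qv (vq TYPE('k)) ==> - x : Qv (vq TYPE('k))" "x : Qv (vq TYPE('k)) ==> inverse x : Qv (vq TYPE('k))"
 "x : Qv (vq TYPE('k)) ==> y : Qv (vq TYPE('k)) ==> x / y : Qv (vq TYPE('k))" "x : \<rat> ==> x : Qv (vq TYPE('k))" using Qv_add Qv_diff Qv_mult[OF vq_rat[where ?'k = 'k]] Qv_neg Qv_inverse[OF vq_rat[where ?'k = 'k]] Qv_rat by (auto simp: divide_inverse)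

lemma hall_carrierI:
 assumes "finite J" "!!j. j : J ==> M j : modnil A" "!!j. j : J ==> c j : Qv (vq TYPE('k))"
 shows "(%X. SUM j:J. c j * hcls A (M j) X) : carrier HA"
proof -
 have s: "{X. (SUM j:J. c j * hcls A (M j) X) ~= 0} <= (%j. isocl A (M j)) ` J"
 proof (clarify, rule ccontr)
  fix X assume X: "X ~: (%j. isocl A (M j)) ` J" "(SUM j:J. c j * hcls A (M j) X) ~= 0"
  have "(SUM j:J. c j * hcls A (M j) X) = 0" using X(1) by (intro sum.neutral) (auto simp: hcls_def)
  with X(2) show False by simp
 qed
 then have "finite {X. (SUM j:J. c j * hcls A (M j) X) ~= 0}" using assms(1) finite_subset by blast
 moreover have "(SUM j:J. c j * hcls A (M j) X) : Qv (vq TYPE('k))" for X using assms(3) by (intro Qv_sum Kv_closed(3)) (auto simp: hcls_def intro: Qv_rat)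
 moreover have "(%j. isocl A (M j)) ` J <= isocl A ` modnil A" using assms(2) by blast
 ultimately show ?thesis using s unfolding hall_simps by (intro CollectI conjI) auto
qed

lemma hall_scale_hcls: "M : modnil A ==> c : Qv (vq TYPE('k)) ==> (%X. c * hcls A M X) : carrier HA" using hall_carrierI[of "{M}" "%M. M" "%_. c"] by simp

lemma hcls_closed: "M : modnil A ==> hcls A M : carrier HA" using hall_scale_hcls[of M 1] Qv_rat[of 1] by simp

lemma hall_expand:
 assumes "fi : carrier HA"
 shows "fi = (%X. \<Sum>Y | fi Y ~= 0. fi Y * hcls A (SOME M. M : Y) X)"
  "finite {Y. fi Y ~= 0}" "!!Y. fi Y ~= 0 ==> (SOME M. M : Y) : modnil A" "!!Y. fi Y : Qv (vq TYPE('k))"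
  "!!Y. fi Y ~= 0 ==> isocl A (SOME M. M : Y) = Y"
proof -
 show fin: "finite {Y. fi Y ~= 0}" and "!!Y. fi Y : Qv (vq TYPE('k))" using assms unfolding hall_simps by auto
 show some: "!!Y. fi Y ~= 0 ==> (SOME M. M : Y) : modnil A" "!!Y. fi Y ~= 0 ==> isocl A (SOME M. M : Y) = Y"
 proof -
  fix Y assume "fi Y ~= 0"
  then have "Y : isocl A ` modnil A" using assms unfolding hall_simps by auto
  then show "(SOME M. M : Y) : modnil A" "isocl A (SOME M. M : Y) = Y" by (rule isocl_some)+
 qed
 show "fi = (%X. \<Sum>Y | fi Y ~= 0. fi Y * hcls A (SOME M. M : Y) X)"
 proof
  fix X
  have "(\<Sum>Y | fi Y ~= 0. fi Y * hcls A (SOME M. M : Y) X) = (\<Sum>Y | fi Y ~= 0. if Y = X then fi Y else 0)" by (rule sum.cong[OF rfl]) (use some(2) in "auto simp: hcls_def")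
  also have "... = fi X" using fin by (simp add: sum.delta')
  finally show "fi X = (\<Sum>Y | fi Y ~= 0. fi Y * hcls A (SOME M. M : Y) X)" by simp
 qed
qed

lemma hall_obtain:
 assumes "fi : carrier HA"
 obtains J and c :: "('k, 'i, 'a) rep set => real" and M where "finite J" "!!j. j : J ==> M j : modnil A"
  "!!j. c j : Qv (vq TYPE('k))" "fi = (%X. SUM j:J. c j * hcls A (M j) X)" using hall_expand[OF assms] that[of "{Y. fi Y ~= 0}" "%Y. SOME M. M : Y" fi] by blast

lemma hall_add_closed: "fi : carrier HA ==> gi : carrier HA ==> (%X. fi X + gi X) : carrier HA"
proof -
 assume p: "fi : carrier HA" "gi : carrier HA"
 have "{X. fi X + gi X ~= 0} <= {X. fi X ~= 0} \<union> {X. gi X ~= 0}" by auto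
 then show ?thesis using p unfolding hall_simps by (auto simp: image_subset_iff intro: finite_subset Qv_add)
qed

lemma hall_scale_closed: "fi : carrier HA ==> c : Qv (vq TYPE('k)) ==> (%X. c * fi X) : carrier HA"
proof -
 assume p: "fi : carrier HA" "c : Qv (vq TYPE('k))"
 have "{X. c * fi X ~= 0} <= {X. fi X ~= 0}" by auto
 then show ?thesis using p unfolding hall_simps by (auto simp: image_subset_iff intro: finite_subset Kv_closed(3))
qed

lemma hall_zero_closed: "(%_. 0) : carrier HA" using Qv_rat[of 0] unfolding hall_simps by auto

lemma abelian_group_hall: "abelian_group HA"
proof (rule abelian_groupI)
 fix x assume x: "x : carrier HA"
 have "(%X. (-1) * x X) : carrier HA" by (rule hall_scale_closed[OF x]) (simp add: Kv_closed)
 then show "EX y:carrier HA. y \<oplus>\<^bsub>HA\<^esub> x = \<zero>\<^bsub>HA\<^esub>" by (rule bexI[rotated]) (simp add: hall_simps)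
qed (simp_all add: hall_simps(3,4) hall_add_closed hall_zero_closed add_ac)

lemma hall_minus: "fi : carrier HA ==> \<ominus>\<^bsub>HA\<^esub> fi = (%X. - fi X)"
proof -
 assume p: "fi : carrier HA"
 interpret abelian_group HA by (rule abelian_group_hall)
 have "(%X. (-1) * fi X) : carrier HA" by (rule hall_scale_closed[OF p]) (simp add: Kv_closed)
 then have "\<ominus>\<^bsub>HA\<^esub> fi = (%X. (-1) * fi X)" by (intro minus_equality[OF _ p]) (simp add: hall_simps)
 then show ?thesis by simp
qed

lemma hall_diff: "fi : carrier HA ==> gi : carrier HA ==> fi \<ominus>\<^bsub>HA\<^esub> gi = (%X. fi X - gi X)" by (simp add: a_minus_def hall_minus hall_simps(4))

lemma hall_mult_closed_hcls:
 assumes M: "M : modnil A" and N: "N : modnil A"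
 shows "hcls A M *H hcls A N : carrier HA"
proof -
 have "(%Z. SUM z:cocycles M N. (1 / real (card (cochain0 M N))) * hcls A (ext_rep M N z) Z) : carrier HA" by (rule hall_carrierI[OF finite_cocycles[OF M N] ext_rep_modnil[OF M N]]) (auto intro: Kv_closed)
 then show ?thesis unfolding hall_mult_hcls[OF M N] by (simp add: sum_divide_distrib)
qed

lemma hall_sum_closed: "(!!j. j : J ==> fi j : carrier HA) ==> (%X. SUM j:J. fi j X) : carrier HA" by (induction J rule: infinite_finite_induct) (auto simp: hall_zero_closed hall_add_closed)

lemma hall_mult_closed: "fi : carrier HA ==> gi : carrier HA ==> fi *H gi : carrier HA"
proof -
 assume p: "fi : carrier HA" and s: "gi : carrier HA"
 obtain J and c :: "('k, 'i, 'a) rep set => real" and M where p': "finite J" "!!j. j : J ==> M j : modnil A" "!!j. c j : Qv (vq TYPE('k))" "fi = (%X. SUM j:J. c j * hcls A (M j) X)" by (rule hall_obtain[OF p]) (rule that)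
 obtain K and d :: "('k, 'i, 'a) rep set => real" and N where s': "finite K" "!!j. j : K ==> N j : modnil A" "!!j. d j : Qv (vq TYPE('k))" "gi = (%X. SUM j:K. d j * hcls A (N j) X)" by (rule hall_obtain[OF s]) (rule that)
 have eq: "fi *H gi = (%Z. SUM j:J. SUM k:K. c j * d k * (hcls A (M j) *H hcls A (N k)) Z)" unfolding p'(4) s'(4) by (rule hall_mult_sums) (simp_all add: p' s')
 show ?thesis unfolding eq by (intro hall_sum_closed hall_scale_closed hall_mult_closed_hcls p' s' Kv_closed(3))
qed

lemma hall_mult_linear_left:
 assumes "fi : carrier HA" "fi' : carrier HA" "gi : carrier HA"
 shows "(%X. a * fi X + b * fi' X) *H gi = (%X. a * (fi *H gi) X + b * (fi' *H gi) X)"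
proof
 fix Z
 let ?F = "{X. fi X ~= 0} \<union> {X. fi' X ~= 0}" and ?G = "{X. gi X ~= 0}"
 have f: "finite ?F" "finite ?G" using assms unfolding hall_simps by auto
 have s: "{X. a * fi X + b * fi' X ~= 0} <= ?F" "{X. fi X ~= 0} <= ?F" "{X. fi' X ~= 0} <= ?F" by auto
 show "((%X. a * fi X + b * fi' X) *H gi) Z = a * (fi *H gi) Z + b * (fi' *H gi) Z" unfolding hall_mult_eq[OF f(1) s(1) f(2) order_refl] hall_mult_eq[OF f(1) s(2) f(2) order_refl]
   hall_mult_eq[OF f(1) s(3) f(2) order_refl] by (simp add: sum_distrib_left ring_distribs sum.distrib mult.assoc)
qed

lemma hall_mult_linear_right:
 assumes "fi : carrier HA" "fi' : carrier HA" "gi : carrier HA"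
 shows "gi *H (%X. a * fi X + b * fi' X) = (%X. a * (gi *H fi) X + b * (gi *H fi') X)"
proof
 fix Z
 let ?F = "{X. fi X ~= 0} \<union> {X. fi' X ~= 0}" and ?G = "{X. gi X ~= 0}"
 have f: "finite ?F" "finite ?G" using assms unfolding hall_simps by auto
 have s: "{X. a * fi X + b * fi' X ~= 0} <= ?F" "{X. fi X ~= 0} <= ?F" "{X. fi' X ~= 0} <= ?F" by auto
 show "(gi *H (%X. a * fi X + b * fi' X)) Z = a * (gi *H fi) Z + b * (gi *H fi') Z" unfolding hall_mult_eq[OF f(2) order_refl f(1) s(1)] hall_mult_eq[OF f(2) order_refl f(1) s(2)]
   hall_mult_eq[OF f(2) order_refl f(1) s(3)] by (simp add: sum_distrib_left ring_distribs sum.distrib mult.assoc mult.left_commute)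
qed

lemma zero_rep_simps [simp]: "Sp zero_rep i = {0}" "Mp zero_rep a x = 0" by (simp_all add: zero_rep_def)

lemma lin_map_from_zero: "subsp (W :: 'k poly set) ==> lin_map {0} W = {%_. 0}"
proof (intro equalityI subsetI)
 fix f assume f: "f : lin_map {0::'k poly} W"
 have "f x = 0" for x using lmD(4)[OF f, of x] lin_map0[OF f] by (cases "x = 0") auto
 then show "f : {%_. 0}" by auto
qed (auto intro: lin_map_zero)

lemma lin_map_to_zero: "lin_map (U :: 'k poly set) {0} = {%_. 0}"
proof (intro equalityI subsetI)
 fix f assume f: "f : lin_map U {0::'k poly}"
 have "f x = 0" for x using lmD(4)[OF f, of x] lmD(1)[OF f, of x] by (cases "x : U") auto
 then show "f : {%_. 0}" by auto
qed (auto simp: lin_map_def)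

lemma fold_zero_rep: "fold (Mp zero_rep) p (0::'k poly) = 0" "fold (%a x. 0) p (0::'k poly) = 0" by (induction p) (simp_all add: zero_rep_def)

lemma zero_rep_modnil: "zero_rep : modnil A"
proof -
 have sub0: "subsp {0::'k poly}" by (simp add: polyv.subspace_def)
 have lin: "(%_. 0) : lin_map {0::'k poly} {0}" by (rule lin_map_zero[OF sub0])
 have p: "prerep A zero_rep" unfolding prerep_def using lin sub0 by (simp add: zero_rep_def)
 have "(\<Sum>(c, p)\<leftarrow>rh. sm c (fold (Mp zero_rep) p (0::'k poly))) = 0" for rh by (induction rh) (auto simp: fold_zero_rep)
 then have r: "zero_rep : reps A" using p unfolding reps_iff by auto
 have n: "(fold (Mp zero_rep) p ^^ n) (0::'k poly) = 0" for p n by (induction n) (simp_all add: fold_zero_rep)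
 show ?thesis unfolding modnil_iff nilp_def fdim_def using r n by auto
qed

lemma iso_rep_bijI:
 assumes M: "prerep A M" and N: "prerep A N" and f: "!!i. f i : lin_map (Sp M i) (Sp N i)" "!!i. bij_betw (f i) (Sp M i) (Sp N i)"
  and c: "!!a x. a : arrs A ==> x : Sp M (tv A a) ==>
   f (hv A a) (Mp M a x) = Mp N a (f (tv A a) x)"
 shows "iso_rep A M N" by (rule iso_repI[OF HomsI]) (use f c in auto)

lemma zero_in_cochains:
 assumes "prerep A N" shows "0 : cochain1 M N" "0 : cochain0 M N" unfolding cochain1_def cochain0_def by (simp_all add: zero_fun_def lin_map_zero[OF prD(1)[OF assms]])

lemma cochain_zero_left:
 assumes "prerep A M"
 shows "cochain1 zero_rep M = {0}" "cochain0 zero_rep M = {0}"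
proof -
 have "z a x = 0" if z: "z : cochain1 zero_rep M" for z a x using cochain1D(1)[OF z, of a] cochain1D(2)[OF z, of a x] lin_map_from_zero[OF prD(1)[OF assms]] by (cases "a : arrs A") auto
 then show "cochain1 zero_rep M = {0}" using zero_in_cochains(1)[OF assms] by (auto simp: fun_eq_iff)
 have "h i x = 0" if h: "h : cochain0 zero_rep M" for h i x using cochain0D[OF h, of i] lin_map_from_zero[OF prD(1)[OF assms]] by auto
 then show "cochain0 zero_rep M = {0}" using zero_in_cochains(2)[OF assms] by (auto simp: fun_eq_iff)
qed

lemma cochain_zero_right: "cochain1 M zero_rep = {0}" "cochain0 M zero_rep = {0}"
proof -
 have "z a x = 0" if z: "z : cochain1 M zero_rep" for z a x using cochain1D(1)[OF z, of a] cochain1D(2)[OF z, of a x] lin_map_to_zero by (cases "a : arrs A") auto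
 then show "cochain1 M zero_rep = {0}" using zero_in_cochains(1)[OF mnD(3)[OF zero_rep_modnil]] by (auto simp: fun_eq_iff)
 have "h i x = 0" if h: "h : cochain0 M zero_rep" for h i x using cochain0D[OF h, of i] lin_map_to_zero by auto
 then show "cochain0 M zero_rep = {0}" using zero_in_cochains(2)[OF mnD(3)[OF zero_rep_modnil]] by (auto simp: fun_eq_iff)
qed

lemma pprod_zero_left: "bij_betw psnd (pprod {0} U) U" and pprod_zero_right: "bij_betw pfst (pprod U {0}) U" by (rule bij_betwI[where g = "pjoin 0"]; auto simp: pprod_def intro: poly_pair_eqI;
   metis pjoin_collapse)
  (rule bij_betwI[where g = "%x. pjoin x 0"]; auto simp: pprod_def intro: poly_pair_eqI; metis pjoin_collapse)

lemma hall_one_left: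
 assumes M: "M : modnil A"
 shows "hcls A zero_rep *H hcls A M = hcls A M"
proof -
 note p = mnD(3)[OF M]
 have pE: "prerep A (ext_rep zero_rep M 0)" using prerep_ext_rep[OF mnD(3)[OF zero_rep_modnil] p, of 0] cochain_zero_left[OF p] by simp
 have z: "subsp (pprod (Sp M i) {0})" for i using prD(1)[OF pE, of i] by simp
 have i: "iso_rep A (ext_rep zero_rep M 0) M"
 proof (rule iso_rep_bijI[OF pE p, of "%i x. if x : pprod (Sp M i) {0} then pfst x else 0"])
  fix i
  show "(%x. if x : pprod (Sp M i) {0} then pfst x else 0) : lin_map (Sp (ext_rep zero_rep M 0) i) (Sp M i)" by (rule lin_mapI) (auto simp: pprodD pfst_add pfst_sm sb_add[OF z] sb_scale[OF z])
  show "bij_betw (%x. if x : pprod (Sp M i) {0} then pfst x else 0) (Sp (ext_rep zero_rep M 0) i) (Sp M i)" unfolding Sp_ext_rep zero_rep_simps using pprod_zero_right[of "Sp M i"] by (subst bij_betw_cong[where g = pfst]) auto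
 next
  fix a x assume a: "a : arrs A" and x: "x : Sp (ext_rep zero_rep M 0) (tv A a)"
  then have x': "x : pprod (Sp M (tv A a)) (Sp zero_rep (tv A a))" by simp
  have "Mp (ext_rep zero_rep M 0) a x : pprod (Sp M (hv A a)) {0}" using prerep_mem[OF pE a x] by simp
  then show "(if Mp (ext_rep zero_rep M 0) a x : pprod (Sp M (hv A a)) {0} then pfst (Mp (ext_rep zero_rep M 0) a x) else 0) =
    Mp M a (if x : pprod (Sp M (tv A a)) {0} then pfst x else 0)" using x' Mp_ext_rep[OF a x'] by simp
 qed
 have r: "ext_rep zero_rep M 0 : reps A" by (rule reps_iso[OF mnD(1)[OF M] pE iso_rep_sym[OF pE i]])
 have c: "cocycles zero_rep M = {0}" using r cochain_zero_left(1)[OF p] unfolding cocycles_def by auto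
 have "isocl A (ext_rep zero_rep M 0) = isocl A M" using isocl_eq_iff[OF iso_modnil[OF M r iso_rep_sym[OF pE i]] M] i by blast
 then show ?thesis unfolding hall_mult_hcls[OF zero_rep_modnil M] c cochain_zero_left(2)[OF p] by (simp add: hcls_def)
qed

lemma hall_one_right:
 assumes M: "M : modnil A"
 shows "hcls A M *H hcls A zero_rep = hcls A M"
proof -
 note p = mnD(3)[OF M]
 have pE: "prerep A (ext_rep M zero_rep 0)" using prerep_ext_rep[OF p mnD(3)[OF zero_rep_modnil], of 0] cochain_zero_right by simp
 have z: "subsp (pprod {0} (Sp M i))" for i using prD(1)[OF pE, of i] by simp
 have i: "iso_rep A (ext_rep M zero_rep 0) M"
 proof (rule iso_rep_bijI[OF pE p, of "%i x. if x : pprod {0} (Sp M i) then psnd x else 0"])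
  fix i
  show "(%x. if x : pprod {0} (Sp M i) then psnd x else 0) : lin_map (Sp (ext_rep M zero_rep 0) i) (Sp M i)" by (rule lin_mapI) (auto simp: pprodD psnd_add psnd_sm sb_add[OF z] sb_scale[OF z])
  show "bij_betw (%x. if x : pprod {0} (Sp M i) then psnd x else 0) (Sp (ext_rep M zero_rep 0) i) (Sp M i)" unfolding Sp_ext_rep zero_rep_simps using pprod_zero_left[of "Sp M i"] by (subst bij_betw_cong[where g = psnd]) auto
 next
  fix a x assume a: "a : arrs A" and x: "x : Sp (ext_rep M zero_rep 0) (tv A a)"
  then have x': "x : pprod (Sp zero_rep (tv A a)) (Sp M (tv A a))" by simp
  have "Mp (ext_rep M zero_rep 0) a x : pprod {0} (Sp M (hv A a))" using prerep_mem[OF pE a x] by simp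
  then show "(if Mp (ext_rep M zero_rep 0) a x : pprod {0} (Sp M (hv A a)) then psnd (Mp (ext_rep M zero_rep 0) a x) else 0) =
    Mp M a (if x : pprod {0} (Sp M (tv A a)) then psnd x else 0)" using x' Mp_ext_rep[OF a x'] by simp
 qed
 have r: "ext_rep M zero_rep 0 : reps A" by (rule reps_iso[OF mnD(1)[OF M] pE iso_rep_sym[OF pE i]])
 have c: "cocycles M zero_rep = {0}" using r cochain_zero_right(1) unfolding cocycles_def by auto
 have "isocl A (ext_rep M zero_rep 0) = isocl A M" using isocl_eq_iff[OF iso_modnil[OF M r iso_rep_sym[OF pE i]] M] i by blast
 then show ?thesis unfolding hall_mult_hcls[OF M zero_rep_modnil] c cochain_zero_right(2) by (simp add: hcls_def)
qed

lemma hall_scalar_left: "fi : carrier HA ==> (%X. c * hcls A zero_rep X) *H fi = (%X. c * fi X)"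
proof -
 assume p: "fi : carrier HA"
 obtain J and d :: "('k, 'i, 'a) rep set => real" and M where p': "finite J" "!!j. j : J ==> M j : modnil A" "!!j. d j : Qv (vq TYPE('k))" "fi = (%X. SUM j:J. d j * hcls A (M j) X)" by (rule hall_obtain[OF p]) (rule that)
 have "(%X. SUM j:{()}. c * hcls A zero_rep X) *H fi = (%X. c * fi X)" unfolding p'(4) by (subst hall_mult_sums) (use p' zero_rep_modnil hall_one_left in "auto simp: sum_distrib_left mult.assoc")
 then show ?thesis by simp
qed

lemma hall_scalar_right: "fi : carrier HA ==> fi *H (%X. c * hcls A zero_rep X) = (%X. c * fi X)"
proof -
 assume p: "fi : carrier HA"
 obtain J and d :: "('k, 'i, 'a) rep set => real" and M where p': "finite J" "!!j. j : J ==> M j : modnil A" "!!j. d j : Qv (vq TYPE('k))" "fi = (%X. SUM j:J. d j * hcls A (M j) X)" by (rule hall_obtain[OF p]) (rule that)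
 have "fi *H (%X. SUM j:{()}. c * hcls A zero_rep X) = (%X. c * fi X)" unfolding p'(4) by (subst hall_mult_sums) (use p' zero_rep_modnil hall_one_right in "auto simp: sum_distrib_left mult.assoc mult.left_commute")
 then show ?thesis by simp
qed

end

text \<open>The weight encodes a grading multiplicatively. Since it is multiplicative in extensions,
  rescaling classes by it respects the product; by \<open>G_wt\<close> the generators of the ideal
  are homogeneous, so it descends to the quotient. Weights are rational and nonzero so that the set
  of denominators, with its rational scalars, is preserved.\<close>

locale weighted_hall = fin_bquiver A for A :: "('k::{finite,field}, 'i, 'a) bquiver" +
 fixes G :: "('k, 'i, 'a) hall set" and P :: "('k, 'i, 'a) rep set"
  and wt :: "('k, 'i, 'a) rep => real"
 assumes G_closed: "G <= carrier HA" and P_modnil: "P <= modnil A" and zero_P: "zero_rep : P"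
  and wt_rat: "M : modnil A ==> wt M : \<rat>" and wt_nonzero: "M : modnil A ==> wt M ~= 0"
  and wt_iso: "M : modnil A ==> N : modnil A ==> iso_rep A M N ==> wt M = wt N"
  and wt_ext: "M : modnil A ==> N : modnil A ==> wt (ext_rep M N z) = wt M * wt N"
  and wt_zero: "wt zero_rep = 1"
  and G_wt: "g : G ==> EX M. M : modnil A & (ALL X. g X ~= 0 --> wt (SOME M. M : X) = wt M)"
begin

abbreviation "I == ideal_gen HA G"
abbreviation "Q == HA Quot I"
definition cs :: "('k, 'i, 'a) hall => ('k, 'i, 'a) hall set" where "cs fi = I +>\<^bsub>HA\<^esub> fi"
abbreviation "SS == {cs (%X. a * hcls A K X) | a K. a : \<rat> & a ~= 0 & K : P}"
abbreviation "R == localization Q SS"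
abbreviation mulR (infixl "*R" 70) where "x *R y == x \<otimes>\<^bsub>R\<^esub> y"
abbreviation invR ("ivR _" [81] 80) where "ivR x == inv\<^bsub>R\<^esub> x"
definition eb :: "('k, 'i, 'a) hall => ('k, 'i, 'a) hall set loc_term set" where "eb fi = loc_emb Q SS (cs fi)"
text \<open>As in \<open>iscale\<close>, scalars act through multiples of the class of the zero
  module, which is the unit; \<open>isc_eb\<close> compares this with scaling the
  coefficients.\<close>

definition isc :: "real => ('k, 'i, 'a) hall set loc_term set => ('k, 'i, 'a) hall set loc_term set" where
 "isc c x = eb (%X. c * hcls A zero_rep X) *R x"

lemma I_closed: "x : I ==> x : carrier HA"
proof (induction rule: ideal_gen.induct)
 case (neg x)
 interpret abelian_group HA by (rule abelian_group_hall)
 show ?case using neg by simp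
qed (use G_closed hall_mult_closed hall_add_closed hall_zero_closed in "auto simp: hall_simps(3,4)")

lemma abelian_subgroup_I: "abelian_subgroup I HA"
proof (rule abelian_subgroupI3)
 interpret abelian_group HA by (rule abelian_group_hall)
 show "additive_subgroup I HA"
 proof (rule additive_subgroupI, rule subgroup.intro)
  show "I <= carrier (add_monoid HA)" using I_closed by auto
  fix x y assume x: "x : I" and y: "y : I"
  show "x \<otimes>\<^bsub>add_monoid HA\<^esub> y : I" using ideal_gen.add[OF x y] by simp
  show "inv\<^bsub>add_monoid HA\<^esub> x : I" using ideal_gen.neg[OF x] by (simp add: a_inv_def)
 next
  show "\<one>\<^bsub>add_monoid HA\<^esub> : I" using ideal_gen.zero[of HA G] by simp
 qed
 show "abelian_group HA" by (rule abelian_group_hall)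
qed

lemma I_add: "x : I ==> y : I ==> (%X. x X + y X) : I" using ideal_gen.add[of x HA G y] by (simp add: hall_simps)

lemma I_neg: "x : I ==> (%X. - x X) : I" using ideal_gen.neg[of x HA G] by (simp add: hall_minus I_closed)

lemma I_scale: "x : I ==> c : Qv (vq TYPE('k)) ==> (%X. c * x X) : I" using ideal_gen.left[of x HA G "%X. c * hcls A zero_rep X"] hall_scale_hcls[OF zero_rep_modnil] by (simp add: hall_scalar_left I_closed)

lemma mem_cs: "gi : cs fi \<longleftrightarrow> (%X. gi X - fi X) : I"
proof
 assume "gi : cs fi"
 then obtain h where "h : I" "gi = (%X. h X + fi X)" unfolding cs_def a_r_coset_def' by (auto simp: hall_simps)
 then show "(%X. gi X - fi X) : I" by simp
next
 assume "(%X. gi X - fi X) : I"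
 then show "gi : cs fi" unfolding cs_def a_r_coset_def' by (auto simp: hall_simps intro!: bexI[of _ "%X. gi X - fi X"])
qed

lemma cs_self: "fi : cs fi" using ideal_gen.zero[of HA G] by (simp add: mem_cs hall_simps)

lemma cs_eq_iff: "cs fi = cs gi \<longleftrightarrow> (%X. fi X - gi X) : I"
proof
 assume "cs fi = cs gi"
 then show "(%X. fi X - gi X) : I" using cs_self[of fi] by (simp add: mem_cs)
next
 assume d: "(%X. fi X - gi X) : I"
 have "(%X. \<chi> X - fi X) : I \<longleftrightarrow> (%X. \<chi> X - gi X) : I" for \<chi>
 proof
  assume "(%X. \<chi> X - fi X) : I"
  from I_add[OF this d] show "(%X. \<chi> X - gi X) : I" by simp
 next
  assume "(%X. \<chi> X - gi X) : I"
  from I_add[OF this I_neg[OF d]] show "(%X. \<chi> X - fi X) : I" by simp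
 qed
 then show "cs fi = cs gi" by (auto simp: mem_cs)
qed

lemma carrier_Q: "carrier Q = cs ` carrier HA" by (auto simp: FactRing_def A_RCOSETS_def' cs_def)

lemma Q_zero: "\<zero>\<^bsub>Q\<^esub> = cs (%_. 0)" by (auto simp: FactRing_def mem_cs)

lemma Q_one: "\<one>\<^bsub>Q\<^esub> = cs (hcls A zero_rep)" by (simp add: FactRing_def cs_def hall_simps)

lemma Q_add: "fi : carrier HA ==> gi : carrier HA ==> cs fi \<oplus>\<^bsub>Q\<^esub> cs gi = cs (%X. fi X + gi X)" using abelian_subgroup.a_rcos_sum[OF abelian_subgroup_I, of fi gi] by (simp add: FactRing_def cs_def hall_simps(4))

lemma cs_closed: "fi : carrier HA ==> gi : cs fi ==> gi : carrier HA" using hall_add_closed[OF I_closed, of "%X. gi X - fi X" fi] by (simp add: mem_cs)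

lemma Q_mult:
 assumes p: "fi : carrier HA" "gi : carrier HA"
 shows "cs fi \<otimes>\<^bsub>Q\<^esub> cs gi = cs (fi *H gi)"
proof -
 have "cs (a *H b) = cs (fi *H gi)" if a: "a : cs fi" and b: "b : cs gi" for a b
 proof -
  note ac = cs_closed[OF p(1) a] and bc = cs_closed[OF p(2) b]
  have ai: "(%X. a X - fi X) : I" and bi: "(%X. b X - gi X) : I" using a b by (simp_all add: mem_cs)
  have 1: "(%X. a X - fi X) *H b : I" by (rule ideal_gen.right[OF ai bc])
  have 2: "fi *H (%X. b X - gi X) : I" by (rule ideal_gen.left[OF bi p(1)])
  have "(%X. a X - fi X) *H b = (%X. (a *H b) X - (fi *H b) X)" using hall_mult_linear_left[OF ac p(1) bc, of 1 "-1"] by simp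
  moreover have "fi *H (%X. b X - gi X) = (%X. (fi *H b) X - (fi *H gi) X)" using hall_mult_linear_right[OF bc p(2,1), of 1 "-1"] by simp
  ultimately show ?thesis using I_add[OF 1 2] by (simp add: cs_eq_iff)
 qed
 then have "(\<Union>a\<in>cs fi. \<Union>b\<in>cs gi. cs (a *H b)) = cs (fi *H gi)" using cs_self by blast
 then show ?thesis by (simp add: FactRing_def rcoset_mult_def cs_def)
qed

lemma SS_closed: "s : SS ==> s : carrier Q" unfolding carrier_Q using hall_scale_hcls Qv_rat P_modnil by blast

sublocale L: loc_setup Q SS
proof
 show "\<zero>\<^bsub>Q\<^esub> : carrier Q" unfolding Q_zero carrier_Q using hall_zero_closed by blast
 show "\<one>\<^bsub>Q\<^esub> : carrier Q" unfolding Q_one carrier_Q using hcls_closed[OF zero_rep_modnil] by blast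
 fix a b assume "a : carrier Q" "b : carrier Q"
 then show "a \<oplus>\<^bsub>Q\<^esub> b : carrier Q" "a \<otimes>\<^bsub>Q\<^esub> b : carrier Q" unfolding carrier_Q using Q_add Q_mult hall_add_closed hall_mult_closed by auto
qed (rule SS_closed)

sublocale R: ring R by (rule L.ring_LR)

lemma cs_in: "fi : carrier HA ==> cs fi : carrier Q" by (simp add: carrier_Q)

lemma eb_closed [simp]: "fi : carrier HA ==> eb fi : carrier R" unfolding eb_def by (rule L.loc_emb_closed[OF cs_in])

lemma eb_add: "fi : carrier HA ==> gi : carrier HA ==> eb (%X. fi X + gi X) = eb fi \<oplus>\<^bsub>R\<^esub> eb gi" unfolding eb_def by (simp add: Q_add[symmetric] L.loc_emb_add cs_in)

lemma eb_mult: "fi : carrier HA ==> gi : carrier HA ==> eb (fi *H gi) = eb fi *R eb gi" unfolding eb_def by (simp add: Q_mult[symmetric] L.loc_emb_mult cs_in)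

lemma eb_zero: "eb (%_. 0) = \<zero>\<^bsub>R\<^esub>" and eb_one: "eb (hcls A zero_rep) = \<one>\<^bsub>R\<^esub>" unfolding eb_def by (simp_all only: Q_zero[symmetric] Q_one[symmetric] L.loc_emb_zero L.loc_emb_one)

lemma eb_cong: "(%X. fi X - gi X) : I ==> eb fi = eb gi" unfolding eb_def by (rule arg_cong[where f = "loc_emb Q SS"]) (simp only: cs_eq_iff)

lemma eb_Units: "K : P ==> a : \<rat> ==> a ~= 0 ==> eb (%X. a * hcls A K X) : Units R" unfolding eb_def by (rule L.loc_emb_Units) blast

abbreviation "Kq == {c. (%X. c * hcls A zero_rep X) : carrier HA}"

lemma Qv_scalar: "c : Qv (vq TYPE('k)) ==> (%X. c * hcls A zero_rep X) : carrier HA" by (rule hall_scale_hcls[OF zero_rep_modnil])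

lemma isc_eb: "fi : carrier HA ==> c : Qv (vq TYPE('k)) ==> isc c (eb fi) = eb (%X. c * fi X)" unfolding isc_def by (simp add: eb_mult[symmetric] Qv_scalar hall_scalar_left)

lemma isc_closed [simp]: "c : Qv (vq TYPE('k)) ==> x : carrier R ==> isc c x : carrier R" unfolding isc_def by (simp add: Qv_scalar)

lemma isc_add_left: "c : Qv (vq TYPE('k)) ==> d : Qv (vq TYPE('k)) ==> x : carrier R ==> isc (c + d) x = isc c x \<oplus>\<^bsub>R\<^esub> isc d x" using eb_add[OF Qv_scalar Qv_scalar, of c d] unfolding isc_def by (simp add: Qv_scalar ring_distribs R.l_distr)

lemma isc_isc: "c : Qv (vq TYPE('k)) ==> d : Qv (vq TYPE('k)) ==> x : carrier R ==> isc c (isc d x) = isc (c * d) x"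
proof -
 assume c: "c : Qv (vq TYPE('k))" and d: "d : Qv (vq TYPE('k))" and x: "x : carrier R"
 have "isc c (isc d x) = isc c (eb (%X. d * hcls A zero_rep X)) *R x" unfolding isc_def using c d x by (simp add: Qv_scalar R.m_assoc)
 also have "isc c (eb (%X. d * hcls A zero_rep X)) = eb (%X. (c * d) * hcls A zero_rep X)" using isc_eb[OF Qv_scalar[OF d] c] by (simp add: mult.assoc)
 finally show ?thesis by (simp add: isc_def)
qed

lemma isc_1 [simp]: "x : carrier R ==> isc 1 x = x" unfolding isc_def by (simp add: eb_one)

lemma isc_0 [simp]: "x : carrier R ==> isc 0 x = \<zero>\<^bsub>R\<^esub>" unfolding isc_def by (simp add: eb_zero)

lemma isc_zero [simp]: "c : Qv (vq TYPE('k)) ==> isc c \<zero>\<^bsub>R\<^esub> = \<zero>\<^bsub>R\<^esub>" unfolding isc_def by (simp add: Qv_scalar)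

lemma isc_mult_left: "c : Qv (vq TYPE('k)) ==> x : carrier R ==> y : carrier R ==> isc c x *R y = isc c (x *R y)" unfolding isc_def by (simp add: Qv_scalar R.m_assoc)

definition fr :: "('k, 'i, 'a) rep => ('k, 'i, 'a) rep => ('k, 'i, 'a) hall set loc_term set" where
 "fr M K = eb (hcls A M) *R ivR eb (hcls A K)"

lemma P_Units: "K : P ==> eb (hcls A K) : Units R" using eb_Units[of K 1] by simp

lemma fr_closed [simp]: "M : modnil A ==> K : P ==> fr M K : carrier R" unfolding fr_def by (simp add: hcls_closed R.Units_inv_closed P_Units)

lemma fr_zero: "M : modnil A ==> fr M zero_rep = eb (hcls A M)" unfolding fr_def by (simp add: eb_one hcls_closed)

lemma scalar_central_eb:
 assumes "fi : carrier HA" "c : Qv (vq TYPE('k))"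
 shows "eb fi *R eb (%X. c * hcls A zero_rep X) = eb (%X. c * hcls A zero_rep X) *R eb fi" using assms by (simp add: eb_mult[symmetric] Qv_scalar hall_scalar_left hall_scalar_right)

lemma scalar_central_inv:
 assumes u: "u : Units R" and k: "k : carrier R" and c: "u *R k = k *R u"
 shows "ivR u *R k = k *R ivR u"
proof -
 have uc: "u : carrier R" "ivR u : carrier R" using u by (simp_all add: R.Units_closed)
 have "ivR u *R k = ivR u *R (k *R u) *R ivR u" using u k uc by (simp add: R.m_assoc)
 also have "... = ivR u *R (u *R k) *R ivR u" using c by simp
 also have "... = k *R ivR u" using u k uc by (simp add: R.m_assoc[symmetric])
 finally show ?thesis .
qed

text \<open>Multiples of the unit commute with \<open>[M]\<close>, and therefore also with the
  inverse of \<open>[K]\<close>. This lets scalars be pulled out of a product from the right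
  factor.\<close>

lemma isc_fr_mult:
 assumes M: "M : modnil A" "K : P" and c: "c : Qv (vq TYPE('k))" and y: "y : carrier R"
 shows "fr M K *R isc c y = isc c (fr M K *R y)"
proof -
 let ?k = "eb (%X. c * hcls A zero_rep X)" and ?m = "eb (hcls A M)" and ?u = "ivR eb (hcls A K)"
 have cl: "?k : carrier R" "?m : carrier R" "?u : carrier R" "eb (hcls A K) : carrier R" using M P_modnil by (auto simp: Qv_scalar[OF c] hcls_closed R.Units_inv_closed P_Units)
 have 1: "?u *R ?k = ?k *R ?u" by (rule scalar_central_inv[OF P_Units[OF M(2)] cl(1) scalar_central_eb[OF hcls_closed c]]) (use M P_modnil in auto)
 have 2: "?m *R ?k = ?k *R ?m" by (rule scalar_central_eb[OF hcls_closed[OF M(1)] c])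
 have "fr M K *R isc c y = ?m *R (?u *R ?k) *R y" unfolding fr_def isc_def using cl y by (simp add: R.m_assoc)
 also have "... = (?m *R ?k) *R ?u *R y" unfolding 1 using cl y by (simp add: R.m_assoc)
 also have "... = isc c (fr M K *R y)" unfolding 2 fr_def isc_def using cl y by (simp add: R.m_assoc)
 finally show ?thesis .
qed

text \<open>The automorphism that multiplies each isoclass by its weight; it separates the degrees, so that
 the homogeneous components of an element of the localization are well defined.\<close>

definition sig :: "('k, 'i, 'a) hall => ('k, 'i, 'a) hall" where
 "sig fi = (%X. wt (SOME M. M : X) * fi X)"

lemma wt_some: "M : modnil A ==> wt (SOME N. N : isocl A M) = wt M" using wt_iso[OF _ some_isocl(1) some_isocl(2)] by metis

lemma sig_hcls: "M : modnil A ==> sig (%X. c * hcls A M X) = (%X. (wt M * c) * hcls A M X)" by (auto simp: sig_def hcls_def wt_some)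

lemma sig_closed: "fi : carrier HA ==> sig fi : carrier HA"
proof -
 assume p: "fi : carrier HA"
 have "{X. sig fi X ~= 0} <= {X. fi X ~= 0}" by (auto simp: sig_def)
 moreover have "sig fi X : Qv (vq TYPE('k))" for X
 proof (cases "fi X = 0")
  case True then show ?thesis by (simp add: sig_def Kv_closed)
 next
  case False
  then have "wt (SOME M. M : X) : \<rat>" using wt_rat hall_expand(3)[OF p] by blast
  then show ?thesis using hall_expand(4)[OF p] unfolding sig_def by (rule Kv_closed(3)[OF Kv_closed(7)])
 qed
 ultimately show ?thesis using p unfolding hall_simps by (auto intro: finite_subset)
qed

lemma sig_add: "sig (%X. fi X + gi X) = (%X. sig fi X + sig gi X)" by (simp add: sig_def ring_distribs)

lemma sig_scale: "sig (%X. c * fi X) = (%X. c * sig fi X)" by (simp add: sig_def mult.left_commute)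

lemma sig_sum: "sig (%X. SUM j:J. fi j X) = (%X. SUM j:J. sig (fi j) X)" by (simp add: sig_def sum_distrib_left)

lemma sig_mult_hcls:
 assumes M: "M : modnil A" and N: "N : modnil A"
 shows "sig (hcls A M *H hcls A N) = (%X. (wt M * wt N) * (hcls A M *H hcls A N) X)"
proof
 fix X
 have e: "wt (SOME M. M : X) * hcls A (ext_rep M N z) X = wt M * wt N * hcls A (ext_rep M N z) X" if "z : cocycles M N" for z using wt_some[OF ext_rep_modnil[OF M N that]] wt_ext[OF M N] by (auto simp: hcls_def)
 show "sig (hcls A M *H hcls A N) X = (wt M * wt N) * (hcls A M *H hcls A N) X" unfolding sig_def hall_mult_hcls[OF M N] times_divide_eq_right sum_distrib_left by (intro arg_cong2[of _ _ _ _ "(/)"] sum.cong rfl e)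
qed

lemma sig_mult:
 assumes p: "fi : carrier HA" and s: "gi : carrier HA"
 shows "sig (fi *H gi) = sig fi *H sig gi"
proof -
 obtain J and c :: "('k, 'i, 'a) rep set => real" and M where p': "finite J" "!!j. j : J ==> M j : modnil A" "!!j. c j : Qv (vq TYPE('k))" "fi = (%X. SUM j:J. c j * hcls A (M j) X)" by (rule hall_obtain[OF p]) (rule that)
 obtain K and d :: "('k, 'i, 'a) rep set => real" and N where s': "finite K" "!!j. j : K ==> N j : modnil A" "!!j. d j : Qv (vq TYPE('k))" "gi = (%X. SUM j:K. d j * hcls A (N j) X)" by (rule hall_obtain[OF s]) (rule that)
 have eq: "fi *H gi = (%Z. SUM j:J. SUM k:K. c j * d k * (hcls A (M j) *H hcls A (N k)) Z)" unfolding p'(4) s'(4) by (rule hall_mult_sums) (simp_all add: p' s')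
 have sp: "sig fi = (%X. SUM j:J. (wt (M j) * c j) * hcls A (M j) X)" unfolding p'(4) sig_sum by (intro ext sum.cong rfl) (simp add: sig_hcls p')
 have ss: "sig gi = (%X. SUM j:K. (wt (N j) * d j) * hcls A (N j) X)" unfolding s'(4) sig_sum by (intro ext sum.cong rfl) (simp add: sig_hcls s')
 have eq': "sig fi *H sig gi = (%Z. SUM j:J. SUM k:K. (wt (M j) * c j) * (wt (N k) * d k) * (hcls A (M j) *H hcls A (N k)) Z)" unfolding sp ss by (rule hall_mult_sums) (simp_all add: p' s')
 show ?thesis unfolding eq eq' sig_sum sig_scale by (intro ext sum.cong rfl) (simp add: sig_mult_hcls p' s' mult_ac)
qed

text \<open>A homogeneous generator is an eigenvector of \<open>sig\<close>, so its image is a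
  multiple of it; the remaining rules pass through because \<open>sig\<close> is additive and
  multiplicative.\<close>

lemma sig_I: "x : I ==> sig x : I"
proof (induction rule: ideal_gen.induct)
 case (gen x)
 obtain M where M: "M : modnil A" "ALL X. x X ~= 0 --> wt (SOME M. M : X) = wt M" using G_wt[OF gen] by blast
 have "sig x = (%X. wt M * x X)" using M(2) by (auto simp: sig_def fun_eq_iff)
 then show ?case using I_scale[OF ideal_gen.gen[OF gen]] wt_rat[OF M(1)] Kv_closed(7) by simp
next
 case zero
 show ?case using ideal_gen.zero[of HA G] by (simp add: hall_simps sig_def)
next
 case (add x y)
 then show ?case using I_add by (simp add: hall_simps(4) sig_add)
next
 case (neg x)
 then show ?case using I_neg[OF neg.IH] I_closed by (simp add: hall_minus sig_def)
next
 case (left x a)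
 then show ?case using ideal_gen.left[OF left.IH sig_closed] I_closed by (simp add: sig_mult)
next
 case (right x a)
 then show ?case using ideal_gen.right[OF right.IH sig_closed] I_closed by (simp add: sig_mult)
qed

definition sigQ :: "('k, 'i, 'a) hall set => ('k, 'i, 'a) hall set" where
 "sigQ X = cs (sig (SOME fi. fi : X))"

lemma sigQ_cs: "sigQ (cs fi) = cs (sig fi)"
proof -
 have "(SOME gi. gi : cs fi) : cs fi" by (rule someI[of "%gi. gi : cs fi", OF cs_self])
 then have "(%X. (SOME gi. gi : cs fi) X - fi X) : I" by (simp add: mem_cs)
 from sig_I[OF this] show ?thesis unfolding sigQ_def cs_eq_iff by (simp add: sig_def algebra_simps)
qed

lemma sigQ_hom:
 "a : carrier Q ==> sigQ a : carrier Q" "s : SS ==> sigQ s : SS"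
 "sigQ \<zero>\<^bsub>Q\<^esub> = \<zero>\<^bsub>Q\<^esub>" "sigQ \<one>\<^bsub>Q\<^esub> = \<one>\<^bsub>Q\<^esub>"
 "a : carrier Q ==> b : carrier Q ==> sigQ (a \<oplus>\<^bsub>Q\<^esub> b) = sigQ a \<oplus>\<^bsub>Q\<^esub> sigQ b"
 "a : carrier Q ==> b : carrier Q ==> sigQ (a \<otimes>\<^bsub>Q\<^esub> b) = sigQ a \<otimes>\<^bsub>Q\<^esub> sigQ b"
proof -
 show "a : carrier Q ==> sigQ a : carrier Q" unfolding carrier_Q using sig_closed sigQ_cs by auto
 show "sigQ \<zero>\<^bsub>Q\<^esub> = \<zero>\<^bsub>Q\<^esub>" unfolding Q_zero sigQ_cs by (simp add: sig_def)
 have "sig (hcls A zero_rep) = hcls A zero_rep" using sig_hcls[OF zero_rep_modnil, of 1] wt_zero by simp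
 then show "sigQ \<one>\<^bsub>Q\<^esub> = \<one>\<^bsub>Q\<^esub>" unfolding Q_one sigQ_cs by simp
 show "sigQ s : SS" if s: "s : SS"
 proof -
  obtain a K where aK: "s = cs (%X. a * hcls A K X)" "a : \<rat>" "a ~= 0" "K : P" using s by blast
  then have K: "K : modnil A" using P_modnil by blast
  have "sigQ s = cs (%X. (wt K * a) * hcls A K X)" unfolding aK(1) sigQ_cs sig_hcls[OF K] ..
  moreover have "wt K * a : \<rat>" "wt K * a ~= 0" using wt_rat[OF K] wt_nonzero[OF K] aK by auto
  ultimately show ?thesis using aK(4) by blast
 qed
 assume "a : carrier Q" "b : carrier Q"
 then obtain fi gi where p: "fi : carrier HA" "gi : carrier HA" "a = cs fi" "b = cs gi" unfolding carrier_Q by blast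
 show "sigQ (a \<oplus>\<^bsub>Q\<^esub> b) = sigQ a \<oplus>\<^bsub>Q\<^esub> sigQ b" "sigQ (a \<otimes>\<^bsub>Q\<^esub> b) = sigQ a \<otimes>\<^bsub>Q\<^esub> sigQ b" using p by (simp_all add: Q_add Q_mult sigQ_cs sig_add sig_mult sig_closed)
qed

definition sigL where "sigL = L.loc_map sigQ"

lemma sigL_hom: "sigL : Ring.ring_hom R R" unfolding sigL_def by (rule L.loc_map_ring_hom; rule sigQ_hom; assumption)

lemma sigL_eb: "fi : carrier HA ==> sigL (eb fi) = eb (sig fi)" unfolding sigL_def eb_def sigQ_cs[symmetric] by (rule L.loc_map_emb; (rule sigQ_hom)?; (assumption | rule cs_in))

lemmas sigL_simps = ring_hom_closed[OF sigL_hom] ring_hom_add[OF sigL_hom] ring_hom_mult[OF sigL_hom] ring_hom_one[OF sigL_hom]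

lemma sigL_isc: "c : Qv (vq TYPE('k)) ==> x : carrier R ==> sigL (isc c x) = isc c (sigL x)" unfolding isc_def by (simp add: sigL_simps Qv_scalar sigL_eb sig_hcls[OF zero_rep_modnil] wt_zero)

lemma wt_Kv: "M : modnil A ==> wt M : Qv (vq TYPE('k))" using wt_rat Kv_closed(7) by blast

lemma sigL_hcls: "M : modnil A ==> sigL (eb (hcls A M)) = isc (wt M) (eb (hcls A M))" using sig_hcls[of M 1] by (simp add: sigL_eb hcls_closed isc_eb wt_Kv)

text \<open>Fractions are eigenvectors, with the quotient of the weights as eigenvalue. This is what
  makes degrees visible inside the localization.\<close>

lemma sigL_fr:
 assumes M: "M : modnil A" and K: "K : P"
 shows "sigL (fr M K) = isc (wt M / wt K) (fr M K)"
proof -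
 have Km: "K : modnil A" using K P_modnil by blast
 let ?u = "eb (hcls A K)" and ?m = "eb (hcls A M)"
 have u: "?u : Units R" "?u : carrier R" "ivR ?u : carrier R" using P_Units[OF K] by (simp_all add: R.Units_closed)
 have m: "?m : carrier R" by (simp add: hcls_closed M)
 note w = wt_Kv[OF M] wt_Kv[OF Km] and wi = Kv_closed(5)[OF wt_Kv[OF Km]]
 have c: "sigL (ivR ?u) : carrier R" by (rule sigL_simps(1)[OF u(3)])
 \<comment> \<open>The automorphism sends the inverse of \<open>?u\<close> to the inverse of
   \<open>wt K\<close> times \<open>?u\<close>; cancelling \<open>?u\<close> and then the scalar on
   the right isolates it.\<close>
 have "sigL (ivR ?u) *R isc (wt K) ?u = \<one>\<^bsub>R\<^esub>" using sigL_simps(3)[OF u(3,2)] sigL_simps(4) u by (simp add: sigL_hcls[OF Km])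
 then have "sigL (ivR ?u) *R (eb (%X. wt K * hcls A zero_rep X) *R ?u) *R ivR ?u = ivR ?u" using u by (simp add: isc_def)
 then have 1: "sigL (ivR ?u) *R eb (%X. wt K * hcls A zero_rep X) = ivR ?u" using u c by (simp add: R.m_assoc Qv_scalar w)
 have kk: "eb (%X. wt K * hcls A zero_rep X) *R eb (%X. inverse (wt K) * hcls A zero_rep X) = \<one>\<^bsub>R\<^esub>" using isc_eb[OF Qv_scalar[OF wi] w(2)] wt_nonzero[OF Km] by (simp add: isc_def eb_one mult.assoc[symmetric])
 have "sigL (ivR ?u) = (sigL (ivR ?u) *R eb (%X. wt K * hcls A zero_rep X)) *R eb (%X. inverse (wt K) * hcls A zero_rep X)" using c kk by (simp add: R.m_assoc Qv_scalar w wi)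
 also have "... = ivR ?u *R eb (%X. inverse (wt K) * hcls A zero_rep X)" by (simp only: 1)
 also have "... = isc (inverse (wt K)) (ivR ?u)" unfolding isc_def by (rule scalar_central_inv[OF u(1) _ scalar_central_eb]) (simp_all add: Qv_scalar wi hcls_closed Km)
 finally have 2: "sigL (ivR ?u) = isc (inverse (wt K)) (ivR ?u)" .
 have "sigL (fr M K) = isc (wt M) ?m *R isc (inverse (wt K)) (ivR ?u)" unfolding fr_def using m u by (simp add: sigL_simps sigL_hcls[OF M] 2)
 also have "... = isc (wt M) (?m *R isc (inverse (wt K)) (ivR ?u))" by (rule isc_mult_left) (simp_all add: w m u wi)
 also have "?m *R isc (inverse (wt K)) (ivR ?u) = isc (inverse (wt K)) (fr M K)" using isc_fr_mult[OF M zero_P wi u(3)] by (simp add: fr_zero[OF M] fr_def[of M K])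
 also have "isc (wt M) ... = isc (wt M / wt K) (fr M K)" using isc_isc[OF w(1) wi fr_closed[OF M K]] by (simp add: divide_inverse)
 finally show ?thesis .
qed

end

section \<open>The twisted product\<close>

context ring
begin

lemma lsum_simps [simp]: "lsum R [] = \<zero>" "lsum R (x # xs) = x \<oplus> lsum R xs" by (simp_all add: lsum_def)

lemma lsum_closed [simp]: "set xs <= carrier R ==> lsum R xs : carrier R" by (induction xs) auto

lemma lsum_append: "set xs <= carrier R ==> set ys <= carrier R ==> lsum R (xs @ ys) = lsum R xs \<oplus> lsum R ys" by (induction xs) (auto simp: a_assoc)

lemma lsum_map_add:
 assumes "!!x. x : set xs ==> f x : carrier R" "!!x. x : set xs ==> g x : carrier R"
 shows "lsum R (map (%x. f x \<oplus> g x) xs) = lsum R (map f xs) \<oplus> lsum R (map g xs)" using assms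
proof (induction xs)
 case (Cons x xs)
 have "lsum R (map f xs) : carrier R" "lsum R (map g xs) : carrier R" using Cons.prems by (auto intro!: lsum_closed)
 then show ?case using Cons by (simp add: a_ac)
qed simp

lemma lsum_map_mult_left:
 assumes "!!x. x : set xs ==> f x : carrier R" "y : carrier R"
 shows "y \<otimes> lsum R (map f xs) = lsum R (map (%x. y \<otimes> f x) xs)" using assms
proof (induction xs)
 case (Cons x xs)
 have "lsum R (map f xs) : carrier R" using Cons.prems by (auto intro!: lsum_closed)
 then show ?case using Cons by (simp add: r_distr)
qed simp

lemma lsum_map_mult_right:
 assumes "!!x. x : set xs ==> f x : carrier R" "y : carrier R"
 shows "lsum R (map f xs) \<otimes> y = lsum R (map (%x. f x \<otimes> y) xs)" using assms
proof (induction xs)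
 case (Cons x xs)
 have "lsum R (map f xs) : carrier R" using Cons.prems by (auto intro!: lsum_closed)
 then show ?case using Cons by (simp add: l_distr)
qed simp

lemma lsum_swap:
 assumes "!!x y. x : set xs ==> y : set ys ==> f x y : carrier R"
 shows "lsum R (concat (map (%x. map (f x) ys) xs)) = lsum R (map (%y. lsum R (map (%x. f x y) xs)) ys)" using assms
proof (induction xs)
 case Nil
 show ?case by (induction ys) simp_all
next
 case (Cons x xs)
 have c: "lsum R (map (%x. f x y) xs) : carrier R" if "y : set ys" for y using Cons.prems that by (auto intro!: lsum_closed)
 have "lsum R (concat (map (%x. map (f x) ys) (x # xs))) = lsum R (map (f x) ys) \<oplus> lsum R (concat (map (%x. map (f x) ys) xs))" using Cons.prems by (auto intro!: lsum_append)
 also have "... = lsum R (map (%y. f x y \<oplus> lsum R (map (%x. f x y) xs)) ys)" using Cons.prems c by (subst Cons.IH) (auto intro!: lsum_map_add[symmetric])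
 finally show ?case by simp
qed

lemma lsum_concat:
 assumes "!!x y. x : set xs ==> y : set ys ==> f x y : carrier R"
 shows "lsum R (concat (map (%x. map (f x) ys) xs)) = lsum R (map (%x. lsum R (map (f x) ys)) xs)" using assms
proof (induction xs)
 case (Cons x xs)
 have "lsum R (map (f x) ys @ concat (map (%x. map (f x) ys) xs)) = lsum R (map (f x) ys) \<oplus> lsum R (concat (map (%x. map (f x) ys) xs))" by (rule lsum_append) (use Cons.prems in auto)
 then show ?case using Cons by simp
qed simp

end

text \<open>The twisting exponent is the Euler form on differences of classes. It depends on a
  fraction through the ratio of weights alone, that is, through the eigenvalue of
  \<open>sigL\<close>.\<close>

locale twisted_hall = weighted_hall A G P wt for A :: "('k::{finite,field}, 'i, 'a) bquiver" and G P wt +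
 fixes ex :: "('k, 'i, 'a) rep => ('k, 'i, 'a) rep => ('k, 'i, 'a) rep => ('k, 'i, 'a) rep => int"
 assumes ex_left: "M : modnil A ==> K : P ==> M' : modnil A ==> K' : P ==> N : modnil A ==> L : P ==>
   wt M / wt K = wt M' / wt K' ==> ex M K N L = ex M' K' N L"
  and ex_right: "M : modnil A ==> K : P ==> M' : modnil A ==> K' : P ==> N : modnil A ==> L : P ==>
   wt M / wt K = wt M' / wt K' ==> ex N L M K = ex N L M' K'"
begin

abbreviation "FR == Qv (vq TYPE('k)) \<times> modnil A \<times> P"

lemma vv_powi: "vq TYPE('k) powi n : Qv (vq TYPE('k))" by (rule Qv_powi[OF vq_rat Qv_self])

text \<open>The element presented by \<open>xs\<close> with each coefficient multiplied by h at the
  weight of its fraction; the constant function 1 gives the element itself. Twisting will be an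
  instance of such a modification.\<close>

definition T :: "(real \<times> ('k, 'i, 'a) rep \<times> ('k, 'i, 'a) rep) list => (real => real) => ('k, 'i, 'a) hall set loc_term set" where
 "T xs h = lsum R (map (%(c, M, K). isc (c * h (wt M / wt K)) (fr M K)) xs)"

definition Lm :: "(real \<times> ('k, 'i, 'a) rep \<times> ('k, 'i, 'a) rep) list => real set" where
 "Lm xs = (%(c, M, K). wt M / wt K) ` set xs"

lemma LmI: "(c, M, K) : set xs ==> wt M / wt K : Lm xs" by (force simp: Lm_def)

lemma Lm_Kv: "set xs <= FR ==> l : Lm xs ==> l : Qv (vq TYPE('k))"
proof -
 assume x: "set xs <= FR" and l: "l : Lm xs"
 then obtain c M K where m: "(c, M, K) : set xs" "l = wt M / wt K" by (auto simp: Lm_def)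
 then have "M : modnil A" "K : modnil A" using x P_modnil by auto
 then show "l : Qv (vq TYPE('k))" unfolding m(2) by (intro Kv_closed(6) wt_Kv)
qed

lemma FR_D: "set xs <= FR ==> (c, M, K) : set xs ==> c : Qv (vq TYPE('k)) & M : modnil A & K : P" by blast

lemma T_mem:
 assumes "set xs <= FR" "!!l. l : Lm xs ==> h l : Qv (vq TYPE('k))" "(c, M, K) : set xs"
 shows "isc (c * h (wt M / wt K)) (fr M K) : carrier R" using FR_D[OF assms(1,3)] assms(2)[OF LmI[OF assms(3)]] by (simp add: Kv_closed(3))

lemma T_closed:
 assumes "set xs <= FR" "!!l. l : Lm xs ==> h l : Qv (vq TYPE('k))"
 shows "T xs h : carrier R" unfolding T_def by (rule R.lsum_closed) (use T_mem[OF assms] in auto)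

lemma T_cong: "(!!l. l : Lm xs ==> h l = h' l) ==> T xs h = T xs h'"
proof -
 assume e: "!!l. l : Lm xs ==> h l = h' l"
 have "map (%(c, M, K). isc (c * h (wt M / wt K)) (fr M K)) xs = map (%(c, M, K). isc (c * h' (wt M / wt K)) (fr M K)) xs" by (rule map_cong[OF rfl]) (use e LmI in auto)
 then show ?thesis unfolding T_def by (rule arg_cong)
qed

lemma T_add:
 assumes x: "set xs <= FR" and h: "!!l. l : Lm xs ==> h l : Qv (vq TYPE('k))" "!!l. l : Lm xs ==> h' l : Qv (vq TYPE('k))"
 shows "T xs (%l. h l + h' l) = T xs h \<oplus>\<^bsub>R\<^esub> T xs h'"
proof -
 have e: "map (%(c, M, K). isc (c * (h (wt M / wt K) + h' (wt M / wt K))) (fr M K)) xs =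
   map (%y. (%(c, M, K). isc (c * h (wt M / wt K)) (fr M K)) y \<oplus>\<^bsub>R\<^esub> (%(c, M, K). isc (c * h' (wt M / wt K)) (fr M K)) y) xs"
 proof (rule map_cong[OF rfl], clarify)
  fix c M K assume m: "(c, M, K) : set xs"
  show "isc (c * (h (wt M / wt K) + h' (wt M / wt K))) (fr M K) = isc (c * h (wt M / wt K)) (fr M K) \<oplus>\<^bsub>R\<^esub> isc (c * h' (wt M / wt K)) (fr M K)" using FR_D[OF x m] h(1)[OF LmI[OF m]] h(2)[OF LmI[OF m]] by (simp add: ring_distribs isc_add_left Kv_closed(3))
 qed
 show ?thesis unfolding T_def e by (rule R.lsum_map_add) (use T_mem[OF x h(1)] T_mem[OF x h(2)] in auto)
qed

lemma lsum_isc: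
 assumes "a : Qv (vq TYPE('k))" "!!x. x : set xs ==> f x : carrier R"
 shows "isc a (lsum R (map f xs)) = lsum R (map (%x. isc a (f x)) xs)" unfolding isc_def by (rule R.lsum_map_mult_left) (use assms Qv_scalar in auto)

lemma T_scale:
 assumes x: "set xs <= FR" and h: "!!l. l : Lm xs ==> h l : Qv (vq TYPE('k))" and a: "a : Qv (vq TYPE('k))"
 shows "T xs (%l. a * h l) = isc a (T xs h)"
proof -
 have "isc a (T xs h) = lsum R (map (%y. isc a ((%(c, M, K). isc (c * h (wt M / wt K)) (fr M K)) y)) xs)" unfolding T_def by (rule lsum_isc[OF a]) (use T_mem[OF x h] in auto)
 also have "... = T xs (%l. a * h l)" unfolding T_def
 proof (intro arg_cong[of _ _ "lsum R"] map_cong rfl, clarify)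
  fix c M K assume m: "(c, M, K) : set xs"
  show "isc a (isc (c * h (wt M / wt K)) (fr M K)) = isc (c * (a * h (wt M / wt K))) (fr M K)" using FR_D[OF x m] h[OF LmI[OF m]] a by (simp add: isc_isc Kv_closed(3) mult.left_commute)
 qed
 finally show ?thesis by simp
qed

text \<open>Applying the automorphism multiplies h by the coordinate function l. Polynomial factors
  h are therefore realized by polynomials in \<open>sigL\<close>.\<close>

lemma T_sig:
 assumes x: "set xs <= FR" and h: "!!l. l : Lm xs ==> h l : Qv (vq TYPE('k))"
 shows "sigL (T xs h) = T xs (%l. l * h l)" using assms
proof (induction xs)
 case Nil
 have "sigL \<zero>\<^bsub>R\<^esub> = \<zero>\<^bsub>R\<^esub>" using sigL_eb[OF hall_zero_closed] by (simp add: eb_zero sig_def)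
 then show ?case by (simp add: T_def)
next
 case (Cons y xs)
 obtain c M K where y: "y = (c, M, K)" by (cases y)
 have m: "(c, M, K) : set (y # xs)" using y by simp
 note d = FR_D[OF Cons.prems(1) m] and hl = Cons.prems(2)[OF LmI[OF m]]
 have Lx: "l : Lm xs ==> l : Lm (y # xs)" for l by (auto simp: Lm_def)
 have sx: "set xs <= FR" using Cons.prems by simp
 have Tc: "T xs h : carrier R" by (rule T_closed[OF sx]) (use Cons.prems(2) Lx in blast)
 have w: "wt M / wt K : Qv (vq TYPE('k))" by (rule Lm_Kv[OF Cons.prems(1) LmI[OF m]])
 have ih: "sigL (T xs h) = T xs (%l. l * h l)" by (rule Cons.IH[OF sx]) (use Cons.prems(2) Lx in blast)
 have "sigL (T (y # xs) h) = sigL (isc (c * h (wt M / wt K)) (fr M K) \<oplus>\<^bsub>R\<^esub> T xs h)" by (simp add: T_def y)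
 also have "... = isc (c * h (wt M / wt K)) (isc (wt M / wt K) (fr M K)) \<oplus>\<^bsub>R\<^esub> T xs (%l. l * h l)" using d hl Tc by (simp add: sigL_simps sigL_isc sigL_fr Kv_closed(3) ih)
 also have "... = T (y # xs) (%l. l * h l)" using d hl w by (simp add: T_def y isc_isc Kv_closed(3) mult_ac)
 finally show ?case .
qed

text \<open>Lagrange interpolation: a relation among fractions may be multiplied by any function of the weight.\<close>

lemma T_zero:
 assumes x: "set xs <= FR" and z: "T xs (%_. 1) = \<zero>\<^bsub>R\<^esub>" and h: "!!l. l : Lm xs ==> h l : Qv (vq TYPE('k))"
 shows "T xs h = \<zero>\<^bsub>R\<^esub>"
proof -
 have fin: "finite (Lm xs)" by (simp add: Lm_def)
 note LK = Lm_Kv[OF x]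
 have prod_Kv: "(\<Prod>\<mu>\<in>D. l - \<mu>) : Qv (vq TYPE('k))" if D: "finite D" "D <= Lm xs" and l: "l : Lm xs" for D l using D
 proof (induction D)
  case (insert \<mu> D)
  then show ?case using LK l by (simp add: Kv_closed)
 qed (simp add: Kv_closed)
 \<comment> \<open>Applying \<open>sigL\<close> minus \<mu> multiplies h by l - \<mu> and preserves
   zero, so a relation survives multiplication by any product of such factors.\<close>
 have P: "T xs (%l. \<Prod>\<mu>\<in>D. l - \<mu>) = \<zero>\<^bsub>R\<^esub>" if D: "finite D" "D <= Lm xs" for D using D
 proof (induction D)
  case empty
  then show ?case using z by simp
 next
  case (insert \<mu> D)
  let ?p = "%l. \<Prod>\<mu>\<in>D. l - \<mu>"
  have pK: "?p l : Qv (vq TYPE('k))" if "l : Lm xs" for l using prod_Kv[of D l] insert that by simp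
  have mK: "- \<mu> : Qv (vq TYPE('k))" using LK insert by (simp add: Kv_closed)
  have "T xs (%l. \<Prod>\<mu>\<in>insert \<mu> D. l - \<mu>) = T xs (%l. l * ?p l + (- \<mu>) * ?p l)" using insert by (intro T_cong) (simp add: algebra_simps)
  also have "... = T xs (%l. l * ?p l) \<oplus>\<^bsub>R\<^esub> T xs (%l. (- \<mu>) * ?p l)" by (rule T_add[OF x]) (use LK pK mK Kv_closed(3) in blast)+
  also have "T xs (%l. l * ?p l) = sigL (T xs ?p)" using T_sig[OF x pK] by simp
  also have "T xs (%l. (- \<mu>) * ?p l) = isc (- \<mu>) (T xs ?p)" by (rule T_scale[OF x pK mK])
  also have "T xs ?p = \<zero>\<^bsub>R\<^esub>" using insert by simp
  also have "sigL \<zero>\<^bsub>R\<^esub> = \<zero>\<^bsub>R\<^esub>" using sigL_eb[OF hall_zero_closed] by (simp add: eb_zero sig_def)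
  finally show ?case using mK by simp
 qed
 let ?q = "%m. \<Prod>\<mu>\<in>Lm xs - {m}. m - \<mu>"
 \<comment> \<open>Lagrange basis functions for the finitely many weights of \<open>xs\<close>,
   scaled by the values of h. The constants stay in \<rat>(v) because the weights do.\<close>
 let ?f = "%m l. (h m / ?q m) * (\<Prod>\<mu>\<in>Lm xs - {m}. l - \<mu>)"
 have aK: "h m / ?q m : Qv (vq TYPE('k))" if "m : Lm xs" for m using h[OF that] prod_Kv[of "Lm xs - {m}" m] fin that by (intro Kv_closed(6)) auto
 have fK: "?f m l : Qv (vq TYPE('k))" if "m : Lm xs" "l : Lm xs" for m l using aK[OF that(1)] prod_Kv[of "Lm xs - {m}" l] fin that by (intro Kv_closed(3)) auto
 have S: "T xs (%l. SUM m:E. ?f m l) = \<zero>\<^bsub>R\<^esub>" if E: "finite E" "E <= Lm xs" for E using E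
 proof (induction E)
  case empty
  show ?case using T_scale[OF x _ Kv_closed(7), of "%_. 1" 0] z by (simp add: Kv_closed)
 next
  case (insert m E)
  have m: "m : Lm xs" using insert by simp
  have "T xs (%l. SUM m:insert m E. ?f m l) = T xs (%l. ?f m l + (SUM m:E. ?f m l))" using insert by (intro T_cong) simp
  also have "... = T xs (?f m) \<oplus>\<^bsub>R\<^esub> T xs (%l. SUM m:E. ?f m l)" by (rule T_add[OF x fK[OF m]]) (use insert fK in "auto intro!: Qv_sum")
  also have "T xs (?f m) = isc (h m / ?q m) (T xs (%l. \<Prod>\<mu>\<in>Lm xs - {m}. l - \<mu>))" by (rule T_scale[OF x _ aK[OF m]]) (use prod_Kv fin in auto)
  also have "T xs (%l. \<Prod>\<mu>\<in>Lm xs - {m}. l - \<mu>) = \<zero>\<^bsub>R\<^esub>" using P fin by simp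
  finally show ?case using insert aK[OF m] by simp
 qed
 have "T xs h = T xs (%l. SUM m:Lm xs. ?f m l)"
 proof (rule T_cong)
  fix l assume l: "l : Lm xs"
  have "?f m l = (if m = l then h l else 0)" if "m : Lm xs" for m
  proof (cases "m = l")
   case True
   have "?q l ~= 0" using fin by simp
   then show ?thesis using True by simp
  next
   case False
   have "(\<Prod>\<mu>\<in>Lm xs - {m}. l - \<mu>) = 0" using fin l False by (intro prod_zero) auto
   then show ?thesis using False by simp
  qed
  then show "h l = (SUM m:Lm xs. ?f m l)" using fin l by (simp add: sum.delta')
 qed
 also have "... = \<zero>\<^bsub>R\<^esub>" by (rule S[OF fin order_refl])
 finally show ?thesis .
qed

lemma T_append:
 assumes "set xs <= FR" "set ys <= FR" "!!l. l : Lm xs \<union> Lm ys ==> h l : Qv (vq TYPE('k))"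
 shows "T (xs @ ys) h = T xs h \<oplus>\<^bsub>R\<^esub> T ys h"
proof -
 have 1: "set (map (%(c, M, K). isc (c * h (wt M / wt K)) (fr M K)) zs) <= carrier R" if "set zs <= FR" "Lm zs <= Lm xs \<union> Lm ys" for zs
 proof -
  have "isc (c * h (wt M / wt K)) (fr M K) : carrier R" if m: "(c, M, K) : set zs" for c M K by (rule T_mem[OF \<open>set zs <= FR\<close> _ m]) (use \<open>Lm zs <= Lm xs \<union> Lm ys\<close> assms(3) in blast)
  then show ?thesis by auto
 qed
 show ?thesis unfolding T_def map_append by (rule R.lsum_append) (use 1 assms in blast)+
qed

text \<open>The two presentations are subtracted by appending the second list with negated
  coefficients, and \<open>T_zero\<close> applies to the resulting relation.\<close>

lemma T_unique:
 assumes x: "set xs <= FR" "set xs' <= FR" and eq: "T xs (%_. 1) = T xs' (%_. 1)" and h: "!!l. h l : Qv (vq TYPE('k))"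
 shows "T xs h = T xs' h"
proof -
 define ys where "ys = map (%(c, M, K). (- c, M, K)) xs'"
 have ys: "set ys <= FR" using x(2) by (auto simp: ys_def Kv_closed(4))
 have neg: "T ys g = \<ominus>\<^bsub>R\<^esub> T xs' g" if g: "!!l. g l : Qv (vq TYPE('k))" for g
 proof -
  have "T ys g = T xs' (%l. (-1) * g l)" unfolding T_def ys_def map_map by (intro arg_cong[of _ _ "lsum R"] map_cong) auto
  also have "... = isc (-1) (T xs' g)" by (rule T_scale[OF x(2)]) (use g Kv_closed in auto)
  finally have e: "T ys g = isc (-1) (T xs' g)" .
  have c: "T xs' g : carrier R" by (rule T_closed[OF x(2) g])
  have "isc (-1) (T xs' g) \<oplus>\<^bsub>R\<^esub> isc 1 (T xs' g) = isc (-1 + 1) (T xs' g)" by (rule isc_add_left[symmetric]) (use c Kv_closed in auto)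
  then have "isc (-1) (T xs' g) \<oplus>\<^bsub>R\<^esub> T xs' g = \<zero>\<^bsub>R\<^esub>" using c by simp
  then show ?thesis unfolding e using c by (intro R.minus_equality[symmetric]) (auto intro!: isc_closed Kv_closed)
 qed
 have one: "(1::real) : Qv (vq TYPE('k))" by (simp add: Kv_closed)
 have app: "T (xs @ ys) g = T xs g \<oplus>\<^bsub>R\<^esub> (\<ominus>\<^bsub>R\<^esub> T xs' g)" if g: "!!l. g l : Qv (vq TYPE('k))" for g using T_append[OF x(1) ys, of g] g neg[OF g] by simp
 have c: "T xs' g : carrier R" "T xs g : carrier R" if "!!l. g l : Qv (vq TYPE('k))" for g by (rule T_closed[OF x(2) that], rule T_closed[OF x(1) that])
 have "T (xs @ ys) (%_. 1) = \<zero>\<^bsub>R\<^esub>" using app[OF one] eq c(1)[OF one] by (simp add: R.r_neg)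
 then have "T (xs @ ys) h = \<zero>\<^bsub>R\<^esub>" by (rule T_zero[rotated]) (use x(1) ys h in auto)
 then have "T xs h \<oplus>\<^bsub>R\<^esub> (\<ominus>\<^bsub>R\<^esub> T xs' h) = \<zero>\<^bsub>R\<^esub>" using app[OF h] by simp
 from R.minus_equality[OF this R.a_inv_closed[OF c(1)[OF h]] c(2)[OF h]] show ?thesis using c[OF h] by simp
qed

section \<open>Independence of the twisted product from the presentations\<close>

definition ZZ :: "(real \<times> ('k, 'i, 'a) rep \<times> ('k, 'i, 'a) rep) list => (real \<times> ('k, 'i, 'a) rep \<times> ('k, 'i, 'a) rep) list
  => ('k, 'i, 'a) hall set loc_term set" where
 "ZZ xs ys = lsum R (concat (map (%(c, M, K). map (%(d, N, L).
  isc (c * d * vq TYPE('k) powi ex M K N L) (fr M K *R fr N L)) ys) xs))"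

text \<open>\<open>exl\<close> and \<open>exr\<close> turn the twist into a function of the weight,
  evaluated at any fraction of that weight. At numbers that are no weight the value is still a power
  of v, so it lies in \<rat>(v) for every argument, as \<open>T_unique\<close> demands.\<close>

definition exl :: "('k, 'i, 'a) rep => ('k, 'i, 'a) rep => real => real" where
 "exl N L l = (let (M, K) = SOME (M, K). M : modnil A & K : P & wt M / wt K = l in vq TYPE('k) powi ex M K N L)"

definition exr :: "('k, 'i, 'a) rep => ('k, 'i, 'a) rep => real => real" where
 "exr N L l = (let (M, K) = SOME (M, K). M : modnil A & K : P & wt M / wt K = l in vq TYPE('k) powi ex N L M K)"

lemma exl_eq:
 assumes "M : modnil A" "K : P" "N : modnil A" "L : P"
 shows "exl N L (wt M / wt K) = vq TYPE('k) powi ex M K N L" "exr N L (wt M / wt K) = vq TYPE('k) powi ex N L M K"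
proof -
 let ?S = "SOME (M', K'). M' : modnil A & K' : P & wt M' / wt K' = wt M / wt K"
 have "case ?S of (M', K') => M' : modnil A & K' : P & wt M' / wt K' = wt M / wt K" by (rule someI[of _ "(M, K)"]) (use assms in simp)
 then obtain M' K' where "?S = (M', K')" "M' : modnil A" "K' : P" "wt M' / wt K' = wt M / wt K" by force
 then show "exl N L (wt M / wt K) = vq TYPE('k) powi ex M K N L" "exr N L (wt M / wt K) = vq TYPE('k) powi ex N L M K" using ex_left[of M' K' M K N L] ex_right[of M' K' M K N L] assms unfolding exl_def exr_def by simp_all
qed

lemma exl_Kv: "exl N L l : Qv (vq TYPE('k))" "exr N L l : Qv (vq TYPE('k))" unfolding exl_def exr_def Let_def by (auto split: prod.split simp: vv_powi)

text \<open>For a fixed fraction on the right the twist is a function of the weight on the left. The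
  inner sum is then of the form \<open>T xs h\<close>, which depends on the element presented by
  \<open>xs\<close> and not on the list.\<close>

lemma ZZ_left:
 assumes x: "set xs <= FR" and y: "set ys <= FR"
 shows "ZZ xs ys = lsum R (map (%(d, N, L). T xs (exl N L) *R isc d (fr N L)) ys)"
proof -
 let ?f = "%x y. case x of (c, M, K) => case y of (d, N, L) => isc (c * d * vq TYPE('k) powi ex M K N L) (fr M K *R fr N L)"
 have "ZZ xs ys = lsum R (concat (map (%x. map (?f x) ys) xs))" unfolding ZZ_def by (intro arg_cong[of _ _ "%l. lsum R (concat l)"] map_cong) auto
 also have "... = lsum R (map (%y. lsum R (map (%x. ?f x y) xs)) ys)"
 proof (rule R.lsum_swap)
  fix p q assume p: "p : set xs" and q: "q : set ys"
  obtain c M K d N L where e: "p = (c, M, K)" "q = (d, N, L)" by (cases p, cases q)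
  show "?f p q : carrier R" using FR_D[OF x p[unfolded e]] FR_D[OF y q[unfolded e]] e by (simp add: Kv_closed(3) vv_powi)
 qed
 also have "... = lsum R (map (%(d, N, L). T xs (exl N L) *R isc d (fr N L)) ys)"
 proof (intro arg_cong[of _ _ "lsum R"] map_cong rfl)
  fix q' assume q': "q' : set ys"
  obtain d N L where qe: "q' = (d, N, L)" by (cases q')
  have q: "(d, N, L) : set ys" using q' qe by simp
  note Q = FR_D[OF y q]
  have "T xs (exl N L) *R isc d (fr N L) = lsum R (map (%p. (%(c, M, K). isc (c * exl N L (wt M / wt K)) (fr M K)) p *R isc d (fr N L)) xs)" unfolding T_def by (rule R.lsum_map_mult_right) (use T_mem[OF x exl_Kv(1)] Q in auto)
  also have "... = lsum R (map (%p. ?f p (d, N, L)) xs)"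
  proof (intro arg_cong[of _ _ "lsum R"] map_cong rfl, clarify)
   fix c M K assume p: "(c, M, K) : set xs"
   note PP = FR_D[OF x p]
   have cl: "c * exl N L (wt M / wt K) : Qv (vq TYPE('k))" using PP exl_Kv Kv_closed(3) by blast
   have "isc (c * exl N L (wt M / wt K)) (fr M K) *R isc d (fr N L) = isc (c * exl N L (wt M / wt K)) (isc d (fr M K *R fr N L))" using PP Q cl by (simp add: isc_mult_left isc_fr_mult)
   also have "... = isc (c * d * vq TYPE('k) powi ex M K N L) (fr M K *R fr N L)" using PP Q cl exl_eq(1)[of M K N L] by (simp add: isc_isc mult_ac)
   finally show "isc (c * exl N L (wt M / wt K)) (fr M K) *R isc d (fr N L) = isc (c * d * vq TYPE('k) powi ex M K N L) (fr M K *R fr N L)" .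
  qed
  finally show "lsum R (map (%p. ?f p q') xs) = (case q' of (d, N, L) => T xs (exl N L) *R isc d (fr N L))" by (simp add: qe)
 qed
 finally show ?thesis .
qed

lemma ZZ_right:
 assumes x: "set xs <= FR" and y: "set ys <= FR"
 shows "ZZ xs ys = lsum R (map (%(c, M, K). isc c (fr M K) *R T ys (exr M K)) xs)"
proof -
 let ?f = "%x y. case x of (c, M, K) => case y of (d, N, L) => isc (c * d * vq TYPE('k) powi ex M K N L) (fr M K *R fr N L)"
 have "ZZ xs ys = lsum R (concat (map (%x. map (?f x) ys) xs))" unfolding ZZ_def by (intro arg_cong[of _ _ "%l. lsum R (concat l)"] map_cong) auto
 also have "... = lsum R (map (%x. lsum R (map (?f x) ys)) xs)"
 proof (rule R.lsum_concat)
  fix p q assume p: "p : set xs" and q: "q : set ys"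
  obtain c M K d N L where e: "p = (c, M, K)" "q = (d, N, L)" by (cases p, cases q)
  show "?f p q : carrier R" using FR_D[OF x p[unfolded e]] FR_D[OF y q[unfolded e]] e by (simp add: Kv_closed(3) vv_powi)
 qed
 also have "... = lsum R (map (%(c, M, K). isc c (fr M K) *R T ys (exr M K)) xs)"
 proof (intro arg_cong[of _ _ "lsum R"] map_cong rfl)
  fix p' assume p': "p' : set xs"
  obtain c M K where pe: "p' = (c, M, K)" by (cases p')
  have p: "(c, M, K) : set xs" using p' pe by simp
  note PP = FR_D[OF x p]
  have "isc c (fr M K) *R T ys (exr M K) = lsum R (map (%q. isc c (fr M K) *R (%(d, N, L). isc (d * exr M K (wt N / wt L)) (fr N L)) q) ys)" unfolding T_def by (rule R.lsum_map_mult_left) (use T_mem[OF y exl_Kv(2)] PP in auto)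
  also have "... = lsum R (map (?f (c, M, K)) ys)"
  proof (intro arg_cong[of _ _ "lsum R"] map_cong rfl, clarify)
   fix d N L assume q: "(d, N, L) : set ys"
   note Q = FR_D[OF y q]
   have cl: "d * exr M K (wt N / wt L) : Qv (vq TYPE('k))" using Q exl_Kv Kv_closed(3) by blast
   show "isc c (fr M K) *R isc (d * exr M K (wt N / wt L)) (fr N L) = isc (c * d * vq TYPE('k) powi ex M K N L) (fr M K *R fr N L)" using PP Q cl exl_eq(2)[of N L M K] by (simp add: isc_mult_left isc_fr_mult isc_isc mult_ac)
  qed
  finally show "lsum R (map (?f p') ys) = (case p' of (c, M, K) => isc c (fr M K) *R T ys (exr M K))" by (simp add: pe)
 qed
 finally show ?thesis .
qed

text \<open>The presentations are changed one factor at a time, first on the left and then on the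
  right.\<close>

lemma ZZ_unique:
 assumes "set xs <= FR" "set ys <= FR" "set xs' <= FR" "set ys' <= FR"
  and "T xs (%_. 1) = T xs' (%_. 1)" "T ys (%_. 1) = T ys' (%_. 1)"
 shows "ZZ xs ys = ZZ xs' ys'"
proof -
 have "T xs (exl N L) = T xs' (exl N L)" for N L by (rule T_unique[OF assms(1,3,5) exl_Kv(1)])
 then have "ZZ xs ys = ZZ xs' ys" unfolding ZZ_left[OF assms(1,2)] ZZ_left[OF assms(3,2)] by simp
 moreover have "T ys (exr N L) = T ys' (exr N L)" for N L by (rule T_unique[OF assms(2,4,6) exl_Kv(2)])
 then have "ZZ xs' ys = ZZ xs' ys'" unfolding ZZ_right[OF assms(3,2)] ZZ_right[OF assms(3,4)] by simp
 ultimately show ?thesis by simp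
qed

definition tw :: "('k, 'i, 'a) hall set loc_term set => ('k, 'i, 'a) hall set loc_term set => ('k, 'i, 'a) hall set loc_term set" where
 "tw x y = (THE z. EX xs ys. set xs <= FR & set ys <= FR
  & x = lsum R [isc c (fr M K). (c, M, K) \<leftarrow> xs]
  & y = lsum R [isc d (fr N L). (d, N, L) \<leftarrow> ys]
  & z = lsum R [isc (c * d * vq TYPE('k) powi ex M K N L) (fr M K *R fr N L). (c, M, K) \<leftarrow> xs, (d, N, L) \<leftarrow> ys])"

lemma tw_eq:
 assumes "set xs <= FR" "set ys <= FR"
 shows "tw (T xs (%_. 1)) (T ys (%_. 1)) = ZZ xs ys"
proof -
 have T1: "lsum R [isc c (fr M K). (c, M, K) \<leftarrow> zs] = T zs (%_. 1)" for zs by (simp add: T_def)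
 have Z1: "lsum R [isc (c * d * vq TYPE('k) powi ex M K N L) (fr M K *R fr N L). (c, M, K) \<leftarrow> xs, (d, N, L) \<leftarrow> ys] = ZZ xs ys" for xs ys by (simp add: ZZ_def)
 show ?thesis unfolding tw_def T1 Z1
 proof (rule the_equality)
  show "EX xs' ys'. set xs' <= FR & set ys' <= FR & T xs (%_. 1) = T xs' (%_. 1) & T ys (%_. 1) = T ys' (%_. 1) & ZZ xs ys = ZZ xs' ys'" using assms by (intro exI[of _ xs] exI[of _ ys]) simp
 next
  fix z assume "EX xs' ys'. set xs' <= FR & set ys' <= FR & T xs (%_. 1) = T xs' (%_. 1) & T ys (%_. 1) = T ys' (%_. 1) & z = ZZ xs' ys'"
  then obtain xs' ys' where "set xs' <= FR" "set ys' <= FR" "T xs (%_. 1) = T xs' (%_. 1)" "T ys (%_. 1) = T ys' (%_. 1)" "z = ZZ xs' ys'" by (elim exE conjE)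
  then show "z = ZZ xs ys" using ZZ_unique[OF assms, of xs' ys'] by simp
 qed
qed

lemma eb_list:
 assumes p: "fi : carrier HA"
 obtains xs where "set xs <= FR" "eb fi = T xs (%_. 1)"
  "!!c M K. (c, M, K) : set xs ==> K = zero_rep & fi (isocl A M) ~= 0 & M = (SOME M'. M' : isocl A M)"
proof -
 note ex = hall_expand[OF p]
 obtain Xs where Xs: "set Xs = {X. fi X ~= 0}" "distinct Xs" using finite_distinct_list[OF ex(2)] by blast
 let ?rep = "%X. SOME M. M : X"
 let ?xs = "map (%X. (fi X, ?rep X, zero_rep)) Xs"
 have FRx: "set ?xs <= FR" using ex(3,4) Xs(1) zero_P by auto
 have cl: "(%Y. SUM X:set Zs. fi X * hcls A (?rep X) Y) : carrier HA" if "set Zs <= set Xs" for Zs by (rule hall_carrierI) (use ex(3,4) Xs(1) that in auto)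
 have "eb (%Y. SUM X:set Zs. fi X * hcls A (?rep X) Y) = lsum R (map (%X. isc (fi X) (eb (hcls A (?rep X)))) Zs)" if "set Zs <= set Xs" "distinct Zs" for Zs using that
 proof (induction Zs)
  case Nil show ?case by (simp add: eb_zero)
 next
  case (Cons X Zs)
  have m: "?rep X : modnil A" using ex(3) Cons.prems Xs(1) by auto
  have "eb (%Y. SUM X:set (X # Zs). fi X * hcls A (?rep X) Y) = eb (%Y. fi X * hcls A (?rep X) Y + (SUM X:set Zs. fi X * hcls A (?rep X) Y))" using Cons.prems by simp
  also have "... = eb (%Y. fi X * hcls A (?rep X) Y) \<oplus>\<^bsub>R\<^esub> eb (%Y. SUM X:set Zs. fi X * hcls A (?rep X) Y)" by (rule eb_add[OF hall_scale_hcls[OF m ex(4)] cl]) (use Cons.prems in auto)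
  also have "eb (%Y. fi X * hcls A (?rep X) Y) = isc (fi X) (eb (hcls A (?rep X)))" using isc_eb[OF hcls_closed[OF m] ex(4)] by simp
  finally show ?case using Cons by simp
 qed
 from this[of Xs] have "eb fi = lsum R (map (%X. isc (fi X) (eb (hcls A (?rep X)))) Xs)" using Xs ex(1) by simp
 also have "... = T ?xs (%_. 1)" unfolding T_def map_map by (intro arg_cong[of _ _ "lsum R"] map_cong rfl) (use ex(3) Xs(1) in "auto simp: fr_zero")
 finally show thesis by (rule that[OF FRx]) (use Xs(1) ex(5) in "auto")
qed

text \<open>If the exponent is constant on the supports, as for homogeneous elements, the twist is a
  single power of v in front of the untwisted product.\<close>

lemma tw_eb:
 assumes p: "fi : carrier HA" and s: "gi : carrier HA"
  and e: "!!M N. M : modnil A ==> N : modnil A ==> fi (isocl A M) ~= 0 ==> gi (isocl A N) ~= 0 ==> ex M zero_rep N zero_rep = n"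
 shows "tw (eb fi) (eb gi) = eb (%Z. vq TYPE('k) powi n * (fi *H gi) Z)"
proof -
 obtain xs where xs: "set xs <= FR" "eb fi = T xs (%_. 1)" "!!c M K. (c, M, K) : set xs ==> K = zero_rep & fi (isocl A M) ~= 0 & M = (SOME M'. M' : isocl A M)" by (rule eb_list[OF p]) (rule that)
 obtain ys where ys: "set ys <= FR" "eb gi = T ys (%_. 1)" "!!c M K. (c, M, K) : set ys ==> K = zero_rep & gi (isocl A M) ~= 0 & M = (SOME M'. M' : isocl A M)" by (rule eb_list[OF s]) (rule that)
 let ?v = "vq TYPE('k) powi n"
 have one: "(1::real) : Qv (vq TYPE('k))" by (simp add: Kv_closed)
 have "tw (eb fi) (eb gi) = ZZ xs ys" unfolding xs(2) ys(2) by (rule tw_eq[OF xs(1) ys(1)])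
 also have "... = lsum R (map (%(c, M, K). isc c (fr M K) *R T ys (exr M K)) xs)" by (rule ZZ_right[OF xs(1) ys(1)])
 also have "... = lsum R (map (%x. (%(c, M, K). isc (c * 1) (fr M K)) x *R isc ?v (eb gi)) xs)"
 proof (intro arg_cong[of _ _ "lsum R"] map_cong rfl, clarify)
  fix c M K assume m: "(c, M, K) : set xs"
  note d = FR_D[OF xs(1) m] xs(3)[OF m]
  have "T ys (exr M K) = T ys (%l. ?v * 1)"
  proof (rule T_cong)
   fix l assume "l : Lm ys"
   then obtain a N L where nl: "(a, N, L) : set ys" "l = wt N / wt L" by (auto simp: Lm_def)
   note d' = FR_D[OF ys(1) nl(1)] ys(3)[OF nl(1)]
   have "ex M K N L = n" using e[of M N] d d' by simp
   then show "exr M K l = ?v * 1" using exl_eq(2)[of N L M K] d d' nl(2) by simp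
  qed
  also have "... = isc ?v (eb gi)" unfolding ys(2) by (rule T_scale[OF ys(1) one vv_powi])
  finally show "isc c (fr M K) *R T ys (exr M K) = isc (c * 1) (fr M K) *R isc ?v (eb gi)" by simp
 qed
 also have "... = T xs (%_. 1) *R isc ?v (eb gi)" unfolding T_def by (rule R.lsum_map_mult_right[symmetric]) (use T_mem[OF xs(1) one] s vv_powi in auto)
 also have "... = eb fi *R isc ?v (eb gi)" unfolding xs(2) ..
 also have "... = eb (fi *H (%X. ?v * gi X))" using p s by (simp add: isc_eb vv_powi eb_mult hall_scale_closed)
 also have "fi *H (%X. ?v * gi X) = (%Z. ?v * (fi *H gi) Z)" using hall_mult_linear_right[OF s s p, of ?v 0] by simp
 finally show ?thesis .
qed

end

section \<open>The algebra of the generalized Kronecker iquiver\<close>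

abbreviation "LH r == hall (Lam r)"
abbreviation "cH r == carrier (LH r)"
abbreviation "hL r == hcls (Lam r)"
abbreviation "mL r == modnil (Lam r)"
abbreviation "iL r == iso_rep (Lam r)"

lemma UNIV_vertex: "UNIV = {V1, V2}" using vertex.exhaust by auto

lemma Lam_simps [simp]:
 "verts (quiver (Lam r)) = UNIV" "arrs (Lam r) = kron_arrows r \<union> {Eps1, Eps2}"
 "tv (Lam r) = src" "hv (Lam r) = tgt"
 "verts (quiver (kQ r)) = UNIV" "arcs (quiver (kQ r)) = kron_arrows r"
 "tail (quiver (kQ r)) = src" "head (quiver (kQ r)) = tgt" "relns (kQ r) = {}" by (simp_all add: Lam_def kQ_def)

lemma kron_arrows_simps [simp]: "Alpha s : kron_arrows r \<longleftrightarrow> s : {1..r}" "Beta s : kron_arrows r \<longleftrightarrow> s : {1..r}"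
 "Eps1 ~: kron_arrows r" "Eps2 ~: kron_arrows r" by (auto simp: kron_arrows_def)

lemma finite_kron_arrows: "finite (kron_arrows r)" by (simp add: kron_arrows_def)

lemma finite_vertex: "finite (UNIV :: vertex set)" by (simp add: UNIV_vertex)

interpretation Lam: fin_bquiver "Lam r :: 'k::{finite,field} kquiver" for r
proof
 fix u rh assume "(u, rh) : relns (Lam r :: 'k kquiver)"
 then consider "(u, rh) = (V2, [(1, [Eps2, Eps1])])" | "(u, rh) = (V1, [(1, [Eps1, Eps2])])"
  | s where "s : {1..r}" "(u, rh) = (V2, [(1, [Eps2, Alpha s]), (-1, [Beta s, Eps1])])"
  | s where "s : {1..r}" "(u, rh) = (V1, [(1, [Eps1, Beta s]), (-1, [Alpha s, Eps2])])" unfolding Lam_def eps_relns_def by auto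
 then show "EX w. ALL (c, p):set rh. qpath (Lam r :: 'k kquiver) u p w" by cases (auto intro: exI[of _ V1] exI[of _ V2])
qed (auto simp: finite_kron_arrows finite_vertex)

interpretation kQ: fin_bquiver "kQ r :: 'k::{finite,field} kquiver" for r by unfold_locales (auto simp: finite_kron_arrows finite_vertex)

lemma reps_Lam_iff: "M : reps (Lam r) \<longleftrightarrow> prerep (Lam r) M &
  (ALL x:Sp M V2. Mp M Eps1 (Mp M Eps2 x) = 0) & (ALL x:Sp M V1. Mp M Eps2 (Mp M Eps1 x) = 0) &
  (ALL s:{1..r}. ALL x:Sp M V2. Mp M (Alpha s) (Mp M Eps2 x) = Mp M Eps1 (Mp M (Beta s) x)) &
  (ALL s:{1..r}. ALL x:Sp M V1. Mp M (Beta s) (Mp M Eps1 x) = Mp M Eps2 (Mp M (Alpha s) x))" unfolding reps_iff by (auto simp: Lam_def eps_relns_def ball_Un)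

section \<open>Dimension vectors and homogeneity of the defining relations\<close>

definition dimv :: "'k::field krep => nat \<times> nat" where
 "dimv M = (dm (Sp M V1), dm (Sp M V2))"

text \<open>Unique factorization makes the rational number 2^(d_1) 3^(d_2) a faithful code for the
  dimension vector, and a ratio of two such numbers a faithful code for the difference of dimension
  vectors.\<close>

definition kwt :: "'k::field krep => real" where
 "kwt M = 2 ^ fst (dimv M) * 3 ^ snd (dimv M)"

lemma pow23_unique:
 assumes "(2::real) ^ a * 3 ^ b = 2 ^ c * 3 ^ d"
 shows "a = c & b = d"
proof -
 have e: "(2::nat) ^ a * 3 ^ b = 2 ^ c * 3 ^ d"
 proof -
  have "real (2 ^ a * 3 ^ b) = real (2 ^ c * 3 ^ d)" using assms by simp
  then show ?thesis by (simp only: of_nat_eq_iff)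
 qed
 have p: "prime (2::nat)" "prime (3::nat)" by simp_all
 have "multiplicity 2 ((2::nat) ^ a * 3 ^ b) = a" for a b using p by (simp add: prime_elem_multiplicity_mult_distrib prime_multiplicity_other multiplicity_distinct_prime_power)
 then have "a = c" using e by metis
 moreover have "b = d" using e \<open>a = c\<close> by simp
 ultimately show ?thesis by simp
qed

lemma dim_zero_space: "dm ({0} :: 'k::field poly set) = 0"
proof -
 have "dm (spn ({} :: 'k poly set)) = card ({} :: 'k poly set)" by (rule polyv.dim_span_eq_card_independent[OF polyv.independent_empty])
 then show ?thesis by (simp add: polyv.span_empty)
qed

lemma kwt_ratio:
 assumes "kwt M / kwt K = kwt M' / kwt K'"
 shows "fst (dimv M) + fst (dimv K') = fst (dimv M') + fst (dimv K)"
  "snd (dimv M) + snd (dimv K') = snd (dimv M') + snd (dimv K)"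
proof -
 have "kwt M * kwt K' = kwt M' * kwt K" using assms by (simp add: kwt_def field_simps)
 then have "(2::real) ^ (fst (dimv M) + fst (dimv K')) * 3 ^ (snd (dimv M) + snd (dimv K')) =
   2 ^ (fst (dimv M') + fst (dimv K)) * 3 ^ (snd (dimv M') + snd (dimv K))" by (simp add: kwt_def power_add mult_ac)
 from pow23_unique[OF this] show "fst (dimv M) + fst (dimv K') = fst (dimv M') + fst (dimv K)"
  "snd (dimv M) + snd (dimv K') = snd (dimv M') + snd (dimv K)" by auto
qed

lemma kwt_cong: "dimv M = dimv N ==> kwt M = kwt N" by (simp add: kwt_def)

text \<open>The Euler form of kQ on dimension vectors, with r arrows in each direction.\<close>

definition ebil :: "nat => nat \<times> nat => nat \<times> nat => int" where
 "ebil r d e = int (fst d * fst e + snd d * snd e) - int r * int (fst d * snd e + snd d * fst e)"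

lemma restr_kQ: "M : reps (Lam r) ==> restr (kQ r) M : reps (kQ r)"
proof -
 assume M: "M : reps (Lam r)"
 note p = prD[OF prR[OF M]]
 show ?thesis unfolding reps_iff prerep_def restr_def using p by auto
qed

lemma euler_kQ:
 fixes M N :: "'k::{finite,field} krep"
 assumes M: "M : mL r" and N: "N : mL r"
 shows "euler (kQ r) (restr (kQ r) M) (restr (kQ r) N) = ebil r (dimv M) (dimv N)"
proof -
 note m = Lam.mnD[OF M] and n = Lam.mnD[OF N]
 have f: "fdim (restr (kQ r) M)" "fdim (restr (kQ r) N)" using m(2) n(2) by (simp_all add: fdim_def restr_def)
 have ka: "kron_arrows r = Alpha ` {1..r} \<union> Beta ` {1..r}" "Alpha ` {1..r} \<inter> Beta ` {1..r} = {}" by (auto simp: kron_arrows_def)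
 have "(SUM a:kron_arrows r. int (dm (Sp M (src a)) * dm (Sp N (tgt a)))) =
   int r * int (dm (Sp M V1) * dm (Sp N V2) + dm (Sp M V2) * dm (Sp N V1))" unfolding ka(1) by (subst sum.union_disjoint[OF _ _ ka(2)]) (simp_all add: sum.reindex inj_on_def algebra_simps)
 then show ?thesis using kQ.euler_eq[OF restr_kQ[OF m(1)] restr_kQ[OF n(1)] _ f] by (simp add: restr_def UNIV_vertex ebil_def dimv_def)
qed

lemma projective_zero_rep: "projective_rep (Lam r) (zero_rep :: 'k::{finite,field} krep)" unfolding projective_rep_def
proof (intro conjI ballI impI)
 fix X Y :: "'k krep" and g h assume X: "X : reps (Lam r)" and h: "h : Homs (Lam r) zero_rep Y" and g: "g : Homs (Lam r) X Y"
 note s = sb_0[OF prD(1)[OF prR[OF X]]]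
 have "(%_ _. 0) : Homs (Lam r) zero_rep X" by (rule HomsI) (simp_all add: lin_map_zero prD(1)[OF prR[OF X]] prerep_Mp0[OF prR[OF X]])
 moreover have "g i 0 = h i 0" for i using lin_map0[OF HomsD(1)[OF g]] lin_map0[OF HomsD(1)[OF h]] by simp
 ultimately show "EX h':Homs (Lam r) zero_rep X. ALL i. ALL x:Sp zero_rep i. g i (h' i x) = h i x" by (intro bexI[of _ "%_ _. 0"]) auto
qed (rule Lam.mnD(1)[OF Lam.zero_rep_modnil])

lemma zero_rep_Pd1: "(zero_rep :: 'k::{finite,field} krep) : Pd1 (Lam r)"
proof -
 have s0: "subsp {0::'k poly}" by (simp add: polyv.subspace_def)
 have h: "(%_ _. 0) : Homs (Lam r) (zero_rep :: 'k krep) zero_rep" by (rule HomsI) (simp_all add: lin_map_zero s0)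
 have "ses (Lam r) (zero_rep :: 'k krep) (%_ _. 0) zero_rep (%_ _. 0) zero_rep" unfolding ses_def using h by auto
 then show ?thesis unfolding Pd1_def using Lam.zero_rep_modnil projective_zero_rep by blast
qed

lemma dim_ses:
 fixes L :: "'k::{finite,field} krep"
 assumes K: "K : mL r" and M: "M : mL r" and L: "L : reps (Lam r)" and s: "ses (Lam r) K f L g M"
 shows "dimv L = (fst (dimv K) + fst (dimv M), snd (dimv K) + snd (dimv M))"
proof -
 have e: "(f, L, g) : extns (Lam r) M K" using s L unfolding extns_def by simp
 obtain z where z: "z : Lam.cocycles r M K" "(Lam.std_extn r M K z, (f, L, g)) : ext_equiv (Lam r) M K" by (rule Lam.extn_std[OF Lam.mnD(1)[OF M] Lam.mnD(1)[OF K] e]) (rule that)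
 have i: "iL r (Lam.ext_rep r M K z) L" by (rule Lam.ext_equiv_iso[OF z(2)[unfolded Lam.std_extn_def] Lam.mnD(1)[OF K]])
 note m = Lam.mnD[OF Lam.ext_rep_modnil[OF M K z(1)]]
 note d = Lam.iso_dim(1)[OF m(3,2) prR[OF L] i]
 have "dm (Sp L j) = dm (Sp K j) + dm (Sp M j)" for j using d[of j] dim_pprod[OF prD(1)[OF Lam.mnD(3)[OF K]] _ prD(1)[OF Lam.mnD(3)[OF M]], of j j]
   Lam.mnD(2)[OF K] Lam.mnD(2)[OF M] by (simp add: fdim_def)
 then show ?thesis by (simp add: dimv_def)
qed

lemma dim_dsum:
 fixes X :: "'k::{finite,field} krep"
 assumes K: "K : mL r" and M: "M : mL r" and X: "X : mL r" and s: "is_dsum (Lam r) X K M"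
 shows "dimv X = (fst (dimv K) + fst (dimv M), snd (dimv K) + snd (dimv M))"
proof -
 obtain f g where b: "!!i. bij_betw (%(x, y). f i x + g i y) (Sp K i \<times> Sp M i) (Sp X i)" using s unfolding is_dsum_def by blast
 note c = card_poly_subspace[OF prD(1)[OF Lam.mnD(3)[OF K]] Lam.mnD(2)[OF K, unfolded fdim_def, rule_format]]
  card_poly_subspace[OF prD(1)[OF Lam.mnD(3)[OF M]] Lam.mnD(2)[OF M, unfolded fdim_def, rule_format]]
  card_poly_subspace[OF prD(1)[OF Lam.mnD(3)[OF X]] Lam.mnD(2)[OF X, unfolded fdim_def, rule_format]]
 have "dm (Sp X j) = dm (Sp K j) + dm (Sp M j)" for j
 proof -
  have "CARD('k) ^ dm (Sp X j) = CARD('k) ^ (dm (Sp K j) + dm (Sp M j))" using bij_betw_same_card[OF b[of j]] c[of j] by (simp add: card_cartesian_product power_add)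
  then show ?thesis using power_inject_exp[OF CARD_gt1[where ?'k='k]] by blast
 qed
 then show ?thesis by (simp add: dimv_def)
qed

lemma dimv_iso:
 fixes M :: "'k::{finite,field} krep"
 assumes "M : mL r" "N : mL r" "iL r M N"
 shows "dimv M = dimv N" using Lam.iso_dim(1)[OF Lam.mnD(3,2)[OF assms(1)] Lam.mnD(3)[OF assms(2)] assms(3)] by (simp add: dimv_def)

text \<open>Both kinds of relations are homogeneous: restriction to the subalgebra generated by the
  \<epsilon> keeps the vertex spaces, and dimensions add up in the same way in exact sequences and
  in direct sums.\<close>

lemma hall_rels_cases:
 fixes g :: "('k::{finite,field}, vertex, arrow) hall"
 assumes "g : hall_rels r"
 obtains L X where "L : mL r" "X : mL r" "dimv L = dimv X" "g = (%Z. hL r L Z - hL r X Z)"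
proof -
 consider K K' where "g = hL r K \<ominus>\<^bsub>LH r\<^esub> hL r K'" "K : Pd1 (Lam r)" "K' : Pd1 (Lam r)" "iso_rep HH (restr HH K) (restr HH K')"
  | L X K M f h where "g = hL r L \<ominus>\<^bsub>LH r\<^esub> hL r X" "K : Pd1 (Lam r)" "M : mL r" "L : mL r"
   "X : mL r" "ses (Lam r) K f L h M" "is_dsum (Lam r) X K M" using assms unfolding hall_rels_def by blast
 then show thesis
 proof cases
  case 1
  have K: "K : mL r" "K' : mL r" using 1 unfolding Pd1_def by auto
  obtain f where "!!i. bij_betw (f i) (Sp K i) (Sp K' i)" using 1(4) unfolding iso_rep_def restr_def by auto
  then have "card (Sp K i) = card (Sp K' i)" for i using bij_betw_same_card by blast
  then have "dimv K = dimv K'" using dim_eq_iff_card[OF prD(1)[OF Lam.mnD(3)[OF K(1)]] _ prD(1)[OF Lam.mnD(3)[OF K(2)]]]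
    Lam.mnD(2)[OF K(1)] Lam.mnD(2)[OF K(2)] by (simp add: dimv_def fdim_def)
  then show ?thesis using that[of K K'] K 1(1) Lam.hall_diff[OF Lam.hcls_closed[OF K(1)] Lam.hcls_closed[OF K(2)]] by simp
 next
  case 2
  have K: "K : mL r" using 2 unfolding Pd1_def by auto
  have "dimv L = dimv X" using dim_ses[OF K 2(3) Lam.mnD(1)[OF 2(4)] 2(6)] dim_dsum[OF K 2(3,5,7)] by simp
  then show ?thesis using that[of L X] 2 Lam.hall_diff[OF Lam.hcls_closed[OF 2(4)] Lam.hcls_closed[OF 2(5)]] by simp
 qed
qed

lemma hall_rels_closed: "hall_rels r <= carrier (hall (Lam r :: 'k::{finite,field} kquiver))"
proof
 fix g :: "('k, vertex, arrow) hall" assume "g : hall_rels r"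
 then obtain L X where g: "L : mL r" "X : mL r" "g = (%Z. hL r L Z - hL r X Z)" by (rule hall_rels_cases)
 have "(%Z. hL r L Z + (-1) * hL r X Z) : cH r" by (intro Lam.hall_add_closed Lam.hall_scale_closed Lam.hcls_closed g Lam.Kv_closed) auto
 then show "g : cH r" using g(3) by simp
qed

lemma kwt_nonzero: "kwt M ~= 0" by (simp add: kwt_def)

lemma twist_exp_eq:
 fixes M K N L :: "'k::{finite,field} krep"
 assumes "M : mL r" "K : Pd1 (Lam r)" "N : mL r" "L : Pd1 (Lam r)"
 shows "twist_exp r M K N L = ebil r (dimv M) (dimv N) - ebil r (dimv M) (dimv L) - ebil r (dimv K) (dimv N) + ebil r (dimv K) (dimv L)"
proof -
 have "K : mL r" "L : mL r" using assms unfolding Pd1_def by auto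
 then show ?thesis using assms by (simp add: twist_exp_def Let_def euler_kQ)
qed

interpretation TH: twisted_hall "Lam r :: 'k::{finite,field} kquiver" "hall_rels r" "Pd1 (Lam r)" kwt "twist_exp r" for r
proof
 show "hall_rels r <= carrier (hall (Lam r :: 'k kquiver))" by (rule hall_rels_closed)
 show "Pd1 (Lam r :: 'k kquiver) <= mL r" unfolding Pd1_def by blast
 show "zero_rep : Pd1 (Lam r :: 'k kquiver)" by (rule zero_rep_Pd1)
 show "kwt (zero_rep :: 'k krep) = 1" by (simp add: kwt_def dimv_def dim_zero_space)
 fix M N :: "'k krep" assume M: "M : mL r"
 show "kwt M : \<rat>" by (simp add: kwt_def)
 show "kwt M ~= 0" by (rule kwt_nonzero)
 assume N: "N : mL r"
 show "iL r M N ==> kwt M = kwt N" using dimv_iso[OF M N] kwt_cong by blast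
 show "kwt (Lam.ext_rep r M N z) = kwt M * kwt N" for z using dim_pprod[OF prD(1)[OF Lam.mnD(3)[OF N]] _ prD(1)[OF Lam.mnD(3)[OF M]]]
   Lam.mnD(2)[OF N] Lam.mnD(2)[OF M] by (simp add: kwt_def dimv_def fdim_def power_add)
next
 fix g :: "('k, vertex, arrow) hall" assume "g : hall_rels r"
 then obtain L X where g: "L : mL r" "X : mL r" "dimv L = dimv X" "g = (%Z. hL r L Z - hL r X Z)" by (rule hall_rels_cases)
 have "kwt (SOME M. M : Y) = kwt L" if "g Y ~= 0" for Y
 proof -
  have "Y = isocl (Lam r) L \<or> Y = isocl (Lam r) X" using that g(4) by (auto simp: hcls_def split: if_splits)
  then show ?thesis using dimv_iso[OF g(1) Lam.some_isocl[OF g(1)]] dimv_iso[OF g(2) Lam.some_isocl[OF g(2)]] g(3) kwt_cong by metis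
 qed
 then show "EX M :: 'k krep. M : mL r & (ALL X. g X ~= 0 --> kwt (SOME M. M : X) = kwt M)" using g(1) by (intro exI[of _ L]) simp
next
 fix M K M' K' N L :: "'k krep"
 assume a: "M : mL r" "K : Pd1 (Lam r)" "M' : mL r" "K' : Pd1 (Lam r)" "N : mL r" "L : Pd1 (Lam r)"
  and w: "kwt M / kwt K = kwt M' / kwt K'"
 from kwt_ratio[OF w] have d: "int (fst (dimv M)) - int (fst (dimv K)) = int (fst (dimv M')) - int (fst (dimv K'))"
  "int (snd (dimv M)) - int (snd (dimv K)) = int (snd (dimv M')) - int (snd (dimv K'))" by linarith+
 \<comment> \<open>By bilinearity the exponent is the Euler form evaluated at the differences of
   dimension vectors.\<close>
 have e1: "ebil r x y - ebil r x y' - ebil r x' y + ebil r x' y' =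
  (int (fst x) - int (fst x')) * (int (fst y) - int (fst y')) + (int (snd x) - int (snd x')) * (int (snd y) - int (snd y'))
  - int r * ((int (fst x) - int (fst x')) * (int (snd y) - int (snd y')) + (int (snd x) - int (snd x')) * (int (fst y) - int (fst y')))" for x x' y y' by (simp add: ebil_def algebra_simps)
 show "twist_exp r M K N L = twist_exp r M' K' N L" "twist_exp r N L M K = twist_exp r N L M' K'" using a by (simp_all add: twist_exp_eq e1 d)
qed

section \<open>The iHall algebra of the Kronecker iquiver\<close>

definition ebr :: "nat => ('k::{finite,field}, vertex, arrow) hall => 'k ihall" where
 "ebr r fi = loc_emb (hall_quot r) (hall_S r) (hall_ideal r +>\<^bsub>LH r\<^esub> fi)"

lemma TH_cs: "weighted_hall.cs (Lam r) (hall_rels r) fi = hall_ideal r +>\<^bsub>LH r\<^esub> fi" by (simp add: TH.cs_def hall_ideal_def)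

text \<open>The locale spells out the quotient, the denominators and the localization. These
  equations and the following ones let its results be read in terms of \<open>sd_hall\<close>,
  \<open>iscale\<close>, \<open>frac\<close> and \<open>twist_mult\<close>.\<close>

lemma TH_eqs:
 "hall_quot r = hall (Lam r) Quot ideal_gen (hall (Lam r)) (hall_rels r)"
 "hall_S r = {weighted_hall.cs (Lam r) (hall_rels r) (%X. a * hL r K X) |a K. a : \<rat> & a ~= 0 & K : Pd1 (Lam r)}" by (simp_all add: hall_quot_def hall_ideal_def hall_S_def qcls_def TH_cs)

lemma TH_R: "localization (hall (Lam r) Quot ideal_gen (hall (Lam r)) (hall_rels r))
 {weighted_hall.cs (Lam r) (hall_rels r) (%X. a * hL r K X) |a K. a : \<rat> & a ~= 0 & K : Pd1 (Lam r)} = sd_hall r" by (simp add: sd_hall_def TH_eqs)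

lemma TH_eb: "weighted_hall.eb (Lam r) (hall_rels r) (Pd1 (Lam r)) = ebr r" by (rule ext) (simp add: TH.eb_def ebr_def TH_eqs TH_cs)

lemma icls_eq: "icls r M = ebr r (hL r M)" by (simp add: icls_def ebr_def qcls_def)

lemma TH_isc: "weighted_hall.isc (Lam r) (hall_rels r) (Pd1 (Lam r)) = iscale r" by (intro ext) (simp add: TH.isc_def iscale_def TH_eb TH_R ebr_def qcls_def)

lemma TH_fr: "weighted_hall.fr (Lam r) (hall_rels r) (Pd1 (Lam r)) = frac r" by (intro ext) (simp add: TH.fr_def frac_def TH_eb TH_R icls_eq)

lemma TH_tw: "twisted_hall.tw (Lam r :: 'k::{finite,field} kquiver) (hall_rels r) (Pd1 (Lam r)) (twist_exp r) = twist_mult r" by (intro ext) (simp only: TH.tw_def twist_mult_def TH_isc TH_fr TH_R fracs_def)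

lemma ring_sd_hall: "ring (sd_hall r :: 'k::{finite,field} ihall ring)" using TH.R.ring_axioms[of r] unfolding TH_R .

lemma ebr_closed: "fi : cH r ==> ebr r fi : carrier (sd_hall r)" for fi :: "('k::{finite,field}, vertex, arrow) hall" using TH.eb_closed[of fi r] unfolding TH_eb TH_R .

lemma ebr_add: "fi : cH r ==> gi : cH r ==> ebr r (%X. fi X + gi X) = ebr r fi \<oplus>\<^bsub>sd_hall r\<^esub> ebr r gi"
 for fi :: "('k::{finite,field}, vertex, arrow) hall" using TH.eb_add[of fi r gi] unfolding TH_eb TH_R .

lemma ebr_mult: "fi : cH r ==> gi : cH r ==> ebr r (fi \<otimes>\<^bsub>LH r\<^esub> gi) = ebr r fi \<otimes>\<^bsub>sd_hall r\<^esub> ebr r gi"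
 for fi :: "('k::{finite,field}, vertex, arrow) hall" using TH.eb_mult[of fi r gi] unfolding TH_eb TH_R .

lemma ebr_zero: "ebr r (%_. 0) = \<zero>\<^bsub>sd_hall r\<^esub>" and ebr_one: "ebr r (hL r zero_rep) = \<one>\<^bsub>sd_hall r\<^esub>" using TH.eb_zero[of r] TH.eb_one[of r] unfolding TH_eb TH_R .

lemma ebr_cong: "(%X. fi X - gi X) : hall_ideal r ==> ebr r fi = ebr r gi" for fi :: "('k::{finite,field}, vertex, arrow) hall" using TH.eb_cong[of fi gi r] unfolding TH_eb hall_ideal_def .

lemma iscale_ebr: "fi : cH r ==> c : Qv (vq TYPE('k)) ==> iscale r c (ebr r fi) = ebr r (%X. c * fi X)"
 for fi :: "('k::{finite,field}, vertex, arrow) hall" using TH.isc_eb[of fi r c] unfolding TH_eb TH_isc .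

lemma ebr_Units: "K : Pd1 (Lam r) ==> ebr r (hL r K) : Units (sd_hall r)" for K :: "'k::{finite,field} krep" using TH.P_Units[of K r] unfolding TH_eb TH_R .

definition hdeg :: "nat => ('k::{finite,field}, vertex, arrow) hall => nat \<times> nat => bool" where
 "hdeg r fi d \<longleftrightarrow> fi : cH r & (ALL M:mL r. fi (isocl (Lam r) M) ~= 0 --> dimv M = d)"

lemma dimv_zero_rep: "dimv (zero_rep :: 'k::field krep) = (0, 0)" by (simp add: dimv_def dim_zero_space zero_rep_def)

lemma twist_mult_ebr:
 fixes fi gi :: "('k::{finite,field}, vertex, arrow) hall"
 assumes p: "hdeg r fi d" and s: "hdeg r gi e"
 shows "twist_mult r (ebr r fi) (ebr r gi) = ebr r (%Z. vq TYPE('k) powi ebil r d e * (fi \<otimes>\<^bsub>LH r\<^esub> gi) Z)"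
proof -
 have "twist_exp r M zero_rep N zero_rep = ebil r d e" if "M : mL r" "N : mL r" "fi (isocl (Lam r) M) ~= 0" "gi (isocl (Lam r) N) ~= 0" for M N using that p s by (simp add: hdeg_def twist_exp_eq zero_rep_Pd1 dimv_zero_rep ebil_def)
 then show ?thesis using TH.tw_eb[of fi r gi "ebil r d e"] p s unfolding TH_eb TH_tw hdeg_def by blast
qed

lemma hdeg_scale: "hdeg r fi d ==> c : Qv (vq TYPE('k)) ==> hdeg r (%X. c * fi X) d" for fi :: "('k::{finite,field}, vertex, arrow) hall" unfolding hdeg_def using Lam.hall_scale_closed by auto

lemma hdeg_hcls: "M : mL r ==> hdeg r (hL r M) (dimv M)" for M :: "'k::{finite,field} krep" unfolding hdeg_def
proof (intro conjI ballI impI)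
 fix N assume M: "M : mL r" and N: "N : mL r" "hL r M (isocl (Lam r) N) ~= 0"
 then have "isocl (Lam r) N = isocl (Lam r) M" by (auto simp: hcls_def split: if_splits)
 then show "dimv N = dimv M" using Lam.isocl_eq_iff[OF N(1) M] dimv_iso[OF N(1) M] by blast
qed (rule Lam.hcls_closed)

lemma hdeg_sum: "(!!j. j : J ==> hdeg r (fi j) d) ==> hdeg r (%X. SUM j:J. fi j X) d"
 for fi :: "'j => ('k::{finite,field}, vertex, arrow) hall" unfolding hdeg_def
proof (intro conjI ballI impI)
 fix M assume h: "!!j. j : J ==> fi j : cH r & (ALL M:mL r. fi j (isocl (Lam r) M) ~= 0 --> dimv M = d)"
  and M: "M : mL r" and n: "(SUM j:J. fi j (isocl (Lam r) M)) ~= 0"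
 obtain j where "j : J" "fi j (isocl (Lam r) M) ~= 0" using n sum.not_neutral_contains_not_neutral by blast
 then show "dimv M = d" using h M by blast
qed (rule Lam.hall_sum_closed, blast)

lemma iHall_simps [simp]: "carrier (iHall r) = carrier (sd_hall r)" "add (iHall r) = add (sd_hall r)"
 "zero (iHall r) = zero (sd_hall r)" "one (iHall r) = one (sd_hall r)" "monoid.mult (iHall r) = twist_mult r" by (simp_all add: iHall_def)

lemma finsum_iHall_ebr:
 fixes fi :: "'j => ('k::{finite,field}, vertex, arrow) hall"
 assumes "finite J" "!!j. j : J ==> fi j : cH r"
 shows "(\<Oplus>\<^bsub>iHall r\<^esub>j\<in>J. ebr r (fi j)) = ebr r (%X. SUM j:J. fi j X)"
proof -
 interpret ring "sd_hall r :: 'k ihall ring" by (rule ring_sd_hall)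
 \<comment> \<open>A finite sum sees only the additive structure, which \<open>iHall\<close> shares
   with the ring \<open>sd_hall\<close>.\<close>
 have "(\<Oplus>\<^bsub>iHall r\<^esub>j\<in>J. ebr r (fi j)) = (\<Oplus>\<^bsub>sd_hall r\<^esub>j\<in>J. ebr r (fi j))" by (simp add: finsum_def)
 also have "... = ebr r (%X. SUM j:J. fi j X)" using assms
 proof (induction J rule: finite_induct)
  case (insert j J)
  then have "(%X. SUM j:J. fi j X) : cH r" by (intro Lam.hall_sum_closed) auto
  with insert show ?case by (subst finsum_insert) (auto simp: ebr_closed ebr_add)
 qed (simp add: ebr_zero)
 finally show ?thesis .
qed

section \<open>A projective resolution of \<open>K\<^sub>1\<close>\<close>

text \<open>
 With \<open>x\<^sub>s = \<alpha>\<^sub>s + \<beta>\<^sub>s\<close> and \<open>\<epsilon> = \<epsilon>\<^sub>1 + \<epsilon>\<^sub>2\<close> the relations say that \<open>\<epsilon>\<close> is central of square zero.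
 The projective module at vertex 1 therefore has the basis \<open>w \<epsilon>\<^sup>f\<close> with \<open>w\<close> a word in \<open>1, \<dots>, r\<close>; the
 nonempty words span a projective submodule whose quotient is \<open>K\<^sub>1\<close>.
\<close>

fun opv :: "vertex => vertex" where "opv V1 = V2" | "opv V2 = V1"
fun arr :: "nat => vertex => arrow" where "arr s V1 = Alpha s" | "arr s V2 = Beta s"
fun eps :: "vertex => arrow" where "eps V1 = Eps1" | "eps V2 = Eps2"

lemma arr_simps [simp]: "src (arr s j) = j" "tgt (arr s j) = opv j" "src (eps j) = j" "tgt (eps j) = opv j" "opv (opv j) = j" by (cases j; simp)+

lemma Lam_arcs_cases:
 assumes "a : kron_arrows r \<union> {Eps1, Eps2}"
 obtains s where "s : {1..r}" "a = arr s (src a)" | "a = eps (src a)" using assms by (cases a) (auto simp: kron_arrows_def)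

lemma arr_arcs [simp]: "arr s j : kron_arrows r \<longleftrightarrow> s : {1..r}" "eps j = Eps1 \<or> eps j = Eps2 \<or> eps j : kron_arrows r" by (cases j; auto simp: kron_arrows_def)+

lemma arcs_arr: "s : {1..r} ==> arr s j : arrs (Lam r)" and arcs_eps: "eps j : arrs (Lam r)" by (cases j; simp add: kron_arrows_def)+

lemma reps_Lam_rels:
 assumes "X : reps (Lam r)" "x : Sp X j"
 shows "Mp X (eps (opv j)) (Mp X (eps j) x) = 0"
  "s : {1..r} ==> Mp X (arr s (opv j)) (Mp X (eps j) x) = Mp X (eps (opv j)) (Mp X (arr s j) x)" using assms unfolding reps_Lam_iff by (cases j; simp)+

text \<open>Polynomials serve as the space with basis \<open>monom 1 n\<close>; this extends a
  prescription on the basis linearly. Together with \<open>PS\<close>, the span of the monomials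
  with exponents in a given set, it allows modules with a combinatorial basis.\<close>

definition lext :: "(nat => 'k::field poly) => 'k poly => 'k poly" where
 "lext v p = (SUM n:{n. coeff p n ~= 0}. sm (coeff p n) (v n))"

lemma finite_coeffs: "finite {n. coeff p n ~= 0}" by (rule finite_subset[of _ "{..degree p}"]) (auto simp: le_degree)

lemma lext_eq: "finite F ==> {n. coeff p n ~= 0} <= F ==> lext v p = (SUM n:F. sm (coeff p n) (v n))" unfolding lext_def by (rule sum.mono_neutral_left) auto

lemma lext_add: "lext v (p + q) = lext v p + lext v q"
proof -
 let ?F = "{n. coeff p n ~= 0} \<union> {n. coeff q n ~= 0}"
 have F: "finite ?F" by (simp add: finite_coeffs)
 have "{n. coeff (p + q) n ~= 0} <= ?F" by auto
 then show ?thesis using lext_eq[OF F, of "p + q" v] lext_eq[OF F, of p v] lext_eq[OF F, of q v] by (simp add: smult_add_left sum.distrib)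
qed

lemma lext_sm: "lext v (sm c p) = sm c (lext v p)"
proof -
 have "{n. coeff (sm c p) n ~= 0} <= {n. coeff p n ~= 0}" by auto
 from lext_eq[OF finite_coeffs this, of v] show ?thesis by (simp add: lext_def polyv.scale_sum_right)
qed

lemma lext_monom [simp]: "lext v (monom 1 n) = v n" using lext_eq[of "{n}" "monom (1::'a) n" v] by (auto simp: coeff_monom)

definition PS :: "nat set => 'k::field poly set" where
 "PS D = {p. ALL n. coeff p n ~= 0 --> n : D}"

lemma subspace_PS: "subsp (PS D)" unfolding polyv.subspace_def PS_def by (auto intro: ccontr) (metis add.right_neutral)

lemma monom_PS: "monom (1::'k::field) n : PS D \<longleftrightarrow> n : D" by (auto simp: PS_def coeff_monom)

lemma PS_span: "PS D <= spn (monom (1::'k::field) ` D)"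
proof
 fix p :: "'k poly" assume p: "p : PS D"
 have "p = (SUM n:{n. coeff p n ~= 0}. sm (coeff p n) (monom 1 n))" by (rule poly_eqI) (simp add: coeff_sum coeff_monom finite_coeffs if_distrib[of "(*) _"] sum.delta' cong: if_cong)
 moreover have "(SUM n:{n. coeff p n ~= 0}. sm (coeff p n) (monom 1 n)) : spn (monom 1 ` D)" using p by (intro polyv.span_sum polyv.span_scale polyv.span_base) (auto simp: PS_def)
 ultimately show "p : spn (monom 1 ` D)" by simp
qed

lemma lin_map_PS_eqI:
 assumes "f : lin_map (PS D) W" "g : lin_map (PS D) W'" "!!n. n : D ==> f (monom 1 n) = g (monom 1 n)"
 shows "f = g" by (rule lin_map_eqI[OF assms(1,2) subspace_PS _ PS_span]) (use assms(3) monom_PS in auto)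

lemma lin_map_lext:
 assumes W: "subsp W" and v: "!!n. n : D ==> v n : W"
 shows "(%p. if p : PS D then lext v p else 0) : lin_map (PS D) W"
proof (rule lin_mapI)
 fix p :: "'a poly" assume p: "p : PS D"
 have "lext v p : W" unfolding lext_def by (rule polyv.subspace_sum[OF W], rule sb_scale[OF W], rule v) (use p in "auto simp: PS_def")
 then show "(if p : PS D then lext v p else 0) : W" using p by simp
qed (simp_all add: lext_add lext_sm sb_add[OF subspace_PS] sb_scale[OF subspace_PS])

text \<open>Every arrow changes the vertex, so a path from vertex 1 ends at the vertex given by the
  parity of its length. In a word the letter s stands for whichever of \<alpha>_s and \<beta>_s can
  be applied at that place.\<close>

definition vt :: "nat list => bool => vertex" where
 "vt w f = (if even (length w + of_bool f) then V1 else V2)"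

lemma vt_simps [simp]: "vt (s # w) f = opv (vt w f)" "vt w True = opv (vt w False)" "vt [] False = V1" by (auto simp: vt_def)

text \<open>Basis elements are coded as exponents by \<open>to_nat\<close>. With k = 0 this is the
  basis of the projective module at vertex 1, with k = 1 that of the submodule of nonempty
  words.\<close>

definition WB :: "nat => nat => vertex => nat set" where
 "WB r k j = {to_nat (w, f) | w f. set w <= {1..r} & k <= length w & vt w f = j}"

fun wact :: "arrow => nat list \<times> bool => 'k::field poly" where
 "wact (Alpha s) (w, f) = monom 1 (to_nat (s # w, f))"
| "wact (Beta s) (w, f) = monom 1 (to_nat (s # w, f))"
| "wact Eps1 (w, f) = (if f then 0 else monom 1 (to_nat (w, True)))"
| "wact Eps2 (w, f) = (if f then 0 else monom 1 (to_nat (w, True)))"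

lemma wact_arr [simp]: "wact (arr s j) (w, f) = monom 1 (to_nat (s # w, f))"
 "wact (eps j) (w, f) = (if f then 0 else monom 1 (to_nat (w, True)))" by (cases j; simp)+

definition word_rep :: "nat => nat => 'k::field krep" where
 "word_rep r k = \<lparr>Sp = (%j. PS (WB r k j)), Mp = (%a p. if a : kron_arrows r \<union> {Eps1, Eps2} & p : PS (WB r k (src a))
  then lext (%n. wact a (from_nat n)) p else 0)\<rparr>"

lemma Sp_word_rep [simp]: "Sp (word_rep r k) j = PS (WB r k j)" by (simp add: word_rep_def)

lemma Mp_word_rep: "a : kron_arrows r \<union> {Eps1, Eps2} ==> p : PS (WB r k (src a)) ==>
  Mp (word_rep r k) a p = lext (%n. wact a (from_nat n)) p" by (simp add: word_rep_def)

lemma WB_I: "set w <= {1..r} ==> k <= length w ==> vt w f = j ==> to_nat (w, f) : WB r k j" unfolding WB_def by blast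

lemma WB_E:
 assumes "n : WB r k j"
 obtains w f where "n = to_nat (w, f)" "set w <= {1..r}" "k <= length w" "vt w f = j" using assms unfolding WB_def by blast

lemma wact_closed:
 assumes a: "a : kron_arrows r \<union> {Eps1, Eps2}" and n: "n : WB r k (src a)"
 shows "(wact a (from_nat n) :: 'k::field poly) : PS (WB r k (tgt a))"
proof -
 obtain w f where w: "n = to_nat (w, f)" "set w <= {1..r}" "k <= length w" "vt w f = src a" using n by (rule WB_E)
 show ?thesis using a
 proof (rule Lam_arcs_cases)
  fix s assume s: "s : {1..r}" and e: "a = arr s (src a)"
  have "tgt a = opv (src a)" by (subst e) simp
  moreover have "(wact a (from_nat n) :: 'k poly) = monom 1 (to_nat (s # w, f))" unfolding w(1) by (subst e) simp
  ultimately show ?thesis using w s by (simp add: monom_PS WB_I)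
 next
  assume e: "a = eps (src a)"
  have "tgt a = opv (src a)" by (subst e) simp
  moreover have "(wact a (from_nat n) :: 'k poly) = (if f then 0 else monom 1 (to_nat (w, True)))" unfolding w(1) by (subst e) simp
  ultimately show ?thesis using w sb_0[OF subspace_PS] by (auto simp: monom_PS intro!: WB_I)
 qed
qed

lemma prerep_word_rep: "prerep (Lam r :: 'k kquiver) (word_rep r k :: 'k::field krep)" unfolding prerep_def
proof (intro conjI allI ballI impI)
 fix a assume a: "a : arrs (Lam r :: 'k kquiver)"
 then have a': "a : kron_arrows r \<union> {Eps1, Eps2}" by simp
 have "Mp (word_rep r k :: 'k krep) a = (%p. if p : PS (WB r k (src a)) then lext (%n. wact a (from_nat n)) p else 0)" using a' by (auto simp: word_rep_def fun_eq_iff)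
 then show "Mp (word_rep r k :: 'k krep) a : lin_map (Sp (word_rep r k) (tv (Lam r :: 'k kquiver) a)) (Sp (word_rep r k) (hv (Lam r :: 'k kquiver) a))" using lin_map_lext[OF subspace_PS, of "WB r k (src a)" "%n. wact a (from_nat n) :: 'k poly" "WB r k (tgt a)"] wact_closed[OF a', where ?'k = 'k] by simp
qed (auto simp: word_rep_def subspace_PS)

lemma Mp_word_arr: 
 assumes "s : {1..r}" "set w <= {1..r}" "k <= length w" "vt w f = j"
 shows "Mp (word_rep r k) (arr s j) (monom 1 (to_nat (w, f))) = monom 1 (to_nat (s # w, f))" using assms arcs_arr[of s r j] by (subst Mp_word_rep) (auto simp: monom_PS WB_I)

lemma Mp_word_eps: 
 assumes "set w <= {1..r}" "k <= length w" "vt w f = j"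
 shows "Mp (word_rep r k) (eps j) (monom 1 (to_nat (w, f))) = (if f then 0 else monom 1 (to_nat (w, True)))" using assms arcs_eps[of j r] by (subst Mp_word_rep) (auto simp: monom_PS WB_I)

lemma word_rep_reps: "(word_rep r k :: 'k::{finite,field} krep) : reps (Lam r)"
proof -
 let ?P = "word_rep r k :: 'k krep"
 note p = prerep_word_rep[of r k, where ?'k = 'k]
 have lin: "Mp ?P (arr s j) : lin_map (PS (WB r k j)) (PS (WB r k (opv j)))" if "s : {1..r}" for s j using prD(3)[OF p arcs_arr[OF that, of j]] by simp
 have lin': "Mp ?P (eps j) : lin_map (PS (WB r k j)) (PS (WB r k (opv j)))" for j using prD(3)[OF p arcs_eps, of j] by simp
 have 1: "Mp ?P (eps (opv j)) (Mp ?P (eps j) x) = 0" if x: "x : Sp ?P j" for j x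
 proof -
  have "(%x. Mp ?P (eps (opv j)) (Mp ?P (eps j) x)) = (%_. 0)"
  proof (rule lin_map_PS_eqI[OF lin_map_comp[OF lin' lin' subspace_PS] lin_map_zero[OF subspace_PS]])
   fix n assume "n : WB r k j"
   then obtain w f where "n = to_nat (w, f)" "set w <= {1..r}" "k <= length w" "vt w f = j" by (rule WB_E)
   then show "Mp ?P (eps (opv j)) (Mp ?P (eps j) (monom 1 n)) = 0" by (cases f) (auto simp: Mp_word_eps prerep_Mp0[OF p])
  qed
  then show ?thesis by (rule fun_cong)
 qed
 have 2: "Mp ?P (arr s (opv j)) (Mp ?P (eps j) x) = Mp ?P (eps (opv j)) (Mp ?P (arr s j) x)" if s: "s : {1..r}" and x: "x : Sp ?P j" for s j x
 proof -
  have "(%x. Mp ?P (arr s (opv j)) (Mp ?P (eps j) x)) = (%x. Mp ?P (eps (opv j)) (Mp ?P (arr s j) x))"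
  proof (rule lin_map_PS_eqI[OF lin_map_comp[OF lin' lin[OF s] subspace_PS] lin_map_comp[OF lin[OF s] lin' subspace_PS]])
   fix n assume "n : WB r k j"
   then obtain w f where "n = to_nat (w, f)" "set w <= {1..r}" "k <= length w" "vt w f = j" by (rule WB_E)
   then show "Mp ?P (arr s (opv j)) (Mp ?P (eps j) (monom 1 n)) = Mp ?P (eps (opv j)) (Mp ?P (arr s j) (monom 1 n))" using s by (cases f) (auto simp: Mp_word_eps Mp_word_arr prerep_Mp0[OF p])
  qed
  then show ?thesis by (rule fun_cong)
 qed
 show ?thesis unfolding reps_Lam_iff using p 1[of _ V1] 1[of _ V2] 2[of _ _ V1] 2[of _ _ V2] by simp
qed

text \<open>The words of length k with no \<epsilon> are free generators: a morphism is determined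
  by their images, and these may be chosen arbitrarily. The images are lifted along g; square zero
  and centrality of \<epsilon> in \<open>X\<close> make the extension to all words a
  morphism.\<close>

lemma projective_word_rep:
 assumes k: "k <= 1"
 shows "projective_rep (Lam r) (word_rep r k :: 'k::{finite,field} krep)" unfolding projective_rep_def
proof (intro conjI ballI impI)
 let ?P = "word_rep r k :: 'k krep"
 show "?P : reps (Lam r)" by (rule word_rep_reps)
 note pP = prerep_word_rep[of r k, where ?'k = 'k]
 fix X Y :: "'k krep" and g h
 assume X: "X : reps (Lam r)" and Y: "Y : reps (Lam r)" and g: "g : Homs (Lam r) X Y" and h: "h : Homs (Lam r) ?P Y"
  and sur: "ALL i. g i ` Sp X i = Sp Y i"
 note pX = prR[OF X] and pY = prR[OF Y]
 let ?m = "%w f. monom (1::'k) (to_nat (w :: nat list, f :: bool))"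
 have hm: "h (vt w f) (?m w f) : Sp Y (vt w f)" if "set w <= {1..r}" "k <= length w" for w f by (rule Homs_mem[OF h]) (simp add: monom_PS WB_I[OF that rfl])
 have "ALL w. EX x. set w <= {1..r} & length w = k --> x : Sp X (vt w False) & g (vt w False) x = h (vt w False) (?m w False)" using hm[of _ False] sur by (metis imageE order_refl)
 then obtain c where c: "!!w. set w <= {1..r} ==> length w = k ==> c w : Sp X (vt w False) & g (vt w False) (c w) = h (vt w False) (?m w False)" by metis
 \<comment> \<open>Preimages chosen for the generators of length k, continued to longer words by the
   arrows of \<open>X\<close>; each further letter is applied on the left.\<close>
 define pv where "pv = rec_list (c []) (%s w y. if length w < k then c (s # w) else Mp X (arr s (vt w False)) y)"
 have pv: "pv [] = c []" "pv (s # w) = (if length w < k then c (s # w) else Mp X (arr s (vt w False)) (pv w))" for s w by (simp_all add: pv_def)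
 have pv1: "pv w : Sp X (vt w False) & g (vt w False) (pv w) = h (vt w False) (?m w False)" if "set w <= {1..r}" "k <= length w" for w using that
 proof (induction w)
  case Nil
  then show ?case using c[of "[]"] by (simp add: pv(1))
 next
  case (Cons s w)
  show ?case
  proof (cases "length w < k")
   case True
   then show ?thesis using c[of "s # w"] Cons.prems by (simp add: pv(2))
  next
   case False
   then have w: "set w <= {1..r}" "k <= length w" "s : {1..r}" using Cons.prems by auto
   let ?j = "vt w False"
   have a: "arr s ?j : arrs (Lam r)" using w by simp
   note ih = Cons.IH[OF w(1,2)]
   have mm: "?m w False : Sp ?P ?j" using w by (simp add: monom_PS WB_I)
   have "g (opv ?j) (Mp X (arr s ?j) (pv w)) = Mp Y (arr s ?j) (h ?j (?m w False))" using HomsD(2)[OF g a, of "pv w"] ih by simp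
   also have "... = h (opv ?j) (Mp ?P (arr s ?j) (?m w False))" using HomsD(2)[OF h a, of "?m w False"] mm by simp
   also have "Mp ?P (arr s ?j) (?m w False) = ?m (s # w) False" by (rule Mp_word_arr) (use w in auto)
   finally show ?thesis using False prerep_mem[OF pX a, of "pv w"] ih by (simp add: pv(2))
  qed
 qed
 define fv where "fv = (%(w, f). if f then Mp X (eps (vt w False)) (pv w) else pv w)"
 have fv: "fv (w, False) = pv w" "fv (w, True) = Mp X (eps (vt w False)) (pv w)" for w by (simp_all add: fv_def)
 have fv1: "fv (w, f) : Sp X (vt w f) & g (vt w f) (fv (w, f)) = h (vt w f) (?m w f)" if w: "set w <= {1..r}" "k <= length w" for w f
 proof (cases f)
  case False
  then show ?thesis using pv1[OF w] by (simp add: fv)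
 next
  case True
  let ?j = "vt w False"
  have a: "eps ?j : arrs (Lam r)" by simp
  have mm: "?m w False : Sp ?P ?j" using w by (simp add: monom_PS WB_I)
  have "g (opv ?j) (Mp X (eps ?j) (pv w)) = Mp Y (eps ?j) (h ?j (?m w False))" using HomsD(2)[OF g a, of "pv w"] pv1[OF w] by simp
  also have "... = h (opv ?j) (Mp ?P (eps ?j) (?m w False))" using HomsD(2)[OF h a, of "?m w False"] mm by simp
  also have "Mp ?P (eps ?j) (?m w False) = ?m w True" using Mp_word_eps[OF w, of False ?j] by simp
  finally show ?thesis using True prerep_mem[OF pX a, of "pv w"] pv1[OF w] by (simp add: fv)
 qed
 \<comment> \<open>Linear extension of the lifts \<open>fv\<close>, in which an element ending in
   \<epsilon> is lifted by applying \<epsilon> to the lift of its word.\<close>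
 define h' where "h' = (%i p. if p : PS (WB r k i) then lext (%n. fv (from_nat n)) p else 0)"
 have h'l: "h' i : lin_map (PS (WB r k i)) (Sp X i)" for i unfolding h'_def
 proof (rule lin_map_lext[OF prD(1)[OF pX]])
  fix n assume "n : WB r k i"
  then obtain w f where "n = to_nat (w, f)" "set w <= {1..r}" "k <= length w" "vt w f = i" by (rule WB_E)
  then show "fv (from_nat n) : Sp X i" using fv1[of w f] by simp
 qed
 have h'm: "h' (vt w f) (?m w f) = fv (w, f)" if "set w <= {1..r}" "k <= length w" for w f using that by (simp add: h'_def monom_PS WB_I)
 have h'm': "h' j (?m w f) = fv (w, f)" if "set w <= {1..r}" "k <= length w" "j = vt w f" for w f j using h'm[OF that(1,2)] that(3) by simp
 have rel: "Mp X (eps (opv (vt w False))) (fv (w, True)) = 0"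
  "s : {1..r} ==> Mp X (arr s (opv (vt w False))) (fv (w, True)) = fv (s # w, True)" if w: "set w <= {1..r}" "k <= length w" for s w using reps_Lam_rels[OF X conjunct1[OF pv1[OF w]]] w by (simp_all add: fv pv)
 have h'H: "h' : Homs (Lam r) ?P X"
 proof (rule HomsI)
  show "h' i : lin_map (Sp ?P i) (Sp X i)" for i using h'l by simp
  fix a p assume "a : arrs (Lam r)" and p: "p : Sp ?P (tv (Lam r) a)"
  then have a: "a : arrs (Lam r)" "a : kron_arrows r \<union> {Eps1, Eps2}" by simp_all
  have lP: "Mp ?P a : lin_map (PS (WB r k (src a))) (PS (WB r k (tgt a)))" using prD(3)[OF pP a(1)] by simp
  have lX: "Mp X a : lin_map (Sp X (src a)) (Sp X (tgt a))" using prD(3)[OF pX a(1)] by simp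
  have "(%p. h' (tgt a) (Mp ?P a p)) = (%p. Mp X a (h' (src a) p))"
  proof (rule lin_map_PS_eqI[OF lin_map_comp[OF lP h'l subspace_PS] lin_map_comp[OF h'l lX subspace_PS]])
   fix n assume "n : WB r k (src a)"
   then obtain w f where n: "n = to_nat (w, f)" and w: "set w <= {1..r}" "k <= length w" "vt w f = src a" by (rule WB_E)
   have hs: "h' (src a) (monom 1 n) = fv (w, f)" unfolding n by (rule h'm') (use w in auto)
   show "h' (tgt a) (Mp ?P a (monom 1 n)) = Mp X a (h' (src a) (monom 1 n))" using a(2)
   proof (rule Lam_arcs_cases)
    fix s assume s: "s : {1..r}" and e: "a = arr s (src a)"
    have t: "tgt a = opv (src a)" by (subst e) simp
    have m: "Mp ?P a (monom 1 n) = ?m (s # w) f" unfolding n by (subst e) (rule Mp_word_arr[OF s w])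
    have "h' (tgt a) (?m (s # w) f) = fv (s # w, f)" by (rule h'm') (use w s t in auto)
    also have "... = Mp X (arr s (src a)) (fv (w, f))"
    proof (cases f)
     case False
     then show ?thesis using w by (simp add: fv pv)
    next
     case True
     have j: "src a = opv (vt w False)" using w(3) True by simp
     show ?thesis using rel(2)[OF w(1,2) s] True unfolding j by simp
    qed
    finally show ?thesis unfolding m hs by (subst (2) e)
   next
    assume e: "a = eps (src a)"
    have t: "tgt a = opv (src a)" by (subst e) simp
    have m: "Mp ?P a (monom 1 n) = (if f then 0 else ?m w True)" unfolding n by (subst e) (rule Mp_word_eps[OF w])
    have "h' (tgt a) (if f then 0 else ?m w True) = Mp X (eps (src a)) (fv (w, f))"
    proof (cases f)
     case False
     have "h' (tgt a) (?m w True) = fv (w, True)" by (rule h'm') (use w t False in auto)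
     then show ?thesis using False w(3) by (simp add: fv)
    next
     case True
     have j: "src a = opv (vt w False)" using w(3) True by simp
     show ?thesis using rel(1)[OF w(1,2)] True lin_map0[OF h'l] unfolding j by simp
    qed
    then show ?thesis unfolding m hs by (subst (2) e)
   qed
  qed
  from fun_cong[OF this, of p] show "h' (hv (Lam r) a) (Mp ?P a p) = Mp X a (h' (tv (Lam r) a) p)" by simp
 qed
 have "g i (h' i x) = h i x" if x: "x : Sp ?P i" for i x
 proof -
  have hl: "h i : lin_map (PS (WB r k i)) (Sp Y i)" using HomsD(1)[OF h, of i] by simp
  have "(%x. g i (h' i x)) = h i"
  proof (rule lin_map_PS_eqI[OF lin_map_comp[OF h'l HomsD(1)[OF g] subspace_PS] hl])
   fix n assume "n : WB r k i"
   then obtain w f where n: "n = to_nat (w, f)" and w: "set w <= {1..r}" "k <= length w" "vt w f = i" by (rule WB_E)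
   show "g i (h' i (monom 1 n)) = h i (monom 1 n)" using h'm'[OF w(1,2), of i f] fv1[OF w(1,2), of f] w(3) unfolding n by simp
  qed
  then show ?thesis by (rule fun_cong)
 qed
 then show "EX h':Homs (Lam r) ?P X. ALL i. ALL x:Sp ?P i. g i (h' i x) = h i x" using h'H by blast
qed

text \<open>The m-th power of a cycle is a path of length at least m, so a uniform bound on the
  lengths of nonzero paths suffices.\<close>

lemma nilpI:
 assumes M: "prerep A M" and z: "!!u p w x. qpath A u p w ==> m <= length p ==> x : Sp M u ==> fold (Mp M) p x = 0"
 shows "nilp A M" unfolding nilp_def
proof (intro allI impI)
 fix u p assume up: "p ~= [] & pre_digraph.awalk (quiver A) u p u"
 then have p: "qpath A u p u" using awalk_qpath[of A u p u] by simp
 have app: "qpath A u (p @ q) w \<longleftrightarrow> (EX v. qpath A u p v & qpath A v q w)" for u p v q w by (induction p arbitrary: u) auto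
 have q: "qpath A u (concat (replicate n p)) u" for n by (induction n) (use p app in auto)
 have f: "fold (Mp M) (concat (replicate n p)) x = (fold (Mp M) p ^^ n) x" for n x by (induction n arbitrary: x) (simp_all add: funpow_swap1)
 have l: "m <= length (concat (replicate m p))" using up by (cases p) (simp_all add: length_concat sum_list_replicate)
 show "EX n. ALL x:Sp M u. (fold (Mp M) p ^^ n) x = 0" using z[OF q l] f by auto
qed

lemma subspace_line: "subsp line" unfolding polyv.subspace_def line_def by (auto simp: image_iff intro: exI[of _ 0])

lemma finite_line: "finite (line :: 'k::{finite,field} poly set)" by (simp add: line_def)

lemma fold_zero: "prerep A M ==> fold (Mp M) p 0 = 0" by (induction p) (simp_all add: prerep_Mp0)

lemma prerep_eps_rep: "e : {Eps1, Eps2} ==> prerep (Lam r :: 'k kquiver) (eps_rep e :: 'k::field krep)"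
proof -
 assume e: "e : {Eps1, Eps2}"
 have "Mp (eps_rep e :: 'k krep) a : lin_map line line" for a using lin_map_id[OF subspace_line] lin_map_zero[OF subspace_line, of line] by (cases "a = e") (simp_all add: eps_rep_def)
 moreover have "a ~= e" if "a ~: kron_arrows r \<union> {Eps1, Eps2}" for a using that e by auto
 ultimately show ?thesis unfolding prerep_def by (auto simp: eps_rep_def subspace_line)
qed

lemma eps_rep_modnil:
 assumes e: "e : {Eps1, Eps2}"
 shows "(eps_rep e :: 'k::{finite,field} krep) : mL r"
proof -
 note p = prerep_eps_rep[OF e, of r, where ?'k = 'k]
 have "(eps_rep e :: 'k krep) : reps (Lam r)" unfolding reps_Lam_iff using p e by (auto simp: eps_rep_def)
 moreover have "fdim (eps_rep e :: 'k krep)" by (simp add: fdim_def eps_rep_def finite_line)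
 moreover have "nilp (Lam r) (eps_rep e :: 'k krep)"
 proof (rule nilpI[OF p, where m = 2])
  fix u q w x assume q: "qpath (Lam r) u q w" "2 <= length q" and x: "x : Sp (eps_rep e :: 'k krep) u"
  then obtain a b q' where e': "q = a # b # q'" by (cases q; cases "tl q") auto
  have "Mp (eps_rep e) b (Mp (eps_rep e) a x) = 0" using q e unfolding e' by (auto simp: eps_rep_def)
  then show "fold (Mp (eps_rep e)) q x = 0" unfolding e' by (simp add: fold_zero[OF p])
 qed
 ultimately show ?thesis unfolding modnil_iff by blast
qed

lemma K1_Pd1: "(eps_rep Eps1 :: 'k::{finite,field} krep) : Pd1 (Lam r)"
proof -
 let ?P0 = "word_rep r 0 :: 'k krep" and ?P1 = "word_rep r 1 :: 'k krep" and ?K = "eps_rep Eps1 :: 'k krep"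
 note p0 = prerep_word_rep[of r 0, where ?'k = 'k] and p1 = prerep_word_rep[of r 1, where ?'k = 'k]
 \<comment> \<open>The exponent of the empty word at vertex i, that is, of the idempotent at vertex
   1 and of \<epsilon>_1 at vertex 2. These two elements are the complement of the nonempty words,
   and \<open>g\<close> below reads off their coefficients.\<close>
 define N where "N = (%i. to_nat ([] :: nat list, i = V2))"
 have WB01: "n : WB r 0 i \<longleftrightarrow> n = N i \<or> n : WB r 1 i" for n i
 proof
  assume "n : WB r 0 i"
  then obtain w f where w: "n = to_nat (w, f)" "set w <= {1..r}" "vt w f = i" by (rule WB_E)
  show "n = N i \<or> n : WB r 1 i"
  proof (cases w)
   case Nil
   then have "f \<longleftrightarrow> i = V2" using w(3) by (cases f) (auto simp: vt_def)
   then show ?thesis using w Nil by (simp add: N_def)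
  next
   case (Cons s w')
   then show ?thesis using w WB_I[of w r 1 f i] by simp
  qed
 next
  assume "n = N i \<or> n : WB r 1 i"
  moreover have "N i : WB r 0 i" unfolding N_def by (rule WB_I) (cases i; simp add: vt_def)+
  moreover have "WB r 1 i <= WB r 0 i" unfolding WB_def by blast
  ultimately show "n : WB r 0 i" by blast
 qed
 have N1: "N i ~: WB r 1 i'" for i i'
 proof
  assume "N i : WB r 1 i'"
  then obtain w f where "N i = to_nat (w, f)" "set w <= {1..r}" "1 <= length w" "vt w f = i'" by (rule WB_E)
  then show False unfolding N_def by (simp add: inj_eq[OF inj_to_nat])
 qed
 have sub: "PS (WB r 1 i) <= (PS (WB r 0 i) :: 'k poly set)" for i using WB01 by (auto simp: PS_def)
 have ker: "p : PS (WB r 1 i) \<longleftrightarrow> p : PS (WB r 0 i) & coeff p (N i) = 0" for i and p :: "'k poly" using WB01[of _ i] N1[of i i] by (auto simp: PS_def)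
 define f where "f = (%i (p :: 'k poly). if p : PS (WB r 1 i) then p else 0)"
 define g where "g = (%i (p :: 'k poly). if p : PS (WB r 0 i) then [:coeff p (N i):] else 0)"
 have gl: "g i : lin_map (PS (WB r 0 i)) line" for i by (rule lin_mapI) (auto simp: g_def line_def sb_add[OF subspace_PS] sb_scale[OF subspace_PS])
 have fH: "f : Homs (Lam r) ?P1 ?P0"
 proof (rule HomsI)
  show "f i : lin_map (Sp ?P1 i) (Sp ?P0 i)" for i unfolding f_def Sp_word_rep by (rule lin_map_mono[OF lin_map_id[OF subspace_PS]]) (use sub in auto)
  fix a p assume a: "a : arrs (Lam r :: 'k kquiver)" and p: "p : Sp ?P1 (tv (Lam r) a)"
  have m: "Mp ?P1 a p : PS (WB r 1 (tgt a))" using prerep_mem[OF p1, of a p] a p by simp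
  have p': "p : PS (WB r 1 (src a))" "p : PS (WB r 0 (src a))" using p sub by auto
  show "f (hv (Lam r) a) (Mp ?P1 a p) = Mp ?P0 a (f (tv (Lam r) a) p)" using m p' a Mp_word_rep[of a r p 1] Mp_word_rep[of a r p 0] by (simp add: f_def)
 qed
 have gm: "g j (monom 1 (to_nat (w, b))) = [:if to_nat (w, b) = N j then 1 else 0:]" if "set w <= {1..r}" "vt w b = j" for w b j using that by (simp add: g_def monom_PS WB_I coeff_monom)
 have gH: "g : Homs (Lam r) ?P0 ?K"
 proof (rule HomsI)
  show "g i : lin_map (Sp ?P0 i) (Sp ?K i)" for i using gl by (simp add: eps_rep_def)
  fix a p assume a: "a : arrs (Lam r :: 'k kquiver)" and p: "p : Sp ?P0 (tv (Lam r) a)"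
  have a2: "a : kron_arrows r \<union> {Eps1, Eps2}" using a by simp
  have lP: "Mp ?P0 a : lin_map (PS (WB r 0 (src a))) (PS (WB r 0 (tgt a)))" using prD(3)[OF p0 a] by simp
  have lK: "Mp ?K a : lin_map line line" using prD(3)[OF prerep_eps_rep a, of Eps1] by (simp add: eps_rep_def)
  have "(%p. g (tgt a) (Mp ?P0 a p)) = (%p. Mp ?K a (g (src a) p))"
  proof (rule lin_map_PS_eqI[OF lin_map_comp[OF lP gl subspace_PS] lin_map_comp[OF gl lK subspace_PS]])
   fix n assume "n : WB r 0 (src a)"
   then obtain w b where n: "n = to_nat (w, b)" and w: "set w <= {1..r}" "0 <= length w" "vt w b = src a" by (rule WB_E)
   have gs: "g (src a) (monom 1 n) = [:if w = [] & b = (src a = V2) then 1 else 0:]" using gm[OF w(1,3)] unfolding n N_def by auto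
   show "g (tgt a) (Mp ?P0 a (monom 1 n)) = Mp ?K a (g (src a) (monom 1 n))" using a2
   proof (rule Lam_arcs_cases)
    fix s assume s: "s : {1..r}" and e: "a = arr s (src a)"
    have t: "tgt a = opv (src a)" by (subst e) simp
    have m: "Mp ?P0 a (monom 1 n) = monom 1 (to_nat (s # w, b))" unfolding n by (subst e) (rule Mp_word_arr[OF s w])
    have "a ~= Eps1" by (subst e, cases "src a") auto
    then show ?thesis unfolding m gs using gm[of "s # w" b "tgt a"] w s t by (simp add: N_def eps_rep_def)
   next
    assume e: "a = eps (src a)"
    have t: "tgt a = opv (src a)" by (subst e) simp
    have m: "Mp ?P0 a (monom 1 n) = (if b then 0 else monom 1 (to_nat (w, True)))" unfolding n by (subst e) (rule Mp_word_eps[OF w])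
    show ?thesis
    proof (cases b)
     case True
     have "w = [] ==> src a = V2" using w(3) True by (auto simp: vt_def)
     moreover have "src a = V2 ==> a ~= Eps1" by auto
     ultimately show ?thesis unfolding m gs using True lin_map0[OF gl] by (auto simp: eps_rep_def)
    next
     case False
     have gg: "g (tgt a) (monom 1 (to_nat (w, True))) = [:if w = [] & tgt a = V2 then 1 else 0:]" using gm[of w True "tgt a"] w False t by (auto simp: N_def)
     show ?thesis
     proof (cases "src a")
      case V1
      then have "a = Eps1" using e by simp
      then show ?thesis unfolding m gs using False gg by (auto simp: eps_rep_def line_def)
     next
      case V2
      then have "a = Eps2" using e by simp
      then show ?thesis unfolding m gs using False gg w(3) by (auto simp: eps_rep_def)
     qed
    qed
   qed
  qed
  from fun_cong[OF this, of p] show "g (hv (Lam r) a) (Mp ?P0 a p) = Mp ?K a (g (tv (Lam r) a) p)" by simp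
 qed
 have "ses (Lam r) ?P1 f ?P0 g ?K" unfolding ses_def
 proof (intro conjI allI fH gH)
  fix i
  show "inj_on (f i) (Sp ?P1 i)" by (auto simp: inj_on_def f_def)
  show "f i ` Sp ?P1 i = {x : Sp ?P0 i. g i x = 0}" using ker[of _ i] by (auto simp: f_def g_def image_iff)
  show "g i ` Sp ?P0 i = Sp ?K i"
  proof (intro equalityI subsetI)
   fix y assume "y : Sp ?K i"
   then obtain c where c: "y = [:c:]" by (auto simp: eps_rep_def line_def)
   have "monom 1 (N i) : (PS (WB r 0 i) :: 'k poly set)" using WB01 by (simp add: monom_PS)
   then have "sm c (monom 1 (N i)) : PS (WB r 0 i)" by (rule sb_scale[OF subspace_PS])
   then show "y : g i ` Sp ?P0 i" by (intro image_eqI[of _ _ "sm c (monom 1 (N i))"]) (simp_all add: g_def c coeff_monom)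
  qed (use lmD(1)[OF gl] in "auto simp: eps_rep_def")
 qed
 then show ?thesis unfolding Pd1_def using eps_rep_modnil[of Eps1 r] projective_word_rep[of 0 r] projective_word_rep[of 1 r] by auto
qed

section \<open>Modules over the iquiver algebra\<close>

text \<open>With \<epsilon> as index 0, the arrows from 1 to 2 and those from 2 to 1 are each
  numbered from 0 to r. This is the origin of the space W of dimension r + 1.\<close>

definition ar :: "nat => arrow" where "ar s = (if s = 0 then Eps1 else Alpha s)"
definition br :: "nat => arrow" where "br s = (if s = 0 then Eps2 else Beta s)"

primrec idx :: "arrow => nat" where
 "idx (Alpha s) = s" | "idx (Beta s) = s" | "idx Eps1 = 0" | "idx Eps2 = 0"

lemma ar_br_simps [simp]: "src (ar s) = V1" "tgt (ar s) = V2" "src (br s) = V2" "tgt (br s) = V1" "idx (ar s) = s" "idx (br s) = s" by (simp_all add: ar_def br_def)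

lemma ar_br_0: "ar 0 = Eps1" "br 0 = Eps2" by (simp_all add: ar_def br_def)

lemma ar_br_pos: "s : {Suc 0..r} ==> Alpha s = ar s" "s : {Suc 0..r} ==> Beta s = br s" by (simp_all add: ar_def br_def)

lemma ar_br_arcs: "s <= r ==> ar s : kron_arrows r \<union> {Eps1, Eps2}" "s <= r ==> br s : kron_arrows r \<union> {Eps1, Eps2}" by (auto simp: ar_def br_def)

lemma Lam_arcs_iff: "a : kron_arrows r \<union> {Eps1, Eps2} \<longleftrightarrow> (EX s<=r. a = ar s \<or> a = br s)"
proof
 assume a: "a : kron_arrows r \<union> {Eps1, Eps2}"
 show "EX s<=r. a = ar s \<or> a = br s"
 proof (cases a)
  case (Alpha s)
  then show ?thesis using a by (intro exI[of _ s]) (simp add: ar_def)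
 next
  case (Beta s)
  then show ?thesis using a by (intro exI[of _ s]) (simp add: br_def)
 next
  case Eps1
  then show ?thesis by (intro exI[of _ 0]) (simp add: ar_br_0)
 next
  case Eps2
  then show ?thesis by (intro exI[of _ 0]) (simp add: ar_br_0)
 qed
next
 assume "EX s<=r. a = ar s \<or> a = br s"
 then obtain s where "s <= r" "a = ar s \<or> a = br s" by blast
 then show "a : kron_arrows r \<union> {Eps1, Eps2}" using ar_br_arcs[of s r] by blast
qed

lemma ball_Lam_arcs: "(ALL a:kron_arrows r \<union> {Eps1, Eps2}. P a) \<longleftrightarrow> (ALL s<=r. P (ar s) & P (br s))" unfolding Ball_def Lam_arcs_iff by blast

lemma all_vertex: "(ALL i. P i) \<longleftrightarrow> P V1 & P V2" using vertex.induct[of P] by blast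

lemma prerep_Lam_iff: "prerep (Lam r :: 'k kquiver) X \<longleftrightarrow> subsp (Sp X V1) & subsp (Sp X V2) &
  (ALL s<=r. Mp X (ar s) : lin_map (Sp X V1) (Sp X V2) & Mp X (br s) : lin_map (Sp X V2) (Sp X V1)) &
  (ALL a. a ~: kron_arrows r \<union> {Eps1, Eps2} --> Mp X a = (%_. 0))" for X :: "'k::{finite,field} krep" unfolding prerep_def Lam_simps ball_Lam_arcs all_vertex[of "%i. subsp (Sp X i)"] by simp

lemma reps_Lam_iff': "X : reps (Lam r) \<longleftrightarrow> prerep (Lam r :: 'k kquiver) X &
  (ALL x:Sp X V2. Mp X (ar 0) (Mp X (br 0) x) = 0) & (ALL x:Sp X V1. Mp X (br 0) (Mp X (ar 0) x) = 0) &
  (ALL s:{1..r}. ALL x:Sp X V2. Mp X (ar s) (Mp X (br 0) x) = Mp X (ar 0) (Mp X (br s) x)) &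
  (ALL s:{1..r}. ALL x:Sp X V1. Mp X (br s) (Mp X (ar 0) x) = Mp X (br 0) (Mp X (ar s) x))" for X :: "'k::{finite,field} krep" unfolding reps_Lam_iff ar_br_0 by (simp only: One_nat_def ar_br_pos cong: ball_cong)

lemma Lam_isoI:
 fixes X Y :: "'k::{finite,field} krep"
 assumes f: "f : lin_map (Sp X V1) (Sp Y V1)" "bij_betw f (Sp X V1) (Sp Y V1)"
  and g: "g : lin_map (Sp X V2) (Sp Y V2)" "bij_betw g (Sp X V2) (Sp Y V2)"
  and c: "!!s x. s <= r ==> x : Sp X V1 ==> g (Mp X (ar s) x) = Mp Y (ar s) (f x)"
   "!!s y. s <= r ==> y : Sp X V2 ==> f (Mp X (br s) y) = Mp Y (br s) (g y)"
 shows "iL r X Y"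
proof (rule iso_repI)
 let ?h = "%i. case i of V1 => f | V2 => g"
 show "?h : Homs (Lam r) X Y"
 proof (rule HomsI)
  show "?h i : lin_map (Sp X i) (Sp Y i)" for i using f g by (cases i) simp_all
  fix a x assume a: "a : arrs (Lam r :: 'k kquiver)" and x: "x : Sp X (tv (Lam r :: 'k kquiver) a)"
  obtain s where "s <= r" "a = ar s \<or> a = br s" using a Lam_arcs_iff[of a r] by auto
  then show "?h (hv (Lam r) a) (Mp X a x) = Mp Y a (?h (tv (Lam r) a) x)" using c x by auto
 qed
 show "bij_betw (?h i) (Sp X i) (Sp Y i)" for i using f g by (cases i) simp_all
qed

section \<open>Cocycles over the iquiver algebra\<close>

lemma cochain1_Lam_iff: "z : Lam.cochain1 r M N \<longleftrightarrow>
  (ALL s<=r. z (ar s) : lin_map (Sp M V1) (Sp N V2) & z (br s) : lin_map (Sp M V2) (Sp N V1)) &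
  (ALL a. a ~: kron_arrows r \<union> {Eps1, Eps2} --> z a = (%_. 0))" for M N :: "'k::{finite,field} krep" unfolding Lam.cochain1_def Lam_simps mem_Collect_eq ball_Lam_arcs by simp

lemma Mp_ext_ar_br:
 fixes M N :: "'k::{finite,field} krep"
 shows "s <= r ==> p : pprod (Sp N V1) (Sp M V1) ==>
   Mp (Lam.ext_rep r M N z) (ar s) p = pjoin (Mp N (ar s) (pfst p) + z (ar s) (psnd p)) (Mp M (ar s) (psnd p))"
  "s <= r ==> p : pprod (Sp N V2) (Sp M V2) ==>
   Mp (Lam.ext_rep r M N z) (br s) p = pjoin (Mp N (br s) (pfst p) + z (br s) (psnd p)) (Mp M (br s) (psnd p))" using Lam.Mp_ext_rep[of "ar s" r p N M z] Lam.Mp_ext_rep[of "br s" r p N M z] ar_br_arcs[of s r] by simp_all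

text \<open>The composite of two block triangular maps has the composites in \<open>N\<close> and
  \<open>M\<close> on the diagonal, where the relations hold by assumption. The conditions express
  the relations for the off-diagonal block.\<close>

lemma cocycles_Lam_iff:
 fixes M N :: "'k::{finite,field} krep"
 assumes M: "M : reps (Lam r)" and N: "N : reps (Lam r)"
 shows "z : Lam.cocycles r M N \<longleftrightarrow> z : Lam.cochain1 r M N &
  (ALL w:Sp M V2. Mp N (ar 0) (z (br 0) w) + z (ar 0) (Mp M (br 0) w) = 0) &
  (ALL u:Sp M V1. Mp N (br 0) (z (ar 0) u) + z (br 0) (Mp M (ar 0) u) = 0) &
  (ALL s:{1..r}. ALL w:Sp M V2. Mp N (ar s) (z (br 0) w) + z (ar s) (Mp M (br 0) w) = Mp N (ar 0) (z (br s) w) + z (ar 0) (Mp M (br s) w)) &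
  (ALL s:{1..r}. ALL u:Sp M V1. Mp N (br s) (z (ar 0) u) + z (br s) (Mp M (ar 0) u) = Mp N (br 0) (z (ar s) u) + z (br 0) (Mp M (ar s) u))"
proof (cases "z : Lam.cochain1 r M N")
 case True
 let ?E = "Lam.ext_rep r M N z"
 note pM = prR[OF M] and pN = prR[OF N]
 have pE: "prerep (Lam r) ?E" by (rule Lam.prerep_ext_rep[OF pM pN True])
 note lM = pM[unfolded prerep_Lam_iff] and lN = pN[unfolded prerep_Lam_iff]
 note rM = M[unfolded reps_Lam_iff'] and rN = N[unfolded reps_Lam_iff']
 note lz = True[unfolded cochain1_Lam_iff]
 have nM: "s <= r ==> x : Sp M V1 ==> Mp M (ar s) x : Sp M V2" "s <= r ==> y : Sp M V2 ==> Mp M (br s) y : Sp M V1" for s x y using lM lmD(1)[of "Mp M (ar s)"] lmD(1)[of "Mp M (br s)"] by blast+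
 have nN: "s <= r ==> x : Sp N V1 ==> Mp N (ar s) x : Sp N V2" "s <= r ==> y : Sp N V2 ==> Mp N (br s) y : Sp N V1" for s x y using lN lmD(1)[of "Mp N (ar s)"] lmD(1)[of "Mp N (br s)"] by blast+
 have nz: "s <= r ==> x : Sp M V1 ==> z (ar s) x : Sp N V2" "s <= r ==> y : Sp M V2 ==> z (br s) y : Sp N V1" for s x y using lz lmD(1)[of "z (ar s)"] lmD(1)[of "z (br s)"] by blast+
 have aN: "s <= r ==> x : Sp N V1 ==> y : Sp N V1 ==> Mp N (ar s) (x + y) = Mp N (ar s) x + Mp N (ar s) y"
  "s <= r ==> x' : Sp N V2 ==> y' : Sp N V2 ==> Mp N (br s) (x' + y') = Mp N (br s) x' + Mp N (br s) y'" for s x y x' y' using lN lmD(2)[of "Mp N (ar s)"] lmD(2)[of "Mp N (br s)"] by blast+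
 have sN: "x : Sp N i ==> y : Sp N i ==> x + y : Sp N i" for x y i using sb_add[OF prD(1)[OF pN]] .
 have c1: "Mp ?E (ar s) (Mp ?E (br t) p) = pjoin (Mp N (ar s) (Mp N (br t) (pfst p)) + (Mp N (ar s) (z (br t) (psnd p)) + z (ar s) (Mp M (br t) (psnd p)))) (Mp M (ar s) (Mp M (br t) (psnd p)))" if st: "s <= r" "t <= r" and p: "p : pprod (Sp N V2) (Sp M V2)" for s t p
 proof -
  have p': "pfst p : Sp N V2" "psnd p : Sp M V2" using pprodD[OF p] by blast+
  have m: "Mp N (br t) (pfst p) : Sp N V1" "z (br t) (psnd p) : Sp N V1" "Mp M (br t) (psnd p) : Sp M V1" using nN(2)[OF st(2) p'(1)] nz(2)[OF st(2) p'(2)] nM(2)[OF st(2) p'(2)] .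
  have "pjoin (Mp N (br t) (pfst p) + z (br t) (psnd p)) (Mp M (br t) (psnd p)) : pprod (Sp N V1) (Sp M V1)" using m sN by simp
  then show ?thesis using Mp_ext_ar_br(1)[OF st(1), of _ N M z] Mp_ext_ar_br(2)[OF st(2) p, of z] aN(1)[OF st(1) m(1,2)] by (simp add: add.assoc)
 qed
 have c2: "Mp ?E (br s) (Mp ?E (ar t) p) = pjoin (Mp N (br s) (Mp N (ar t) (pfst p)) + (Mp N (br s) (z (ar t) (psnd p)) + z (br s) (Mp M (ar t) (psnd p)))) (Mp M (br s) (Mp M (ar t) (psnd p)))" if st: "s <= r" "t <= r" and p: "p : pprod (Sp N V1) (Sp M V1)" for s t p
 proof -
  have p': "pfst p : Sp N V1" "psnd p : Sp M V1" using pprodD[OF p] by blast+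
  have m: "Mp N (ar t) (pfst p) : Sp N V2" "z (ar t) (psnd p) : Sp N V2" "Mp M (ar t) (psnd p) : Sp M V2" using nN(1)[OF st(2) p'(1)] nz(1)[OF st(2) p'(2)] nM(1)[OF st(2) p'(2)] .
  have "pjoin (Mp N (ar t) (pfst p) + z (ar t) (psnd p)) (Mp M (ar t) (psnd p)) : pprod (Sp N V2) (Sp M V2)" using m sN by simp
  then show ?thesis using Mp_ext_ar_br(2)[OF st(1), of _ N M z] Mp_ext_ar_br(1)[OF st(2) p, of z] aN(2)[OF st(1) m(1,2)] by (simp add: add.assoc)
 qed
 have all_pprod: "(ALL p:pprod (Sp N i) (Sp M i). P p) \<longleftrightarrow> (ALL x:Sp N i. ALL y:Sp M i. P (pjoin x y))" for i P by (metis pjoin_collapse pjoin_in_pprod pprodD)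
 have z0: "0 : Sp N i" for i by (rule sb_0[OF prD(1)[OF pN]])
 have n0: "Mp N a 0 = 0" for a by (rule prerep_Mp0[OF pN])
 have sp: "Sp ?E i = pprod (Sp N i) (Sp M i)" for i by simp
 have sM: "!!x. x : Sp M V2 ==> Mp M (ar 0) (Mp M (br 0) x) = 0" "!!x. x : Sp M V1 ==> Mp M (br 0) (Mp M (ar 0) x) = 0"
  "!!s x. s : {1..r} ==> x : Sp M V2 ==> Mp M (ar s) (Mp M (br 0) x) = Mp M (ar 0) (Mp M (br s) x)"
  "!!s x. s : {1..r} ==> x : Sp M V1 ==> Mp M (br s) (Mp M (ar 0) x) = Mp M (br 0) (Mp M (ar s) x)" using rM by blast+
 have sN': "!!x. x : Sp N V2 ==> Mp N (ar 0) (Mp N (br 0) x) = 0" "!!x. x : Sp N V1 ==> Mp N (br 0) (Mp N (ar 0) x) = 0"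
  "!!s x. s : {1..r} ==> x : Sp N V2 ==> Mp N (ar s) (Mp N (br 0) x) = Mp N (ar 0) (Mp N (br s) x)"
  "!!s x. s : {1..r} ==> x : Sp N V1 ==> Mp N (br s) (Mp N (ar 0) x) = Mp N (br 0) (Mp N (ar s) x)" using rN by blast+
 have r1: "(ALL p:Sp ?E V2. Mp ?E (ar 0) (Mp ?E (br 0) p) = 0) \<longleftrightarrow> (ALL w:Sp M V2. Mp N (ar 0) (z (br 0) w) + z (ar 0) (Mp M (br 0) w) = 0)"
 proof -
  have "Mp ?E (ar 0) (Mp ?E (br 0) (pjoin x w)) = 0 \<longleftrightarrow> Mp N (ar 0) (z (br 0) w) + z (ar 0) (Mp M (br 0) w) = 0" if "x : Sp N V2" "w : Sp M V2" for x w using c1[of 0 0 "pjoin x w"] that sM(1)[OF that(2)] sN'(1)[OF that(1)] by simp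
  then show ?thesis unfolding sp all_pprod using z0[of V2] by blast
 qed
 have r2: "(ALL p:Sp ?E V1. Mp ?E (br 0) (Mp ?E (ar 0) p) = 0) \<longleftrightarrow> (ALL w:Sp M V1. Mp N (br 0) (z (ar 0) w) + z (br 0) (Mp M (ar 0) w) = 0)"
 proof -
  have "Mp ?E (br 0) (Mp ?E (ar 0) (pjoin x w)) = 0 \<longleftrightarrow> Mp N (br 0) (z (ar 0) w) + z (br 0) (Mp M (ar 0) w) = 0" if "x : Sp N V1" "w : Sp M V1" for x w using c2[of 0 0 "pjoin x w"] that sM(2)[OF that(2)] sN'(2)[OF that(1)] by simp
  then show ?thesis unfolding sp all_pprod using z0[of V1] by blast
 qed
 have r3: "(ALL p:Sp ?E V2. Mp ?E (ar s) (Mp ?E (br 0) p) = Mp ?E (ar 0) (Mp ?E (br s) p)) \<longleftrightarrow>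
   (ALL w:Sp M V2. Mp N (ar s) (z (br 0) w) + z (ar s) (Mp M (br 0) w) = Mp N (ar 0) (z (br s) w) + z (ar 0) (Mp M (br s) w))" if s: "s : {1..r}" for s
 proof -
  have "Mp ?E (ar s) (Mp ?E (br 0) (pjoin x w)) = Mp ?E (ar 0) (Mp ?E (br s) (pjoin x w)) \<longleftrightarrow>
    Mp N (ar s) (z (br 0) w) + z (ar s) (Mp M (br 0) w) = Mp N (ar 0) (z (br s) w) + z (ar 0) (Mp M (br s) w)" if "x : Sp N V2" "w : Sp M V2" for x w using c1[of s 0 "pjoin x w"] c1[of 0 s "pjoin x w"] s that sM(3)[OF s that(2)] sN'(3)[OF s that(1)] by simp
  then show ?thesis unfolding sp all_pprod using z0[of V2] by blast
 qed
 have r4: "(ALL p:Sp ?E V1. Mp ?E (br s) (Mp ?E (ar 0) p) = Mp ?E (br 0) (Mp ?E (ar s) p)) \<longleftrightarrow>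
   (ALL w:Sp M V1. Mp N (br s) (z (ar 0) w) + z (br s) (Mp M (ar 0) w) = Mp N (br 0) (z (ar s) w) + z (br 0) (Mp M (ar s) w))" if s: "s : {1..r}" for s
 proof -
  have "Mp ?E (br s) (Mp ?E (ar 0) (pjoin x w)) = Mp ?E (br 0) (Mp ?E (ar s) (pjoin x w)) \<longleftrightarrow>
    Mp N (br s) (z (ar 0) w) + z (br s) (Mp M (ar 0) w) = Mp N (br 0) (z (ar s) w) + z (br 0) (Mp M (ar s) w)" if "x : Sp N V1" "w : Sp M V1" for x w using c2[of s 0 "pjoin x w"] c2[of 0 s "pjoin x w"] s that sM(4)[OF s that(2)] sN'(4)[OF s that(1)] by simp
  then show ?thesis unfolding sp all_pprod using z0[of V1] by blast
 qed
 have R3: "(ALL s:{1..r}. ALL p:Sp ?E V2. Mp ?E (ar s) (Mp ?E (br 0) p) = Mp ?E (ar 0) (Mp ?E (br s) p)) \<longleftrightarrow>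
   (ALL s:{1..r}. ALL w:Sp M V2. Mp N (ar s) (z (br 0) w) + z (ar s) (Mp M (br 0) w) = Mp N (ar 0) (z (br s) w) + z (ar 0) (Mp M (br s) w))" by (rule ball_cong[OF rfl r3])
 have R4: "(ALL s:{1..r}. ALL p:Sp ?E V1. Mp ?E (br s) (Mp ?E (ar 0) p) = Mp ?E (br 0) (Mp ?E (ar s) p)) \<longleftrightarrow>
   (ALL s:{1..r}. ALL w:Sp M V1. Mp N (br s) (z (ar 0) w) + z (br s) (Mp M (ar 0) w) = Mp N (br 0) (z (ar s) w) + z (br 0) (Mp M (ar s) w))" by (rule ball_cong[OF rfl r4])
 show ?thesis unfolding Lam.cocycles_def mem_Collect_eq reps_Lam_iff' r1 r2 R3 R4 using True pE by blast
qed (simp add: Lam.cocycles_def)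

definition md :: "nat => 'k::field poly set => 'k poly set => (nat => 'k poly => 'k poly) => (nat => 'k poly => 'k poly) => 'k krep" where
 "md r U W A B = \<lparr>Sp = (%i. case i of V1 => U | V2 => W),
  Mp = (%a. if a : kron_arrows r \<union> {Eps1, Eps2} then (if src a = V1 then A (idx a) else B (idx a)) else (%_. 0))\<rparr>"

lemma md_simps [simp]: "Sp (md r U W A B) V1 = U" "Sp (md r U W A B) V2 = W"
 "s <= r ==> Mp (md r U W A B) (ar s) = A s" "s <= r ==> Mp (md r U W A B) (br s) = B s" using ar_br_arcs[of s r] by (auto simp: md_def)

lemma prerep_md: "subsp U ==> subsp W ==> (!!s. s <= r ==> A s : lin_map U W) ==> (!!s. s <= r ==> B s : lin_map W U) ==>
  prerep (Lam r :: 'k kquiver) (md r U W A B :: 'k::{finite,field} krep)" unfolding prerep_Lam_iff by (simp, simp add: md_def)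

text \<open>The standard model of k^n inside the space of polynomials.\<close>

definition pl :: "nat => 'k::field poly set" where
 "pl n = {p. ALL i>=n. coeff p i = 0}"

lemma spl: "subsp (pl n)" unfolding polyv.subspace_def pl_def by auto

lemma bij_pl: "bij_betw (%f. Poly (map f [0..<n])) ({..<n} \<rightarrow>\<^sub>E (UNIV :: 'k::{finite,field} set)) (pl n)"
proof (rule bij_betw_byWitness[where f' = "%p. \<lambda>i\<in>{..<n}. coeff p i"])
 show "ALL f:{..<n} \<rightarrow>\<^sub>E UNIV. (\<lambda>i\<in>{..<n}. coeff (Poly (map f [0..<n])) i) = f" by (auto simp: fun_eq_iff nth_default_def PiE_iff extensional_def)
 show "ALL p:pl n. Poly (map (\<lambda>i\<in>{..<n}. coeff p i) [0..<n]) = p" by (auto simp: pl_def poly_eq_iff nth_default_def)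
 show "(%p. \<lambda>i\<in>{..<n}. coeff p i) ` pl n <= {..<n} \<rightarrow>\<^sub>E UNIV" by (rule image_subsetI) simp
 show "(%f. Poly (map f [0..<n])) ` ({..<n} \<rightarrow>\<^sub>E UNIV) <= (pl n :: 'k poly set)" by (rule image_subsetI) (simp add: pl_def nth_default_def)
qed

lemma card_pl: "card (pl n :: 'k::{finite,field} poly set) = CARD('k) ^ n" "finite (pl n :: 'k poly set)"
proof -
 show "card (pl n :: 'k::{finite,field} poly set) = CARD('k) ^ n" using bij_betw_same_card[OF bij_pl[of n, where ?'k = 'k]] by (simp add: card_PiE)
 show "finite (pl n :: 'k poly set)" using bij_betw_finite[OF bij_pl[of n, where ?'k = 'k]] by (simp add: finite_PiE)
qed

lemma dim_of_card: "subsp U ==> finite U ==> card U = CARD('k) ^ n ==> dm U = n" for U :: "'k::{finite,field} poly set" using card_poly_subspace[of U] CARD_gt1[where ?'k = 'k] by simp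

lemma dim_pl: "dm (pl n :: 'k::{finite,field} poly set) = n" by (rule dim_of_card) (simp_all add: spl card_pl)

lemma line_eq_pl: "line = pl 1" unfolding line_def pl_def by (auto simp: poly_eq_iff coeff_pCons image_iff split: nat.splits)

lemma dim_line: "dm (line :: 'k::{finite,field} poly set) = 1" unfolding line_eq_pl by (rule dim_pl)

lemma pl_0: "pl 0 = {0}" unfolding pl_def by (auto simp: poly_eq_iff)

text \<open>The direct sum of t copies of S_1, the only module with dimension vector (t, 0) since
  there is no arrow from 1 to 1.\<close>

definition S1p :: "nat => 'k::field krep" where
 "S1p t = \<lparr>Sp = (%i. if i = V1 then pl t else {0}), Mp = (%_ _. 0)\<rparr>"

lemma S1p_simps [simp]: "Sp (S1p t) V1 = pl t" "Sp (S1p t) V2 = {0}" "Mp (S1p t) a = (%_. 0)" by (simp_all add: S1p_def)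

lemma modnil_trivial:
 fixes X :: "'k::{finite,field} krep"
 assumes s: "!!i. subsp (Sp X i)" "!!i. finite (Sp X i)" and m: "!!a. Mp X a = (%_. 0)"
 shows "X : mL r"
proof -
 have p: "prerep (Lam r :: 'k kquiver) X" unfolding prerep_def using s m lin_map_zero[OF s(1)] by simp
 have "X : reps (Lam r)" unfolding reps_Lam_iff' using p m by simp
 moreover have "nilp (Lam r) X"
 proof (rule nilpI[OF p, where m = 1])
  fix u w x and q :: "arrow list" assume "1 <= length q"
  then obtain a q' where "q = a # q'" by (cases q) auto
  then show "fold (Mp X) q x = 0" by (simp add: m fold_zero[OF p])
 qed
 ultimately show ?thesis unfolding modnil_iff fdim_def using s by blast
qed

lemma subspace_zero: "subsp {0 :: 'k::field poly}" by (simp add: polyv.subspace_def)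

lemma S1p_modnil: "(S1p t :: 'k::{finite,field} krep) : mL r" by (rule modnil_trivial) (auto simp: S1p_def spl subspace_zero card_pl)

lemma simple_modnil: "(simple_rep i :: 'k::{finite,field} krep) : mL r" by (rule modnil_trivial) (auto simp: simple_rep_def subspace_line subspace_zero finite_line)

lemma dimv_S1p: "dimv (S1p t :: 'k::{finite,field} krep) = (t, 0)" by (simp add: dimv_def dim_pl dim_zero_space)

lemma simple_V1: "simple_rep V1 = S1p 1" unfolding simple_rep_def S1p_def line_eq_pl by simp

lemma zero_rep_S1p: "zero_rep = S1p 0" unfolding zero_rep_def S1p_def pl_0 by (simp add: fun_eq_iff)

lemma simple_V2_simps [simp]: "Sp (simple_rep V2) V1 = {0}" "Sp (simple_rep V2) V2 = line" "Mp (simple_rep V2) a = (%_. 0)" by (simp_all add: simple_rep_def)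

lemma Sp_eps_rep [simp]: "Sp (eps_rep e) i = line" by (simp_all add: eps_rep_def)

lemma card_cochain0_Lam:
 fixes M N :: "'k::{finite,field} krep"
 assumes "M : mL r" "N : mL r"
 shows "card (Lam.cochain0 M N) = CARD('k) ^ (fst (dimv M) * fst (dimv N) + snd (dimv M) * snd (dimv N))" using Lam.finite_card_cochain0(2)[OF Lam.mnD(3,2)[OF assms(1)] Lam.mnD(3,2)[OF assms(2)]] by (simp add: UNIV_vertex dimv_def)

lemma hcls_cong: "M : mL r ==> N : mL r ==> iL r M N ==> hL r M = hL r N"
 for M N :: "'k::{finite,field} krep" unfolding hcls_def using Lam.isocl_eq_iff[of M r N] by simp

text \<open>Linear maps \<open>U \<rightarrow> pl (r + 1)\<close> encode \<open>r + 1\<close> linear forms on \<open>U\<close>.\<close>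

definition cf :: "('k::field poly => 'k poly) => nat => 'k poly => 'k poly" where
 "cf a s x = [:coeff (a x) s:]"

definition comb :: "nat => (nat => 'k::field poly => 'k poly) => 'k poly => 'k poly" where
 "comb r A x = (SUM s<=r. monom (coeff (A s x) 0) s)"

text \<open>Dually, a map from \<open>pl (Suc r)\<close> to \<open>V\<close> is a family of r + 1
  maps from \<open>line\<close> to \<open>V\<close>, given by its values on the monomials.\<close>

definition bf :: "('k::field poly => 'k poly) => nat => 'k poly => 'k poly" where
 "bf b s y = (if y : line then b (monom (coeff y 0) s) else 0)"

definition bcomb :: "nat => (nat => 'k::field poly => 'k poly) => 'k poly => 'k poly" where
 "bcomb r B p = (if p : pl (Suc r) then SUM s<=r. B s [:coeff p s:] else 0)"

lemma coeff_comb: "coeff (comb r A x) i = (if i <= r then coeff (A i x) 0 else 0)" by (simp add: comb_def coeff_sum coeff_monom)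

lemma cf_lin: "a : lin_map U (pl (Suc r)) ==> cf a s : lin_map U line" by (rule lin_mapI) (auto simp: cf_def line_def lmD[of a U "pl (Suc r)"])

lemma comb_lin: "(!!s. s <= r ==> A s : lin_map U line) ==> comb r A : lin_map U (pl (Suc r))"
proof (rule lin_mapI)
 assume A: "!!s. s <= r ==> A s : lin_map U line"
 show "comb r A x : pl (Suc r)" for x by (simp add: pl_def coeff_comb)
 show "comb r A (x + y) = comb r A x + comb r A y" if "x : U" "y : U" for x y by (rule poly_eqI) (simp add: coeff_comb lmD(2)[OF A that])
 show "comb r A (sm c x) = sm c (comb r A x)" if "x : U" for c x by (rule poly_eqI) (simp add: coeff_comb lmD(3)[OF A that])
 show "comb r A x = 0" if "x ~: U" for x by (rule poly_eqI) (simp add: coeff_comb lmD(4)[OF A that])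
qed

lemma line_coeff: "y : line ==> [:coeff y 0:] = y" by (auto simp: line_def)

lemma cf_comb: "(!!s. s <= r ==> A s : lin_map U line) ==> s <= r ==> cf (comb r A) s = A s"
proof
 fix x assume A: "!!s. s <= r ==> A s : lin_map U line" and s: "s <= r"
 have "A s x : line" using lmD(1,4)[OF A[OF s], of x] sb_0[OF subspace_line] by (cases "x : U") auto
 then show "cf (comb r A) s x = A s x" using s by (simp add: cf_def coeff_comb line_coeff)
qed

lemma cf_inj: "a : lin_map U (pl (Suc r)) ==> a' : lin_map U (pl (Suc r)) ==> (!!s. s <= r ==> cf a s = cf a' s) ==> a = a'"
proof (rule ext, rule poly_eqI)
 fix x i assume a: "a : lin_map U (pl (Suc r))" "a' : lin_map U (pl (Suc r))" and e: "!!s. s <= r ==> cf a s = cf a' s"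
 have m: "b x : pl (Suc r)" if "b : lin_map U (pl (Suc r))" for b using lmD(1,4)[OF that, of x] sb_0[OF spl] by (cases "x : U") auto
 show "coeff (a x) i = coeff (a' x) i"
 proof (cases "i <= r")
  case True
  from fun_cong[OF e[OF this], of x] show ?thesis by (simp add: cf_def)
 next
  case False
  then show ?thesis using m[OF a(1)] m[OF a(2)] by (simp add: pl_def)
 qed
qed

lemma monom_pl: "s <= r ==> monom c s : pl (Suc r)" by (auto simp: pl_def coeff_monom)

lemma bf_lin: "b : lin_map (pl (Suc r)) V ==> subsp V ==> s <= r ==> bf b s : lin_map line V"
proof (rule lin_mapI)
 assume b: "b : lin_map (pl (Suc r)) V" and V: "subsp V" and s: "s <= r"
 show "bf b s y : V" if "y : line" for y using that lmD(1)[OF b monom_pl[OF s]] by (simp add: bf_def)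
 show "bf b s (x + y) = bf b s x + bf b s y" if "x : line" "y : line" for x y using that lmD(2)[OF b monom_pl[OF s] monom_pl[OF s]] sb_add[OF subspace_line that] by (simp add: bf_def flip: add_monom)
 show "bf b s (sm c x) = sm c (bf b s x)" if "x : line" for c x using that lmD(3)[OF b monom_pl[OF s]] sb_scale[OF subspace_line that] by (simp add: bf_def flip: smult_monom)
qed (simp add: bf_def)

lemma bcomb_lin: "(!!s. s <= r ==> B s : lin_map line V) ==> subsp V ==> bcomb r B : lin_map (pl (Suc r)) V"
proof (rule lin_mapI)
 assume B: "!!s. s <= r ==> B s : lin_map line V" and V: "subsp V"
 have l: "[:c:] : line" for c :: 'a by (simp add: line_def)
 show "bcomb r B p : V" if "p : pl (Suc r)" for p unfolding bcomb_def if_P[OF that] by (rule polyv.subspace_sum[OF V], rule lmD(1)[OF B l]) simp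
 show "bcomb r B (x + y) = bcomb r B x + bcomb r B y" if "x : pl (Suc r)" "y : pl (Suc r)" for x y using that sb_add[OF spl that] lmD(2)[OF B l l] by (simp add: bcomb_def sum.distrib)
 show "bcomb r B (sm c x) = sm c (bcomb r B x)" if "x : pl (Suc r)" for c x using that sb_scale[OF spl that] lmD(3)[OF B l] by (simp add: bcomb_def polyv.scale_sum_right)
qed (simp add: bcomb_def)

lemma bf_bcomb: "(!!s. s <= r ==> B s : lin_map line V) ==> s <= r ==> bf (bcomb r B) s = B s"
proof
 fix y assume B: "!!s. s <= r ==> B s : lin_map line V" and s: "s <= r"
 show "bf (bcomb r B) s y = B s y"
 proof (cases "y : line")
  case True
  have "(SUM j<=r. B j [:coeff (monom (coeff y 0) s) j:]) = (SUM j<=r. if j = s then B s y else 0)" by (rule sum.cong) (use lin_map0[OF B] True in "auto simp: coeff_monom line_coeff")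
  then show ?thesis using True s by (simp add: bf_def bcomb_def monom_pl)
 next
  case False
  then show ?thesis using lmD(4)[OF B[OF s]] by (simp add: bf_def)
 qed
qed

lemma pl_span: "pl (Suc r) <= spn ((%s. monom (1::'k::field) s) ` {..r})"
proof
 fix p :: "'k poly" assume p: "p : pl (Suc r)"
 have "p = (SUM s<=r. sm (coeff p s) (monom 1 s))" by (rule poly_eqI) (use p in \<open>simp add: coeff_sum coeff_monom pl_def not_le if_distrib[of "(*) _"] sum.delta' cong: if_cong\<close>)
 moreover have "(SUM s<=r. sm (coeff p s) (monom 1 s)) : spn ((%s. monom 1 s) ` {..r})" by (intro polyv.span_sum polyv.span_scale polyv.span_base) auto
 ultimately show "p : spn ((%s. monom 1 s) ` {..r})" by simp
qed

lemma bf_inj: "b : lin_map (pl (Suc r)) V ==> b' : lin_map (pl (Suc r)) V ==> (!!s. s <= r ==> bf b s = bf b' s) ==> b = b'"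
proof (rule lin_map_eqI[OF _ _ spl _ pl_span])
 fix p assume e: "!!s. s <= r ==> bf b s = bf b' s" and "p : (%s. monom (1::'a) s) ` {..r}"
 then obtain s where s: "s <= r" "p = monom 1 s" by auto
 from fun_cong[OF e[OF s(1)], of "[:1:]"] show "b p = b' p" using s by (simp add: bf_def line_def)
qed (auto simp: monom_pl)

lemma lin_iso_ex:
 fixes U :: "'k::{finite,field} poly set"
 assumes U: "subsp U" "finite U" and W: "subsp W" "finite W" and c: "card U = card W"
 obtains g where "g : lin_map U W" "bij_betw g U W"
proof -
 have h: "(%_. 0) : lin_map {0} W" by (rule lin_map_zero[OF W(1)])
 have "subsp {0 :: 'k poly}" "{0} <= U" "inj_on (%_. 0 :: 'k poly) {0 :: 'k poly}" using sb_0[OF U(1)] subspace_zero by simp_all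
 from lin_iso_extend[OF U W c this(1,2) h this(3)] show ?thesis using that by blast
qed

text \<open>Elements of \<open>lin_map\<close> are zero outside their domain, so formulas for
  projections and isomorphisms have to be cut off.\<close>

definition rst :: "'k::field poly set => ('k poly => 'k poly) => 'k poly => 'k poly" where
 "rst U f x = (if x : U then f x else 0)"

lemma rst_pfst: "subsp U ==> subsp W ==> rst (pprod U W) pfst : lin_map (pprod U W) U"
 and rst_psnd: "subsp U ==> subsp W ==> rst (pprod U W) psnd : lin_map (pprod U W) W" by (rule lin_mapI; auto simp: rst_def pprod_def pfst_add psnd_add pfst_sm psnd_sm sb_add sb_scale)+

lemma bij_rst_pfst: "bij_betw (rst (pprod U {0}) pfst) (pprod U {0}) U" by (rule bij_betw_byWitness[where f' = "%x. pjoin x 0"]) (auto simp: rst_def pprod_def intro: poly_pair_eqI)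

lemma bij_rst_psnd: "bij_betw (rst (pprod {0} U) psnd) (pprod {0} U) U" by (rule bij_betw_byWitness[where f' = "%x. pjoin 0 x"]) (auto simp: rst_def pprod_def intro: poly_pair_eqI)

lemma rst_id: "subsp U ==> rst U (%x. x) : lin_map U U" "bij_betw (rst U (%x. x)) U U"
proof -
 have e: "rst U (%x. x) = (%x. if x : U then x else 0)" by (simp add: rst_def fun_eq_iff)
 show "subsp U ==> rst U (%x. x) : lin_map U U" unfolding e by (rule lin_map_id)
 show "bij_betw (rst U (%x. x)) U U" by (simp add: rst_def bij_betw_def inj_on_def)
qed

lemma lin_map_from_0: "f : lin_map {0} W \<longleftrightarrow> f = (%_. 0)" if "subsp W"
proof
 assume f: "f : lin_map {0} W"
 show "f = (%_. 0)"
 proof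
  show "f x = 0" for x using lin_map0[OF f] lmD(4)[OF f, of x] by (cases "x = 0") simp_all
 qed
qed (simp add: lin_map_zero[OF that])

lemma lin_map_to_0: "f : lin_map U {0} \<longleftrightarrow> f = (%_. 0)" 
proof
 assume f: "f : lin_map U {0}"
 show "f = (%_. 0)"
 proof
  show "f x = 0" for x using lmD(1,4)[OF f, of x] by (cases "x : U") simp_all
 qed
qed (simp add: lin_map_zero subspace_zero)

definition ch :: "nat => (nat => 'k::field poly => 'k poly) => (nat => 'k poly => 'k poly) => arrow => 'k poly => 'k poly" where
 "ch r A B = Mp (md r UNIV UNIV A B)"

lemma ch_simps [simp]: "s <= r ==> ch r A B (ar s) = A s" "s <= r ==> ch r A B (br s) = B s" by (simp_all add: ch_def)

lemma ch_0 [simp]: "ch r A B Eps1 = A 0" "ch r A B Eps2 = B 0" using ch_simps(1)[of 0 r A B] ch_simps(2)[of 0 r A B] by (simp_all add: ar_br_0)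

lemma ch_out [simp]: "a ~: kron_arrows r \<union> {Eps1, Eps2} ==> ch r A B a = (%_. 0)" by (simp add: ch_def md_def)

lemma ch_cochain1: "ch r A B : Lam.cochain1 r M N \<longleftrightarrow>
  (ALL s<=r. A s : lin_map (Sp M V1) (Sp N V2) & B s : lin_map (Sp M V2) (Sp N V1))" for M N :: "'k::{finite,field} krep" unfolding cochain1_Lam_iff by (simp add: ch_def, simp add: md_def)

lemma ch_eqI: "z : Lam.cochain1 r M N ==> (!!s. s <= r ==> A s = z (ar s) & B s = z (br s)) ==> ch r A B = z" for M N :: "'k::{finite,field} krep"
proof
 fix a assume z: "z : Lam.cochain1 r M N" and e: "!!s. s <= r ==> A s = z (ar s) & B s = z (br s)"
 show "ch r A B a = z a"
 proof (cases "a : kron_arrows r \<union> {Eps1, Eps2}")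
  case True
  then obtain s where "s <= r" "a = ar s \<or> a = br s" unfolding Lam_arcs_iff by blast
  then show ?thesis using e[of s] by auto
 next
  case False
  then have "z a = (%_. 0)" using z unfolding cochain1_Lam_iff by blast
  then show ?thesis using False by (simp add: ch_def md_def)
 qed
qed

text \<open>The modules that are one-dimensional at vertex 2: \<open>a\<close> collects the r + 1
  arrows out of \<open>V\<close> and \<open>b\<close> those into it.\<close>

definition Kr :: "nat => 'k::field poly set => ('k poly => 'k poly) => ('k poly => 'k poly) => 'k krep" where
 "Kr r V a b = md r V line (cf a) (bf b)"

text \<open>The relations starting at vertex 1, with c = a x: the first says \<epsilon>_2
  \<epsilon>_1 = 0 and the second \<beta>_s \<epsilon>_1 = \<epsilon>_2 \<alpha>_s. They involve
  \<open>a\<close> through its image alone.\<close>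

definition kcond :: "nat => 'k::field poly set => ('k poly => 'k poly) => bool" where
 "kcond r C b \<longleftrightarrow> (ALL c:C. b (monom (coeff c 0) 0) = 0 & (ALL s:{1..r}. b (monom (coeff c 0) s) = b (monom (coeff c s) 0)))"

lemma cf_line: "cf a s x : line" by (simp add: cf_def line_def)

text \<open>When a b = 0 all composites from 2 through 1 to 2 vanish, which settles the relations
  starting at vertex 2.\<close>

lemma Kr_reps:
 fixes V :: "'k::{finite,field} poly set"
 assumes V: "subsp V" and a: "a : lin_map V (pl (Suc r))" and b: "b : lin_map (pl (Suc r)) V"
  and ab: "!!p. p : pl (Suc r) ==> a (b p) = 0" and k: "kcond r (a ` V) b"
 shows "Kr r V a b : reps (Lam r)"
proof -
 have z: "cf a s (bf b t y) = 0" if "t <= r" for s t y using ab[OF monom_pl[OF that]] lin_map0[OF a] by (simp add: cf_def bf_def)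
 have z': "bf b s (cf a t x) = b (monom (coeff (a x) t) s)" for s t x using cf_line[of a t x] by (simp add: bf_def) (simp add: cf_def)
 have "prerep (Lam r :: 'k kquiver) (Kr r V a b)" unfolding Kr_def by (rule prerep_md[OF V subspace_line cf_lin[OF a] bf_lin[OF b V]])
 moreover have "bf b 0 (cf a 0 x) = 0" "s : {1..r} ==> bf b s (cf a 0 x) = bf b 0 (cf a s x)" if "x : V" for x s using k that unfolding kcond_def z' by blast+
 ultimately show ?thesis unfolding reps_Lam_iff' Kr_def using z by simp
qed

lemma Kr_iso:
 fixes V :: "'k::{finite,field} poly set"
 assumes g: "g : lin_map V V'" "bij_betw g V V'" and c: "!!x. x : V ==> a' (g x) = a x" "!!p. p : pl (Suc r) ==> g (b p) = b' p"
 shows "iL r (Kr r V a b) (Kr r V' a' b')"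
proof (rule Lam_isoI[of g _ _ "rst line (%x. x)"])
 fix s y assume "s <= r"
 then show "g (Mp (Kr r V a b) (br s) y) = Mp (Kr r V' a' b') (br s) (rst line (%x. x) y)" if "y : Sp (Kr r V a b) V2" using that c(2)[OF monom_pl] by (simp add: Kr_def bf_def rst_def)
next
 fix s x assume "s <= r" "x : Sp (Kr r V a b) V1"
 then show "rst line (%x. x) (Mp (Kr r V a b) (ar s) x) = Mp (Kr r V' a' b') (ar s) (g x)" using c(1) cf_line[of a s x] by (simp add: Kr_def rst_def cf_def)
qed (use g rst_id(1)[OF subspace_line] rst_id(2)[of line] in "simp_all add: Kr_def")

lemma Kr_normal_form:
 fixes V :: "'k::{finite,field} poly set"
 assumes V: "subsp V" "finite V" and V': "subsp V'" "finite V'" and c: "card V = card V'"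
  and a: "a : lin_map V (pl (Suc r))" "a' : lin_map V' (pl (Suc r))" and im: "a ` V = a' ` V'"
  and b: "b : lin_map (pl (Suc r)) V" "b' : lin_map (pl (Suc r)) V'" and ker: "!!x. x : pl (Suc r) ==> b x = 0 \<longleftrightarrow> b' x = 0"
  and ab: "!!x. x : pl (Suc r) ==> a (b x) = 0" "!!x. x : pl (Suc r) ==> a' (b' x) = 0"
 shows "iL r (Kr r V a b) (Kr r V' a' b')"
proof -
 obtain g where "g : lin_map V V'" "bij_betw g V V'" "!!x. x : V ==> a' (g x) = a x" "!!x. x : pl (Suc r) ==> g (b x) = b' x" by (rule lin_pair_normal_form[OF V V' c spl spl card_pl(2) a im b]) ((rule ker ab, assumption)+, rule that)
 then show ?thesis by (rule Kr_iso)
qed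

text \<open>Evaluates a product from any parametrization of the cocycles together with convenient
  models of the middle terms. The power of q is the number of 0-cochains.\<close>

lemma hall_mult_reindex:
 fixes M N :: "'k::{finite,field} krep"
 assumes M: "M : mL r" and N: "N : mL r" and b: "bij_betw zt J (Lam.cocycles r M N)"
  and L: "!!j. j : J ==> L j : reps (Lam r)" "!!j. j : J ==> iL r (Lam.ext_rep r M N (zt j)) (L j)"
 shows "hL r M \<otimes>\<^bsub>LH r\<^esub> hL r N = (%Z. (SUM j:J. hL r (L j) Z) /
   CARD('k) ^ (fst (dimv M) * fst (dimv N) + snd (dimv M) * snd (dimv N)))"
  "!!j. j : J ==> L j : mL r"
proof -
 have m: "Lam.ext_rep r M N (zt j) : mL r" if "j : J" for j by (rule Lam.ext_rep_modnil[OF M N]) (use b that in "auto simp: bij_betw_def")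
 show l: "L j : mL r" if "j : J" for j by (rule iso_modnil[OF m[OF that] L(1)[OF that] L(2)[OF that]])
 have "(SUM z:Lam.cocycles r M N. hL r (Lam.ext_rep r M N z) Z) = (SUM j:J. hL r (L j) Z)" for Z
 proof -
  have "(SUM z:Lam.cocycles r M N. hL r (Lam.ext_rep r M N z) Z) = (SUM j:J. hL r (Lam.ext_rep r M N (zt j)) Z)" by (rule sum.reindex_bij_betw[OF b, symmetric])
  also have "... = (SUM j:J. hL r (L j) Z)" by (rule sum.cong) (use hcls_cong[OF m l L(2)] in auto)
  finally show ?thesis .
 qed
 then show "hL r M \<otimes>\<^bsub>LH r\<^esub> hL r N = (%Z. (SUM j:J. hL r (L j) Z) /
   CARD('k) ^ (fst (dimv M) * fst (dimv N) + snd (dimv M) * snd (dimv N)))" unfolding Lam.hall_mult_hcls[OF M N] card_cochain0_Lam[OF M N] by simp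
qed

lemma dimv_simple_V2: "dimv (simple_rep V2 :: 'k::{finite,field} krep) = (0, 1)" by (simp add: dimv_def dim_line dim_zero_space)

lemma comb_cf: "a : lin_map U (pl (Suc r)) ==> comb r (cf a) = a" if "subsp U" by (rule cf_inj[OF comb_lin[OF cf_lin]]) (auto intro: cf_comb cf_lin)

lemma bcomb_bf: "b : lin_map (pl (Suc r)) V ==> subsp V ==> bcomb r (bf b) = b" by (rule bf_inj[OF bcomb_lin[OF bf_lin]]) (auto intro: bf_bcomb bf_lin)

lemma comb_cong: "(!!s. s <= r ==> A s = B s) ==> comb r A = comb r B" by (auto simp: comb_def fun_eq_iff)

lemma bcomb_cong: "(!!s. s <= r ==> A s = B s) ==> bcomb r A = bcomb r B" by (auto simp: bcomb_def fun_eq_iff)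

text \<open>The cocycles live on the arrows from 1 to 2 and are unrestricted, hence correspond to
  all linear maps \<open>a\<close>. The two modules have no common vertex, so there is no
  denominator.\<close>

lemma S1_S2:
 fixes r t :: nat
 defines "J == lin_map (pl t) (pl (Suc r)) :: ('k::{finite,field} poly => 'k poly) set"
 shows "hL r (S1p t :: 'k krep) \<otimes>\<^bsub>LH r\<^esub> hL r (simple_rep V2) = (%Z. SUM a:J. hL r (Kr r (pl t) a (%_. 0)) Z)"
  "!!a. a : J ==> Kr r (pl t) a (%_. 0) : mL r"
proof -
 let ?M = "S1p t :: 'k krep" and ?N = "simple_rep V2 :: 'k krep"
 let ?z = "%a. ch r (cf a) (%_ _. 0 :: 'k poly)"
 have coc: "z : Lam.cocycles r ?M ?N \<longleftrightarrow> (ALL s<=r. z (ar s) : lin_map (pl t) line & z (br s) = (%_. 0)) & (ALL a. a ~: kron_arrows r \<union> {Eps1, Eps2} --> z a = (%_. 0))" for z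
 proof -
  have "z : Lam.cocycles r ?M ?N \<longleftrightarrow> z : Lam.cochain1 r ?M ?N" using Lam.cochain1_0[of z r ?M ?N] unfolding cocycles_Lam_iff[OF Lam.mnD(1)[OF S1p_modnil] Lam.mnD(1)[OF simple_modnil]] by auto
  then show ?thesis unfolding cochain1_Lam_iff by (simp add: lin_map_to_0)
 qed
 have bij: "bij_betw ?z J (Lam.cocycles r ?M ?N)"
 proof (rule bij_betw_byWitness[where f' = "%z. comb r (%s. z (ar s))"])
  show "ALL a:J. comb r (%s. ?z a (ar s)) = a" by (simp add: J_def comb_cf[OF spl] cong: comb_cong)
  show "ALL z:Lam.cocycles r ?M ?N. ?z (comb r (%s. z (ar s))) = z"
  proof
   fix z assume z: "z : Lam.cocycles r ?M ?N"
   note z' = z[unfolded coc]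
   show "?z (comb r (%s. z (ar s))) = z" by (rule ch_eqI[where M = ?M and N = ?N]) (use z z' cf_comb[of r "%s. z (ar s)" "pl t"] in "auto simp: Lam.cocycles_def")
  qed
  show "?z ` J <= Lam.cocycles r ?M ?N"
  proof (rule image_subsetI)
   fix a assume "a : J"
   then have "cf a s : lin_map (pl t) line" for s unfolding J_def by (rule cf_lin)
   then show "?z a : Lam.cocycles r ?M ?N" unfolding coc by simp
  qed
  show "(%z. comb r (%s. z (ar s))) ` Lam.cocycles r ?M ?N <= J" unfolding J_def by (auto simp: coc intro!: comb_lin)
 qed
 have rep: "Kr r (pl t) a (%_. 0) : reps (Lam r)" if "a : J" for a by (rule Kr_reps) (use that in \<open>auto simp: J_def spl lin_map_zero kcond_def lin_map0[of a "pl t" "pl (Suc r)"]\<close>)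
 have iso: "iL r (Lam.ext_rep r ?M ?N (?z a)) (Kr r (pl t) a (%_. 0))" if a: "a : J" for a by (rule Lam_isoI[of "rst (pprod {0} (pl t)) psnd" _ _ "rst (pprod line {0}) pfst"])
   (use a rst_pfst[OF subspace_line subspace_zero] rst_psnd[OF subspace_zero spl[of t]] bij_rst_pfst[of line] bij_rst_psnd[of "pl t"] cf_line
    in "auto simp: Kr_def Mp_ext_ar_br rst_def pprod_def bf_def")
 note R = hall_mult_reindex[OF S1p_modnil simple_modnil bij, of "%a. Kr r (pl t) a (%_. 0)"]
 show "hL r ?M \<otimes>\<^bsub>LH r\<^esub> hL r ?N = (%Z. SUM a:J. hL r (Kr r (pl t) a (%_. 0)) Z)" using R(1)[OF rep iso] by (simp add: dimv_S1p dimv_simple_V2)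
 show "!!a. a : J ==> Kr r (pl t) a (%_. 0) : mL r" using R(2)[OF rep iso] by blast
qed

lemma dimv_Kr: "dimv (Kr r V a b :: 'k::{finite,field} krep) = (dm V, 1)" by (simp add: dimv_def Kr_def dim_line)

lemma Kr_simps [simp]: "Sp (Kr r V a b) V1 = V" "Sp (Kr r V a b) V2 = line"
 "s <= r ==> Mp (Kr r V a b) (ar s) = cf a s" "s <= r ==> Mp (Kr r V a b) (br s) = bf b s" by (simp_all add: Kr_def)

lemma psnd_comp_lin:
 fixes V :: "'k::field poly set"
 assumes V: "subsp V" and a: "a : lin_map V W"
 shows "(%p. a (rst (pprod (pl t) V) psnd p)) : lin_map (pprod (pl t) V) W"
  "(%p. a (rst (pprod (pl t) V) psnd p)) ` pprod (pl t) V = a ` V"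
proof -
 show "(%p. a (rst (pprod (pl t) V) psnd p)) : lin_map (pprod (pl t) V) W" by (rule lin_map_comp[OF rst_psnd[OF spl V] a subspace_pprod[OF spl V]])
 have "a x = a (rst (pprod (pl t) V) psnd (pjoin 0 x))" "pjoin 0 x : pprod (pl t) V" if "x : V" for x
 proof -
  have "0 : (pl t :: 'k poly set)" by (rule sb_0[OF spl])
  then show "a x = a (rst (pprod (pl t) V) psnd (pjoin 0 x))" "pjoin 0 x : pprod (pl t) V" using that by (simp_all add: rst_def)
 qed
 then have "a ` V <= (%p. a (rst (pprod (pl t) V) psnd p)) ` pprod (pl t) V" by blast
 moreover have "(%p. a (rst (pprod (pl t) V) psnd p)) ` pprod (pl t) V <= a ` V" by (rule image_subsetI) (simp add: rst_def pprod_def)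
 ultimately show "(%p. a (rst (pprod (pl t) V) psnd p)) ` pprod (pl t) V = a ` V" by blast
qed

lemma pjoin_lin:
 assumes b: "b : lin_map U U'" and V: "subsp V"
 shows "(%p. pjoin (b p) 0) : lin_map U (pprod U' V)"
proof (rule lin_mapI)
 show "pjoin (b x) 0 : pprod U' V" if "x : U" for x using lmD(1)[OF b that] sb_0[OF V] by simp
 show "pjoin (b (x + y)) 0 = pjoin (b x) 0 + pjoin (b y) 0" if "x : U" "y : U" for x y using lmD(2)[OF b that] by (simp add: pjoin_add)
 show "pjoin (b (sm c x)) 0 = sm c (pjoin (b x) 0)" if "x : U" for c x using lmD(3)[OF b that] by (simp add: pjoin_sm)
 show "pjoin (b x) 0 = 0" if "x ~: U" for x using lmD(4)[OF b that] by simp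
qed

text \<open>The new components live on the arrows from 2 to 1 and form the map \<open>b\<close>,
  restricted by the relations at vertex 1. It lands in the new summand \<open>pl t\<close>, on which
  \<open>a\<close> vanishes, so the composite a b is zero.\<close>

lemma Kr_S1:
 fixes V :: "'k::{finite,field} poly set" and r t :: nat
 assumes V: "subsp V" and a: "a : lin_map V (pl (Suc r))" and m: "Kr r V a (%_. 0) : mL r"
 defines "J == {b : lin_map (pl (Suc r)) (pl t). kcond r (a ` V) b}"
  and "L == %b. Kr r (pprod (pl t) V) (%p. a (rst (pprod (pl t) V) psnd p)) (%p. pjoin (b p) 0)"
 shows "hL r (Kr r V a (%_. 0)) \<otimes>\<^bsub>LH r\<^esub> hL r (S1p t) =
   (%Z. (SUM b:J. hL r (L b) Z) / CARD('k) ^ (dm V * t))"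
  "!!b. b : J ==> L b : mL r"
proof -
 let ?M = "Kr r V a (%_. 0) :: 'k krep" and ?N = "S1p t :: 'k krep"
 let ?z = "%b. ch r (%_ _. 0 :: 'k poly) (bf b)"
 have lb: "bf b s (cf a u x) = b (monom (coeff (a x) u) s)" for b :: "'k poly => 'k poly" and s u x using cf_line[of a u x] by (simp add: bf_def) (simp add: cf_def)
 have chc: "z : Lam.cochain1 r ?M ?N \<longleftrightarrow> (ALL s<=r. z (ar s) = (%_. 0) & z (br s) : lin_map line (pl t)) & (ALL a. a ~: kron_arrows r \<union> {Eps1, Eps2} --> z a = (%_. 0))" for z unfolding cochain1_Lam_iff by (simp add: lin_map_to_0)
 have coc: "z : Lam.cocycles r ?M ?N \<longleftrightarrow> z : Lam.cochain1 r ?M ?N & (ALL x:V. z (br 0) (cf a 0 x) = 0) & (ALL s:{1..r}. ALL x:V. z (br s) (cf a 0 x) = z (br 0) (cf a s x))" for z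
 proof -
  have e: "z (ar s) x = 0" if "z : Lam.cochain1 r ?M ?N" "s <= r" for s x using that unfolding chc by simp
  show ?thesis unfolding cocycles_Lam_iff[OF Lam.mnD(1)[OF m] Lam.mnD(1)[OF S1p_modnil]] using e[of 0] e by auto
 qed
 have bij: "bij_betw ?z J (Lam.cocycles r ?M ?N)"
 proof (rule bij_betw_byWitness[where f' = "%z. bcomb r (%s. z (br s))"])
  show "ALL b:J. bcomb r (%s. ?z b (br s)) = b"
  proof
   fix b assume "b : J"
   then have "b : lin_map (pl (Suc r)) (pl t)" by (simp add: J_def)
   then have "bcomb r (bf b) = b" by (rule bcomb_bf[OF _ spl])
   then show "bcomb r (%s. ?z b (br s)) = b" by (simp cong: bcomb_cong)
  qed
  have inv: "bf (bcomb r (%s. z (br s))) s = z (br s)" if "z : Lam.cocycles r ?M ?N" "s <= r" for z s by (rule bf_bcomb[where V = "pl t"]) (use that coc chc in auto)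
  show "ALL z:Lam.cocycles r ?M ?N. ?z (bcomb r (%s. z (br s))) = z"
  proof
   fix z assume z: "z : Lam.cocycles r ?M ?N"
   then have c: "z : Lam.cochain1 r ?M ?N" unfolding coc by blast
   show "?z (bcomb r (%s. z (br s))) = z" by (rule ch_eqI[OF c]) (use c[unfolded chc] inv[OF z] in auto)
  qed
  show "?z ` J <= Lam.cocycles r ?M ?N"
  proof
   fix z assume "z : ?z ` J"
   then obtain b where z: "z = ?z b" and b: "b : lin_map (pl (Suc r)) (pl t)" "kcond r (a ` V) b" unfolding J_def by blast
   have "z : Lam.cochain1 r ?M ?N" unfolding z ch_cochain1 using bf_lin[OF b(1) spl] by (simp add: lin_map_zero[OF subspace_zero])
   then show "z : Lam.cocycles r ?M ?N" unfolding coc unfolding z using b(2) by (simp add: lb kcond_def)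
  qed
  show "(%z. bcomb r (%s. z (br s))) ` Lam.cocycles r ?M ?N <= J"
  proof
   fix b assume "b : (%z. bcomb r (%s. z (br s))) ` Lam.cocycles r ?M ?N"
   then obtain z where z: "z : Lam.cocycles r ?M ?N" and b: "b = bcomb r (%s. z (br s))" by blast
   have "b : lin_map (pl (Suc r)) (pl t)" unfolding b by (rule bcomb_lin[OF _ spl]) (use z coc chc in auto)
   moreover have "b (monom (coeff (a x) u) s) = z (br s) (cf a u x)" if "s <= r" for u s x using lb[of b s u x] inv[OF z that] unfolding b by simp
   ultimately show "b : J" unfolding J_def kcond_def using z unfolding coc by auto
  qed
 qed
 have W: "subsp (pprod (pl t) V)" by (rule subspace_pprod[OF spl V])
 have la: "(%p. a (rst (pprod (pl t) V) psnd p)) : lin_map (pprod (pl t) V) (pl (Suc r))"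
  and im: "(%p. a (rst (pprod (pl t) V) psnd p)) ` pprod (pl t) V = a ` V" by (rule psnd_comp_lin[OF V a])+
 have lb': "(%p. pjoin (b p) 0) : lin_map (pl (Suc r)) (pprod (pl t) V)" if b: "b : J" for b by (rule pjoin_lin[OF _ V]) (use b in "simp add: J_def")
 have rep: "L b : reps (Lam r)" if b: "b : J" for b unfolding L_def
 proof (rule Kr_reps[OF W la lb'[OF b]])
  show "a (rst (pprod (pl t) V) psnd (pjoin (b p) 0)) = 0" for p using lin_map0[OF a] by (simp add: rst_def)
  show "kcond r ((%p. a (rst (pprod (pl t) V) psnd p)) ` pprod (pl t) V) (%p. pjoin (b p) 0)" unfolding im using b by (simp add: J_def kcond_def)
 qed
 have iso: "iL r (Lam.ext_rep r ?M ?N (?z b)) (L b)" if b: "b : J" for b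
 proof (rule Lam_isoI[of "rst (pprod (pl t) V) (%x. x)" _ _ "rst (pprod {0} line) psnd"])
  show "rst (pprod {0} line) psnd (Mp (Lam.ext_rep r ?M ?N (?z b)) (ar s) x) = Mp (L b) (ar s) (rst (pprod (pl t) V) (%x. x) x)" if "s <= r" "x : Sp (Lam.ext_rep r ?M ?N (?z b)) V1" for s x using that cf_line[of a s "psnd x"] by (simp add: Mp_ext_ar_br L_def) (simp add: rst_def cf_def)
  show "rst (pprod (pl t) V) (%x. x) (Mp (Lam.ext_rep r ?M ?N (?z b)) (br s) y) = Mp (L b) (br s) (rst (pprod {0} line) psnd y)" if "s <= r" "y : Sp (Lam.ext_rep r ?M ?N (?z b)) V2" for s y
  proof -
   have y: "y : pprod {0} line" "psnd y : line" using that pprodD[of y] by auto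
   have "pjoin (b (monom (coeff (psnd y) 0) s)) 0 : pprod (pl t) V" by (rule lmD(1)[OF lb'[OF b] monom_pl[OF that(1)]])
   then show ?thesis using that(1) y by (simp add: Mp_ext_ar_br L_def bf_def) (simp add: rst_def bf_def)
  qed
 qed (use rst_id(1)[OF W] rst_id(2)[of "pprod (pl t) V"] rst_psnd[OF subspace_zero subspace_line] bij_rst_psnd[of line] in "simp_all add: L_def")
 note R = hall_mult_reindex[OF m S1p_modnil bij, of L]
 show "hL r ?M \<otimes>\<^bsub>LH r\<^esub> hL r ?N = (%Z. (SUM b:J. hL r (L b) Z) / CARD('k) ^ (dm V * t))" using R(1)[OF rep iso] by (simp add: dimv_S1p dimv_Kr)
 show "!!b. b : J ==> L b : mL r" using R(2)[OF rep iso] by blast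
qed

text \<open>There is no arrow from 1 to 1, so zero is the only cocycle, and the product is the
  direct sum divided by the number q^t of 0-cochains.\<close>

lemma S1_S1: "hL r (S1p t :: 'k::{finite,field} krep) \<otimes>\<^bsub>LH r\<^esub> hL r (S1p 1) = (%Z. hL r (S1p (Suc t)) Z / CARD('k) ^ t)"
proof -
 let ?M = "S1p t :: 'k krep" and ?N = "S1p (Suc 0) :: 'k krep" and ?z = "%_ _. 0 :: 'k poly"
 have coc: "Lam.cocycles r ?M ?N = {?z}"
 proof -
  have "z : Lam.cochain1 r ?M ?N \<longleftrightarrow> z = ?z" for z
  proof
   assume z: "z : Lam.cochain1 r ?M ?N"
   show "z = ?z"
   proof
    fix a show "z a = (%_. 0)" using z Lam_arcs_iff[of a r] unfolding cochain1_Lam_iff by (auto simp: lin_map_to_0 lin_map_from_0 spl)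
   qed
  qed (simp add: cochain1_Lam_iff lin_map_zero subspace_zero spl)
  then show ?thesis unfolding set_eq_iff cocycles_Lam_iff[OF Lam.mnD(1)[OF S1p_modnil] Lam.mnD(1)[OF S1p_modnil]] by auto
 qed
 obtain g where g: "g : lin_map (pprod (pl (Suc 0)) (pl t)) (pl (Suc t) :: 'k poly set)" "bij_betw g (pprod (pl (Suc 0)) (pl t)) (pl (Suc t))" by (rule lin_iso_ex[of "pprod (pl (Suc 0)) (pl t)" "pl (Suc t)"]) (simp_all add: subspace_pprod spl finite_pprod card_pl card_pprod)
 have iso: "iL r (Lam.ext_rep r ?M ?N ?z) (S1p (Suc t))" by (rule Lam_isoI[of g _ _ "%_. 0"]) (use g lin_map0[OF g(1)] in "auto simp: pprod_zero lin_map_to_0 Mp_ext_ar_br bij_betw_def")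
 show ?thesis using hall_mult_reindex(1)[OF S1p_modnil S1p_modnil, of "%_. ?z" "{()}" r t "Suc 0" "%_. S1p (Suc t)"] iso Lam.mnD(1)[OF S1p_modnil[of "Suc t" r]] by (simp add: bij_betw_def coc dimv_S1p)
qed

section \<open>Extensions by \<open>K\<^sub>1\<close> and \<open>K\<^sub>2\<close>\<close>

lemma ext_rep_0_dsum:
 fixes M N :: "'k::{finite,field} krep"
 assumes M: "M : mL r" and N: "N : mL r"
 shows "(%_ _. 0) : Lam.cocycles r M N" "is_dsum (Lam r) (Lam.ext_rep r M N (%_ _. 0)) N M"
proof -
 let ?E = "Lam.ext_rep r M N (%_ _. 0)"
 note pM = Lam.mnD(3)[OF M] and pN = Lam.mnD(3)[OF N]
 have c1: "(%_ _. 0) : Lam.cochain1 r M N" unfolding cochain1_Lam_iff using lin_map_zero prD(1)[OF pN] by blast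
 show coc: "(%_ _. 0) : Lam.cocycles r M N" unfolding cocycles_Lam_iff[OF Lam.mnD(1)[OF M] Lam.mnD(1)[OF N]] using c1 prerep_Mp0[OF pN] by simp
 have z: "0 : Sp N i" for i by (rule sb_0[OF prD(1)[OF pN]])
 define g where "g = (%i. rst (Sp M i) (%x. pjoin 0 x))"
 define f where "f = (%i x. if x : Sp N i then pjoin x 0 else 0)"
 have "f : Homs (Lam r) N ?E" unfolding f_def by (rule Lam.std_extn_homs(1)[OF pM pN c1])
 moreover have "g : Homs (Lam r) M ?E"
 proof (rule HomsI)
  show "g i : lin_map (Sp M i) (Sp ?E i)" for i by (rule lin_mapI) (use z sb_add[OF prD(1)[OF pM]] sb_scale[OF prD(1)[OF pM]] in "auto simp: g_def rst_def pjoin_add pjoin_sm")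
  fix a x assume a: "a : arrs (Lam r :: 'k kquiver)" and x: "x : Sp M (tv (Lam r :: 'k kquiver) a)"
  show "g (hv (Lam r) a) (Mp M a x) = Mp ?E a (g (tv (Lam r) a) x)" using Lam.Mp_ext_rep[OF a, of "pjoin 0 x" N M "%_ _. 0"] prerep_mem[OF pM a x] x z prerep_Mp0[OF pN] by (simp add: g_def rst_def)
 qed
 moreover have "bij_betw (%(x, y). f i x + g i y) (Sp N i \<times> Sp M i) (Sp ?E i)" for i
 proof -
  have "bij_betw (%(x, y). f i x + g i y) (Sp N i \<times> Sp M i) (Sp ?E i) \<longleftrightarrow> bij_betw (%(x, y). pjoin x y) (Sp N i \<times> Sp M i) (Sp ?E i)" by (rule bij_betw_cong) (auto simp: f_def g_def rst_def pjoin_add)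
  then show ?thesis using bij_pprod[of "Sp N i" "Sp M i"] by simp
 qed
 ultimately show "is_dsum (Lam r) ?E N M" unfolding is_dsum_def by blast
qed

text \<open>The second kind of defining relations identifies every extension of \<open>M\<close> by
  \<open>K\<close> with the direct sum, and thus all of them with each other.\<close>

lemma ebr_ext_rep:
 fixes M K :: "'k::{finite,field} krep"
 assumes M: "M : mL r" and K: "K : Pd1 (Lam r)" and z: "z : Lam.cocycles r M K" "w : Lam.cocycles r M K"
 shows "ebr r (hL r (Lam.ext_rep r M K z)) = ebr r (hL r (Lam.ext_rep r M K w))"
proof -
 have K': "K : mL r" using K unfolding Pd1_def by blast
 have e: "ebr r (hL r (Lam.ext_rep r M K z)) = ebr r (hL r (Lam.ext_rep r M K (%_ _. 0)))" if z: "z : Lam.cocycles r M K" for z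
 proof -
  let ?L = "Lam.ext_rep r M K z" and ?X = "Lam.ext_rep r M K (%_ _. 0)"
  note m = Lam.ext_rep_modnil[OF M K' z] Lam.ext_rep_modnil[OF M K' ext_rep_0_dsum(1)[OF M K']]
  have s: "ses (Lam r) K (%i x. if x : Sp K i then pjoin x 0 else 0) ?L (%i p. if p : pprod (Sp K i) (Sp M i) then psnd p else 0) M" by (rule Lam.std_extn_ses[OF Lam.mnD(3)[OF M] Lam.mnD(3)[OF K']]) (use z in "simp add: Lam.cocycles_def")
  have "hL r ?L \<ominus>\<^bsub>LH r\<^esub> hL r ?X : hall_rels r" unfolding hall_rels_def using K M m s ext_rep_0_dsum(2)[OF M K'] by blast
  then have "hL r ?L \<ominus>\<^bsub>LH r\<^esub> hL r ?X : hall_ideal r" unfolding hall_ideal_def by (rule ideal_gen.gen)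
  then show ?thesis using Lam.hall_diff[OF Lam.hcls_closed[OF m(1)] Lam.hcls_closed[OF m(2)]] by (intro ebr_cong) simp
 qed
 show ?thesis unfolding e[OF z(1)] e[OF z(2)] ..
qed

lemma CARD_Qv: "real CARD('k::{finite,field}) powi n : Qv (vq TYPE('k))" by (intro Qv_powi vq_rat Qv_rat) simp

text \<open>All middle terms have the same image, so the product is the number of cocycles over that
  of 0-cochains times any single middle term. The freedom to choose this term is exploited
  below.\<close>

lemma ebr_mult_ext:
 fixes M K :: "'k::{finite,field} krep"
 assumes M: "M : mL r" and K: "K : Pd1 (Lam r)" and w: "w : Lam.cocycles r M K"
  and L: "L : mL r" "iL r (Lam.ext_rep r M K w) L"
 shows "ebr r (hL r M) \<otimes>\<^bsub>sd_hall r\<^esub> ebr r (hL r K) =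
  ebr r (%Z. real (card (Lam.cocycles r M K)) / CARD('k) ^ (fst (dimv M) * fst (dimv K) + snd (dimv M) * snd (dimv K)) * hL r L Z)"
proof -
 interpret R: ring "sd_hall r :: 'k ihall ring" by (rule ring_sd_hall)
 have K': "K : mL r" using K unfolding Pd1_def by blast
 let ?C = "Lam.cocycles r M K" and ?c = "1 / real CARD('k) ^ (fst (dimv M) * fst (dimv K) + snd (dimv M) * snd (dimv K))"
 have cq: "?c : Qv (vq TYPE('k))" using CARD_Qv[of "- int (fst (dimv M) * fst (dimv K) + snd (dimv M) * snd (dimv K))", where ?'k = 'k] by (simp only: power_int_minus power_int_of_nat inverse_eq_divide)
 have e: "ebr r (%Z. ?c * hL r (Lam.ext_rep r M K z) Z) = ebr r (%Z. ?c * hL r L Z)" if z: "z : ?C" for z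
 proof -
  have "hL r (Lam.ext_rep r M K w) = hL r L" by (rule hcls_cong[OF Lam.ext_rep_modnil[OF M K' w] L])
  then show ?thesis using ebr_ext_rep[OF M K z w]
   iscale_ebr[OF Lam.hcls_closed[OF Lam.ext_rep_modnil[OF M K' z]] cq] iscale_ebr[OF Lam.hcls_closed[OF L(1)] cq] by simp
 qed
 have cl: "(%Z. ?c * hL r X Z) : cH r" if "X : mL r" for X :: "'k krep" by (rule Lam.hall_scale_closed[OF Lam.hcls_closed[OF that]]) (use cq in simp)
 have "ebr r (hL r M) \<otimes>\<^bsub>sd_hall r\<^esub> ebr r (hL r K) = ebr r (%Z. SUM z:?C. ?c * hL r (Lam.ext_rep r M K z) Z)" unfolding ebr_mult[OF Lam.hcls_closed[OF M] Lam.hcls_closed[OF K'], symmetric] Lam.hall_mult_hcls[OF M K'] card_cochain0_Lam[OF M K'] by (simp add: sum_divide_distrib)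
 also have "... = (\<Oplus>\<^bsub>iHall r\<^esub>z\<in>?C. ebr r (%Z. ?c * hL r (Lam.ext_rep r M K z) Z))" by (rule finsum_iHall_ebr[symmetric]) (use Lam.finite_cocycles[OF M K'] cl Lam.ext_rep_modnil[OF M K'] in auto)
 also have "... = (\<Oplus>\<^bsub>sd_hall r\<^esub>z\<in>?C. ebr r (%Z. ?c * hL r (Lam.ext_rep r M K z) Z))" by (simp add: finsum_def)
 also have "... = (\<Oplus>\<^bsub>sd_hall r\<^esub>z\<in>?C. ebr r (%Z. ?c * hL r L Z))" by (rule R.finsum_cong') (use e ebr_closed[OF cl[OF L(1)]] in auto)
 also have "... = (\<Oplus>\<^bsub>iHall r\<^esub>z\<in>?C. ebr r (%Z. ?c * hL r L Z))" by (simp add: finsum_def)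
 also have "... = ebr r (%Z. SUM z:?C. ?c * hL r L Z)" by (rule finsum_iHall_ebr) (use Lam.finite_cocycles[OF M K'] cl[OF L(1)] in auto)
 finally show ?thesis by simp
qed

lemma K1_modnil: "(eps_rep Eps1 :: 'k::{finite,field} krep) : mL r" and K2_modnil: "(eps_rep Eps2 :: 'k::{finite,field} krep) : mL r" by (rule eps_rep_modnil; simp)+

lemma dimv_eps_rep: "dimv (eps_rep e :: 'k::{finite,field} krep) = (1, 1)" by (simp add: dimv_def dim_line)

lemma Mp_K1 [simp]: "Mp (eps_rep Eps1) (ar s) x = (if s = 0 & x : line then x else 0)" "Mp (eps_rep Eps1) (br s) x = 0"
 and Mp_K2 [simp]: "Mp (eps_rep Eps2) (br s) x = (if s = 0 & x : line then x else 0)" "Mp (eps_rep Eps2) (ar s) x = 0" by (auto simp: ar_def br_def eps_rep_def)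

text \<open>A cocycle with values in \<open>K\<^sub>1\<close> is determined by its components at the arrows from 1 to 2.\<close>

lemma cocycles_K1:
 fixes M :: "'k::{finite,field} krep"
 assumes M: "M : mL r"
 shows "card (Lam.cocycles r M (eps_rep Eps1)) = CARD('k) ^ (Suc r * fst (dimv M))"
proof -
 let ?K = "eps_rep Eps1 :: 'k krep" and ?J = "lin_map (Sp M V1) (pl (Suc r)) :: ('k poly => 'k poly) set"
 note rM = Lam.mnD(1)[OF M, unfolded reps_Lam_iff'] and pM = Lam.mnD(3)[OF M]
 note lM = pM[unfolded prerep_Lam_iff]
 have sM: "!!x. x : Sp M V2 ==> Mp M (ar 0) (Mp M (br 0) x) = 0" "!!x. x : Sp M V1 ==> Mp M (br 0) (Mp M (ar 0) x) = 0"
  "!!s x. s : {1..r} ==> x : Sp M V2 ==> Mp M (ar s) (Mp M (br 0) x) = Mp M (ar 0) (Mp M (br s) x)"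
  "!!s x. s : {1..r} ==> x : Sp M V1 ==> Mp M (br s) (Mp M (ar 0) x) = Mp M (br 0) (Mp M (ar s) x)" using rM by blast+
 have la: "Mp M (ar s) : lin_map (Sp M V1) (Sp M V2)" "Mp M (br s) : lin_map (Sp M V2) (Sp M V1)" if "s <= r" for s using lM that by blast+
 have sub: "subsp (Sp M i)" for i by (rule prD(1)[OF pM])
 \<comment> \<open>On K_1 the map \<epsilon>_1 is the identity of \<open>line\<close>, so the
   relations starting at vertex 2 can be solved for the components on the arrows from 2 to 1. The
   relations starting at vertex 1 then hold because they hold in \<open>M\<close>.\<close>
 define B where "B A s = (if s = 0 then (%y. - A 0 (Mp M (br 0) y)) else (%y. A s (Mp M (br 0) y) - A 0 (Mp M (br s) y)))" for A :: "nat => 'k poly => 'k poly" and s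
 have Bl: "B A s : lin_map (Sp M V2) line" if A: "!!s. s <= r ==> A s : lin_map (Sp M V1) line" and s: "s <= r" for A s
 proof -
  note c = lin_map_comp[OF la(2) A sub]
  have "(%y. sm (-1) (A 0 (Mp M (br 0) y))) : lin_map (Sp M V2) line" by (rule lin_map_scale[OF c subspace_line]) simp_all
  moreover have "(%y. A s (Mp M (br 0) y) - A 0 (Mp M (br s) y)) : lin_map (Sp M V2) line" by (rule lin_map_sub[OF c c subspace_line]) (simp_all add: s)
  ultimately show ?thesis by (simp add: B_def)
 qed
 have coc: "z : Lam.cocycles r M ?K \<longleftrightarrow> z : Lam.cochain1 r M ?K & (ALL s<=r. z (br s) = B (%s. z (ar s)) s)" for z
 proof (cases "z : Lam.cochain1 r M ?K")
  case True
  note lz = True[unfolded cochain1_Lam_iff]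
  have za: "z (ar s) : lin_map (Sp M V1) line" "z (br s) : lin_map (Sp M V2) line" if "s <= r" for s using lz that by simp_all
  have zl: "z (br s) w : line" if "s <= r" "w : Sp M V2" for s w by (rule lmD(1)[OF za(2)[OF that(1)] that(2)])
  have Bla: "B (%s. z (ar s)) s : lin_map (Sp M V2) line" if "s <= r" for s by (rule Bl[OF za(1) that])
  have c1: "(ALL w:Sp M V2. Mp ?K (ar 0) (z (br 0) w) + z (ar 0) (Mp M (br 0) w) = 0) \<longleftrightarrow> z (br 0) = B (%s. z (ar s)) 0"
  proof -
   have "Mp ?K (ar 0) (z (br 0) w) + z (ar 0) (Mp M (br 0) w) = 0 \<longleftrightarrow> z (br 0) w = B (%s. z (ar s)) 0 w" if "w : Sp M V2" for w using zl[OF _ that, of 0] by (simp add: B_def eq_neg_iff_add_eq_0)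
   moreover have "z (br 0) w = B (%s. z (ar s)) 0 w" if "w ~: Sp M V2" for w using lmD(4)[OF za(2) that, of 0] lmD(4)[OF Bla that, of 0] by simp
   ultimately show ?thesis unfolding fun_eq_iff by blast
  qed
  have c2: "(ALL w:Sp M V2. Mp ?K (ar s) (z (br 0) w) + z (ar s) (Mp M (br 0) w) = Mp ?K (ar 0) (z (br s) w) + z (ar 0) (Mp M (br s) w)) \<longleftrightarrow> z (br s) = B (%s. z (ar s)) s" if s: "s : {1..r}" for s
  proof -
   have "Mp ?K (ar s) (z (br 0) w) + z (ar s) (Mp M (br 0) w) = Mp ?K (ar 0) (z (br s) w) + z (ar 0) (Mp M (br s) w) \<longleftrightarrow> z (br s) w = B (%s. z (ar s)) s w" if "w : Sp M V2" for w using zl[OF _ that, of s] s by (auto simp: B_def algebra_simps)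
   moreover have "z (br s) w = B (%s. z (ar s)) s w" if "w ~: Sp M V2" for w using lmD(4)[OF za(2) that, of s] lmD(4)[OF Bla that, of s] s by simp
   ultimately show ?thesis unfolding fun_eq_iff by blast
  qed
  have all: "(ALL s<=r. P s) \<longleftrightarrow> P 0 & (ALL s:{1..r}. P s)" for P by (auto simp: Suc_le_eq)
  have c3: "z (br 0) (Mp M (ar 0) u) = 0 & z (br s) (Mp M (ar 0) u) = z (br 0) (Mp M (ar s) u)" if e: "!!s. s <= r ==> z (br s) = B (%s. z (ar s)) s" and u: "u : Sp M V1" and s: "s : {1..r}" for u s using e[of 0] e[of s] s sM(2)[OF u] sM(4)[OF s u] lin_map0[OF za(1)[of 0]] lin_map0[OF za(1)[of s]] by (simp add: B_def)
  have c4: "z (br 0) (Mp M (ar 0) u) = 0" if e: "z (br 0) = B (%s. z (ar s)) 0" and u: "u : Sp M V1" for u using e sM(2)[OF u] lin_map0[OF za(1)[of 0]] by (simp add: B_def)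
  have R3: "(ALL s:{1..r}. ALL w:Sp M V2. Mp ?K (ar s) (z (br 0) w) + z (ar s) (Mp M (br 0) w) = Mp ?K (ar 0) (z (br s) w) + z (ar 0) (Mp M (br s) w)) \<longleftrightarrow> (ALL s:{1..r}. z (br s) = B (%s. z (ar s)) s)" by (rule ball_cong[OF rfl c2])
  have R2: "ALL u:Sp M V1. Mp ?K (br 0) (z (ar 0) u) + z (br 0) (Mp M (ar 0) u) = 0" if "z (br 0) = B (%s. z (ar s)) 0" using c4[OF that] by simp
  have R4: "ALL s:{1..r}. ALL u:Sp M V1. Mp ?K (br s) (z (ar 0) u) + z (br s) (Mp M (ar 0) u) = Mp ?K (br 0) (z (ar s) u) + z (br 0) (Mp M (ar s) u)" if e: "ALL s<=r. z (br s) = B (%s. z (ar s)) s"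
  proof (intro ballI)
   fix s u assume "s : {1..r}" "u : Sp M V1"
   from c3[OF _ this(2,1)] e show "Mp ?K (br s) (z (ar 0) u) + z (br s) (Mp M (ar 0) u) = Mp ?K (br 0) (z (ar s) u) + z (br 0) (Mp M (ar s) u)" by simp
  qed
  show ?thesis unfolding cocycles_Lam_iff[OF Lam.mnD(1)[OF M] Lam.mnD(1)[OF K1_modnil]] c1 R3 using True R2 R4 all[of "%s. z (br s) = B (%s. z (ar s)) s"] by argo
 qed (simp add: Lam.cocycles_def)
 have Bc: "B A s = B A' s" if "!!s. s <= r ==> A s = A' s" "s <= r" for A A' s using that by (simp add: B_def)
 have bij: "bij_betw (%a. ch r (cf a) (B (cf a))) ?J (Lam.cocycles r M ?K)"
 proof (rule bij_betw_byWitness[where f' = "%z. comb r (%s. z (ar s))"])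
  show "ALL a:?J. comb r (%s. ch r (cf a) (B (cf a)) (ar s)) = a" by (simp add: comb_cf[OF sub] cong: comb_cong)
  show "ALL z:Lam.cocycles r M ?K. ch r (cf (comb r (%s. z (ar s)))) (B (cf (comb r (%s. z (ar s))))) = z"
  proof
   fix z assume z: "z : Lam.cocycles r M ?K"
   then have c: "z : Lam.cochain1 r M ?K" and e: "!!s. s <= r ==> z (br s) = B (%s. z (ar s)) s" unfolding coc by blast+
   have a: "cf (comb r (%s. z (ar s))) s = z (ar s)" if "s <= r" for s by (rule cf_comb[OF _ that, where U = "Sp M V1"]) (use c in "simp add: cochain1_Lam_iff")
   show "ch r (cf (comb r (%s. z (ar s)))) (B (cf (comb r (%s. z (ar s))))) = z" by (rule ch_eqI[OF c]) (use a e Bc[OF a] in simp)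
  qed
  show "(%a. ch r (cf a) (B (cf a))) ` ?J <= Lam.cocycles r M ?K"
  proof (rule image_subsetI)
   fix a assume a: "a : ?J"
   have "ch r (cf a) (B (cf a)) : Lam.cochain1 r M ?K" unfolding ch_cochain1 using cf_lin[OF a] Bl[OF cf_lin[OF a]] by simp
   then show "ch r (cf a) (B (cf a)) : Lam.cocycles r M ?K" unfolding coc using Bc[of "cf a" "%s. ch r (cf a) (B (cf a)) (ar s)"] by simp
  qed
  show "(%z. comb r (%s. z (ar s))) ` Lam.cocycles r M ?K <= ?J"
  proof (rule image_subsetI)
   fix z assume "z : Lam.cocycles r M ?K"
   then have "z : Lam.cochain1 r M ?K" unfolding coc by blast
   then show "comb r (%s. z (ar s)) : ?J" by (intro comb_lin) (simp add: cochain1_Lam_iff)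
  qed
 qed
 have "card (Lam.cocycles r M ?K) = card ?J" by (rule bij_betw_same_card[OF bij, symmetric])
 also have "... = CARD('k) ^ (Suc r * fst (dimv M))" using card_lin_map_dim[OF sub _ spl card_pl(2), of V1 "Suc r"] Lam.mnD(2)[OF M] by (simp add: fdim_def dim_pl dimv_def mult.commute)
 finally show ?thesis .
qed

text \<open>A common extension by K_1 makes the products of \<open>[M]\<close> and
  \<open>[N]\<close> with \<open>[K_1]\<close> multiples of one class; equality of the dimensions
  makes the factors equal. Then \<open>[K_1]\<close> is cancelled.\<close>

lemma ebr_cancel_K1:
 fixes M N :: "'k::{finite,field} krep"
 assumes M: "M : mL r" and N: "N : mL r" and d: "dimv M = dimv N"
  and z: "z : Lam.cocycles r M (eps_rep Eps1)" and w: "w : Lam.cocycles r N (eps_rep Eps1)"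
  and i: "iL r (Lam.ext_rep r M (eps_rep Eps1) z) (Lam.ext_rep r N (eps_rep Eps1) w)"
 shows "ebr r (hL r M) = ebr r (hL r N)"
proof -
 interpret R: ring "sd_hall r :: 'k ihall ring" by (rule ring_sd_hall)
 let ?K = "eps_rep Eps1 :: 'k krep" and ?u = "ebr r (hL r (eps_rep Eps1 :: 'k krep))"
 let ?x = "ebr r (hL r M)" and ?y = "ebr r (hL r N)" and ?L = "Lam.ext_rep r N ?K w"
 have L: "?L : mL r" by (rule Lam.ext_rep_modnil[OF N K1_modnil w])
 have "iL r ?L ?L" by (rule iso_rep_refl[OF Lam.mnD(3)[OF L]])
 then have e: "?x \<otimes>\<^bsub>sd_hall r\<^esub> ?u = ?y \<otimes>\<^bsub>sd_hall r\<^esub> ?u" using ebr_mult_ext[OF M K1_Pd1 z L i] ebr_mult_ext[OF N K1_Pd1 w L] cocycles_K1[OF M] cocycles_K1[OF N] d by simp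
 have u: "?u : Units (sd_hall r)" by (rule ebr_Units[OF K1_Pd1])
 have c: "?x : carrier (sd_hall r)" "?y : carrier (sd_hall r)" "?u : carrier (sd_hall r)" "inv\<^bsub>sd_hall r\<^esub> ?u : carrier (sd_hall r)" using ebr_closed[OF Lam.hcls_closed[OF M]] ebr_closed[OF Lam.hcls_closed[OF N]] u by auto
 have "x = (x \<otimes>\<^bsub>sd_hall r\<^esub> ?u) \<otimes>\<^bsub>sd_hall r\<^esub> inv\<^bsub>sd_hall r\<^esub> ?u" if "x : carrier (sd_hall r)" for x using that c u by (simp add: R.m_assoc)
 from this[OF c(1)] this[OF c(2)] e show ?thesis by simp
qed

text \<open>Truncation after the coefficient of index m. It interpolates between the inclusion of W
  (m = r), which the triple product yields, and a map of rank one (m = 0), which belongs to the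
  direct sum of K_2 and copies of S_1.\<close>

definition btr :: "nat => nat => 'k::field poly => 'k poly" where
 "btr r m = rst (pl (Suc r)) (poly_cutoff (Suc m))"

lemma poly_cutoff_lin: "poly_cutoff n (p + q) = poly_cutoff n p + poly_cutoff n q" "poly_cutoff n (sm c p) = sm c (poly_cutoff n p)" by (rule poly_eqI; simp add: coeff_poly_cutoff)+

lemma btr_lin: "Suc m <= n ==> btr r m : lin_map (pl (Suc r)) (pl n)"
proof (rule lin_mapI)
 assume n: "Suc m <= n"
 show "btr r m x : pl n" if "x : pl (Suc r)" for x using that n by (auto simp: btr_def rst_def pl_def coeff_poly_cutoff)
qed (auto simp: btr_def rst_def poly_cutoff_lin sb_add[OF spl] sb_scale[OF spl])

lemma bf_btr: "s <= r ==> bf (btr r m) s y = (if y : line & s <= m then monom (coeff y 0) s else 0)" by (auto simp: bf_def btr_def rst_def monom_pl coeff_poly_cutoff coeff_monom intro!: poly_eqI)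

lemma kcond_0: "kcond r {0} b" if "b 0 = 0" using that by (simp add: kcond_def)

text \<open>Nilpotency is inherited by recognizing the module as a middle term in
  \<open>Kr_S1\<close>, with zero-dimensional first factor.\<close>

lemma Kr_0_modnil:
 assumes b: "b : lin_map (pl (Suc r)) (pl n)"
 shows "(Kr r (pl n) (%_. 0) b :: 'k::{finite,field} krep) : mL r"
proof -
 have a: "(%_. 0) : lin_map (pl 0) (pl (Suc r) :: 'k poly set)" by (rule lin_map_zero[OF spl])
 have p0: "subsp (pl 0 :: 'k poly set)" by (rule spl)
 have k: "b : {b : lin_map (pl (Suc r)) (pl n). kcond r ((%_. 0) ` (pl 0 :: 'k poly set)) b}" using b lin_map0[OF b] by (simp add: kcond_0 pl_0)
 let ?L = "Kr r (pprod (pl n) (pl 0)) (%p. (%_. 0) (rst (pprod (pl n) (pl 0)) psnd p)) (%p. pjoin (b p) 0) :: 'k krep"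
 have m: "?L : mL r" by (rule Kr_S1(2)[OF p0 a S1_S2(2)[OF a] k])
 have g: "rst (pprod (pl n) (pl 0)) pfst : lin_map (pprod (pl n) (pl 0)) (pl n :: 'k poly set)" "bij_betw (rst (pprod (pl n) (pl 0)) pfst) (pprod (pl n) (pl 0)) (pl n :: 'k poly set)" using rst_pfst[OF spl[of n] p0] bij_rst_pfst[of "pl n :: 'k poly set"] by (simp_all add: pl_0)
 have "iL r ?L (Kr r (pl n) (%_. 0) b)" by (rule Kr_iso[OF g]) (use lmD(1)[OF b] in "auto simp: rst_def pl_0")
 moreover have "Kr r (pl n) (%_. 0) b : reps (Lam r)" by (rule Kr_reps[OF spl lin_map_zero[OF spl] b]) (use lin_map0[OF b] sb_0[OF spl[of n]] in "auto simp: kcond_def")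
 ultimately show ?thesis using iso_modnil[OF m] by blast
qed

text \<open>
 The extension of \<open>M = Kr 0 b\<close> by \<open>K\<^sub>1\<close> defined by the cocycle below contains a second copy of
 \<open>K\<^sub>1\<close>; passing to the other quotient changes \<open>\<beta>\<^sub>m\<close>.
\<close>

lemma ebr_btr_step:
 assumes m: "Suc m <= r" and n: "Suc r <= n"
 shows "ebr r (hL r (Kr r (pl n) (%_. 0) (btr r m) :: 'k::{finite,field} krep)) = ebr r (hL r (Kr r (pl n) (%_. 0) (btr r (Suc m))))"
proof -
 let ?X = "%j. Kr r (pl n) (%_. 0) (btr r j) :: 'k krep" and ?K = "eps_rep Eps1 :: 'k krep"
 \<comment> \<open>At \<alpha>_(m+1) the cocycle reads off the constant coefficient, where the image
   of \<epsilon>_2 lies. The relation \<alpha>_(m+1) \<epsilon>_2 = \<epsilon>_1 \<beta>_(m+1) then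
   forces \<open>B\<close> to be the identity at \<beta>_(m+1). The truncations all agree at
   \<epsilon>_2, so the same cocycle serves for \<open>?X m\<close> and
   \<open>?X (Suc m)\<close>.\<close>
 define A where "A = (%s x :: 'k poly. if s = Suc m & x : pl n then [:coeff x 0:] else 0)"
 define B where "B = (%s y :: 'k poly. if s = Suc m & y : line then y else 0)"
 have X: "?X j : mL r" if "j <= r" for j by (rule Kr_0_modnil[OF btr_lin]) (use that n in simp)
 have Al: "A s : lin_map (pl n) line" for s by (rule lin_mapI) (auto simp: A_def line_def sb_add[OF spl] sb_scale[OF spl])
 have Bl: "B s : lin_map line line" for s by (rule lin_mapI) (auto simp: B_def sb_add[OF subspace_line] sb_scale[OF subspace_line] sb_0[OF subspace_line])
 have mo: "monom c s : pl n" if "s <= r" for c :: 'k and s using that n by (auto simp: pl_def coeff_monom)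
 have cf0: "cf (%_. 0) s x = 0" for s and x :: "'k poly" by (simp add: cf_def)
 have l0: "(0 :: 'k poly) : line" by (rule sb_0[OF subspace_line])
 have coc: "ch r A B : Lam.cocycles r (?X j) ?K" if j: "j <= r" for j
 proof -
  have c1: "ch r A B : Lam.cochain1 r (?X j) ?K" unfolding ch_cochain1 using Al Bl by simp
  show ?thesis unfolding cocycles_Lam_iff[OF Lam.mnD(1)[OF X[OF j]] Lam.mnD(1)[OF K1_modnil]] using c1 by (auto simp: bf_btr cf0 A_def B_def l0 mo line_coeff coeff_monom)
 qed
 \<comment> \<open>In both extensions \<beta>_(m+1) y has y as its component in K_1. Adding the
   corresponding multiple of the monomial of exponent m + 1 supplies the missing value of
   \<beta>_(m+1), and it leaves alone the constant coefficient that \<open>A\<close> reads.\<close>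
 let ?f = "rst (pprod line (pl n)) (%p. pjoin (pfst p) (psnd p + monom (coeff (pfst p) 0) (Suc m))) :: 'k poly => 'k poly"
 let ?g = "rst (pprod line (pl n)) (%p. pjoin (pfst p) (psnd p - monom (coeff (pfst p) 0) (Suc m))) :: 'k poly => 'k poly"
 note sp = sb_add[OF spl] sb_diff[OF spl] mo[OF m] sb_scale[OF spl]
 have sub: "subsp (pprod line (pl n) :: 'k poly set)" by (rule subspace_pprod[OF subspace_line spl])
 have f: "?f : lin_map (pprod line (pl n)) (pprod line (pl n))"
 proof (rule lin_mapI)
  fix x y :: "'k poly" and c :: 'k assume x: "x : pprod line (pl n)" and y: "y : pprod line (pl n)"
  show "?f (x + y) = ?f x + ?f y" using x y sb_add[OF sub x y] by (simp add: rst_def pjoin_add pfst_add psnd_add add_ac flip: add_monom)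
  show "?f (sm c x) = sm c (?f x)" using x sb_scale[OF sub x] by (simp add: rst_def pjoin_sm pfst_sm psnd_sm smult_add_right smult_monom)
 qed (auto simp: rst_def pprod_def sp)
 have fb: "bij_betw ?f (pprod line (pl n)) (pprod line (pl n))" by (rule bij_betw_byWitness[where f' = ?g]) (auto simp: rst_def pprod_def sp intro: poly_pair_eqI)
 have iso: "iL r (Lam.ext_rep r (?X m) ?K (ch r A B)) (Lam.ext_rep r (?X (Suc m)) ?K (ch r A B))"
 proof (rule Lam_isoI[of ?f _ _ "rst (pprod line line) (%x. x)"])
  fix s p assume s: "s <= r" and p: "p : Sp (Lam.ext_rep r (?X m) ?K (ch r A B)) V1"
  then have p': "p : pprod line (pl n)" "pfst p : line" "psnd p : pl n" using pprodD[of p] by auto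
  have fp: "?f p : pprod line (pl n)" by (rule lmD(1)[OF f p'(1)])
  have 1: "Mp (Lam.ext_rep r (?X m) ?K (ch r A B)) (ar s) p = pjoin (Mp ?K (ar s) (pfst p) + A s (psnd p)) 0" using Mp_ext_ar_br(1)[OF s, of p ?K "?X m" "ch r A B"] s p' cf0 by simp
  have 2: "Mp (Lam.ext_rep r (?X (Suc m)) ?K (ch r A B)) (ar s) (?f p) = pjoin (Mp ?K (ar s) (pfst p) + A s (psnd p)) 0" using Mp_ext_ar_br(1)[OF s, of "?f p" ?K "?X (Suc m)" "ch r A B"] s p' fp cf0 by (simp add: rst_def A_def sp coeff_monom)
  have "Mp ?K (ar s) (pfst p) + A s (psnd p) : line" using lmD(1)[OF Al p'(3)] p'(2) sb_add[OF subspace_line] by (cases "s = 0") (auto simp: l0)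
  then show "rst (pprod line line) (%x. x) (Mp (Lam.ext_rep r (?X m) ?K (ch r A B)) (ar s) p) = Mp (Lam.ext_rep r (?X (Suc m)) ?K (ch r A B)) (ar s) (?f p)" unfolding 1 2 by (simp add: rst_def l0)
 next
  fix s y assume s: "s <= r" and y: "y : Sp (Lam.ext_rep r (?X m) ?K (ch r A B)) V2"
  then have y': "y : pprod line line" "psnd y : line" using pprodD[of y] by auto
  have 1: "Mp (Lam.ext_rep r (?X j) ?K (ch r A B)) (br s) y = pjoin (B s (psnd y)) (bf (btr r j) s (psnd y))" for j using Mp_ext_ar_br(2)[OF s, of y ?K "?X j" "ch r A B"] s y' by simp
  have "pjoin (B s (psnd y)) (bf (btr r m) s (psnd y)) : pprod line (pl n)" using lmD(1)[OF Bl y'(2)] y'(2) mo[OF s] sb_0[OF spl[of n, where ?'a = 'k]] s by (simp add: bf_btr)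
  moreover have 2: "rst (pprod line line) (%x. x) y = y" using y' by (simp add: rst_def)
  ultimately show "?f (Mp (Lam.ext_rep r (?X m) ?K (ch r A B)) (br s) y) = Mp (Lam.ext_rep r (?X (Suc m)) ?K (ch r A B)) (br s) (rst (pprod line line) (%x. x) y)" unfolding 1 2 using y' s by (auto simp: rst_def bf_btr B_def le_Suc_eq)
 qed (use f fb rst_id(1)[OF subspace_pprod[OF subspace_line subspace_line]] rst_id(2) in simp_all)
 show ?thesis by (rule ebr_cancel_K1[OF X X _ coc coc iso]) (use m in "simp_all add: dimv_Kr")
qed

lemma ebr_btr:
 assumes n: "Suc r <= n" and m: "m <= r"
 shows "ebr r (hL r (Kr r (pl n) (%_. 0) (btr r m) :: 'k::{finite,field} krep)) = ebr r (hL r (Kr r (pl n) (%_. 0) (btr r 0)))" using m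
proof (induction m)
 case (Suc m)
 then show ?case using ebr_btr_step[OF Suc.prems n, where ?'k = 'k] by simp
qed simp

text \<open>The coordinate of K_1 or K_2 at vertex 1 becomes the coefficient of index 0, the index
  reserved for \<epsilon>; the coordinates of the copies of S_1 move up by one.\<close>

lemma pcons_lin:
 fixes n :: nat
 defines "h == rst (pprod line (pl n)) (%p. pCons (coeff (pfst p) 0) (psnd p))"
 shows "h : lin_map (pprod line (pl n)) (pl (Suc n) :: 'k::{finite,field} poly set)" "bij_betw h (pprod line (pl n)) (pl (Suc n))"
proof -
 have sub: "subsp (pprod line (pl n) :: 'k poly set)" by (rule subspace_pprod[OF subspace_line spl])
 have mem: "pCons c q : pl (Suc n) \<longleftrightarrow> q : pl n" for c and q :: "'k poly"
 proof
  assume h: "pCons c q : pl (Suc n)"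
  have "coeff q i = 0" if "n <= i" for i using h that unfolding pl_def by (metis (mono_tags, lifting) Suc_le_mono coeff_pCons_Suc mem_Collect_eq)
  then show "q : pl n" by (simp add: pl_def)
 next
  assume "q : pl n"
  then show "pCons c q : pl (Suc n)" by (auto simp: pl_def coeff_pCons split: nat.splits)
 qed
 show "h : lin_map (pprod line (pl n)) (pl (Suc n))"
 proof (rule lin_mapI)
  fix x y :: "'k poly" and c :: 'k assume x: "x : pprod line (pl n)" and y: "y : pprod line (pl n)"
  show "h (x + y) = h x + h y" using x y sb_add[OF sub x y] by (simp add: h_def rst_def pfst_add psnd_add)
  show "h (sm c x) = sm c (h x)" using x sb_scale[OF sub x] by (simp add: h_def rst_def pfst_sm psnd_sm)
 qed (auto simp: h_def rst_def pprod_def mem)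
 show "bij_betw h (pprod line (pl n)) (pl (Suc n))"
 proof (rule bij_betw_byWitness[where f' = "%p. pjoin [:coeff p 0:] (poly_shift 1 p)"])
  show "ALL p:pprod line (pl n). pjoin [:coeff (h p) 0:] (poly_shift 1 (h p)) = p"
  proof -
   have "poly_shift 1 (pCons c q) = q" for c and q :: "'k poly" by (rule poly_eqI) (simp add: coeff_poly_shift)
   then show ?thesis by (auto simp: h_def rst_def pprod_def line_coeff intro!: poly_pair_eqI)
  qed
  have e: "pCons (coeff p 0) (poly_shift 1 p) = p" for p :: "'k poly" by (rule poly_eqI) (simp add: coeff_pCons coeff_poly_shift split: nat.splits)
  have s: "poly_shift 1 p : pl n" if "p : pl (Suc n)" for p :: "'k poly" using mem[of "coeff p 0" "poly_shift 1 p"] that e by simp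
  have l: "[:c:] : line" for c :: 'k by (simp add: line_def)
  show "ALL p:pl (Suc n). h (pjoin [:coeff p 0:] (poly_shift 1 p)) = p" using s l e by (simp add: h_def rst_def)
  show "h ` pprod line (pl n) <= pl (Suc n)" by (rule image_subsetI) (simp add: h_def rst_def mem pprod_def)
  show "(%p :: 'k poly. pjoin [:coeff p 0:] (poly_shift 1 p)) ` pl (Suc n) <= pprod line (pl n)" using s l by (auto simp del: One_nat_def)
 qed
qed

text \<open>There are q^((r+1)n) cocycles and q^n 0-cochains, hence the factor q^(rn). The middle
  term is chosen so that \<open>a\<close> maps onto W, as in the module with C = D = W; r
  independent forms on \<open>pl n\<close> require r <= n.\<close>

lemma S1p_K1:
 fixes r n :: nat
 assumes n: "r <= n"
 defines "a == rst (pl (Suc n)) (poly_cutoff (Suc r)) :: 'k::{finite,field} poly => 'k poly"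
 shows "a : lin_map (pl (Suc n)) (pl (Suc r))" "a ` pl (Suc n) = pl (Suc r)"
  "ebr r (hL r (S1p n :: 'k krep)) \<otimes>\<^bsub>sd_hall r\<^esub> ebr r (hL r (eps_rep Eps1)) =
  ebr r (%Z. real CARD('k) ^ (r * n) * hL r (Kr r (pl (Suc n)) a (%_. 0)) Z)"
proof -
 let ?M = "S1p n :: 'k krep" and ?K = "eps_rep Eps1 :: 'k krep"
 show a: "a : lin_map (pl (Suc n)) (pl (Suc r))"
 proof (rule lin_mapI)
  show "a x : pl (Suc r)" for x by (auto simp: a_def rst_def pl_def coeff_poly_cutoff)
 qed (auto simp: a_def rst_def poly_cutoff_lin sb_add[OF spl] sb_scale[OF spl])
 show "a ` pl (Suc n) = pl (Suc r)"
 proof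
  show "pl (Suc r) <= a ` pl (Suc n)"
  proof
   fix p :: "'k poly" assume p: "p : pl (Suc r)"
   then have "p : pl (Suc n)" "poly_cutoff (Suc r) p = p" using n by (auto simp: pl_def coeff_poly_cutoff intro!: poly_eqI)
   then show "p : a ` pl (Suc n)" by (intro image_eqI[of _ _ p]) (simp_all add: a_def rst_def)
  qed
 qed (use lmD(1)[OF a] in auto)
 \<comment> \<open>The shift by one matches the renumbering of coordinates in
   \<open>pcons_lin\<close>; the value zero at s = 0 leaves \<epsilon>_1 to the submodule
   K_1.\<close>
 define A where "A = (%s x :: 'k poly. if x : pl n & s ~= 0 then [:coeff x (s - 1):] else 0)"
 let ?z = "ch r A (%_ _. 0 :: 'k poly)"
 have l0: "(0 :: 'k poly) : line" by (rule sb_0[OF subspace_line])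
 have Al: "A s : lin_map (pl n) line" for s by (rule lin_mapI) (auto simp: A_def line_def sb_add[OF spl] sb_scale[OF spl])
 have z: "?z : Lam.cocycles r ?M ?K"
 proof -
  have "?z : Lam.cochain1 r ?M ?K" unfolding ch_cochain1 using Al by (simp add: lin_map_zero subspace_line)
  then show ?thesis unfolding cocycles_Lam_iff[OF Lam.mnD(1)[OF S1p_modnil] Lam.mnD(1)[OF K1_modnil]] using lin_map0[OF Al] by simp
 qed
 let ?L = "Kr r (pl (Suc n)) a (%_. 0) :: 'k krep"
 let ?h = "rst (pprod line (pl n)) (%p. pCons (coeff (pfst p) 0) (psnd p)) :: 'k poly => 'k poly"
 have L: "?L : mL r" by (rule S1_S2(2)[OF a])
 have iso: "iL r (Lam.ext_rep r ?M ?K ?z) ?L"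
 proof (rule Lam_isoI[of ?h _ _ "rst (pprod line {0}) pfst"])
  fix s p assume s: "s <= r" and p: "p : Sp (Lam.ext_rep r ?M ?K ?z) V1"
  then have p': "p : pprod line (pl n)" "pfst p : line" "psnd p : pl n" using pprodD[of p] by auto
  have hp: "?h p : pl (Suc n)" by (rule lmD(1)[OF pcons_lin(1) p'(1)])
  have 1: "Mp (Lam.ext_rep r ?M ?K ?z) (ar s) p = pjoin (Mp ?K (ar s) (pfst p) + A s (psnd p)) 0" using Mp_ext_ar_br(1)[OF s, of p ?K ?M ?z] s p' by simp
  have "Mp ?K (ar s) (pfst p) + A s (psnd p) : line" using lmD(1)[OF Al p'(3)] p'(2) sb_add[OF subspace_line] by (cases "s = 0") (auto simp: l0)
  moreover have "cf a s (?h p) = Mp ?K (ar s) (pfst p) + A s (psnd p)" using s p' hp by (cases s) (simp_all add: cf_def a_def rst_def coeff_poly_cutoff A_def line_coeff)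
  ultimately show "rst (pprod line {0}) pfst (Mp (Lam.ext_rep r ?M ?K ?z) (ar s) p) = Mp ?L (ar s) (?h p)" unfolding 1 using s by (simp add: rst_def)
 next
  fix s y assume s: "s <= r" and y: "y : Sp (Lam.ext_rep r ?M ?K ?z) V2"
  then show "?h (Mp (Lam.ext_rep r ?M ?K ?z) (br s) y) = Mp ?L (br s) (rst (pprod line {0}) pfst y)" using Mp_ext_ar_br(2)[OF s, of y ?K ?M ?z] by (simp add: rst_def bf_def)
 qed (use pcons_lin[where ?'k = 'k] rst_pfst[OF subspace_line subspace_zero] bij_rst_pfst in simp_all)
 show "ebr r (hL r ?M) \<otimes>\<^bsub>sd_hall r\<^esub> ebr r (hL r ?K) = ebr r (%Z. real CARD('k) ^ (r * n) * hL r ?L Z)" using ebr_mult_ext[OF S1p_modnil K1_Pd1 z L iso] cocycles_K1[OF S1p_modnil[of n r], where ?'k = 'k] CARD_gt1[where ?'k = 'k] by (simp add: dimv_S1p dimv_eps_rep power_add)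
qed

text \<open>On K_2 the map \<epsilon>_2 is injective, so the relations starting at vertex 1
  annihilate all components on the arrows from 1 to 2. The product is therefore already a multiple
  of a direct sum in the Hall algebra itself.\<close>

lemma S1p_K2:
 "hL r (S1p n :: 'k::{finite,field} krep) \<otimes>\<^bsub>LH r\<^esub> hL r (eps_rep Eps2) =
  (%Z. hL r (Kr r (pl (Suc n)) (%_. 0) (btr r 0)) Z / CARD('k) ^ n)"
proof -
 let ?M = "S1p n :: 'k krep" and ?K = "eps_rep Eps2 :: 'k krep" and ?z = "%_ _. 0 :: 'k poly"
 have l0: "(0 :: 'k poly) : line" by (rule sb_0[OF subspace_line])
 have coc: "Lam.cocycles r ?M ?K = {?z}"
 proof (intro equalityI subsetI)
  fix z assume z: "z : Lam.cocycles r ?M ?K"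
  note c = z[unfolded cocycles_Lam_iff[OF Lam.mnD(1)[OF S1p_modnil] Lam.mnD(1)[OF K2_modnil]]]
  have za: "z (ar s) : lin_map (pl n) line" "z (br s) = (%_. 0)" if "s <= r" for s using c that by (auto simp: cochain1_Lam_iff lin_map_from_0 subspace_line)
  have "z (ar s) x = 0" if s: "s <= r" for s x
  proof (cases "x : pl n")
   case True
   have "z (ar s) x : line" by (rule lmD(1)[OF za(1)[OF s] True])
   show ?thesis
   proof (cases "s = 0")
    case False
    then have "s : {1..r}" using s by simp
    then have "Mp ?K (br s) (z (ar 0) x) + z (br s) (Mp ?M (ar 0) x) = Mp ?K (br 0) (z (ar s) x) + z (br 0) (Mp ?M (ar s) x)" using c True S1p_simps(1) by blast
    then show ?thesis using False za(2)[of 0] za(2)[OF s] \<open>z (ar s) x : line\<close> by simp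
   next
    case True
    then show ?thesis using c \<open>x : pl n\<close> za(2)[of 0] \<open>z (ar s) x : line\<close> by auto
   qed
  qed (rule lmD(4)[OF za(1)[OF s]])
  moreover have "z a = (%_. 0)" if "a ~: kron_arrows r \<union> {Eps1, Eps2}" for a using c that by (simp add: cochain1_Lam_iff)
  ultimately have "z a x = 0" for a x using za(2) Lam_arcs_iff[of a r] by metis
  then show "z : {?z}" by (simp add: fun_eq_iff)
 qed (use ext_rep_0_dsum(1)[OF S1p_modnil K2_modnil] in simp)
 let ?L = "Kr r (pl (Suc n)) (%_. 0) (btr r 0) :: 'k krep"
 let ?h = "rst (pprod line (pl n)) (%p. pCons (coeff (pfst p) 0) (psnd p)) :: 'k poly => 'k poly"
 have L: "?L : mL r" by (rule Kr_0_modnil[OF btr_lin]) simp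
 have iso: "iL r (Lam.ext_rep r ?M ?K ?z) ?L"
 proof (rule Lam_isoI[of ?h _ _ "rst (pprod line {0}) pfst"])
  fix s p assume s: "s <= r" and p: "p : Sp (Lam.ext_rep r ?M ?K ?z) V1"
  show "rst (pprod line {0}) pfst (Mp (Lam.ext_rep r ?M ?K ?z) (ar s) p) = Mp ?L (ar s) (?h p)" using Mp_ext_ar_br(1)[OF s, of p ?K ?M ?z] s p by (simp add: rst_def cf_def)
 next
  fix s y assume s: "s <= r" and y: "y : Sp (Lam.ext_rep r ?M ?K ?z) V2"
  then have y': "y : pprod line {0}" "pfst y : line" using pprodD[of y] by auto
  have 1: "Mp (Lam.ext_rep r ?M ?K ?z) (br s) y = pjoin (if s = 0 then pfst y else 0) 0" using Mp_ext_ar_br(2)[OF s, of y ?K ?M ?z] y' by simp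
  have "pjoin (if s = 0 then pfst y else 0) 0 : pprod line (pl n)" using y' l0 sb_0[OF spl[of n, where ?'a = 'k]] by simp
  then show "?h (Mp (Lam.ext_rep r ?M ?K ?z) (br s) y) = Mp ?L (br s) (rst (pprod line {0}) pfst y)" unfolding 1 using s y' by (simp add: rst_def bf_btr monom_0)
 qed (use pcons_lin[where ?'k = 'k] rst_pfst[OF subspace_line subspace_zero] bij_rst_pfst in simp_all)
 show ?thesis using hall_mult_reindex(1)[OF S1p_modnil K2_modnil, of "%_. ?z" "{()}" r n "%_. ?L"] iso Lam.mnD(1)[OF L] by (simp add: bij_betw_def coc dimv_S1p dimv_eps_rep)
qed

section \<open>Counting pairs of linear maps\<close>

lemma card_fibres:
 fixes g :: "'a => real"
 assumes "finite A" "finite S" "!!a. a : A ==> f a : S"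
 shows "(SUM a:A. g (f a)) = (SUM x:S. real (card {a : A. f a = x}) * g x)"
proof -
 have "(SUM a:A. g (f a)) = (SUM x:S. SUM a:{a : A. f a = x}. g (f a))" by (rule sum.group[symmetric]) (use assms in auto)
 also have "... = (SUM x:S. real (card {a : A. f a = x}) * g x)" by (rule sum.cong) auto
 finally show ?thesis .
qed

text \<open>Moebius inversion without the Moebius function: only the leading coefficient is needed.\<close>

lemma fibre_count:
 fixes A :: "nat => 'b set" and q :: real and d :: "'a => nat" and R :: "'a => 'a => bool"
 assumes S: "finite S" and A: "!!t. finite (A t)" "!!t a. a : A t ==> f t a : S"
  and lt: "!!x y. x : S ==> y : S ==> R y x ==> y ~= x ==> d y < d x" "!!x. R x x"
  and cnt: "!!x t. x : S ==> real (card {a : A t. R (f t a) x}) = q ^ (d x * t)"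
  and x: "x : S"
 shows "EX c. c (d x) = 1 & (ALL t. real (card {a : A t. f t a = x}) = (SUM j<=d x. c j * q ^ (j * t)))" using x
proof (induction "d x" arbitrary: x rule: less_induct)
 case less
 let ?T = "{y : S. R y x & y ~= x}" and ?N = "%t x. real (card {a : A t. f t a = x})"
 have "EX c. ALL t. ?N t y = (SUM j<=d y. c j * q ^ (j * t))" if "y : ?T" for y using less.hyps[of y] lt(1)[OF less.prems, of y] that by blast
 then have "ALL y:?T. EX c. ALL t. ?N t y = (SUM j<=d y. c j * q ^ (j * t))" by (rule ballI)
 from bchoice[OF this] obtain c where "ALL y:?T. ALL t. ?N t y = (SUM j<=d y. c y j * q ^ (j * t))" ..
 then have c: "?N t y = (SUM j<=d y. c y j * q ^ (j * t))" if "y : ?T" for y t using that by blast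
 \<comment> \<open>Comparing coefficients: the count of all a with \<open>R (f t a) x\<close> gives
   the leading term 1, and the lower coefficients collect what the strictly smaller y take
   away.\<close>
 define e where "e j = (if j = d x then 1 else - (SUM y:?T. if j <= d y then c y j else 0))" for j
 have "?N t x = (SUM j<=d x. e j * q ^ (j * t))" for t
 proof -
  have "q ^ (d x * t) = (SUM a:{a : A t. R (f t a) x}. 1)" using cnt[OF less.prems, of t] by simp
  also have "... = (SUM y:insert x ?T. real (card {a : {a : A t. R (f t a) x}. f t a = y}) * 1)" by (rule card_fibres) (use A S in auto)
  also have "... = (SUM y:insert x ?T. ?N t y)" by (rule sum.cong) (auto simp: lt(2) intro!: arg_cong[where f = card])
  also have "... = ?N t x + (SUM y:?T. ?N t y)" by (rule sum.insert) (use S in auto)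
  also have "(SUM y:?T. ?N t y) = (SUM y:?T. SUM j<d x. (if j <= d y then c y j else 0) * q ^ (j * t))"
  proof (rule sum.cong[OF rfl])
   fix y assume y: "y : ?T"
   then have "d y < d x" using lt(1)[OF less.prems, of y] by blast
   then have "(SUM j<=d y. c y j * q ^ (j * t)) = (SUM j<d x. (if j <= d y then c y j else 0) * q ^ (j * t))" by (intro sum.mono_neutral_cong_left) auto
   then show "?N t y = (SUM j<d x. (if j <= d y then c y j else 0) * q ^ (j * t))" using c[OF y] by simp
  qed
  also have "... = (SUM j<d x. (SUM y:?T. if j <= d y then c y j else 0) * q ^ (j * t))" unfolding sum_distrib_right by (rule sum.swap)
  also have "... = - (SUM j<d x. e j * q ^ (j * t))" unfolding sum_negf[symmetric] by (rule sum.cong) (auto simp: e_def)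
  finally have "?N t x = q ^ (d x * t) + (SUM j<d x. e j * q ^ (j * t))" by simp
  then show ?thesis by (simp add: lessThan_Suc_atMost[symmetric] e_def)
 qed
 moreover have "e (d x) = 1" by (simp add: e_def)
 ultimately show ?case by blast
qed

lemma finite_subspaces: "finite W ==> finite {C. subsp C & C <= W}" by (rule finite_subset[of _ "Pow W"]) auto

lemma dim_psubset:
 fixes C :: "'k::{finite,field} poly set"
 assumes "subsp C" "subsp D" "finite D" "C <= D" "C ~= D"
 shows "dm C < dm D"
proof -
 have f: "finite C" using assms finite_subset by blast
 have "card C < card D" using assms by (intro psubset_card_mono) auto
 then show ?thesis using card_poly_subspace[OF assms(1) f] card_poly_subspace[OF assms(2,3)] CARD_gt1[where ?'k = 'k] by (simp add: power_strict_increasing_iff)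
qed

text \<open>The order is inclusion: the maps with image inside C are all maps to C, of which there
  are q^(dim C t).\<close>

lemma count_image:
 fixes W :: "'k::{finite,field} poly set"
 assumes W: "subsp W" "finite W" and C: "subsp C" "C <= W"
 shows "EX c. c (dm C) = (1 :: real) &
  (ALL t. real (card {a : lin_map (pl t) W. a ` pl t = C}) = (SUM j<=dm C. c j * real CARD('k) ^ (j * t)))"
proof (rule fibre_count[where S = "{C. subsp C & C <= W}" and R = "(\<subseteq>)" and A = "%t. lin_map (pl t) W" and f = "%t a. a ` pl t" and d = dm])
 fix t
 show "finite (lin_map (pl t) W)" by (rule card_lin_map(2)[OF spl card_pl(2) W])
 show "a ` pl t : {C. subsp C & C <= W}" if "a : lin_map (pl t) W" for a using subspace_lin_image[OF that spl] lmD(1)[OF that] by blast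
 fix x assume x: "x : {C. subsp C & C <= W}"
 have f: "finite x" using x W finite_subset by blast
 have "{a : lin_map (pl t) W. a ` pl t <= x} = lin_map (pl t) x" using x lin_map_mono[of _ "pl t" W x] lin_map_mono[of _ "pl t" x W] lmD(1)[of _ "pl t" x] by blast
 then show "real (card {a : lin_map (pl t) W. a ` pl t <= x}) = real CARD('k) ^ (dm x * t)" using card_lin_map_dim[OF spl card_pl(2) _ f, of t] x by (simp add: dim_pl mult.commute)
next
 fix x y assume h: "x : {C. subsp C & C <= W}" "y : {C. subsp C & C <= W}" "y <= x" "y ~= x"
 have "finite x" using h W finite_subset by blast
 then show "dm y < dm x" using h by (intro dim_psubset) auto
qed (use finite_subspaces[OF W(2)] C in auto)

text \<open>The order is reverse inclusion: the maps vanishing on D factor through the quotient by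
  D, so the degree is the codimension.\<close>

lemma count_kernel:
 fixes W :: "'k::{finite,field} poly set"
 assumes W: "subsp W" "finite W" and D: "subsp D" "D <= W"
 shows "EX c. c (dm W - dm D) = (1 :: real) &
  (ALL t. real (card {b : lin_map W (pl t). {x : W. b x = 0} = D}) = (SUM j<=dm W - dm D. c j * real CARD('k) ^ (j * t)))"
proof (rule fibre_count[where S = "{C. subsp C & C <= W}" and R = "%C D. D <= C" and d = "%D. dm W - dm D"
  and A = "%t. lin_map W (pl t)" and f = "%t b. {x : W. b x = 0}"])
 show "dm W - dm y < dm W - dm x" if "x : {C. subsp C & C <= W}" "y : {C. subsp C & C <= W}" "x <= y" "y ~= x" for x y
 proof -
  have f: "finite y" using that W finite_subset by blast
  have "dm x < dm y" by (rule dim_psubset) (use that f in auto)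
  moreover have "dm y <= dm W" using dim_psubset[of y W] that W by (cases "y = W") auto
  ultimately show ?thesis by simp
 qed
 fix t
 show "finite (lin_map W (pl t))" by (rule card_lin_map(2)[OF W spl card_pl(2)])
 show "{x : W. b x = 0} : {C. subsp C & C <= W}" if "b : lin_map W (pl t)" for b using subspace_lin_kernel[OF that W(1)] by blast
 fix x assume x: "x : {C. subsp C & C <= W}"
 have "{b : lin_map W (pl t). x <= {y : W. b y = 0}} = {b : lin_map W (pl t). ALL y:x. b y = 0}" using x by blast
 then show "real (card {b : lin_map W (pl t). x <= {y : W. b y = 0}}) = real CARD('k) ^ ((dm W - dm x) * t)" using card_lin_map_vanishing[OF W _ _ spl card_pl(2), of x t] x by (simp add: card_pl mult.commute flip: power_mult)
qed (use finite_subspaces[OF W(2)] D in auto)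

section \<open>The triple product\<close>

text \<open>By linearity \<open>kcond\<close> depends on \<open>b\<close> only through its kernel.
  This is the resulting compatibility of C with D = ker b.\<close>

definition kc :: "nat => 'k::field poly set => 'k poly set => bool" where
 "kc r C D \<longleftrightarrow> (ALL c:C. monom (coeff c 0) 0 : D & (ALL s:{1..r}. monom (coeff c 0) s - monom (coeff c s) 0 : D))"

lemma kcond_iff:
 assumes b: "b : lin_map (pl (Suc r)) V"
 shows "kcond r C b \<longleftrightarrow> kc r C {x : pl (Suc r). b x = 0}"
proof -
 have "b (monom x s) = b (monom y 0) \<longleftrightarrow> monom x s - monom y 0 : {x : pl (Suc r). b x = 0}" if "s : {1..r}" for x y s
 proof -
  have "s <= r" using that by simp
  then show ?thesis using lin_map_diff[OF b spl monom_pl[of s r x] monom_pl[of 0 r y]]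
   sb_diff[OF spl monom_pl[of s r x] monom_pl[of 0 r y]] by simp
 qed
 moreover have "b (monom x 0) = 0 \<longleftrightarrow> monom x 0 : {x : pl (Suc r). b x = 0}" for x by (simp add: monom_pl)
 ultimately show ?thesis unfolding kcond_def kc_def by blast
qed

text \<open>The condition for the single element c = 1 puts all monomials of exponent at most r into
  D.\<close>

lemma kc_full:
 assumes D: "subsp D" "D <= pl (Suc r)" and k: "kc r (pl (Suc r)) D"
 shows "D = pl (Suc r)"
proof -
 have "1 : pl (Suc r)" by (simp add: pl_def coeff_1)
 then have k1: "monom (coeff 1 0) 0 : D" "!!s. s : {1..r} ==> monom (coeff 1 0) s - monom (coeff 1 s) 0 : D" using k unfolding kc_def by blast+
 have "monom 1 s : D" if "s <= r" for s
 proof (cases "s = 0")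
  case False
  then show ?thesis using k1(2)[of s] that by (simp add: coeff_1)
 qed (use k1(1) in simp)
 then have "(%s. monom 1 s) ` {..r} <= D" by auto
 then have "spn ((%s. monom 1 s) ` {..r}) <= D" using D(1) by (intro polyv.span_minimal)
 then show ?thesis using pl_span D(2) by blast
qed

text \<open>With D = 0 the condition first kills the constant coefficient of c, and then, this being
  zero, all others.\<close>

lemma kc_zero:
 assumes C: "subsp C" "C <= pl (Suc r)" and k: "kc r C {0}"
 shows "C = {0}"
proof -
 have "c = 0" if c: "c : C" for c
 proof (rule poly_eqI)
  have c0: "coeff c 0 = 0" using k c by (simp add: kc_def)
  show "coeff c s = coeff 0 s" for s
  proof (cases "s <= r")
   case True
   show ?thesis
   proof (cases "s = 0")
    case False
    then have "monom (coeff c 0) s - monom (coeff c s) 0 : {0}" using k c True unfolding kc_def by auto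
    then show ?thesis using c0 by simp
   qed (simp add: c0)
  next
   case False
   then show ?thesis using c C(2) by (auto simp: pl_def)
  qed
 qed
 then show ?thesis using sb_0[OF C(1)] by blast
qed

text \<open>The middle terms of the threefold product: \<open>a\<close> acts on the summand of the
  left factor and \<open>b\<close> maps into that of the right factor.\<close>

definition trp :: "nat => nat => nat => ('k::field poly => 'k poly) => ('k poly => 'k poly) => 'k krep" where
 "trp r t m a b = Kr r (pprod (pl m) (pl t)) (%p. a (rst (pprod (pl m) (pl t)) psnd p)) (%p. pjoin (b p) 0)"

definition trps :: "nat => nat => nat => ('k::field poly => 'k poly) => ('k poly => 'k poly) set" where
 "trps r t m a = {b : lin_map (pl (Suc r)) (pl m). kcond r (a ` pl t) b}"

lemma trp_modnil:
 assumes "a : lin_map (pl t) (pl (Suc r))" "b : trps r t m a"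
 shows "(trp r t m a b :: 'k::{finite,field} krep) : mL r" using Kr_S1(2)[OF spl assms(1) S1_S2(2)[OF assms(1)], of b m] assms(2) by (simp add: trp_def trps_def)

lemma S1_S2_S1:
 fixes r t m :: nat
 defines "\<Phi> == hL r (S1p t :: 'k::{finite,field} krep) \<otimes>\<^bsub>LH r\<^esub> hL r (simple_rep V2)"
 shows "\<Phi> \<otimes>\<^bsub>LH r\<^esub> hL r (S1p m) = (%Z. (SUM a:lin_map (pl t) (pl (Suc r)). SUM b:trps r t m a. hL r (trp r t m a b) Z) / CARD('k) ^ (t * m))"
proof -
 let ?J = "lin_map (pl t) (pl (Suc r)) :: ('k poly => 'k poly) set"
 have fin: "finite ?J" by (rule card_lin_map(2)[OF spl card_pl(2) spl card_pl(2)])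
 have "\<Phi> = (%Z. SUM a:?J. 1 * hL r (Kr r (pl t) a (%_. 0)) Z)" unfolding \<Phi>_def S1_S2(1) by simp
 moreover have "hL r (S1p m :: 'k krep) = (%Z. SUM k:{()}. 1 * hL r (S1p m) Z)" by simp
 moreover have m: "Kr r (pl t) a (%_. 0) : mL r" if "a : ?J" for a by (rule S1_S2(2)[OF that])
 ultimately have "\<Phi> \<otimes>\<^bsub>LH r\<^esub> hL r (S1p m) =
   (%Z. SUM a:?J. (hL r (Kr r (pl t) a (%_. 0)) \<otimes>\<^bsub>LH r\<^esub> hL r (S1p m)) Z)" using Lam.hall_mult_sums[of ?J "%a. Kr r (pl t) a (%_. 0)" r "{()}" "%_. S1p m :: 'k krep" "%_. 1" "%_. 1"] fin m S1p_modnil[of m r, where ?'k = 'k] by simp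
 also have "... = (%Z. SUM a:?J. (SUM b:trps r t m a. hL r (trp r t m a b) Z) / CARD('k) ^ (t * m))" by (intro ext sum.cong rfl) (simp add: Kr_S1(1)[OF spl _ S1_S2(2)] trp_def trps_def dim_pl)
 finally show ?thesis by (simp add: sum_divide_distrib)
qed

lemma trp_class:
 fixes a a' b b' :: "'k::{finite,field} poly => 'k poly"
 assumes n: "t + m = t' + m'" and a: "a : lin_map (pl t) (pl (Suc r))" "b : trps r t m a"
  and a': "a' : lin_map (pl t') (pl (Suc r))" "b' : trps r t' m' a'"
  and im: "a ` pl t = a' ` pl t'" and ker: "{x : pl (Suc r). b x = 0} = {x : pl (Suc r). b' x = 0}"
 shows "hL r (trp r t m a b) = hL r (trp r t' m' a' b')"
proof (rule hcls_cong[OF trp_modnil[OF a] trp_modnil[OF a']])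
 have b: "b : lin_map (pl (Suc r)) (pl m)" "b' : lin_map (pl (Suc r)) (pl m')" using a a' by (simp_all add: trps_def)
 note V = subspace_pprod[OF spl spl] finite_pprod[OF card_pl(2) card_pl(2)]
 have c: "card (pprod (pl m) (pl t) :: 'k poly set) = card (pprod (pl m') (pl t') :: 'k poly set)" using n by (simp add: card_pprod card_pl flip: power_add) (simp add: add.commute)
 have im': "(%p. a (rst (pprod (pl m) (pl t)) psnd p)) ` pprod (pl m) (pl t) = (%p. a' (rst (pprod (pl m') (pl t')) psnd p)) ` pprod (pl m') (pl t')" unfolding psnd_comp_lin(2)[OF spl a(1)] psnd_comp_lin(2)[OF spl a'(1)] by (rule im)
 show "iL r (trp r t m a b) (trp r t' m' a' b')" unfolding trp_def by (rule Kr_normal_form[OF V V c psnd_comp_lin(1)[OF spl a(1)] psnd_comp_lin(1)[OF spl a'(1)] im' pjoin_lin[OF b(1) spl] pjoin_lin[OF b(2) spl]])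
   (use ker lin_map0[OF a(1)] lin_map0[OF a'(1)] in "auto simp: rst_def")
qed

text \<open>After grouping by C = im a and D = ker b, the multiplicity of the class is a combination
  of the T j i with j <= dim C and i <= codim D. The assumption annihilates all T j i but two, and
  \<open>kc\<close> leaves a single pair (C, D) for each of these.\<close>

lemma triple_sum:
 fixes w :: "nat => real" and r n :: nat and a1 :: "'k::{finite,field} poly => 'k poly"
 defines "q == real CARD('k)"
 defines "T == %j i. SUM t<=n. w t * q ^ (j * t) * q ^ (i * (n - t))"
 assumes n: "Suc r <= n"
  and T: "!!i j. i <= Suc r ==> j <= Suc r ==> (j, i) ~= (Suc r, 0) ==> (j, i) ~= (0, Suc r) ==> T j i = 0"
  and a1: "a1 : lin_map (pl n) (pl (Suc r))" "a1 ` pl n = pl (Suc r)"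
 shows "(SUM t<=n. w t * (SUM a:lin_map (pl t) (pl (Suc r)). SUM b:trps r t (n - t) a. hL r (trp r t (n - t) a b) Z)) =
  T (Suc r) 0 * hL r (Kr r (pl n) a1 (%_. 0)) Z + T 0 (Suc r) * hL r (Kr r (pl n) (%_. 0) (btr r r)) Z"
proof -
 let ?W = "pl (Suc r) :: 'k poly set"
 define SS where "SS = {C. subsp C & C <= ?W}"
 note W = spl[of "Suc r", where ?'a = 'k] card_pl(2)[of "Suc r", where ?'k = 'k]
 have dW: "dm ?W = Suc r" by (rule dim_pl)
 have fS: "finite SS" unfolding SS_def by (rule finite_subspaces[OF W(2)])
 define kr where "kr b = {x : ?W. b x = 0}" for b :: "'k poly => 'k poly"
 \<comment> \<open>By \<open>trp_class\<close> the class depends on C and D alone once n is fixed,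
   so \<open>H C D\<close> may be read off from any pair (a, b), also for a different t.\<close>
 define P where "P C D h \<longleftrightarrow> (EX t a b. t <= n & a : lin_map (pl t) ?W & b : trps r t (n - t) a & a ` pl t = C & kr b = D & h = hL r (trp r t (n - t) a b))" for C D h
 define H where "H C D = (SOME h. P C D h)" for C D
 have H: "hL r (trp r t (n - t) a b) = H (a ` pl t) (kr b)" if "t <= n" "a : lin_map (pl t) ?W" "b : trps r t (n - t) a" for t a b
 proof -
  have "P (a ` pl t) (kr b) (hL r (trp r t (n - t) a b))" unfolding P_def using that by blast
  then have "P (a ` pl t) (kr b) (H (a ` pl t) (kr b))" unfolding H_def by (rule someI[of "P (a ` pl t) (kr b)"])
  then obtain t' a' b' where h: "t' <= n" "a' : lin_map (pl t') ?W" "b' : trps r t' (n - t') a'" "a' ` pl t' = a ` pl t" "kr b' = kr b"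
   "H (a ` pl t) (kr b) = hL r (trp r t' (n - t') a' b')" unfolding P_def by blast
  show ?thesis unfolding h(6) by (rule trp_class[OF _ that(2,3) h(2,3)]) (use h that in "simp_all add: kr_def")
 qed
 define g where "g C D = (if kc r C D then H C D Z else 0)" for C D
 define N where "N t C = real (card {a : lin_map (pl t) ?W. a ` pl t = C})" for t C
 define N' where "N' m D = real (card {b : lin_map ?W (pl m). kr b = D})" for m D
 have inner: "(SUM a:lin_map (pl t) ?W. SUM b:trps r t (n - t) a. hL r (trp r t (n - t) a b) Z) = (SUM C:SS. N t C * (SUM D:SS. N' (n - t) D * g C D))" if t: "t <= n" for t
 proof -
  have fa: "finite (lin_map (pl t) ?W)" by (rule card_lin_map(2)[OF spl card_pl(2) W])
  have fb: "finite (lin_map ?W (pl (n - t)))" by (rule card_lin_map(2)[OF W spl card_pl(2)])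
  have iS: "a ` pl t : SS" if "a : lin_map (pl t) ?W" for a using subspace_lin_image[OF that spl] lmD(1)[OF that] unfolding SS_def by blast
  have kS: "kr b : SS" if "b : lin_map ?W (pl (n - t))" for b using subspace_lin_kernel[OF that W(1)] unfolding SS_def kr_def by blast
  have "(SUM b:trps r t (n - t) a. hL r (trp r t (n - t) a b) Z) = (SUM D:SS. N' (n - t) D * g (a ` pl t) D)" if a: "a : lin_map (pl t) ?W" for a
  proof -
   have "(SUM b:trps r t (n - t) a. hL r (trp r t (n - t) a b) Z) = (SUM b:lin_map ?W (pl (n - t)). g (a ` pl t) (kr b))"
   proof (rule sum.mono_neutral_cong_left[OF fb])
    show "ALL b:lin_map ?W (pl (n - t)) - trps r t (n - t) a. g (a ` pl t) (kr b) = 0" using kcond_iff[of _ r "pl (n - t)" "a ` pl t"] by (auto simp: trps_def g_def kr_def)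
    show "hL r (trp r t (n - t) a b) Z = g (a ` pl t) (kr b)" if b: "b : trps r t (n - t) a" for b using H[OF t a b] kcond_iff[of b r "pl (n - t)" "a ` pl t"] b by (simp add: trps_def g_def kr_def)
   qed (auto simp: trps_def)
   also have "... = (SUM D:SS. N' (n - t) D * g (a ` pl t) D)" unfolding N'_def by (rule card_fibres[OF fb fS kS])
   finally show ?thesis .
  qed
  then have "(SUM a:lin_map (pl t) ?W. SUM b:trps r t (n - t) a. hL r (trp r t (n - t) a b) Z) = (SUM a:lin_map (pl t) ?W. (SUM D:SS. N' (n - t) D * g (a ` pl t) D))" by (rule sum.cong[OF rfl])
  also have "... = (SUM C:SS. N t C * (SUM D:SS. N' (n - t) D * g C D))" unfolding N_def by (rule card_fibres[OF fa fS iS])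
  finally show ?thesis .
 qed
 define E where "E C D = (SUM t<=n. w t * N t C * N' (n - t) D)" for C D
 have EE: "E C D * g C D = (if C = ?W & D = ?W then T (Suc r) 0 * g ?W ?W else 0) + (if C = {0} & D = {0} then T 0 (Suc r) * g {0} {0} else 0)" if C: "C : SS" and D: "D : SS" for C D
 proof (cases "kc r C D")
  case False
  then show ?thesis by (auto simp: g_def)
 next
  case True
  have C': "subsp C" "C <= ?W" and D': "subsp D" "D <= ?W" using C D by (auto simp: SS_def)
  obtain c where c: "c (dm C) = (1::real)" "!!t. N t C = (SUM j<=dm C. c j * q ^ (j * t))" using count_image[OF W C'] unfolding N_def q_def by blast
  obtain d where d: "d (Suc r - dm D) = (1::real)" "!!t. N' t D = (SUM i<=Suc r - dm D. d i * q ^ (i * t))" using count_kernel[OF W D'] unfolding N'_def kr_def dW q_def by blast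
  have "E C D = (SUM t<=n. SUM j<=dm C. SUM i<=Suc r - dm D. c j * d i * (w t * q ^ (j * t) * q ^ (i * (n - t))))" unfolding E_def c(2) d(2) by (rule sum.cong[OF rfl], simp only: mult.assoc sum_product, simp add: sum_distrib_left mult_ac)
  also have "... = (SUM j<=dm C. SUM t<=n. SUM i<=Suc r - dm D. c j * d i * (w t * q ^ (j * t) * q ^ (i * (n - t))))" by (rule sum.swap)
  also have "... = (SUM j<=dm C. SUM i<=Suc r - dm D. c j * d i * T j i)" unfolding T_def sum_distrib_left by (rule sum.cong[OF rfl], rule sum.swap)
  finally have e: "E C D = (SUM j<=dm C. SUM i<=Suc r - dm D. c j * d i * T j i)" .
  have W0: "?W ~= {0}" using monom_pl[of 0 r "1::'k"] by auto
  have dCle: "dm C <= Suc r" using dim_psubset[OF C'(1) W C'(2)] dW by (cases "C = ?W") auto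
  have dDle: "dm D <= Suc r" using dim_psubset[OF D'(1) W D'(2)] dW by (cases "D = ?W") auto
  \<comment> \<open>T (r+1) 0 requires dim C = r + 1, and T 0 (r+1) requires codim D = r + 1. In
    these cases \<open>kc\<close> fixes the other subspace, so one of the two counting polynomials
    is constant; its leading coefficient, like that of the other, is 1.\<close>
  consider "C = ?W" | "D = {0}" | "C ~= ?W" "D ~= {0}" by blast
  then show ?thesis
  proof cases
   case 1
   have D1: "D = ?W" using kc_full[OF D'] True 1 by blast
   have "E C D = (SUM j<=Suc r. c j * d 0 * T j 0)" using e unfolding 1 D1 dW by (simp del: sum.atMost_Suc)
   also have "... = (SUM j<=Suc r. if j = Suc r then T (Suc r) 0 else 0)" by (rule sum.cong[OF rfl]) (use T[of 0] c(1) d(1) in "auto simp: 1 D1 dW")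
   finally show ?thesis using 1 D1 W0 by simp
  next
   case 2
   have C0: "C = {0}" using kc_zero[OF C'] True 2 by blast
   have "E C D = (SUM i<=Suc r. c 0 * d i * T 0 i)" using e unfolding 2 C0 dim_zero_space by (simp del: sum.atMost_Suc)
   also have "... = (SUM i<=Suc r. if i = Suc r then T 0 (Suc r) else 0)" by (rule sum.cong[OF rfl]) (use T[of _ 0] c(1) d(1) in "auto simp: 2 C0 dim_zero_space")
   finally show ?thesis using 2 C0 W0 by simp
  next
   case 3
   have "dm C < Suc r" using dim_psubset[OF C'(1) W C'(2)] 3 dW by simp
   moreover have "0 < dm D" using dim_psubset[OF subspace_zero D'(1) finite_subset[OF D'(2) W(2)]] sb_0[OF D'(1)] 3 by (auto simp: dim_zero_space)
   ultimately have "T j i = 0" if "j <= dm C" "i <= Suc r - dm D" for j i using that by (intro T) auto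
   then have "E C D = 0" unfolding e by simp
   then show ?thesis using 3 by simp
  qed
 qed
 have "(SUM t<=n. w t * (SUM a:lin_map (pl t) ?W. SUM b:trps r t (n - t) a. hL r (trp r t (n - t) a b) Z)) =
   (SUM t<=n. SUM C:SS. SUM D:SS. w t * N t C * N' (n - t) D * g C D)" by (rule sum.cong[OF rfl]) (simp add: inner sum_distrib_left mult_ac)
 also have "... = (SUM C:SS. SUM t<=n. SUM D:SS. w t * N t C * N' (n - t) D * g C D)" by (rule sum.swap)
 also have "... = (SUM C:SS. SUM D:SS. E C D * g C D)" unfolding E_def sum_distrib_right by (rule sum.cong[OF rfl], rule sum.swap)
 also have "... = (SUM C:SS. SUM D:SS. (if C = ?W & D = ?W then T (Suc r) 0 * g ?W ?W else 0) + (if C = {0} & D = {0} then T 0 (Suc r) * g {0} {0} else 0))" by (intro sum.cong rfl EE)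
 also have "... = T (Suc r) 0 * g ?W ?W + T 0 (Suc r) * g {0} {0}"
 proof -
  have m: "?W : SS" "{0} : SS" using W(1) subspace_zero sb_0[OF W(1)] by (auto simp: SS_def)
  have "(SUM C:SS. SUM D:SS. if C = X & D = X then y else 0) = y" if "X : SS" for X and y :: real
  proof -
   have "(SUM D:SS. if C = X & D = X then y else 0) = (if C = X then y else 0)" for C using fS that by (cases "C = X") simp_all
   then show ?thesis using fS that by simp
  qed
  then show ?thesis using m by (simp add: sum.distrib)
 qed
 \<comment> \<open>The class is computed from the pair with t = n, where \<open>b\<close> maps to
   the zero space. Below, that of C = D = 0 is computed from t = 0, with \<open>b\<close> the
   inclusion of W.\<close>
 also have "g ?W ?W = hL r (Kr r (pl n) a1 (%_. 0)) Z"
 proof -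
  have p0: "pl (n - n) = {0 :: 'k poly}" by (simp add: pl_0)
  have b: "(%_. 0) : trps r n (n - n) a1" unfolding trps_def by (simp add: lin_map_zero spl kcond_def)
  have k: "kr (%_. 0) = ?W" by (simp add: kr_def)
  have "kc r ?W ?W" using kcond_iff[of "%_. 0" r "pl (n - n)" ?W] b a1(2) by (simp add: trps_def)
  moreover have "hL r (trp r n (n - n) a1 (%_. 0)) = H ?W ?W" using H[OF order_refl a1(1) b] a1(2) k by simp
  moreover have "hL r (trp r n (n - n) a1 (%_. 0)) = hL r (Kr r (pl n) a1 (%_. 0))"
  proof (rule hcls_cong[OF trp_modnil[OF a1(1) b] S1_S2(2)[OF a1(1)]])
   have "rst (pprod {0} (pl n)) psnd : lin_map (pprod {0} (pl n)) (pl n)" by (rule rst_psnd[OF subspace_zero spl])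
   then show "iL r (trp r n (n - n) a1 (%_. 0)) (Kr r (pl n) a1 (%_. 0))" unfolding trp_def p0 by (rule Kr_iso[OF _ bij_rst_psnd]) (simp_all add: rst_def)
  qed
  ultimately show ?thesis by (simp add: g_def)
 qed
 also have "g {0} {0} = hL r (Kr r (pl n) (%_. 0) (btr r r)) Z"
 proof -
  have p0: "pl 0 = {0 :: 'k poly}" by (rule pl_0)
  have l: "btr r r : lin_map ?W (pl (n - 0))" using btr_lin[of r n r, where ?'a = 'k] n by simp
  have a: "(%_. 0) : lin_map (pl 0) ?W" by (rule lin_map_zero[OF W(1)])
  have b: "btr r r : trps r 0 (n - 0) (%_. 0 :: 'k poly)" unfolding trps_def p0 using l lin_map0[OF l] by (simp add: kcond_def)
  have id: "btr r r x = x" if "x : ?W" for x using that by (auto simp: btr_def rst_def coeff_poly_cutoff pl_def intro!: poly_eqI)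
  have k: "kr (btr r r) = {0}" using id sb_0[OF W(1)] by (auto simp: kr_def)
  have "kc r {0 :: 'k poly} {0}" by (simp add: kc_def)
  moreover have "hL r (trp r 0 (n - 0) (%_. 0) (btr r r)) = H {0} {0}" using H[OF le0 a b] k by (simp add: p0)
  moreover have "hL r (trp r 0 (n - 0) (%_. 0) (btr r r)) = hL r (Kr r (pl n) (%_. 0) (btr r r) :: 'k krep)"
  proof (rule hcls_cong[OF trp_modnil[OF a b] Kr_0_modnil])
   have "rst (pprod (pl n) {0}) pfst : lin_map (pprod (pl n) {0}) (pl n :: 'k poly set)" by (rule rst_pfst[OF spl subspace_zero])
   then show "iL r (trp r 0 (n - 0) (%_. 0) (btr r r)) (Kr r (pl n) (%_. 0) (btr r r) :: 'k krep)" unfolding trp_def p0 diff_zero by (rule Kr_iso[OF _ bij_rst_pfst]) (use lmD(1)[OF l] in "auto simp: rst_def")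
  qed (use l in simp)
  ultimately show ?thesis by (simp add: g_def)
 qed
 finally show ?thesis .
qed

section \<open>Quantum integers\<close>

lemma power_inverse_cancel: "v ~= 0 ==> v ^ n * inverse v ^ n = 1" for v :: real by (simp add: power_mult_distrib[symmetric])

lemma powi_add: "v ~= 0 ==> v powi a * v powi b = v powi (a + b)" for v :: real by (simp add: power_int_add)

lemma qint_pos: "1 < v ==> 0 < n ==> 0 < qint v n"
proof -
 assume v: "1 < v" and n: "0 < n"
 have "inverse v < 1" using v by (simp add: inverse_less_1_iff)
 moreover have "inverse v ^ n < 1" using v n by (simp add: power_inverse inverse_less_1_iff one_less_power)
 moreover have "1 < v ^ n" using v n by (rule one_less_power)
 ultimately show ?thesis unfolding qint_def using v by (simp add: power_int_minus power_inverse)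
qed

lemma qint_0 [simp]: "qint v 0 = 0" by (simp add: qint_def)

lemma qfact_0 [simp]: "qfact v 0 = 1" by (simp add: qfact_def)

lemma qfact_Suc: "qfact v (Suc n) = qint v (Suc n) * qfact v n" by (simp add: qfact_def mult.commute)

lemma qfact_pos: "1 < v ==> 0 < qfact v n" unfolding qfact_def by (rule prod_pos) (simp add: qint_pos)

lemma qint_eq: "qint v n = (v ^ n - inverse v ^ n) / (v - inverse v)" by (simp add: qint_def power_int_minus power_inverse)

text \<open>The splitting of [a + b] behind the Pascal rule for quantum binomial
  coefficients.\<close>

lemma qint_add: "qint v (a + b) = v ^ b * qint v a + inverse v ^ a * qint v b" unfolding qint_eq by (simp add: add_divide_distrib[symmetric] power_add algebra_simps)

text \<open>The alternating sum of the quantum binomial coefficients with weights x^t, divided by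
  [n]!.\<close>

definition qsum :: "real => nat => real => real" where
 "qsum v n x = (SUM t<=n. (- x) ^ t / (qfact v t * qfact v (n - t)))"

text \<open>Writing [n + 1] as a combination of [n + 1 - t] and [t] lowers one of the two factorials
  in each term. Both parts become the sum for n at x v, after an index shift in the second.\<close>

lemma qsum_Suc:
 assumes v: "1 < v"
 shows "qint v (Suc n) * qsum v (Suc n) x = (1 - x * inverse v ^ n) * qsum v n (x * v)"
proof -
 let ?u = "inverse v" and ?f = "qfact v"
 have f: "?f t ~= 0" for t using qfact_pos[OF v, of t] by simp
 have i: "qint v (Suc t) ~= 0" for t using qint_pos[OF v, of "Suc t"] by simp
 define G where "G t = (- x) ^ t * v ^ t * qint v (Suc n - t) / (?f t * ?f (Suc n - t))" for t
 define H where "H t = (- x) ^ t * ?u ^ (Suc n - t) * qint v t / (?f t * ?f (Suc n - t))" for t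
 have "qint v (Suc n) * qsum v (Suc n) x = (SUM t<=Suc n. G t + H t)" unfolding qsum_def sum_distrib_left
 proof (rule sum.cong[OF rfl])
  fix t assume "t : {..Suc n}"
  then have "qint v (Suc n) = v ^ t * qint v (Suc n - t) + ?u ^ (Suc n - t) * qint v t" using qint_add[of v "Suc n - t" t] by simp
  then have "qint v (Suc n) * ((- x) ^ t / (?f t * ?f (Suc n - t))) = (v ^ t * qint v (Suc n - t) + ?u ^ (Suc n - t) * qint v t) * ((- x) ^ t / (?f t * ?f (Suc n - t)))" by (rule arg_cong)
  also have "... = G t + H t" unfolding G_def H_def by (simp add: mult_ac ring_distribs add_divide_distrib)
  finally show "qint v (Suc n) * ((- x) ^ t / (?f t * ?f (Suc n - t))) = G t + H t" .
 qed
 also have "... = (SUM t<=Suc n. G t) + (SUM t<=Suc n. H t)" by (rule sum.distrib)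
 also have "(SUM t<=Suc n. G t) = (SUM t<=n. G t)" by (simp add: G_def)
 also have "... = qsum v n (x * v)" unfolding qsum_def
 proof (rule sum.cong[OF rfl])
  fix t assume "t : {..n}"
  then have "Suc n - t = Suc (n - t)" by simp
  moreover have "(- (x * v)) ^ t = (- x) ^ t * v ^ t" by (simp add: power_mult_distrib[symmetric])
  ultimately show "G t = (- (x * v)) ^ t / (?f t * ?f (n - t))" using f i[of "n - t"] by (simp add: G_def qfact_Suc field_simps)
 qed
 also have "(SUM t<=Suc n. H t) = (SUM t<=n. H (Suc t))" unfolding sum.atMost_Suc_shift by (simp add: H_def)
 also have "... = - x * ?u ^ n * qsum v n (x * v)" unfolding qsum_def sum_distrib_left
 proof (rule sum.cong[OF rfl])
  fix t assume "t : {..n}"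
  then have t: "t <= n" by simp
  have "?u ^ (n - t) = ?u ^ n * v ^ t" using v t by (simp add: power_diff power_inverse field_simps)
  moreover have "(- (x * v)) ^ t = (- x) ^ t * v ^ t" by (simp add: power_mult_distrib[symmetric])
  ultimately show "H (Suc t) = - x * ?u ^ n * ((- (x * v)) ^ t / (?f t * ?f (n - t)))" using f i[of t] by (simp add: H_def qfact_Suc field_simps)
 qed
 finally show ?thesis by (simp add: algebra_simps)
qed

text \<open>The q-binomial theorem. The factor with index s is 1 - x v^(n-1-2s), written with powers
  of v and of its inverse because the exponent may be negative.\<close>

lemma qsum_prod:
 assumes v: "1 < v"
 shows "qfact v n * qsum v n x = (\<Prod>s<n. 1 - x * v ^ n * inverse v ^ (2 * s + 1))"
proof (induction n arbitrary: x)
 case 0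
 then show ?case by (simp add: qsum_def)
next
 case (Suc n)
 have "qfact v (Suc n) * qsum v (Suc n) x = (1 - x * inverse v ^ n) * (qfact v n * qsum v n (x * v))" using qsum_Suc[OF v, of n x] by (simp add: qfact_Suc mult_ac)
 also have "... = (1 - x * inverse v ^ n) * (\<Prod>s<n. 1 - x * v ^ Suc n * inverse v ^ (2 * s + 1))" unfolding Suc by (simp add: mult_ac)
 also have "1 - x * inverse v ^ n = 1 - x * v ^ Suc n * inverse v ^ (2 * n + 1)"
 proof -
  have "v ^ Suc n * inverse v ^ (Suc n + n) = inverse v ^ n" using power_inverse_cancel[of v "Suc n"] v by (simp add: power_add mult.assoc[symmetric])
  then show ?thesis by (simp add: mult.assoc mult_2)
 qed
 finally show ?case by (simp add: mult.commute)
qed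

text \<open>For n = 2r + 1 the factor with index s vanishes at x = q^(s-r), so the zeros are the q^k
  with |k| <= r. Here k = j - i, which gives the witness s = j + r - i.\<close>

lemma qsum_zero:
 assumes v: "1 < v" and ij: "i <= j + r" "j <= i + r"
 shows "qsum v (2 * r + 1) (v ^ (2 * j) * inverse v ^ (2 * i)) = 0"
proof -
 let ?s = "j + r - i"
 have "v ^ (2 * j) * inverse v ^ (2 * i) * v ^ (2 * r + 1) * inverse v ^ (2 * ?s + 1) = v ^ (2 * j + (2 * r + 1)) * inverse v ^ (2 * i + (2 * ?s + 1))" by (simp add: power_add mult_ac)
 also have "2 * i + (2 * ?s + 1) = 2 * j + (2 * r + 1)" using ij by simp
 also have "v ^ (2 * j + (2 * r + 1)) * inverse v ^ (2 * j + (2 * r + 1)) = 1" by (rule power_inverse_cancel) (use v in simp)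
 finally have "(\<Prod>s<2 * r + 1. 1 - v ^ (2 * j) * inverse v ^ (2 * i) * v ^ (2 * r + 1) * inverse v ^ (2 * s + 1)) = 0" using ij by (intro prod_zero bexI[of _ ?s]) auto
 then have "qfact v (2 * r + 1) * qsum v (2 * r + 1) (v ^ (2 * j) * inverse v ^ (2 * i)) = 0" unfolding qsum_prod[OF v] .
 then show ?thesis using qfact_pos[OF v, of "2 * r + 1"] by simp
qed

text \<open>At x = q^(r+1), just beyond the zeros, the factors are 1 - q^i for i from 1 to 2r + 1 in
  reverse order; at x = q^(-r-1) they are 1 - q^(-i) in order.\<close>

lemma qsum_top:
 assumes v: "1 < v"
 shows "qfact v (2 * r + 1) * qsum v (2 * r + 1) (v ^ (2 * Suc r)) = qpoch (v * v) (v * v) (2 * r + 1)"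
  "qfact v (2 * r + 1) * qsum v (2 * r + 1) (inverse v ^ (2 * Suc r)) = qpoch (inverse (v * v)) (inverse (v * v)) (2 * r + 1)"
proof -
 let ?n = "2 * r + 1"
 have v0: "v ~= 0" using v by simp
 have "(\<Prod>s<?n. 1 - v ^ (2 * Suc r) * v ^ ?n * inverse v ^ (2 * s + 1)) = (\<Prod>s<?n. 1 - (v * v) ^ (Suc (?n - Suc s)))"
 proof (rule prod.cong[OF rfl])
  fix s assume "s : {..<?n}"
  then have e: "2 * Suc r + ?n = 2 * Suc (?n - Suc s) + (2 * s + 1)" by simp
  have "v ^ (2 * Suc r) * v ^ ?n * inverse v ^ (2 * s + 1) = v ^ (2 * Suc (?n - Suc s)) * (v ^ (2 * s + 1) * inverse v ^ (2 * s + 1))" unfolding power_add[symmetric] e by (simp only: power_add mult.assoc)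
  also have "... = (v * v) ^ (Suc (?n - Suc s))" unfolding power_inverse_cancel[OF v0] by (simp only: power_mult power2_eq_square mult_1_right)
  finally show "1 - v ^ (2 * Suc r) * v ^ ?n * inverse v ^ (2 * s + 1) = 1 - (v * v) ^ (Suc (?n - Suc s))" by simp
 qed
 also have "... = (\<Prod>s<?n. 1 - (v * v) ^ Suc s)" by (rule prod.nat_diff_reindex)
 finally show "qfact v ?n * qsum v ?n (v ^ (2 * Suc r)) = qpoch (v * v) (v * v) ?n" unfolding qsum_prod[OF v] by (simp add: qpoch_def)
 have "(\<Prod>s<?n. 1 - inverse v ^ (2 * Suc r) * v ^ ?n * inverse v ^ (2 * s + 1)) = (\<Prod>s<?n. 1 - inverse (v * v) * inverse (v * v) ^ s)"
 proof (rule prod.cong[OF rfl])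
  fix s
  have "inverse v ^ (2 * Suc r) * v ^ ?n * inverse v ^ (2 * s + 1) = (v ^ ?n * inverse v ^ ?n) * (inverse v ^ (2 * Suc s))" by (simp add: power_add mult_ac power2_eq_square)
  also have "... = inverse (v * v) ^ Suc s" unfolding power_inverse_cancel[OF v0] by (simp only: power_mult power2_eq_square inverse_mult_distrib mult_1)
  finally show "1 - inverse v ^ (2 * Suc r) * v ^ ?n * inverse v ^ (2 * s + 1) = 1 - inverse (v * v) * inverse (v * v) ^ s" by simp
 qed
 then show "qfact v ?n * qsum v ?n (inverse v ^ (2 * Suc r)) = qpoch (inverse (v * v)) (inverse (v * v)) ?n" unfolding qsum_prod[OF v] by (simp add: qpoch_def)
qed

lemma qpoch_Suc: "qpoch a x (Suc n) = qpoch a x n * (1 - a * x ^ n)" by (simp add: qpoch_def)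

text \<open>Each factor satisfies (1 - q^(-i)) q^i = -(1 - q^i). The conversion is called for
  because the alternating sum yields each of the two symbols with the base opposite to that of the
  claim.\<close>

lemma qpoch_inverse: "q ~= 0 ==> qpoch (inverse q) (inverse q) m * q ^ (SUM i<=m. i) = (- 1) ^ m * qpoch q q m"
proof (induction m)
 case (Suc m)
 have *: "(1 - inverse q * inverse q ^ m) * q ^ Suc m = - (1 - q * q ^ m)" using Suc.prems by (simp add: field_simps power_inverse)
 have "qpoch (inverse q) (inverse q) (Suc m) * q ^ (SUM i<=Suc m. i) = (qpoch (inverse q) (inverse q) m * q ^ (SUM i<=m. i)) * ((1 - inverse q * inverse q ^ m) * q ^ Suc m)" unfolding qpoch_Suc sum.atMost_Suc power_add by (simp only: mult_ac)
 also have "... = (- 1) ^ Suc m * qpoch q q (Suc m)" unfolding Suc.IH[OF Suc.prems] qpoch_Suc * by (simp add: algebra_simps)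
 finally show ?case .
qed (simp add: qpoch_def)

section \<open>The identity\<close>

lemma vq_gt1: "1 < vq TYPE('k::{finite,field})" using CARD_gt1[where ?'k = 'k] by (simp add: vq_def)

lemma qint_Qv: "qint (vq TYPE('k::finite)) n : Qv (vq TYPE('k))" unfolding qint_eq divide_inverse by (intro Qv_mult[OF vq_rat] Qv_diff Qv_inverse[OF vq_rat] Qv_power[OF vq_rat] Qv_self)

lemma qfact_Qv: "qfact (vq TYPE('k::finite)) n : Qv (vq TYPE('k))"
proof (induction n)
 case (Suc n)
 then show ?case unfolding qfact_Suc by (intro Qv_mult[OF vq_rat] qint_Qv)
qed (simp add: Qv_rat)

lemma hall_mult_scale:
 fixes fi gi :: "('k::{finite,field}, vertex, arrow) hall"
 assumes "fi : cH r" "gi : cH r"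
 shows "(%X. a * fi X) \<otimes>\<^bsub>LH r\<^esub> (%X. b * gi X) = (%Z. a * b * (fi \<otimes>\<^bsub>LH r\<^esub> gi) Z)"
proof
 fix Z
 let ?F = "{X. fi X ~= 0}" and ?G = "{X. gi X ~= 0}"
 have f: "finite ?F" "finite ?G" using assms by (simp_all add: Lam.hall_simps)
 have "{X. a * fi X ~= 0} <= ?F" "{X. b * gi X ~= 0} <= ?G" by auto
 from Lam.hall_mult_eq[OF f(1) this(1) f(2) this(2)] Lam.hall_mult_eq[OF f(1) order_refl f(2) order_refl]
 show "((%X. a * fi X) \<otimes>\<^bsub>LH r\<^esub> (%X. b * gi X)) Z = a * b * (fi \<otimes>\<^bsub>LH r\<^esub> gi) Z" by (simp add: sum_distrib_left mult_ac)
qed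

lemma twist_scaled:
 fixes fi gi :: "('k::{finite,field}, vertex, arrow) hall"
 assumes p: "hdeg r fi d" and s: "hdeg r gi e" and c: "a : Qv (vq TYPE('k))" "b : Qv (vq TYPE('k))"
 shows "twist_mult r (ebr r (%X. a * fi X)) (ebr r (%X. b * gi X)) =
  ebr r (%Z. a * b * vq TYPE('k) powi ebil r d e * (fi \<otimes>\<^bsub>LH r\<^esub> gi) Z)" unfolding twist_mult_ebr[OF hdeg_scale[OF p c(1)] hdeg_scale[OF s c(2)]] using hall_mult_scale[of fi r gi a b] p s by (simp add: hdeg_def mult_ac)

text \<open>The coefficient of the class of S_1^t in the t-th divided power. Multiplying the t-th
  power by one more S_1 gives v^t from the twist and q^(-t) from the Hall product, altogether
  v^(-t).\<close>

definition dpc :: "real => nat => real" where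
 "dpc v t = v powi (- int (SUM i<t. i)) / qfact v t"

lemma dpc_Qv: "dpc (vq TYPE('k::finite)) t : Qv (vq TYPE('k))" unfolding dpc_def divide_inverse by (intro Qv_mult[OF vq_rat] Qv_powi[OF vq_rat] Qv_inverse[OF vq_rat] Qv_self qfact_Qv)

lemma CARD_vq: "real CARD('k::finite) = vq TYPE('k) powi 2" using vq_square[where ?'k = 'k] by (simp add: power2_eq_square)

lemma hdeg_S1p: "hdeg r (hL r (S1p t :: 'k::{finite,field} krep)) (t, 0)" using hdeg_hcls[OF S1p_modnil, of r t, where ?'k = 'k] by (simp add: dimv_S1p)

section \<open>Divided powers and products in the twisted algebra\<close>

lemma pow_S1:
 "icls r (simple_rep V1 :: 'k::{finite,field} krep) [^]\<^bsub>iHall r\<^esub> t = ebr r (%Z. vq TYPE('k) powi (- int (SUM i<t. i)) * hL r (S1p t) Z)"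
proof (induction t)
 case 0
 then show ?case by (simp add: nat_pow_def zero_rep_S1p flip: ebr_one)
next
 case (Suc t)
 let ?v = "vq TYPE('k)" and ?c = "vq TYPE('k) powi (- int (SUM i<t. i))"
 have v: "?v ~= 0" using vq_gt1[where ?'k = 'k] by simp
 have "icls r (simple_rep V1 :: 'k krep) [^]\<^bsub>iHall r\<^esub> Suc t = twist_mult r (ebr r (%Z. ?c * hL r (S1p t) Z)) (ebr r (%Z. 1 * hL r (S1p 1) Z))" using Suc by (simp add: nat_pow_def icls_eq simple_V1)
 also have "... = ebr r (%Z. ?c * 1 * ?v powi ebil r (t, 0) (1, 0) * (hL r (S1p t) \<otimes>\<^bsub>LH r\<^esub> hL r (S1p 1)) Z)" by (rule twist_scaled[OF hdeg_S1p hdeg_S1p]) (simp_all add: Qv_rat Qv_powi[OF vq_rat Qv_self])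
 also have "... = ebr r (%Z. ?v powi (- int (SUM i<Suc t. i)) * hL r (S1p (Suc t)) Z)"
 proof -
  have "?c * ?v powi ebil r (t, 0) (1, 0) / real CARD('k) ^ t = ?v powi (- int (SUM i<Suc t. i))"
  proof -
   have "real CARD('k) ^ t = ?v powi (2 * int t)" by (simp only: CARD_vq power_int_mult power_int_of_nat)
   then show ?thesis by (simp only: divide_inverse power_int_minus[symmetric] powi_add[OF v])
    (rule arg_cong[where f = "%x. ?v powi x"], simp add: ebil_def)
  qed
  then show ?thesis unfolding S1_S1 by (simp add: field_simps)
 qed
 finally show ?case .
qed

lemma divpow_S1: "divpow r (simple_rep V1 :: 'k::{finite,field} krep) t = ebr r (%Z. dpc (vq TYPE('k)) t * hL r (S1p t) Z)"
proof -
 have c: "1 / qfact (vq TYPE('k)) t : Qv (vq TYPE('k))" using Qv_inverse[OF vq_rat qfact_Qv[of t, where ?'k = 'k]] by (simp add: inverse_eq_divide)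
 have "(%Z. vq TYPE('k) powi (- int (SUM i<t. i)) * hL r (S1p t) Z) : carrier (hall (Lam r :: 'k kquiver))" by (rule Lam.hall_scale_closed[OF Lam.hcls_closed[OF S1p_modnil]]) (rule Qv_powi[OF vq_rat Qv_self])
 then show ?thesis unfolding divpow_def pow_S1 by (simp add: iscale_ebr[OF _ c] dpc_def)
qed

lemma hdeg_S1_S2: "hdeg r (hL r (S1p t :: 'k::{finite,field} krep) \<otimes>\<^bsub>LH r\<^esub> hL r (simple_rep V2)) (t, 1)" unfolding S1_S2(1)
proof (rule hdeg_sum)
 fix a :: "'k poly => 'k poly" assume "a : lin_map (pl t) (pl (Suc r))"
 from hdeg_hcls[OF S1_S2(2)[OF this]] show "hdeg r (hL r (Kr r (pl t) a (%_. 0))) (t, 1)" by (simp add: dimv_Kr dim_pl)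
qed

lemma triangle_add: "(SUM i<t + m. i) = (SUM i<t. i) + (SUM i<m. i) + t * m" for t m :: nat by (induction m) auto

lemma triangle_double: "int (SUM i<2 * r. i) = 2 * int r * int r - int r" by (induction r) (simp_all add: algebra_simps)

text \<open>The twists, the divided powers and the denominator q^(tm) combine into a power of v that
  depends on t + m alone. In the alternating sum this leaves the quantum factorials as the only
  weights besides the signs.\<close>

lemma triple_term:
 fixes r t m :: nat
 defines "v == vq TYPE('k::{finite,field})"
 shows "twist_mult r (twist_mult r (divpow r (simple_rep V1 :: 'k krep) t) (icls r (simple_rep V2))) (divpow r (simple_rep V1) m) =
  ebr r (%Z. v powi (- int (r * (t + m) + (SUM i<t + m. i))) / (qfact v t * qfact v m) *
   (SUM a:lin_map (pl t) (pl (Suc r)). SUM b:trps r t m a. hL r (trp r t m a b) Z))"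
proof -
 let ?A = "(dpc v t * v powi ebil r (t, 0) (0, 1)) * dpc v m * v powi ebil r (t, 1) (m, 0)"
  and ?B = "v powi (- int (r * (t + m) + (SUM i<t + m. i))) / (qfact v t * qfact v m)"
  and ?S = "%Z. SUM a:lin_map (pl t) (pl (Suc r)). SUM b:trps r t m a. hL r (trp r t m a b :: 'k krep) Z"
 let ?S2 = "hL r (simple_rep V2 :: 'k krep)" and ?P = "%t. hL r (S1p t :: 'k krep)"
 have v: "v ~= 0" using vq_gt1[where ?'k = 'k] by (simp add: v_def)
 have h2: "hdeg r ?S2 (0, 1)" using hdeg_hcls[OF simple_modnil, of r V2, where ?'k = 'k] by (simp add: dimv_simple_V2)
 have "twist_mult r (divpow r (simple_rep V1 :: 'k krep) t) (icls r (simple_rep V2)) =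
   twist_mult r (ebr r (%Z. dpc v t * ?P t Z)) (ebr r (%Z. 1 * ?S2 Z))" unfolding divpow_S1 icls_eq v_def by simp
 also have "... = ebr r (%Z. dpc v t * 1 * v powi ebil r (t, 0) (0, 1) * (?P t \<otimes>\<^bsub>LH r\<^esub> ?S2) Z)" unfolding v_def by (rule twist_scaled[OF hdeg_S1p h2 dpc_Qv]) (simp add: Qv_rat)
 finally have 1: "twist_mult r (divpow r (simple_rep V1 :: 'k krep) t) (icls r (simple_rep V2)) =
   ebr r (%Z. (dpc v t * v powi ebil r (t, 0) (0, 1)) * (?P t \<otimes>\<^bsub>LH r\<^esub> ?S2) Z)" by simp
 have c: "dpc v t * v powi ebil r (t, 0) (0, 1) : Qv (vq TYPE('k))" unfolding v_def by (intro Qv_mult[OF vq_rat] dpc_Qv Qv_powi[OF vq_rat] Qv_self)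
 have "twist_mult r (twist_mult r (divpow r (simple_rep V1 :: 'k krep) t) (icls r (simple_rep V2))) (divpow r (simple_rep V1) m) =
   ebr r (%Z. (dpc v t * v powi ebil r (t, 0) (0, 1)) * dpc v m * v powi ebil r (t, 1) (m, 0) * ((?P t \<otimes>\<^bsub>LH r\<^esub> ?S2) \<otimes>\<^bsub>LH r\<^esub> ?P m) Z)" unfolding 1 divpow_S1[of r m] using twist_scaled[OF hdeg_S1_S2 hdeg_S1p c dpc_Qv] by (simp add: v_def)
 also have "... = ebr r (%Z. ?A * (?S Z / real CARD('k) ^ (t * m)))" unfolding S1_S2_S1 by simp
 also have "... = ebr r (%Z. ?B * ?S Z)"
 proof -
  have q: "real CARD('k) ^ (t * m) = v powi (2 * int (t * m))" by (simp only: CARD_vq v_def power_int_mult power_int_of_nat)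
  have "v powi (- int (SUM i<t. i)) * v powi ebil r (t, 0) (0, 1) * v powi (- int (SUM i<m. i)) * v powi ebil r (t, 1) (m, 0) * inverse (v powi (2 * int (t * m))) =
   v powi (- int (r * (t + m) + (SUM i<t + m. i)))" by (simp only: triangle_add power_int_minus[symmetric] powi_add[OF v])
    (rule arg_cong[where f = "%x. v powi x"], simp add: ebil_def algebra_simps)
  then have "?A / real CARD('k) ^ (t * m) = ?B" unfolding q dpc_def by (simp only: divide_inverse inverse_mult_distrib mult_ac)
  moreover have "?A * (x / real CARD('k) ^ (t * m)) = ?A / real CARD('k) ^ (t * m) * x" for x by simp
  ultimately have "?A * (x / real CARD('k) ^ (t * m)) = ?B * x" for x by (simp only:)
  then show ?thesis by simp
 qed
 finally show ?thesis .
qed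

text \<open>The exponent 3r is the sum of r - 2r^2 from the divided power, 2r - 2r^2 from the twist
  and 4r^2 from the factor q^(2 r r) in \<open>S1p_K1\<close>.\<close>

lemma S1_K1:
 fixes r :: nat
 defines "v == vq TYPE('k::{finite,field})"
 defines "a == rst (pl (2 * r + 1)) (poly_cutoff (Suc r)) :: 'k poly => 'k poly"
 shows "twist_mult r (divpow r (simple_rep V1) (2 * r)) (icls r (eps_rep Eps1 :: 'k krep)) =
  ebr r (%Z. v ^ (3 * r) / qfact v (2 * r) * hL r (Kr r (pl (2 * r + 1)) a (%_. 0)) Z)"
proof -
 let ?K = "hL r (eps_rep Eps1 :: 'k krep)" and ?P = "hL r (S1p (2 * r) :: 'k krep)"
 let ?L = "hL r (Kr r (pl (2 * r + 1)) a (%_. 0))"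
 have v: "v ~= 0" using vq_gt1[where ?'k = 'k] by (simp add: v_def)
 have h: "hdeg r ?K (1, 1)" using hdeg_hcls[OF K1_modnil, of r, where ?'k = 'k] by (simp add: dimv_eps_rep)
 let ?c = "dpc v (2 * r) * v powi ebil r (2 * r, 0) (1, 1)"
 have c: "?c : Qv (vq TYPE('k))" unfolding v_def by (intro Qv_mult[OF vq_rat] dpc_Qv Qv_powi[OF vq_rat] Qv_self)
 note a = S1p_K1[of r "2 * r", where ?'k = 'k]
 have am: "a : lin_map (pl (2 * r + 1)) (pl (Suc r))" using a(1) by (simp add: a_def)
 have "twist_mult r (divpow r (simple_rep V1) (2 * r)) (icls r (eps_rep Eps1 :: 'k krep)) = twist_mult r (ebr r (%Z. dpc v (2 * r) * ?P Z)) (ebr r (%Z. 1 * ?K Z))" unfolding divpow_S1 icls_eq v_def by simp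
 also have "... = ebr r (%Z. dpc v (2 * r) * 1 * v powi ebil r (2 * r, 0) (1, 1) * (?P \<otimes>\<^bsub>LH r\<^esub> ?K) Z)" unfolding v_def by (rule twist_scaled[OF hdeg_S1p h dpc_Qv]) (simp add: Qv_rat)
 also have "... = iscale r ?c (ebr r (?P \<otimes>\<^bsub>LH r\<^esub> ?K))" using iscale_ebr[OF Lam.hall_mult_closed[OF Lam.hcls_closed[OF S1p_modnil] Lam.hcls_closed[OF K1_modnil]] c] by simp
 also have "ebr r (?P \<otimes>\<^bsub>LH r\<^esub> ?K) = ebr r (%Z. real CARD('k) ^ (r * (2 * r)) * ?L Z)" unfolding ebr_mult[OF Lam.hcls_closed[OF S1p_modnil] Lam.hcls_closed[OF K1_modnil]] using a(3) by (simp add: a_def)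
 also have "iscale r ?c ... = ebr r (%Z. ?c * (real CARD('k) ^ (r * (2 * r)) * ?L Z))" by (rule iscale_ebr[OF Lam.hall_scale_closed[OF Lam.hcls_closed[OF S1_S2(2)[OF am]]] c]) (simp add: Qv_rat)
 also have "?c * real CARD('k) ^ (r * (2 * r)) = v ^ (3 * r) / qfact v (2 * r)"
 proof -
  have q: "real CARD('k) ^ (r * (2 * r)) = v powi (2 * int (r * (2 * r)))" by (simp only: CARD_vq v_def power_int_mult power_int_of_nat)
  have "v powi (- int (SUM i<2 * r. i)) * v powi ebil r (2 * r, 0) (1, 1) * v powi (2 * int (r * (2 * r))) = v powi int (3 * r)" by (simp only: triangle_double powi_add[OF v]) (rule arg_cong[where f = "%x. v powi x"], simp add: ebil_def algebra_simps)
  then show ?thesis unfolding q dpc_def by (simp only: power_int_of_nat divide_inverse mult_ac)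
 qed
 then have "(%Z. ?c * (real CARD('k) ^ (r * (2 * r)) * ?L Z)) = (%Z. v ^ (3 * r) / qfact v (2 * r) * ?L Z)" by (simp add: mult.assoc[symmetric])
 finally show ?thesis .
qed

text \<open>As for K_1, except that the last contribution is -4r, from the denominator q^(2r) in
  \<open>S1p_K2\<close>.\<close>

lemma S1_K2:
 fixes r :: nat
 defines "v == vq TYPE('k::{finite,field})"
 shows "twist_mult r (divpow r (simple_rep V1) (2 * r)) (icls r (eps_rep Eps2 :: 'k krep)) =
  ebr r (%Z. v powi (- int (4 * r * r + r)) / qfact v (2 * r) * hL r (Kr r (pl (2 * r + 1)) (%_. 0) (btr r 0)) Z)"
proof -
 let ?K = "hL r (eps_rep Eps2 :: 'k krep)" and ?P = "hL r (S1p (2 * r) :: 'k krep)"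
 let ?L = "hL r (Kr r (pl (2 * r + 1)) (%_. 0) (btr r 0) :: 'k krep)"
 have v: "v ~= 0" using vq_gt1[where ?'k = 'k] by (simp add: v_def)
 have h: "hdeg r ?K (1, 1)" using hdeg_hcls[OF K2_modnil, of r, where ?'k = 'k] by (simp add: dimv_eps_rep)
 let ?c = "dpc v (2 * r) * v powi ebil r (2 * r, 0) (1, 1)"
 have "twist_mult r (divpow r (simple_rep V1) (2 * r)) (icls r (eps_rep Eps2 :: 'k krep)) = twist_mult r (ebr r (%Z. dpc v (2 * r) * ?P Z)) (ebr r (%Z. 1 * ?K Z))" unfolding divpow_S1 icls_eq v_def by simp
 also have "... = ebr r (%Z. dpc v (2 * r) * 1 * v powi ebil r (2 * r, 0) (1, 1) * (?P \<otimes>\<^bsub>LH r\<^esub> ?K) Z)" unfolding v_def by (rule twist_scaled[OF hdeg_S1p h dpc_Qv]) (simp add: Qv_rat)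
 also have "... = ebr r (%Z. ?c / real CARD('k) ^ (2 * r) * ?L Z)" unfolding S1p_K2 by simp
 also have "?c / real CARD('k) ^ (2 * r) = v powi (- int (4 * r * r + r)) / qfact v (2 * r)"
 proof -
  have q: "real CARD('k) ^ (2 * r) = v powi (2 * int (2 * r))" by (simp only: CARD_vq v_def power_int_mult power_int_of_nat)
  have "v powi (- int (SUM i<2 * r. i)) * v powi ebil r (2 * r, 0) (1, 1) * inverse (v powi (2 * int (2 * r))) = v powi (- int (4 * r * r + r))" by (simp only: triangle_double power_int_minus[symmetric] powi_add[OF v]) (rule arg_cong[where f = "%x. v powi x"], simp add: ebil_def algebra_simps)
  then show ?thesis unfolding q dpc_def by (simp only: divide_inverse mult_ac)
 qed
 finally show ?thesis .
qed

text \<open>Pulling out q^(i n) turns q^(jt) q^(i(n-t)) into the t-th power of x = q^(j-i), so every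
  T j i of \<open>triple_sum\<close> is a value of \<open>qsum\<close>.\<close>

lemma weight_sum:
 assumes v: "v ~= 0"
 shows "(SUM t<=n. ((- 1) ^ t * (K / (qfact v t * qfact v (n - t)))) * (v * v) ^ (j * t) * (v * v) ^ (i * (n - t))) =
  K * (v * v) ^ (i * n) * qsum v n (v ^ (2 * j) * inverse v ^ (2 * i))" unfolding qsum_def sum_distrib_left
proof (rule sum.cong[OF rfl])
 fix t assume "t : {..n}"
 then have "n = (n - t) + t" by simp
 then have t: "i * n = i * (n - t) + i * t" by (metis add_mult_distrib2)
 have "(v * v) ^ (i * t) * (inverse v ^ (2 * i)) ^ t = 1" using power_inverse_cancel[OF v, of "2 * i * t"] by (simp add: power_mult power2_eq_square)
 then have e1: "(v * v) ^ (i * n) * (inverse v ^ (2 * i)) ^ t = (v * v) ^ (i * (n - t))" unfolding t power_add by (simp add: mult.assoc)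
 have e2: "(- (v ^ (2 * j) * inverse v ^ (2 * i))) ^ t = (- 1) ^ t * (v * v) ^ (j * t) * (inverse v ^ (2 * i)) ^ t"
 proof -
  have "(- (v ^ (2 * j) * inverse v ^ (2 * i))) ^ t = ((- 1) * v ^ (2 * j) * inverse v ^ (2 * i)) ^ t" by simp
  also have "... = (- 1) ^ t * (v ^ (2 * j)) ^ t * (inverse v ^ (2 * i)) ^ t" by (simp only: power_mult_distrib)
  finally show ?thesis by (simp add: power_mult power2_eq_square)
 qed
 show "((- 1) ^ t * (K / (qfact v t * qfact v (n - t)))) * (v * v) ^ (j * t) * (v * v) ^ (i * (n - t)) =
  K * (v * v) ^ (i * n) * ((- (v ^ (2 * j) * inverse v ^ (2 * i))) ^ t / (qfact v t * qfact v (n - t)))" unfolding e1[symmetric] e2 by (simp only: divide_inverse mult_ac)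
qed

text \<open>The claim has Pochhammer symbols of length 2r, while \<open>qsum_top\<close> yields
  length 2r + 1. The last factor splits off q - 1 and the quantum integer [2r + 1], which cancels
  against the quotient of [2r + 1]! and [2r]!.\<close>

lemma top_factors:
 assumes v: "1 < v"
 shows "1 - (v * v) * (v * v) ^ (2 * r) = - (v ^ (2 * r) * (v * v - 1) * qint v (2 * r + 1))"
  "1 - inverse (v * v) * inverse (v * v) ^ (2 * r) = inverse v ^ (2 * r + 2) * (v * v - 1) * qint v (2 * r + 1)"
proof -
 let ?n = "2 * r + 1"
 have v0: "v ~= 0" "v - inverse v ~= 0" using v by (simp_all add: field_simps) (metis less_irrefl less_1_mult)
 have d: "(v - inverse v) * qint v ?n = v ^ ?n - inverse v ^ ?n" using v0 by (simp add: qint_eq)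
 have e: "v * v - 1 = v * (v - inverse v)" using v0 by (simp add: right_diff_distrib)
 have "v ^ (2 * r) * (v * v - 1) * qint v ?n = v ^ ?n * ((v - inverse v) * qint v ?n)" unfolding e by simp
 also have "... = v ^ ?n * v ^ ?n - v ^ ?n * inverse v ^ ?n" unfolding d by (simp only: right_diff_distrib)
 also have "... = (v * v) * (v * v) ^ (2 * r) - 1" unfolding power_inverse_cancel[OF v0(1)] by (simp add: power_mult_distrib mult_ac)
 finally show "1 - (v * v) * (v * v) ^ (2 * r) = - (v ^ (2 * r) * (v * v - 1) * qint v ?n)" by simp
 have "inverse v ^ (2 * r + 2) * (v * v - 1) * qint v ?n = (v * inverse v) * inverse v ^ ?n * ((v - inverse v) * qint v ?n)" unfolding e by simp
 also have "... = v ^ ?n * inverse v ^ ?n - inverse v ^ ?n * inverse v ^ ?n" unfolding d using v0 by (simp add: right_diff_distrib mult_ac)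
 also have "... = 1 - inverse (v * v) * inverse (v * v) ^ (2 * r)" unfolding power_inverse_cancel[OF v0(1)] by (simp add: power_mult_distrib mult_ac)
 finally show "1 - inverse (v * v) * inverse (v * v) ^ (2 * r) = inverse v ^ (2 * r + 2) * (v * v - 1) * qint v ?n" by simp
qed

lemma triangle_odd: "(SUM i<=2 * r. i) = 2 * r * r + r" for r :: nat by (induction r) (simp_all add: algebra_simps)

lemma cancel_factors: "x ~= 0 ==> y ~= 0 ==> x * (y * a) = b * (c * x) ==> a = b * c / y" for x :: real
proof -
 assume x: "x ~= 0" and y: "y ~= 0" and e: "x * (y * a) = b * (c * x)"
 have "x * (y * a) = x * (b * c)" using e by (simp only: mult_ac)
 then have "y * a = b * c" using x by simp
 then show "a = b * c / y" using y by (simp add: eq_divide_eq mult.commute)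
qed

text \<open>\<open>K\<close> is the power of v from \<open>triple_term\<close> at t + m = 2r + 1.
  The last factors on the right are the coefficients in \<open>S1_K1\<close> and
  \<open>S1_K2\<close>, so what precedes them is the coefficient in the claim.\<close>

lemma scalars:
 fixes v :: real and r :: nat
 assumes v: "1 < v"
 defines "n == 2 * r + 1" and "K == v powi (- int (4 * r * r + 2 * r))"
 shows "K * qsum v n (v ^ (2 * Suc r)) = - (v powi (- int r)) * (v * v - 1) * qpoch (inverse (v * v)) (inverse (v * v)) (2 * r) * (v ^ (3 * r) / qfact v (2 * r))"
  "K * (v * v) ^ (Suc r * n) * qsum v n (inverse v ^ (2 * Suc r)) = v ^ r * (v * v - 1) * qpoch (v * v) (v * v) (2 * r) * (v powi (- int (4 * r * r + r)) / qfact v (2 * r))"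
proof -
 let ?Q = "qpoch (v * v) (v * v) (2 * r)" and ?I = "qpoch (inverse (v * v)) (inverse (v * v)) (2 * r)" and ?f = "qfact v (2 * r)" and ?i = "qint v n"
 have v0: "v ~= 0" using v by simp
 have i: "?i ~= 0" using qint_pos[OF v, of n] by (simp add: n_def)
 have f: "?f ~= 0" using qfact_pos[OF v, of "2 * r"] by simp
 have fn: "qfact v n = ?i * ?f" unfolding n_def by (simp add: qfact_Suc)
 have vv: "(v * v) ^ m = v powi (2 * int m)" for m using power_int_mult[of v 2 "int m"] by (simp only: power_int_of_nat) (simp add: power2_eq_square)
 have "?I * (v * v) ^ (2 * r * r + r) = ?Q" using qpoch_inverse[of "v * v" "2 * r"] v0 by (simp add: triangle_odd)
 moreover have "(v * v) ^ (2 * r * r + r) * K = 1" unfolding vv K_def powi_add[OF v0] by (simp add: algebra_simps)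
 \<comment> \<open>The power of q exchanging the two Pochhammer symbols of length 2r is exactly
   \<open>K\<close>; the sign is absent because the length is even.\<close>
 ultimately have I: "?I = ?Q * K" by (metis mult.assoc mult_1_right)
 have s1: "?i * (?f * qsum v n (v ^ (2 * Suc r))) = ?Q * (- (v ^ (2 * r) * (v * v - 1)) * ?i)" using qsum_top(1)[OF v, of r] top_factors(1)[OF v, of r] fn unfolding n_def by (simp only: qpoch_Suc[of _ _ "2 * r", unfolded Suc_eq_plus1] mult.assoc mult_minus_left)
 have s2: "?i * (?f * qsum v n (inverse v ^ (2 * Suc r))) = ?I * (inverse v ^ (2 * r + 2) * (v * v - 1) * ?i)" using qsum_top(2)[OF v, of r] top_factors(2)[OF v, of r] fn unfolding n_def by (simp only: qpoch_Suc[of _ _ "2 * r", unfolded Suc_eq_plus1] mult.assoc)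
 note q1 = cancel_factors[OF i f s1] and q2 = cancel_factors[OF i f s2]
 have w: "v powi (- int r) * v ^ (3 * r) = v ^ (2 * r)"
 proof -
  have "v powi (- int r) * v powi int (3 * r) = v powi int (2 * r)" unfolding powi_add[OF v0] by simp
  then show ?thesis by (simp only: power_int_of_nat)
 qed
 have "K * qsum v n (v ^ (2 * Suc r)) = - (v powi (- int r) * v ^ (3 * r)) * (v * v - 1) * (?Q * K) / ?f" unfolding q1 w by (simp add: mult_ac)
 then show "K * qsum v n (v ^ (2 * Suc r)) = - (v powi (- int r)) * (v * v - 1) * ?I * (v ^ (3 * r) / ?f)" unfolding I by (simp add: mult_ac)
 have w2: "K * K * (v * v) ^ (Suc r * n) * inverse v ^ (2 * r + 2) = v ^ r * v powi (- int (4 * r * r + r))"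
 proof -
  have "inverse v ^ (2 * r + 2) = v powi (- int (2 * r + 2))" by (simp only: power_int_minus power_int_of_nat power_inverse)
  moreover have "v ^ r = v powi int r" by (simp only: power_int_of_nat)
  ultimately show ?thesis unfolding vv K_def by (simp only: powi_add[OF v0]) (rule arg_cong[where f = "%x. v powi x"], simp add: n_def algebra_simps)
 qed
 have "K * (v * v) ^ (Suc r * n) * qsum v n (inverse v ^ (2 * Suc r)) = (K * K * (v * v) ^ (Suc r * n) * inverse v ^ (2 * r + 2)) * (v * v - 1) * ?Q / ?f" unfolding q2 I by (simp only: divide_inverse mult_ac)
 then show "K * (v * v) ^ (Suc r * n) * qsum v n (inverse v ^ (2 * Suc r)) = v ^ r * (v * v - 1) * ?Q * (v powi (- int (4 * r * r + r)) / ?f)" unfolding w2 by (simp only: divide_inverse mult_ac)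
qed

lemma qpoch_Qv: "a : Qv (vq TYPE('k::finite)) ==> x : Qv (vq TYPE('k)) ==> qpoch a x n : Qv (vq TYPE('k))"
proof (induction n)
 case (Suc n)
 then show ?case unfolding qpoch_Suc by (intro Qv_mult[OF vq_rat] Qv_diff Qv_power[OF vq_rat]) (auto simp: Qv_rat)
qed (simp add: qpoch_def Qv_rat)

theorem proposition5p7:
  fixes r :: nat and q v :: real
    and S1 S2 K1 K2 :: "'k::{finite,field} krep"
  assumes q: "q = real CARD('k)" and v: "v = sqrt q"
    and S1: "S1 = simple_rep V1" and S2: "S2 = simple_rep V2"
    and K1: "K1 = eps_rep Eps1" and K2: "K2 = eps_rep Eps2"
  shows "(\<Oplus>\<^bsub>iHall r\<^esub> t\<in>{0..2 * r + 1}.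
            iscale r ((- 1) ^ t)
              (divpow r S1 t \<otimes>\<^bsub>iHall r\<^esub> icls r S2 \<otimes>\<^bsub>iHall r\<^esub> divpow r S1 (2 * r + 1 - t)))
       = iscale r (- (v powi (- int r)) * (q - 1) * qpoch (inverse q) (inverse q) (2 * r))
           (divpow r S1 (2 * r) \<otimes>\<^bsub>iHall r\<^esub> icls r K1)
         \<oplus>\<^bsub>iHall r\<^esub>
         iscale r (v ^ r * (q - 1) * qpoch q q (2 * r))
           (divpow r S1 (2 * r) \<otimes>\<^bsub>iHall r\<^esub> icls r K2)"
proof -
 let ?n = "2 * r + 1" and ?f = "qfact v"
 have vq: "v = vq TYPE('k)" using q v by (simp add: vq_def)
 have v1: "1 < v" unfolding vq by (rule vq_gt1)
 have v0: "v ~= 0" using v1 by simp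
 have qv: "q = v * v" unfolding q vq by (rule vq_square[symmetric])
 define a where "a = (rst (pl ?n) (poly_cutoff (Suc r)) :: 'k poly => 'k poly)"
 note a1 = S1p_K1[of r "2 * r", where ?'k = 'k]
 have a: "a : lin_map (pl ?n) (pl (Suc r))" "a ` pl ?n = pl (Suc r)" using a1(1,2) by (simp_all add: a_def)
 define K where "K = v powi (- int (4 * r * r + 2 * r))"
 define S where "S t Z = (SUM a:lin_map (pl t) (pl (Suc r)). SUM b:trps r t (?n - t) a. hL r (trp r t (?n - t) a b :: 'k krep) Z)" for t Z
 define w where "w t = (- 1) ^ t * (K / (?f t * ?f (?n - t)))" for t
 let ?L = "hL r (Kr r (pl ?n) a (%_. 0))" and ?X = "%m. hL r (Kr r (pl ?n) (%_. 0) (btr r m) :: 'k krep)"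
 have vQ: "v : Qv (vq TYPE('k))" unfolding vq by (rule Qv_self)
 have fQ: "?f m : Qv (vq TYPE('k))" for m unfolding vq by (rule qfact_Qv)
 have KQ: "K : Qv (vq TYPE('k))" unfolding K_def by (rule Qv_powi[OF vq_rat vQ])
 have qQ: "q : Qv (vq TYPE('k))" unfolding q by (simp add: Qv_rat)
 have oQ: "(- 1) ^ t : Qv (vq TYPE('k))" for t by (intro Qv_power[OF vq_rat] Qv_neg Qv_rat) simp
 have kQ: "K / (?f t * ?f (?n - t)) : Qv (vq TYPE('k))" for t unfolding divide_inverse by (intro Qv_mult[OF vq_rat] KQ Qv_inverse[OF vq_rat] fQ)
 have Sc: "S t : cH r" for t
 proof -
  have "S t = (%Z. SUM a:lin_map (pl t) (pl (Suc r)). SUM b:trps r t (?n - t) a. hL r (trp r t (?n - t) a b) Z)" by (rule ext) (simp add: S_def)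
  also have "... : cH r" by (intro Lam.hall_sum_closed Lam.hcls_closed trp_modnil) assumption+
  finally show ?thesis .
 qed
 have Lc: "?L : cH r" by (rule Lam.hcls_closed[OF S1_S2(2)[OF a(1)]])
 have Xc: "?X m : cH r" if "m <= r" for m by (rule Lam.hcls_closed[OF Kr_0_modnil[OF btr_lin]]) (use that in simp)
 have summand: "iscale r ((- 1) ^ t) (divpow r S1 t \<otimes>\<^bsub>iHall r\<^esub> icls r S2 \<otimes>\<^bsub>iHall r\<^esub> divpow r S1 (?n - t)) = ebr r (%Z. w t * S t Z)" if t: "t <= ?n" for t
 proof -
  have n: "t + (?n - t) = ?n" using t by simp
  have "(SUM i<?n. i) = (SUM i<=2 * r. i)" by (simp only: lessThan_Suc_atMost Suc_eq_plus1[symmetric])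
  then have "r * (t + (?n - t)) + (SUM i<t + (?n - t). i) = 4 * r * r + 2 * r" unfolding n triangle_odd by simp
  then have "divpow r S1 t \<otimes>\<^bsub>iHall r\<^esub> icls r S2 \<otimes>\<^bsub>iHall r\<^esub> divpow r S1 (?n - t) = ebr r (%Z. K / (?f t * ?f (?n - t)) * S t Z)" using triple_term[of r t "?n - t", where ?'k = 'k] unfolding S1 S2 K_def S_def by (simp only: vq[symmetric] iHall_simps)
  then show ?thesis by (simp only: iscale_ebr[OF Lam.hall_scale_closed[OF Sc kQ] oQ] w_def mult.assoc)
 qed
 have wQ: "w t : Qv (vq TYPE('k))" for t unfolding w_def by (intro Qv_mult[OF vq_rat] oQ kQ)
 interpret R: ring "sd_hall r :: 'k ihall ring" by (rule ring_sd_hall)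
 \<comment> \<open>With i and j at most r + 1 the difference j - i exceeds r in absolute value just
   for (r+1, 0) and (0, r+1); all other sums vanish by \<open>qsum_zero\<close>.\<close>
 have T: "(SUM t<=?n. w t * q ^ (j * t) * q ^ (i * (?n - t))) = K * q ^ (i * ?n) * qsum v ?n (v ^ (2 * j) * inverse v ^ (2 * i))" for i j unfolding w_def qv by (rule weight_sum[OF v0])
 have T0: "(SUM t<=?n. w t * q ^ (j * t) * q ^ (i * (?n - t))) = 0" if "i <= Suc r" "j <= Suc r" "(j, i) ~= (Suc r, 0)" "(j, i) ~= (0, Suc r)" for i j
 proof -
  have "i <= j + r" "j <= i + r" using that by auto
  then show ?thesis unfolding T by (simp only: qsum_zero[OF v1] mult_zero_right)
 qed
 have sum: "(SUM t<=?n. w t * S t Z) = K * qsum v ?n (v ^ (2 * Suc r)) * ?L Z + K * q ^ (Suc r * ?n) * qsum v ?n (inverse v ^ (2 * Suc r)) * ?X r Z" for Z using triple_sum[of r ?n w a Z, folded q] T0 a T[of "Suc r" 0] T[of 0 "Suc r"] unfolding S_def by simp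
 let ?A = "- (v powi (- int r)) * (q - 1) * qpoch (inverse q) (inverse q) (2 * r)" and ?B = "v ^ r * (q - 1) * qpoch q q (2 * r)"
 let ?c = "v ^ (3 * r) / ?f (2 * r)" and ?d = "v powi (- int (4 * r * r + r)) / ?f (2 * r)"
 have AQ: "?A : Qv (vq TYPE('k))"  by (intro Qv_mult[OF vq_rat] Qv_neg Qv_powi[OF vq_rat] Qv_diff qpoch_Qv Qv_inverse[OF vq_rat] vQ qQ) (simp add: Qv_rat)
 have BQ: "?B : Qv (vq TYPE('k))"  by (intro Qv_mult[OF vq_rat] Qv_power[OF vq_rat] Qv_diff qpoch_Qv vQ qQ) (simp add: Qv_rat)
 have cQ: "?c : Qv (vq TYPE('k))" "?d : Qv (vq TYPE('k))" unfolding divide_inverse by (intro Qv_mult[OF vq_rat] Qv_inverse[OF vq_rat] Qv_power[OF vq_rat] Qv_powi[OF vq_rat] vQ fQ)+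
 have dQ: "?B * ?d : Qv (vq TYPE('k))" by (rule Qv_mult[OF vq_rat BQ cQ(2)])
 have "(\<Oplus>\<^bsub>iHall r\<^esub> t\<in>{0..?n}. iscale r ((- 1) ^ t)
       (divpow r S1 t \<otimes>\<^bsub>iHall r\<^esub> icls r S2 \<otimes>\<^bsub>iHall r\<^esub> divpow r S1 (?n - t))) =
   (\<Oplus>\<^bsub>sd_hall r\<^esub> t\<in>{0..?n}. iscale r ((- 1) ^ t)
       (divpow r S1 t \<otimes>\<^bsub>iHall r\<^esub> icls r S2 \<otimes>\<^bsub>iHall r\<^esub> divpow r S1 (?n - t)))" by (simp add: finsum_def)
 also have "... = (\<Oplus>\<^bsub>sd_hall r\<^esub> t\<in>{0..?n}. ebr r (%Z. w t * S t Z))" by (rule R.finsum_cong') (use summand ebr_closed[OF Lam.hall_scale_closed[OF Sc wQ]] in auto)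
 also have "... = (\<Oplus>\<^bsub>iHall r\<^esub> t\<in>{0..?n}. ebr r (%Z. w t * S t Z))" by (simp add: finsum_def)
 also have "... = ebr r (%Z. SUM t:{0..?n}. w t * S t Z)" by (rule finsum_iHall_ebr) (use Lam.hall_scale_closed[OF Sc wQ] in auto)
 also have "... = ebr r (%Z. ?A * ?c * ?L Z + ?B * ?d * ?X r Z)" unfolding atLeast0AtMost sum unfolding K_def qv scalars[OF v1] by (rule rfl)
 also have "... = ebr r (%Z. ?A * ?c * ?L Z) \<oplus>\<^bsub>sd_hall r\<^esub> ebr r (%Z. ?B * ?d * ?X r Z)" by (rule ebr_add[OF Lam.hall_scale_closed[OF Lc Qv_mult[OF vq_rat AQ cQ(1)]] Lam.hall_scale_closed[OF Xc[OF order_refl] dQ]])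
 \<comment> \<open>Up to here the module with C = D = 0 had \<open>b\<close> injective; the passage
   to the direct sum of K_2 and copies of S_1 takes place in the localization, where
   \<open>[K_1]\<close> has been cancelled.\<close>
 also have "ebr r (%Z. ?B * ?d * ?X r Z) = ebr r (%Z. ?B * ?d * ?X 0 Z)" using iscale_ebr[OF Xc[OF order_refl] dQ] iscale_ebr[OF Xc[OF le0] dQ] ebr_btr[of r ?n r, where ?'k = 'k] by simp
 also have "ebr r (%Z. ?A * ?c * ?L Z) = iscale r ?A (divpow r S1 (2 * r) \<otimes>\<^bsub>iHall r\<^esub> icls r K1)" using S1_K1[of r, where ?'k = 'k] iscale_ebr[OF Lam.hall_scale_closed[OF Lc cQ(1)] AQ] unfolding S1 K1 vq[symmetric] a_def by (simp add: mult.assoc)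
 also have "ebr r (%Z. ?B * ?d * ?X 0 Z) = iscale r ?B (divpow r S1 (2 * r) \<otimes>\<^bsub>iHall r\<^esub> icls r K2)" using S1_K2[of r, where ?'k = 'k] iscale_ebr[OF Lam.hall_scale_closed[OF Xc[OF le0] cQ(2)] BQ] unfolding S1 K2 vq[symmetric] by (simp add: mult.assoc)
 finally show ?thesis by simp
qed

end
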